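(* Let $f$ be the solution of the homogeneous Boltzmann problem with initial datum $f_0$, let $b>0$ be the fixed parameter in the normalized moments, and let $\eta$ be any multi-index. Let $T>0$ and assume that $\delta^{\eta}m_{0}>0$ and that $\delta^{\nu}m_{0}$, $\delta^{\nu}m_{1}$ are uniformly bounded in $[0,T]$ for all $\nu\leq\eta$. Also assume that for some constants $k>0$ and $q\geq1$ the initial normalized moments of the derivatives satisfy, for all $\nu\le\eta$, the growth condition $$\delta^{\nu}z_{p}(0)\leq kq^{p},\qquad p=3/2,\,2,\,5/2,\dots$$ Then we have the following uniform bound for the normalized moments for $t\in[0,T]$: $$\delta^{\nu}z_{p}(t)\leq KQ^{p},\qquad p=3/2,\,2,\,5/2,\dots$$ for all $\nu\leq\eta$, for some $Q\geq q$ and some positive constant $K=K(\eta,\|f\|_{L^{\infty}([0,T];W^{|\eta|,1}_{2})},k)$ depending on the multi-index $\eta$, the constant $k$, and the $L^{\infty}([0,T];W^{|\eta|,1}_{2})$ norm of $f$.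
   Context: Boltzmann problem: $f(\xi,t)\ge 0$, $(\xi,t)\in\mathbb{R}^n\times\mathbb{R}^+$, solves $\partial_t f=Q(f,f)$, $f(\xi,0)=f_0(\xi)\ge0$, where $$Q(f,g)(\xi)=\int_{\mathbb{R}^{n}}\int_{S^{n-1}}\left(f'g'_{*}-fg_{*}\right)B(\xi-\xi_{*},\sigma)\,d\sigma\, d\xi_{*},$$ with $f=f(\xi)$, $g_*=g(\xi_* )$, $f'=f(\xi')$, $g'_*=g(\xi'_* )$, $u=\xi-\xi_*$, $\hat u=u/|u|$, $\xi'=\xi+\frac12(|u|\sigma-u)$, $\xi'_*=\xi_*-\frac12(|u|\sigma-u)$. The kernel is $B(u,\sigma)=|u|^{\alpha}h(\hat u\cdot\sigma)$ with $\alpha\in(0,1]$, where: (i) $h\ge 0$ on $(-1,1)$ and $h(z)+h(-z)$ is nondecreasing on $(0,1)$; (ii) $0\le h(z)(1-z^2)^{\mu/2}\le C$ for $z\in(-1,1)$, for some constants $\mu<n-1$ and $C>0$. It is normalized by $\int_{S^{n-1}}h(\hat u\cdot\sigma)\,d\sigma=1$. The initial datum satisfies $\int f_0\,d\xi=1$, $\int f_0\,\xi\,d\xi=0$, $\int f_0|\xi|^2d\xi<\infty$. The solution is understood as the usual one, conserving mass, momentum and energy. Norms: $\|f\|_{W^{s,1}_k}=\sum_{|\nu|\le s}\int|\partial^\nu f|(1+|\xi|^2)^{k/2}d\xi$. Multi-indices: $\partial^\nu$ denotes derivatives in $\xi$; $|\nu|=\sum_i\nu_i$; $\nu\le\eta$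 means $\nu_i\le\eta_i$ for all $i$. Moments of derivatives: $\delta^{\nu}m_p(t)=\int_{\mathbb{R}^n}|\partial^\nu f(\xi,t)||\xi|^{2p}d\xi$ (for $p\ge0$). Normalized moments: $\delta^\nu z_p=\delta^\nu m_p/\Gamma(p+b)$, where $\Gamma$ is the gamma function and $b>0$ is a fixed parameter. *)

theory Defs
  imports "HOL-Analysis.Analysis" "HOL-Probability.Essential_Supremum"
begin

text \<open>
  Functions of the velocity have type \<open>real ^ 'n \<Rightarrow> real\<close>, with \<open>n = CARD('n)\<close>; functions of
  time and velocity are written with the time argument first.
\<close>

subsection \<open>The collision operator\<close>

text \<open>
  Surface measure on the unit sphere, in polar form: the area of \<open>A\<close> is \<open>n\<close> times the volume
  of the cone \<open>{r *\<^sub>R \<omega> | 0 < r < 1, \<omega> \<in> A}\<close>.  Here \<open>sgn x = x /\<^sub>R norm x\<close>.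
\<close>

definition sphere_measure :: "(real ^ 'n) measure" where
  "sphere_measure =
     scale_measure (of_nat CARD('n))
       (distr (restrict_space lborel (ball 0 1 - {0})) (restrict_space borel (sphere 0 1)) sgn)"

definition collision_kernel :: "real \<Rightarrow> (real \<Rightarrow> real) \<Rightarrow> real ^ 'n \<Rightarrow> real ^ 'n \<Rightarrow> real" where
  "collision_kernel \<alpha> h u \<sigma> = norm u powr \<alpha> * h (sgn u \<bullet> \<sigma>)"

definition post_velocity :: "real ^ 'n \<Rightarrow> real ^ 'n \<Rightarrow> real ^ 'n \<Rightarrow> real ^ 'n" where
  "post_velocity \<xi> \<xi>s \<sigma> = \<xi> + (1 / 2) *\<^sub>R (norm (\<xi> - \<xi>s) *\<^sub>R \<sigma> - (\<xi> - \<xi>s))"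

definition post_velocity_star :: "real ^ 'n \<Rightarrow> real ^ 'n \<Rightarrow> real ^ 'n \<Rightarrow> real ^ 'n" where
  "post_velocity_star \<xi> \<xi>s \<sigma> = \<xi>s - (1 / 2) *\<^sub>R (norm (\<xi> - \<xi>s) *\<^sub>R \<sigma> - (\<xi> - \<xi>s))"

definition collision_op ::
  "real \<Rightarrow> (real \<Rightarrow> real) \<Rightarrow> (real ^ 'n \<Rightarrow> real) \<Rightarrow> (real ^ 'n \<Rightarrow> real) \<Rightarrow> real ^ 'n \<Rightarrow> real" where
  "collision_op \<alpha> h f g \<xi> =
     (\<integral>\<xi>s. (\<integral>\<sigma>. (f (post_velocity \<xi> \<xi>s \<sigma>) * g (post_velocity_star \<xi> \<xi>s \<sigma>) - f \<xi> * g \<xi>s)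
                    * collision_kernel \<alpha> h (\<xi> - \<xi>s) \<sigma> \<partial>sphere_measure) \<partial>lborel)"

text \<open>
  The dimension enters through the bound on the exponent and through the normalization, so it
  is passed as a type argument.
\<close>

definition angular_kernel :: "'n::finite itself \<Rightarrow> (real \<Rightarrow> real) \<Rightarrow> bool" where
  "angular_kernel _ h \<longleftrightarrow>
     set_borel_measurable borel {-1<..<1} h \<and>
     (\<forall>z\<in>{-1<..<1}. 0 \<le> h z) \<and>
     mono_on {0<..<1} (\<lambda>z. h z + h (- z)) \<and>
     (\<exists>\<mu> C. \<mu> < real CARD('n) - 1 \<and> C > 0 \<and>
        (\<forall>z\<in>{-1<..<1}. 0 \<le> h z * (1 - z\<^sup>2) powr (\<mu> / 2) \<and> h z * (1 - z\<^sup>2) powr (\<mu> / 2) \<le> C)) \<and>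
     (\<forall>e :: real ^ 'n. norm e = 1 \<longrightarrow> has_bochner_integral sphere_measure (\<lambda>\<sigma>. h (e \<bullet> \<sigma>)) 1)"

subsection \<open>Solutions of the homogeneous Boltzmann problem\<close>

definition initial_datum :: "(real ^ 'n \<Rightarrow> real) \<Rightarrow> bool" where
  "initial_datum f0 \<longleftrightarrow>
     (\<forall>\<xi>. 0 \<le> f0 \<xi>) \<and>
     has_bochner_integral lborel f0 1 \<and>
     has_bochner_integral lborel (\<lambda>\<xi>. f0 \<xi> *\<^sub>R \<xi>) 0 \<and>
     integrable lborel (\<lambda>\<xi>. f0 \<xi> * (norm \<xi>)\<^sup>2)"

text \<open>
  The equation is understood in the usual integrated sense \<open>f(t) = f0 + \<integral>\<^sub>0\<^sup>t Q(f(s),f(s)) ds\<close>,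
  almost everywhere in the velocity.  Conservation of mass, momentum and energy is part of the
  notion of solution: without it uniqueness fails.
\<close>

definition boltzmann_solution ::
  "real \<Rightarrow> (real \<Rightarrow> real) \<Rightarrow> (real ^ 'n \<Rightarrow> real) \<Rightarrow> (real \<Rightarrow> real ^ 'n \<Rightarrow> real) \<Rightarrow> bool" where
  "boltzmann_solution \<alpha> h f0 f \<longleftrightarrow>
     (\<lambda>(t, \<xi>). f t \<xi>) \<in> borel_measurable (restrict_space borel ({0..} \<times> UNIV)) \<and>
     (\<forall>t\<ge>0. \<forall>\<xi>. 0 \<le> f t \<xi>) \<and>
     f 0 = f0 \<and>
     (\<forall>t\<ge>0. AE \<xi> in lborel.
        set_integrable lborel {0..t} (\<lambda>s. collision_op \<alpha> h (f s) (f s) \<xi>) \<and>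
        f t \<xi> = f0 \<xi> + (LINT s:{0..t}|lborel. collision_op \<alpha> h (f s) (f s) \<xi>)) \<and>
     (\<forall>t\<ge>0.
        has_bochner_integral lborel (f t) (\<integral>\<xi>. f0 \<xi> \<partial>lborel) \<and>
        has_bochner_integral lborel (\<lambda>\<xi>. f t \<xi> *\<^sub>R \<xi>) (\<integral>\<xi>. f0 \<xi> *\<^sub>R \<xi> \<partial>lborel) \<and>
        has_bochner_integral lborel (\<lambda>\<xi>. f t \<xi> * (norm \<xi>)\<^sup>2) (\<integral>\<xi>. f0 \<xi> * (norm \<xi>)\<^sup>2 \<partial>lborel))"

subsection \<open>Weak derivatives\<close>

definition partial :: "'n \<Rightarrow> (real ^ 'n \<Rightarrow> real) \<Rightarrow> real ^ 'n \<Rightarrow> real" where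
  "partial i \<phi> x = frechet_derivative \<phi> (at x) (axis i 1)"

definition test_function :: "(real ^ 'n \<Rightarrow> real) \<Rightarrow> bool" where
  "test_function \<phi> \<longleftrightarrow>
     (\<forall>is x. foldr partial is \<phi> differentiable (at x)) \<and> compact (closure {x. \<phi> x \<noteq> 0})"

definition locally_integrable :: "(real ^ 'n \<Rightarrow> real) \<Rightarrow> bool" where
  "locally_integrable g \<longleftrightarrow> (\<forall>A. compact A \<longrightarrow> set_integrable lborel A g)"

definition multi_order :: "('n::finite \<Rightarrow> nat) \<Rightarrow> nat" where
  "multi_order \<nu> = (\<Sum>i\<in>UNIV. \<nu> i)"

text \<open>
  A multi-index has type \<open>'n \<Rightarrow> nat\<close>.  Every list \<open>is\<close> in which each \<open>i\<close> occurs \<open>\<nu> i\<close> times gives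
  the same iterated derivative of a test function, namely its derivative of multi-index \<open>\<nu>\<close>;
  quantifying over these lists avoids choosing an order on \<open>'n\<close>.
\<close>

definition has_weak_deriv ::
  "('n \<Rightarrow> nat) \<Rightarrow> (real ^ 'n \<Rightarrow> real) \<Rightarrow> (real ^ 'n \<Rightarrow> real) \<Rightarrow> bool" where
  "has_weak_deriv \<nu> g d \<longleftrightarrow>
     locally_integrable g \<and> locally_integrable d \<and>
     (\<forall>\<phi> is. test_function \<phi> \<and> (\<forall>i. count_list is i = \<nu> i) \<longrightarrow>
        (\<integral>x. g x * foldr partial is \<phi> x \<partial>lborel) =
        (- 1) ^ multi_order \<nu> * (\<integral>x. d x * \<phi> x \<partial>lborel))"

definition weak_deriv :: "('n \<Rightarrow> nat) \<Rightarrow> (real ^ 'n \<Rightarrow> real) \<Rightarrow> real ^ 'n \<Rightarrow> real" where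
  "weak_deriv \<nu> g = (SOME d. has_weak_deriv \<nu> g d)"

text \<open>
  All integrals of derivatives below have the form \<open>\<integral> |\<partial>\<^sup>\<nu> g| w\<close> with a weight \<open>w \<ge> 0\<close>.  They take
  values in \<open>[0, \<infinity>]\<close>, and the value is \<open>\<infinity>\<close> if the weak derivative does not exist.
\<close>

definition deriv_integral ::
  "('n \<Rightarrow> nat) \<Rightarrow> (real ^ 'n \<Rightarrow> real) \<Rightarrow> (real ^ 'n \<Rightarrow> real) \<Rightarrow> ennreal" where
  "deriv_integral \<nu> w g =
     (if \<exists>d. has_weak_deriv \<nu> g d
      then \<integral>\<^sup>+ \<xi>. ennreal (\<bar>weak_deriv \<nu> g \<xi>\<bar> * w \<xi>) \<partial>lborel else \<infinity>)"

subsection \<open>Moments and norms\<close>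

text \<open>For \<open>p = 0\<close> the weight is \<open>1\<close> except at the origin, where \<open>0 powr 0 = 0\<close>; this is a null set.\<close>

definition deriv_moment :: "('n \<Rightarrow> nat) \<Rightarrow> real \<Rightarrow> (real ^ 'n \<Rightarrow> real) \<Rightarrow> ennreal" where
  "deriv_moment \<nu> p g = deriv_integral \<nu> (\<lambda>\<xi>. norm \<xi> powr (2 * p)) g"

definition normalized_deriv_moment ::
  "real \<Rightarrow> ('n \<Rightarrow> nat) \<Rightarrow> real \<Rightarrow> (real ^ 'n \<Rightarrow> real) \<Rightarrow> ennreal" where
  "normalized_deriv_moment b \<nu> p g = deriv_moment \<nu> p g / ennreal (Gamma (p + b))"

definition sobolev_norm :: "nat \<Rightarrow> real \<Rightarrow> (real ^ 'n \<Rightarrow> real) \<Rightarrow> ennreal" where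
  "sobolev_norm s k g =
     (\<Sum>\<nu> | multi_order \<nu> \<le> s. deriv_integral \<nu> (\<lambda>\<xi>. (1 + (norm \<xi>)\<^sup>2) powr (k / 2)) g)"

text \<open>
  \<open>esssup\<close> is \<open>\<infinity>\<close> on non-measurable functions.  For solutions as above this does not arise: they
  are continuous in time with values in \<open>L\<^sup>1\<close>, and \<open>sobolev_norm\<close> is lower semicontinuous in \<open>L\<^sup>1\<close>.
\<close>

definition Linf_sobolev_norm :: "real \<Rightarrow> nat \<Rightarrow> real \<Rightarrow> (real \<Rightarrow> real ^ 'n \<Rightarrow> real) \<Rightarrow> ennreal" where
  "Linf_sobolev_norm T s k f =
     esssup (restrict_space lborel {0..T}) (\<lambda>t. sobolev_norm s k (f t))"

end

theory Submission
  imports Defs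
begin

text \<open>
  The factor \<open>Q\<close> may depend on the whole solution and \<open>p \<ge> 3/2\<close>, so every constant can be moved into
  \<open>Q\<close>, and the bound \<open>z\<^sub>p \<le> Q\<^sup>p\<close> for all half-integers \<open>p\<close> comes down to a qualitative
  statement: some Gaussian weight \<open>exp (a |\<xi>|\<^sup>2)\<close>, \<open>a > 0\<close>, is integrable against every
  \<open>\<partial>\<^sup>\<nu> f(t)\<close>, uniformly in \<open>t \<le> T\<close>.  Indeed \<open>\<Gamma>(p + b)\<close> is comparable with a factorial up to a
  geometric factor, and the even moments add up to the exponential series
  (\<open>gauss_from_moments\<close>, \<open>moment_from_gauss\<close>).  What has to be shown is that such Gaussian
  integrability propagates from time \<open>0\<close> to \<open>[0, T]\<close>.

  The kernel grows like \<open>|\<xi> - \<xi>\<^sub>*|\<^sup>\<alpha>\<close> with \<open>\<alpha> \<le> 1\<close>, so a Gaussian moment of the collision term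
  costs an extra factor \<open>|\<xi>|\<^sup>\<alpha>\<close>.  On a bounded time interval this loss is absorbed by letting the
  rate of the weight decrease linearly in time: differentiating \<open>exp (a(t) |\<xi>|\<^sup>2)\<close> produces the
  damping \<open>a'(t) |\<xi>|\<^sup>2\<close>, and \<open>|\<xi>|\<^sup>\<alpha> \<le> \<epsilon> |\<xi>|\<^sup>2 + C\<^sub>\<epsilon>\<close>.  No cancellation between the gain and the loss
  term is needed for the derivatives, only the conservation of energy in a collision, which gives
  \<open>exp (a |\<xi>'|\<^sup>2) \<le> exp (a |\<xi>|\<^sup>2) exp (a |\<xi>\<^sub>*|\<^sup>2)\<close>.

  For the density itself the Gaussian moment enters quadratically, and its finiteness at positive
  times is not known beforehand.  The exponential is therefore continued beyond \<open>|\<xi>|\<^sup>2 = R\<close> by its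
  tangent.  The resulting weight grows like \<open>|\<xi>|\<^sup>2\<close>, so its integral is finite; being convex with
  value \<open>0\<close> at the origin it is superadditive, which bounds its collision production by a product of
  two capped exponential moments.  A continuity argument keeps the moment below twice a bound for its
  initial value provided the rate is small, and \<open>R \<rightarrow> \<infinity>\<close> gives \<open>gaussian_propagation\<close>.

  For derivatives the damped inequality is linear in the highest order term, but it can only be used
  if the damping term is known to be finite, and a weak derivative is a priori only known to have
  two moments.  Difference quotients of \<open>f\<close> with a fixed step do inherit Gaussian integrability
  from \<open>f\<close>.  The collision operator is bilinear and commutes with translations, so difference
  quotients obey an exact product rule (\<open>fdiff_leibniz\<close>), and induction on the order bounds them
  uniformly in the step (\<open>bounded_differences_step\<close>).  Their initial values are averages of
  translates of the initial derivatives (\<open>fdiff_gauss_bound\<close>), and as the step tends to \<open>0\<close> they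
  converge in \<open>L\<^sup>1\<close> to the derivatives (\<open>fdiff_tendsto_derivative\<close>); hence \<open>derivative_propagation\<close>.
\<close>


section \<open>The surface measure and polar coordinates\<close>

lemma nn_integral_lborel_shift:
  fixes f :: "'a::euclidean_space \<Rightarrow> ennreal"
  assumes [measurable]: "f \<in> borel_measurable borel"
  shows "(\<integral>\<^sup>+x. f (x + v) \<partial>lborel) = (\<integral>\<^sup>+x. f x \<partial>lborel)"
proof -
  have "(\<integral>\<^sup>+x. f x \<partial>lborel) = (\<integral>\<^sup>+x. f x \<partial>distr lborel borel ((+) v))"
    by (simp add: lborel_distr_plus)
  also have "\<dots> = (\<integral>\<^sup>+x. f (x + v) \<partial>lborel)"
    by (subst nn_integral_distr) (auto simp: add.commute)
  finally show ?thesis ..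
qed

lemma space_sphere_measure [simp]: "space (sphere_measure :: (real^'n) measure) = sphere 0 1"
  by (simp add: sphere_measure_def space_scale_measure space_restrict_space)

lemma sets_sphere_measure [simp]:
  "sets (sphere_measure :: (real^'n) measure) = sets (restrict_space borel (sphere 0 1))"
  by (simp add: sphere_measure_def)

lemma sgn_measurable_punctured [measurable]:
  "sgn \<in> restrict_space lborel (A - {0::real^'n}) \<rightarrow>\<^sub>M restrict_space borel (sphere 0 1)"
proof (rule measurable_restrict_space2)
  show "sgn \<in> space (restrict_space lborel (A - {0::real^'n})) \<rightarrow> sphere 0 1"
    by (auto simp: space_restrict_space norm_sgn)
  show "sgn \<in> restrict_space lborel (A - {0::real^'n}) \<rightarrow>\<^sub>M borel"
    unfolding sgn_div_norm[abs_def] by (intro measurable_restrict_space1) measurable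
qed

lemma measurable_sphere_measure_borel [measurable]:
  "(\<lambda>\<sigma>. \<sigma>) \<in> (sphere_measure :: (real^'n) measure) \<rightarrow>\<^sub>M borel"
  by (simp add: measurable_cong_sets[OF sets_sphere_measure refl] measurable_restrict_space1)

lemma measurable_snd_sphere_measure_borel [measurable]:
  "snd \<in> N \<Otimes>\<^sub>M (sphere_measure :: (real^'n) measure) \<rightarrow>\<^sub>M borel"
  by (rule measurable_compose[OF measurable_snd measurable_sphere_measure_borel])

lemma emeasure_sphere_measure:
  assumes "B \<in> sets (sphere_measure :: (real^'n) measure)"
  shows "emeasure sphere_measure B =
    of_nat CARD('n) * emeasure lborel {x \<in> ball 0 1 - {0::real^'n}. sgn x \<in> B}"
proof -
  have B: "B \<in> sets (restrict_space borel (sphere 0 1))" using assms by simp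
  have eq: "sgn -` B \<inter> space (restrict_space lborel (ball 0 1 - {0::real^'n})) =
      {x \<in> ball 0 1 - {0::real^'n}. sgn x \<in> B}"
    by (auto simp: space_restrict_space)
  have "emeasure sphere_measure B = of_nat CARD('n) *
      emeasure (restrict_space lborel (ball 0 1 - {0::real^'n}))
        {x \<in> ball 0 1 - {0::real^'n}. sgn x \<in> B}"
    unfolding sphere_measure_def emeasure_scale_measure
    by (subst emeasure_distr[OF sgn_measurable_punctured B]) (simp only: eq)
  also have "emeasure (restrict_space lborel (ball 0 1 - {0::real^'n}))
        {x \<in> ball 0 1 - {0::real^'n}. sgn x \<in> B} = emeasure lborel {x \<in> ball 0 1 - {0::real^'n}. sgn x \<in> B}"
    by (rule emeasure_restrict_space) auto
  finally show ?thesis .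
qed

lemma sets_cone [measurable]:
  assumes "B \<in> sets (sphere_measure :: (real^'n) measure)" and [measurable]: "A \<in> sets borel"
  shows "{x. x \<noteq> 0 \<and> norm x \<in> A \<and> sgn x \<in> B} \<in> sets (lborel :: (real^'n) measure)"
proof -
  have "B \<in> sets (borel :: (real^'n) measure)"
    using assms(1) by (auto simp: sets_restrict_space)
  then have [measurable]: "{x. sgn x \<in> B} \<in> sets (borel :: (real^'n) measure)"
    unfolding sgn_div_norm[abs_def] by measurable
  have "{x. x \<noteq> 0 \<and> norm x \<in> A \<and> sgn x \<in> B} = (- {0}) \<inter> (norm -` A \<inter> space borel) \<inter> {x::real^'n. sgn x \<in> B}" by auto
  then show ?thesis by simp
qed

lemma finite_measure_sphere: "finite_measure (sphere_measure :: (real^'n) measure)"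
proof
  have "emeasure lborel {x \<in> ball 0 1 - {0::real^'n}. sgn x \<in> sphere 0 1} \<le> emeasure lborel (ball 0 1 :: (real^'n) set)"
    by (intro emeasure_mono) auto
  also have "\<dots> < \<infinity>" by (intro emeasure_bounded_finite) auto
  finally show "emeasure (sphere_measure :: (real^'n) measure) (space sphere_measure) \<noteq> \<infinity>"
    by (subst emeasure_sphere_measure) (auto simp: ennreal_mult_eq_top_iff sets_restrict_space)
qed

lemma sigma_finite_sphere: "sigma_finite_measure (sphere_measure :: (real^'n) measure)"
  using finite_measure_sphere by (rule finite_measure.axioms(1))

text \<open>Homogeneity of Lebesgue measure: the cone over \<open>B\<close> truncated at radius \<open>R\<close> is a dilate of the one
  truncated at radius \<open>1\<close>, by which the surface measure is defined.\<close>

lemma emeasure_cone_scale: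
  fixes B :: "(real^'n) set"
  assumes "B \<in> sets sphere_measure" "0 < R"
  shows "of_nat CARD('n) * emeasure lborel {x. x \<noteq> 0 \<and> norm x < R \<and> sgn x \<in> B} =
    ennreal (R ^ CARD('n)) * emeasure sphere_measure B"
proof -
  have m: "{x. x \<noteq> 0 \<and> norm x < R \<and> sgn x \<in> B} \<in> sets lborel"
    using sets_cone[OF assms(1), of "{..<R}"] by simp
  have "emeasure lborel {x. x \<noteq> 0 \<and> norm x < R \<and> sgn x \<in> B} =
     emeasure (density (distr lborel borel (\<lambda>x::real^'n. 0 + R *\<^sub>R x)) (\<lambda>_. \<bar>R\<bar>^DIM(real^'n)))
       {x. x \<noteq> 0 \<and> norm x < R \<and> sgn x \<in> B}"
    using lborel_affine[of R "0::real^'n"] assms(2) by simp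
  also have "\<dots> = ennreal (R ^ CARD('n)) * emeasure lborel {x. x \<noteq> 0 \<and> norm (R *\<^sub>R x) < R \<and> sgn (R *\<^sub>R x) \<in> B}"
    using m assms(2) by (subst emeasure_density)
      (auto simp: nn_integral_cmult emeasure_distr ennreal_power intro!: arg_cong2[where f="(*)"] arg_cong[where f="emeasure lborel"])
  also have "{x. x \<noteq> 0 \<and> norm (R *\<^sub>R x) < R \<and> sgn (R *\<^sub>R x) \<in> B} = {x \<in> ball 0 1 - {0}. sgn x \<in> B}"
    using assms(2) by (auto simp: sgn_scaleR)
  finally show ?thesis
    by (simp add: emeasure_sphere_measure[OF assms(1)] ac_simps)
qed

definition radial_measure :: "'n::finite itself \<Rightarrow> real measure" where
  "radial_measure _ = density lborel (\<lambda>r. ennreal (r ^ (CARD('n) - 1)) * indicator {0<..} r)"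

lemma sets_radial [simp, measurable_cong]: "sets (radial_measure TYPE('n::finite)) = sets borel"
  by (simp add: radial_measure_def)

lemma space_radial [simp]: "space (radial_measure TYPE('n::finite)) = UNIV"
  by (simp add: radial_measure_def)

lemma emeasure_radial_lessThan:
  "of_nat CARD('n) * emeasure (radial_measure TYPE('n::finite)) {..<R} = ennreal ((max 0 R) ^ CARD('n))"
proof (cases "R > 0")
  case True
  have n: "CARD('n) > 0" by simp
  have "emeasure (radial_measure TYPE('n)) {..<R} =
     (\<integral>\<^sup>+r. ennreal (r ^ (CARD('n) - 1)) * indicator {0<..} r * indicator {..<R} r \<partial>lborel)"
    unfolding radial_measure_def by (subst emeasure_density) auto
  also have "\<dots> = (\<integral>\<^sup>+r. ennreal (r ^ (CARD('n) - 1)) * indicator {0..R} r \<partial>lborel)"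
    using AE_lborel_singleton[of 0] AE_lborel_singleton[of R]
    by (intro nn_integral_cong_AE, eventually_elim) (auto split: split_indicator)
  also have "\<dots> = ennreal (R ^ CARD('n) / CARD('n) - 0 ^ CARD('n) / CARD('n))"
  proof (rule nn_integral_FTC_Icc[where F="\<lambda>x. x ^ CARD('n) / CARD('n)"])
    fix x :: real assume "x \<in> {0..R}"
    show "((\<lambda>x. x ^ CARD('n) / CARD('n)) has_real_derivative x ^ (CARD('n) - 1)) (at x)"
      using n by (auto intro!: derivative_eq_intros)
  qed (use True in auto)
  finally have "emeasure (radial_measure TYPE('n)) {..<R} = ennreal (R ^ CARD('n) / CARD('n))"
    using n by (simp add: power_0_left)
  moreover have "of_nat CARD('n) = ennreal (real CARD('n))" by (simp add: ennreal_of_nat_eq_real_of_nat)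
  ultimately show ?thesis using True
    by (simp add: ennreal_mult[symmetric])
next
  case False
  have "emeasure (radial_measure TYPE('n)) {..<R} =
     (\<integral>\<^sup>+r. ennreal (r ^ (CARD('n) - 1)) * indicator {0<..} r * indicator {..<R} r \<partial>lborel)"
    unfolding radial_measure_def by (subst emeasure_density) auto
  also have "\<dots> = (\<integral>\<^sup>+r. 0 \<partial>(lborel::real measure))"
    using False by (intro nn_integral_cong) (auto split: split_indicator)
  finally show ?thesis using False by simp
qed

lemma sigma_finite_radial: "sigma_finite_measure (radial_measure TYPE('n::finite))"
  unfolding radial_measure_def
  by (subst sigma_finite_measure.sigma_finite_iff_density_finite[OF sigma_finite_lborel]) (auto simp: ennreal_mult_eq_top_iff split: split_indicator)

text \<open>For fixed \<open>B\<close> both sides are measures in \<open>A\<close>, and by the scaling of cones they agree on the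
  generating rays \<open>{..<R}\<close>.\<close>

lemma emeasure_polar_rect:
  fixes B :: "(real^'n) set"
  assumes B[measurable]: "B \<in> sets sphere_measure" and A[measurable]: "A \<in> sets borel"
  shows "emeasure lborel {x. x \<noteq> 0 \<and> norm x \<in> A \<and> sgn x \<in> B} =
     emeasure (radial_measure TYPE('n)) A * emeasure sphere_measure B"
proof -
  define C where "C = {x::real^'n. x \<noteq> 0 \<and> sgn x \<in> B}"
  have C[measurable]: "C \<in> sets lborel"
    using sets_cone[OF B, of UNIV] by (simp add: C_def)
  define \<nu> where "\<nu> = distr (restrict_space lborel C) borel norm"
  define \<nu>' where "\<nu>' = scale_measure (emeasure sphere_measure B) (radial_measure TYPE('n))"
  have \<nu>: "emeasure \<nu> X = emeasure lborel {x. x \<noteq> 0 \<and> norm x \<in> X \<and> sgn x \<in> B}" if "X \<in> sets borel" for X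
  proof -
    have "emeasure \<nu> X = emeasure (restrict_space lborel C) {x. x \<noteq> 0 \<and> norm x \<in> X \<and> sgn x \<in> B}"
      unfolding \<nu>_def using that
      by (subst emeasure_distr) (auto simp: C_def space_restrict_space measurable_restrict_space1 intro!: arg_cong[where f="emeasure _"])
    also have "\<dots> = emeasure lborel {x. x \<noteq> 0 \<and> norm x \<in> X \<and> sgn x \<in> B}"
      using C by (intro emeasure_restrict_space) (auto simp: C_def)
    finally show ?thesis .
  qed
  have n: "of_nat CARD('n) \<noteq> (0::ennreal)" "of_nat CARD('n) \<noteq> (top::ennreal)" by auto
  have fin: "emeasure sphere_measure B \<noteq> \<infinity>"
    using finite_measure.emeasure_finite[OF finite_measure_sphere] by auto
  have less: "emeasure \<nu> {..<R} = emeasure \<nu>' {..<R}" for R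
  proof -
    have "of_nat CARD('n) * emeasure \<nu> {..<R} = of_nat CARD('n) * emeasure \<nu>' {..<R}"
    proof (cases "R > 0")
      case True
      then show ?thesis using emeasure_cone_scale[OF B True] emeasure_radial_lessThan[where 'n='n, of R]
        by (simp add: \<nu> \<nu>'_def mult.assoc[symmetric] mult.commute[of "emeasure sphere_measure B"])
    next
      case False
      then have e: "{x. x \<noteq> 0 \<and> norm x \<in> {..<R} \<and> sgn x \<in> B} = {}"
        by (auto simp: not_less) (meson less_le_trans norm_ge_zero not_less)
      have "emeasure \<nu> {..<R} = 0" by (subst \<nu>) (simp_all only: e, simp_all)
      moreover have "emeasure (radial_measure TYPE('n)) {..<R} = 0"
        using emeasure_radial_lessThan[where 'n='n, of R] False by (simp add: zero_power)
      ultimately show ?thesis by (simp add: \<nu>'_def)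
    qed
    then show ?thesis using n by (simp add: ennreal_mult_cancel_left)
  qed
  have "\<nu> = \<nu>'"
  proof (rule measure_eqI_generator_eq[where E="range lessThan" and \<Omega>=UNIV and A="\<lambda>i::nat. {..<real i}"])
    show "Int_stable (range (lessThan :: real \<Rightarrow> _))"
    proof (rule Int_stableI)
      fix a b :: "real set" assume "a \<in> range lessThan" "b \<in> range lessThan"
      then obtain x y where "a = {..<x}" "b = {..<y}" by auto
      then have "a \<inter> b = {..<min x y}" by auto
      then show "a \<inter> b \<in> range lessThan" by auto
    qed
    show "sets \<nu> = sigma_sets UNIV (range lessThan)" "sets \<nu>' = sigma_sets UNIV (range lessThan)"
      by (simp_all add: \<nu>_def \<nu>'_def) (simp_all add: borel_Iio)
    show "(\<Union>i. {..<real i}) = UNIV" using reals_Archimedean2 by auto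
    show "emeasure \<nu> {..<real i} \<noteq> \<infinity>" for i
    proof -
      have "emeasure (radial_measure TYPE('n)) {..<real i} \<noteq> \<infinity>"
        using emeasure_radial_lessThan[where 'n='n, of "real i"] by (auto simp: ennreal_mult_eq_top_iff)
      then show ?thesis unfolding less using fin by (simp add: \<nu>'_def ennreal_mult_eq_top_iff)
    qed
  qed (use less in auto)
  then have "emeasure \<nu> A = emeasure \<nu>' A" by simp
  then show ?thesis by (simp add: \<nu> \<nu>'_def mult.commute)
qed

lemma distr_polar:
  "distr (restrict_space lborel (UNIV - {0::real^'n})) (borel \<Otimes>\<^sub>M sphere_measure) (\<lambda>x. (norm x, sgn x)) =
     radial_measure TYPE('n) \<Otimes>\<^sub>M (sphere_measure :: (real^'n) measure)" (is "?D = _")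
proof (rule pair_measure_eqI[symmetric])
  have m: "(\<lambda>x::real^'n. (norm x, sgn x)) \<in> restrict_space lborel (UNIV - {0}) \<rightarrow>\<^sub>M borel \<Otimes>\<^sub>M sphere_measure"
    using sgn_measurable_punctured[of UNIV]
    by (intro measurable_Pair) (auto simp: measurable_restrict_space1 measurable_cong_sets[OF refl sets_sphere_measure])
  fix A B assume A: "A \<in> sets (radial_measure TYPE('n))" and B: "B \<in> sets (sphere_measure :: (real^'n) measure)"
  have "emeasure ?D (A \<times> B) = emeasure (restrict_space lborel (UNIV - {0::real^'n})) {x. x \<noteq> 0 \<and> norm x \<in> A \<and> sgn x \<in> B}"
    using A B by (subst emeasure_distr[OF m]) (auto simp: space_restrict_space intro!: arg_cong[where f="emeasure _"])
  also have "\<dots> = emeasure lborel {x. x \<noteq> 0 \<and> norm x \<in> A \<and> sgn x \<in> B}"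
    by (intro emeasure_restrict_space) auto
  also have "\<dots> = emeasure (radial_measure TYPE('n)) A * emeasure sphere_measure B"
    using A B by (intro emeasure_polar_rect) auto
  finally show "emeasure (radial_measure TYPE('n)) A * emeasure sphere_measure B = emeasure ?D (A \<times> B)" ..
qed (auto intro: sigma_finite_radial sigma_finite_sphere cong: sets_pair_measure_cong)

lemma nn_integral_polar:
  fixes f :: "real^'n \<Rightarrow> ennreal"
  assumes [measurable]: "f \<in> borel_measurable borel"
  shows "(\<integral>\<^sup>+x. f x \<partial>lborel) = (\<integral>\<^sup>+r. \<integral>\<^sup>+\<omega>. f (r *\<^sub>R \<omega>) \<partial>sphere_measure \<partial>radial_measure TYPE('n))"
proof -
  interpret S: sigma_finite_measure "sphere_measure :: (real^'n) measure" by (rule sigma_finite_sphere)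
  have m: "(\<lambda>x::real^'n. (norm x, sgn x)) \<in> restrict_space lborel (UNIV - {0}) \<rightarrow>\<^sub>M borel \<Otimes>\<^sub>M sphere_measure"
    using sgn_measurable_punctured[of UNIV]
    by (intro measurable_Pair) (auto simp: measurable_restrict_space1 measurable_cong_sets[OF refl sets_sphere_measure])
  have g: "(\<lambda>(r, \<omega>). f (r *\<^sub>R \<omega>)) \<in> borel_measurable (borel \<Otimes>\<^sub>M (sphere_measure :: (real^'n) measure))"
    unfolding split_beta' by (rule measurable_compose[OF _ assms]) measurable
  have "(\<integral>\<^sup>+r. \<integral>\<^sup>+\<omega>. f (r *\<^sub>R \<omega>) \<partial>sphere_measure \<partial>radial_measure TYPE('n)) =
     (\<integral>\<^sup>+z. (\<lambda>(r, \<omega>). f (r *\<^sub>R \<omega>)) z \<partial>(radial_measure TYPE('n) \<Otimes>\<^sub>M sphere_measure))"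
    by (subst S.nn_integral_fst[symmetric]) auto
  also have "\<dots> = (\<integral>\<^sup>+x. f (norm x *\<^sub>R sgn x) \<partial>restrict_space lborel (UNIV - {0::real^'n}))"
    unfolding distr_polar[symmetric] by (subst nn_integral_distr[OF m]) (simp_all add: g)
  also have "\<dots> = (\<integral>\<^sup>+x. f x \<partial>restrict_space lborel (UNIV - {0::real^'n}))"
    by (intro nn_integral_cong) (simp add: sgn_div_norm)
  also have "\<dots> = (\<integral>\<^sup>+x. f x * indicator (UNIV - {0}) x \<partial>lborel)"
    by (subst nn_integral_restrict_space) auto
  also have "\<dots> = (\<integral>\<^sup>+x. f x \<partial>lborel)"
    using AE_lborel_singleton[of "0::real^'n"] by (intro nn_integral_cong_AE, eventually_elim) auto
  finally show ?thesis ..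
qed

lemma AE_radial_pos: "AE r in radial_measure TYPE('n::finite). 0 < r"
  unfolding radial_measure_def by (subst AE_density) (auto split: split_indicator)

text \<open>In polar coordinates both sides integrate \<open>f (r \<omega>, r \<sigma>)\<close> over radii and pairs of directions.\<close>

lemma nn_integral_sphere_swap:
  fixes f :: "real^'n \<Rightarrow> real^'n \<Rightarrow> ennreal"
  assumes [measurable]: "(\<lambda>(x, y). f x y) \<in> borel_measurable borel"
  shows "(\<integral>\<^sup>+u. \<integral>\<^sup>+\<sigma>. f u (norm u *\<^sub>R \<sigma>) \<partial>sphere_measure \<partial>lborel) =
         (\<integral>\<^sup>+u. \<integral>\<^sup>+\<sigma>. f (norm u *\<^sub>R \<sigma>) u \<partial>sphere_measure \<partial>lborel)"
proof -
  interpret S: sigma_finite_measure "sphere_measure :: (real^'n) measure" by (rule sigma_finite_sphere)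
  interpret SS: pair_sigma_finite "sphere_measure :: (real^'n) measure" "sphere_measure :: (real^'n) measure" ..
  have [measurable]: "(\<lambda>(x, y). f x y) \<in> borel_measurable (borel \<Otimes>\<^sub>M borel)"
    using assms by (simp add: borel_prod)
  have 1: "(\<integral>\<^sup>+u. \<integral>\<^sup>+\<sigma>. f u (norm u *\<^sub>R \<sigma>) \<partial>sphere_measure \<partial>lborel) =
     (\<integral>\<^sup>+r. \<integral>\<^sup>+\<omega>. \<integral>\<^sup>+\<sigma>. f (r *\<^sub>R \<omega>) (r *\<^sub>R \<sigma>) \<partial>sphere_measure \<partial>sphere_measure \<partial>radial_measure TYPE('n))"
    apply (subst nn_integral_polar)
    subgoal by measurable
    using AE_radial_pos[where 'n='n]
    by (intro nn_integral_cong_AE, eventually_elim) (auto intro!: nn_integral_cong)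
  have 2: "(\<integral>\<^sup>+u. \<integral>\<^sup>+\<sigma>. f (norm u *\<^sub>R \<sigma>) u \<partial>sphere_measure \<partial>lborel) =
     (\<integral>\<^sup>+r. \<integral>\<^sup>+\<omega>. \<integral>\<^sup>+\<sigma>. f (r *\<^sub>R \<sigma>) (r *\<^sub>R \<omega>) \<partial>sphere_measure \<partial>sphere_measure \<partial>radial_measure TYPE('n))"
    apply (subst nn_integral_polar)
    subgoal by measurable
    using AE_radial_pos[where 'n='n]
    by (intro nn_integral_cong_AE, eventually_elim) (auto intro!: nn_integral_cong)
  have 3: "(\<integral>\<^sup>+\<omega>. \<integral>\<^sup>+\<sigma>. f (r *\<^sub>R \<omega>) (r *\<^sub>R \<sigma>) \<partial>sphere_measure \<partial>sphere_measure) =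
      (\<integral>\<^sup>+\<omega>. \<integral>\<^sup>+\<sigma>. f (r *\<^sub>R \<sigma>) (r *\<^sub>R \<omega>) \<partial>sphere_measure \<partial>sphere_measure)" for r
    by (rule SS.Fubini') measurable
  show ?thesis unfolding 1 2 by (simp add: 3)
qed

section \<open>The collision transformation\<close>

lemma nn_integral_center_of_mass:
  fixes g :: "real^'n \<Rightarrow> real^'n \<Rightarrow> ennreal"
  assumes [measurable]: "(\<lambda>(x, y). g x y) \<in> borel_measurable borel"
  shows "(\<integral>\<^sup>+x. \<integral>\<^sup>+y. g x y \<partial>lborel \<partial>lborel) =
     (\<integral>\<^sup>+c. \<integral>\<^sup>+u. g (c + (1/2) *\<^sub>R u) (c - (1/2) *\<^sub>R u) \<partial>lborel \<partial>lborel)"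
proof -
  have [measurable]: "(\<lambda>(x, y). g x y) \<in> borel_measurable (borel \<Otimes>\<^sub>M borel)"
    using assms by (simp add: borel_prod)
  have "(\<integral>\<^sup>+x. \<integral>\<^sup>+y. g x y \<partial>lborel \<partial>lborel) = (\<integral>\<^sup>+y. \<integral>\<^sup>+x. g x y \<partial>lborel \<partial>lborel)"
    by (rule lborel_pair.Fubini'[symmetric]) measurable
  also have "\<dots> = (\<integral>\<^sup>+y. \<integral>\<^sup>+u. g (u + y) y \<partial>lborel \<partial>lborel)"
    by (intro nn_integral_cong nn_integral_lborel_shift[symmetric]) measurable
  also have "\<dots> = (\<integral>\<^sup>+u. \<integral>\<^sup>+y. g (u + y) y \<partial>lborel \<partial>lborel)"
    by (rule lborel_pair.Fubini') measurable
  also have "\<dots> = (\<integral>\<^sup>+u. \<integral>\<^sup>+y. g (u + (y + (- (1/2)) *\<^sub>R u)) (y + (- (1/2)) *\<^sub>R u) \<partial>lborel \<partial>lborel)"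
    by (intro nn_integral_cong nn_integral_lborel_shift[symmetric]) measurable
  also have "\<dots> = (\<integral>\<^sup>+u. \<integral>\<^sup>+c. g (c + (1/2) *\<^sub>R u) (c - (1/2) *\<^sub>R u) \<partial>lborel \<partial>lborel)"
  proof -
    have e: "u + (y + (- (1/2)) *\<^sub>R u) = y + (1/2) *\<^sub>R u" for u y :: "real^'n"
      by (simp add: vec_eq_iff)
    show ?thesis unfolding e by simp
  qed
  also have "\<dots> = (\<integral>\<^sup>+c. \<integral>\<^sup>+u. g (c + (1/2) *\<^sub>R u) (c - (1/2) *\<^sub>R u) \<partial>lborel \<partial>lborel)"
    by (rule lborel_pair.Fubini') measurable
  finally show ?thesis .
qed

lemma post_velocity_center:
  "post_velocity (c + (1/2) *\<^sub>R u) (c - (1/2) *\<^sub>R u) \<sigma> = c + (1/2) *\<^sub>R (norm u *\<^sub>R \<sigma>)"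
  "post_velocity_star (c + (1/2) *\<^sub>R u) (c - (1/2) *\<^sub>R u) \<sigma> = c - (1/2) *\<^sub>R (norm u *\<^sub>R \<sigma>)"
proof -
  have e: "c + (1/2) *\<^sub>R u - (c - (1/2) *\<^sub>R u) = u" by (simp add: vec_eq_iff)
  show "post_velocity (c + (1/2) *\<^sub>R u) (c - (1/2) *\<^sub>R u) \<sigma> = c + (1/2) *\<^sub>R (norm u *\<^sub>R \<sigma>)"
   "post_velocity_star (c + (1/2) *\<^sub>R u) (c - (1/2) *\<^sub>R u) \<sigma> = c - (1/2) *\<^sub>R (norm u *\<^sub>R \<sigma>)"
    unfolding post_velocity_def post_velocity_star_def e by (simp_all add: algebra_simps)
qed

text \<open>Pre- and post-collisional velocities share their centre of mass, and the relative velocities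
  before and after the collision have equal length; this reduces the invariance of the collision
  measure to the exchange of two directions.\<close>

lemma nn_integral_collision_swap:
  fixes F :: "(real^'n) \<times> (real^'n) \<Rightarrow> (real^'n) \<times> (real^'n) \<Rightarrow> ennreal"
  assumes [measurable]: "(\<lambda>(x, y). F x y) \<in> borel_measurable borel"
  shows "(\<integral>\<^sup>+x. \<integral>\<^sup>+y. \<integral>\<^sup>+\<sigma>. F (x, y) (post_velocity x y \<sigma>, post_velocity_star x y \<sigma>) \<partial>sphere_measure \<partial>lborel \<partial>lborel) =
    (\<integral>\<^sup>+x. \<integral>\<^sup>+y. \<integral>\<^sup>+\<sigma>. F (post_velocity x y \<sigma>, post_velocity_star x y \<sigma>) (x, y) \<partial>sphere_measure \<partial>lborel \<partial>lborel)"
proof -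
  interpret S: sigma_finite_measure "sphere_measure :: (real^'n) measure" by (rule sigma_finite_sphere)
  have [measurable]: "(\<lambda>(x, y). F x y) \<in> borel_measurable ((borel \<Otimes>\<^sub>M borel) \<Otimes>\<^sub>M (borel \<Otimes>\<^sub>M borel))"
    using assms by (simp add: borel_prod)
  note pv = post_velocity_def post_velocity_star_def
  have 1: "(\<lambda>(x, y). \<integral>\<^sup>+\<sigma>. F (x, y) (post_velocity x y \<sigma>, post_velocity_star x y \<sigma>) \<partial>sphere_measure) \<in> borel_measurable borel"
    unfolding pv borel_prod[symmetric] by measurable
  have 2: "(\<lambda>(x, y). \<integral>\<^sup>+\<sigma>. F (post_velocity x y \<sigma>, post_velocity_star x y \<sigma>) (x, y) \<partial>sphere_measure) \<in> borel_measurable borel"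
    unfolding pv borel_prod[symmetric] by measurable
  show ?thesis
    unfolding nn_integral_center_of_mass[OF 1] nn_integral_center_of_mass[OF 2] post_velocity_center
    apply (rule nn_integral_cong)
    subgoal for c
      using nn_integral_sphere_swap[of "\<lambda>u v. F (c + (1/2) *\<^sub>R u, c - (1/2) *\<^sub>R u) (c + (1/2) *\<^sub>R v, c - (1/2) *\<^sub>R v)"]
      apply (rule meta_mp)
      unfolding borel_prod[symmetric] by measurable
    done
qed


section \<open>The collision integral of a function of two velocities\<close>

lemma sets_lborel_sphere: "sets (lborel \<Otimes>\<^sub>M (sphere_measure :: (real^'n) measure)) =
   sets (borel \<Otimes>\<^sub>M sphere_measure)"
  by (intro sets_pair_measure_cong) auto

lemma distr_sphere_uminus:
  "distr sphere_measure sphere_measure uminus = (sphere_measure :: (real^'n) measure)"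
proof (rule measure_eqI)
  have m: "uminus \<in> sphere_measure \<rightarrow>\<^sub>M (sphere_measure :: (real^'n) measure)"
    unfolding measurable_cong_sets[OF refl sets_sphere_measure]
    by (rule measurable_restrict_space2) auto
  fix B :: "(real^'n) set" assume "B \<in> sets (distr sphere_measure sphere_measure uminus)"
  then have B: "B \<in> sets sphere_measure" by simp
  have B': "uminus -` B \<inter> sphere 0 1 \<in> sets sphere_measure"
    using measurable_sets[OF m B] by simp
  have s: "{x. x \<noteq> 0 \<and> norm x \<in> {..<1} \<and> sgn x \<in> B} \<in> sets lborel"
    using B by (intro sets_cone) auto
  have "emeasure lborel {x. x \<noteq> 0 \<and> norm x \<in> {..<1} \<and> sgn x \<in> B} =
    emeasure (density (distr lborel borel (\<lambda>x. 0 + (-1) *\<^sub>R x)) (\<lambda>_. \<bar>-1::real\<bar>^DIM(real^'n))) {x. x \<noteq> 0 \<and> norm x \<in> {..<1} \<and> sgn x \<in> B}"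
    using lborel_affine[of "-1" "0::real^'n"] by simp
  also have "\<dots> = emeasure lborel ((\<lambda>x. - x) -` {x. x \<noteq> 0 \<and> norm x \<in> {..<1} \<and> sgn x \<in> B})"
    using s by (subst emeasure_density) (auto simp: emeasure_distr)
  also have "((\<lambda>x. - x) -` {x. x \<noteq> 0 \<and> norm x \<in> {..<1} \<and> sgn x \<in> B}) =
     {x \<in> ball 0 1 - {0}. sgn x \<in> uminus -` B \<inter> sphere 0 1}"
    by (auto simp: sgn_minus norm_sgn)
  also have "{x. x \<noteq> 0 \<and> norm x \<in> {..<1} \<and> sgn x \<in> B} = {x \<in> ball 0 1 - {0}. sgn x \<in> B}"
    by auto
  finally show "emeasure (distr sphere_measure sphere_measure uminus) B = emeasure sphere_measure B"
    using B B' by (simp add: emeasure_distr[OF m] emeasure_sphere_measure)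
qed simp

lemma nn_integral_sphere_uminus:
  assumes "f \<in> borel_measurable (sphere_measure :: (real^'n) measure)"
  shows "(\<integral>\<^sup>+\<sigma>. f (- \<sigma>) \<partial>sphere_measure) = (\<integral>\<^sup>+\<sigma>. f \<sigma> \<partial>(sphere_measure :: (real^'n) measure))"
proof -
  have m: "uminus \<in> sphere_measure \<rightarrow>\<^sub>M (sphere_measure :: (real^'n) measure)"
    unfolding measurable_cong_sets[OF refl sets_sphere_measure]
    by (rule measurable_restrict_space2) auto
  have "(\<integral>\<^sup>+\<sigma>. f \<sigma> \<partial>(sphere_measure :: (real^'n) measure)) = (\<integral>\<^sup>+\<sigma>. f \<sigma> \<partial>distr sphere_measure sphere_measure uminus)"
    by (simp add: distr_sphere_uminus)
  also have "\<dots> = (\<integral>\<^sup>+\<sigma>. f (- \<sigma>) \<partial>sphere_measure)"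
    by (rule nn_integral_distr[OF m]) (use assms in simp)
  finally show ?thesis ..
qed

lemma post_velocity_diff:
  fixes x y :: "real^'n"
  shows  "post_velocity x y \<sigma> - post_velocity_star x y \<sigma> = norm (x - y) *\<^sub>R \<sigma>"
proof -
  have "x + (1/2) *\<^sub>R (r - (x - y)) - (y - (1/2) *\<^sub>R (r - (x - y))) = r" for r :: "real^'n"
    unfolding vec_eq_iff by (simp add: diff_divide_distrib)
  then show ?thesis unfolding post_velocity_def post_velocity_star_def .
qed

lemma post_velocity_energy:
  fixes x y \<sigma> :: "real^'n"
  assumes "\<sigma> \<in> sphere 0 1"
  shows "(norm (post_velocity x y \<sigma>))\<^sup>2 + (norm (post_velocity_star x y \<sigma>))\<^sup>2 = (norm x)\<^sup>2 + (norm y)\<^sup>2"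
proof -
  have par: "(norm (p::real^'n))\<^sup>2 + (norm q)\<^sup>2 = ((norm (p + q))\<^sup>2 + (norm (p - q))\<^sup>2) / 2" for p q
    by (simp add: power2_norm_eq_inner inner_add_left inner_add_right inner_diff_left inner_diff_right inner_commute)
  have "post_velocity x y \<sigma> + post_velocity_star x y \<sigma> = x + y"
    by (simp add: post_velocity_def post_velocity_star_def)
  moreover have "norm (post_velocity x y \<sigma> - post_velocity_star x y \<sigma>) = norm (x - y)"
    using assms by (simp add: post_velocity_diff)
  ultimately show ?thesis
    using par[of "post_velocity x y \<sigma>" "post_velocity_star x y \<sigma>"] par[of x y] by simp
qed

lemma post_velocity_swap:
  fixes x y :: "real^'n"
  shows  "post_velocity y x (- \<sigma>) = post_velocity_star x y \<sigma>"
  unfolding post_velocity_def post_velocity_star_def norm_minus_commute[of y x]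
  by (simp add: vec_eq_iff algebra_simps)

lemma post_velocity_shift:
  fixes x y :: "real^'n"
  shows  "post_velocity (x + v) (y + v) \<sigma> = post_velocity x y \<sigma> + v"
  "post_velocity_star (x + v) (y + v) \<sigma> = post_velocity_star x y \<sigma> + v"
  by (simp_all add: post_velocity_def post_velocity_star_def algebra_simps)

lemma powr_norm_diff_le:
  assumes "0 < \<alpha>" "\<alpha> \<le> 1"
  shows "norm (x - y) powr \<alpha> \<le> norm x powr \<alpha> + norm y powr \<alpha>"
proof -
  have sub: "(a + b) powr \<alpha> \<le> a powr \<alpha> + b powr \<alpha>" if "0 \<le> a" "0 \<le> b" for a b :: real
  proof (cases "a + b = 0")
    case False
    then have p: "a + b > 0" using that by auto
    have q: "t \<le> t powr \<alpha>" if "0 \<le> t" "t \<le> 1" for t :: real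
      using powr_mono_both'[of \<alpha> 1 t t] that assms by (cases "t = 0") (auto intro: powr_mono')
    have "1 = a / (a + b) + b / (a + b)" using p by (simp add: add_divide_distrib[symmetric])
    also have "\<dots> \<le> (a / (a + b)) powr \<alpha> + (b / (a + b)) powr \<alpha>"
      using that p by (intro add_mono q) (auto simp: divide_le_eq)
    also have "\<dots> = (a powr \<alpha> + b powr \<alpha>) / (a + b) powr \<alpha>"
      using that p by (simp add: powr_divide add_divide_distrib)
    finally show ?thesis using p by (simp add: le_divide_eq)
  qed (use that in auto)
  have "norm (x - y) powr \<alpha> \<le> (norm x + norm y) powr \<alpha>"
    using assms by (intro powr_mono2 norm_triangle_ineq4) auto
  also have "\<dots> \<le> norm x powr \<alpha> + norm y powr \<alpha>" by (rule sub) auto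
  finally show ?thesis .
qed

text \<open>The angular kernel is a nonnegative Borel function on the whole line; a general kernel is reduced
  to this case below.\<close>

locale collision =
  fixes \<alpha> :: real and h :: "real \<Rightarrow> real" and dim :: "'n::finite itself"
  assumes alpha_pos: "0 < \<alpha>" and alpha_le_1: "\<alpha> \<le> 1"
    and h_meas [measurable]: "h \<in> borel_measurable borel"
    and h_nonneg: "\<And>z. 0 \<le> h z"
    and h_normalized: "\<And>e :: real^'n. norm e = 1 \<Longrightarrow> (\<integral>\<^sup>+\<sigma>. ennreal (h (e \<bullet> \<sigma>)) \<partial>sphere_measure) = 1"
begin

abbreviation K :: "real^'n \<Rightarrow> real^'n \<Rightarrow> real" where "K \<equiv> collision_kernel \<alpha> h"
abbreviation S :: "(real^'n) measure" where "S \<equiv> sphere_measure"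

lemma K_nonneg: "0 \<le> K u \<sigma>" by (simp add: collision_kernel_def h_nonneg)

lemma K_meas [measurable]: "(\<lambda>(u, \<sigma>). K u \<sigma>) \<in> borel_measurable (borel \<Otimes>\<^sub>M borel)"
  unfolding collision_kernel_def sgn_div_norm by measurable

lemma nn_integral_K: "(\<integral>\<^sup>+\<sigma>. ennreal (K u \<sigma>) \<partial>S) = ennreal (norm u powr \<alpha>)"
proof (cases "u = 0")
  case False
  then have "norm (sgn u) = 1" by (simp add: norm_sgn)
  then show ?thesis
    using h_normalized[of "sgn u"] h_nonneg
    by (simp add: collision_kernel_def ennreal_mult nn_integral_cmult)
qed (simp add: collision_kernel_def)

lemma pv_meas [measurable]:
  "(\<lambda>(z, \<sigma>). post_velocity (fst z) (snd z) \<sigma>) \<in> (borel \<Otimes>\<^sub>M borel) \<Otimes>\<^sub>M S \<rightarrow>\<^sub>M (borel :: (real^'n) measure)"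
  "(\<lambda>(z, \<sigma>). post_velocity_star (fst z) (snd z) \<sigma>) \<in> (borel \<Otimes>\<^sub>M borel) \<Otimes>\<^sub>M S \<rightarrow>\<^sub>M (borel :: (real^'n) measure)"
  unfolding post_velocity_def post_velocity_star_def by measurable

definition collision_integrand :: "((real^'n) \<times> (real^'n) \<Rightarrow> real) \<Rightarrow> real^'n \<Rightarrow> (real^'n) \<times> (real^'n) \<Rightarrow> real" where
  "collision_integrand H x = (\<lambda>(y, \<sigma>).
     (H (post_velocity x y \<sigma>, post_velocity_star x y \<sigma>) - H (x, y)) * K (x - y) \<sigma>)"

text \<open>The collision operator is quadratic in the density; as a functional of a function \<open>H\<close> of two
  velocities it is linear, so that differences and translations of \<open>Q(f, f)\<close> can be computed on
  \<open>H = f \<otimes> f\<close>.\<close>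

definition coll :: "((real^'n) \<times> (real^'n) \<Rightarrow> real) \<Rightarrow> real^'n \<Rightarrow> real" where
  "coll H x = integral\<^sup>L (lborel \<Otimes>\<^sub>M S) (collision_integrand H x)"

definition coll_abs :: "((real^'n) \<times> (real^'n) \<Rightarrow> real) \<Rightarrow> real^'n \<Rightarrow> ennreal" where
  "coll_abs H x = (\<integral>\<^sup>+y. \<integral>\<^sup>+\<sigma>. ennreal ((\<bar>H (post_velocity x y \<sigma>, post_velocity_star x y \<sigma>)\<bar> + \<bar>H (x, y)\<bar>) * K (x - y) \<sigma>) \<partial>S \<partial>lborel)"

lemma collision_integrand_meas2:
  assumes [measurable]: "H \<in> borel_measurable borel"
  shows "(\<lambda>(x, z). collision_integrand H x z) \<in> borel_measurable (borel \<Otimes>\<^sub>M (borel \<Otimes>\<^sub>M S))"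
proof -
  have [measurable]: "H \<in> borel_measurable (borel \<Otimes>\<^sub>M borel)" using assms by (simp add: borel_prod)
  show ?thesis
    unfolding collision_integrand_def post_velocity_def post_velocity_star_def by measurable
qed

lemma collision_integrand_meas:
  assumes "H \<in> borel_measurable borel"
  shows "collision_integrand H x \<in> borel_measurable (lborel \<Otimes>\<^sub>M S)"
  using measurable_compose[OF measurable_Pair1' collision_integrand_meas2[OF assms], of x]
  by (simp add: measurable_cong_sets[OF sets_lborel_sphere refl])

lemma coll_abs_ge:
  assumes H[measurable]: "H \<in> borel_measurable borel"
  shows "(\<integral>\<^sup>+z. ennreal \<bar>collision_integrand H x z\<bar> \<partial>(lborel \<Otimes>\<^sub>M S)) \<le> coll_abs H x"
proof -
  interpret S: sigma_finite_measure S by (rule sigma_finite_sphere)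
  note [measurable] = collision_integrand_meas[OF H, of x]
  have "(\<integral>\<^sup>+z. ennreal \<bar>collision_integrand H x z\<bar> \<partial>(lborel \<Otimes>\<^sub>M S)) =
    (\<integral>\<^sup>+y. \<integral>\<^sup>+\<sigma>. ennreal \<bar>collision_integrand H x (y, \<sigma>)\<bar> \<partial>S \<partial>lborel)"
    by (subst S.nn_integral_fst[symmetric]) auto
  also have "\<dots> \<le> coll_abs H x"
    unfolding coll_abs_def collision_integrand_def
    by (intro nn_integral_mono ennreal_leI) (auto simp: abs_mult K_nonneg intro!: mult_right_mono)
  finally show ?thesis .
qed

lemma abs_coll_le:
  assumes H: "H \<in> borel_measurable borel"
  shows "ennreal \<bar>coll H x\<bar> \<le> coll_abs H x"
proof (cases "integrable (lborel \<Otimes>\<^sub>M S) (collision_integrand H x)")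
  case True
  have "ennreal \<bar>coll H x\<bar> \<le> (\<integral>\<^sup>+z. ennreal \<bar>collision_integrand H x z\<bar> \<partial>(lborel \<Otimes>\<^sub>M S))"
    using integral_norm_bound_ennreal[OF True] by (simp add: coll_def)
  then show ?thesis using coll_abs_ge[OF H] by (rule order_trans)
next
  case False
  then show ?thesis by (simp add: coll_def not_integrable_integral_eq)
qed

lemma integrable_collision_integrand:
  assumes H: "H \<in> borel_measurable borel" and "coll_abs H x < \<infinity>"
  shows "integrable (lborel \<Otimes>\<^sub>M S) (collision_integrand H x)"
  using coll_abs_ge[OF H, of x] assms(2) collision_integrand_meas[OF H]
  by (auto simp: integrable_iff_bounded)

lemma nn_integral_collision_swap_kernel:
  fixes A B :: "(real^'n) \<times> (real^'n) \<Rightarrow> ennreal"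
  assumes [measurable]: "A \<in> borel_measurable borel" "B \<in> borel_measurable borel"
  shows "(\<integral>\<^sup>+x. \<integral>\<^sup>+y. \<integral>\<^sup>+\<sigma>. A (post_velocity x y \<sigma>, post_velocity_star x y \<sigma>) * B (x, y) * K (x - y) \<sigma> \<partial>S \<partial>lborel \<partial>lborel) =
    (\<integral>\<^sup>+x. \<integral>\<^sup>+y. \<integral>\<^sup>+\<sigma>. A (x, y) * B (post_velocity x y \<sigma>, post_velocity_star x y \<sigma>) * K (x - y) \<sigma> \<partial>S \<partial>lborel \<partial>lborel)"
proof -
  define k where "k u v = ennreal (norm u powr \<alpha> * h (sgn u \<bullet> sgn v))" for u v :: "real^'n"
  have [measurable]: "A \<in> borel_measurable (borel \<Otimes>\<^sub>M borel)" "B \<in> borel_measurable (borel \<Otimes>\<^sub>M borel)"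
    using assms by (simp_all add: borel_prod)
  define F where "F p q = A q * B p * k (fst p - snd p) (fst q - snd q)" for p q :: "(real^'n) \<times> (real^'n)"
  have m: "(\<lambda>(p, q). F p q) \<in> borel_measurable borel"
    unfolding F_def k_def sgn_div_norm borel_prod[symmetric] by measurable
  have K1: "k (x - y) (post_velocity x y \<sigma> - post_velocity_star x y \<sigma>) = ennreal (K (x - y) \<sigma>)"
    "k (post_velocity x y \<sigma> - post_velocity_star x y \<sigma>) (x - y) = ennreal (K (x - y) \<sigma>)" if "\<sigma> \<in> sphere 0 1" for x y \<sigma>
    using that by (cases "x = y"; force simp: k_def post_velocity_diff collision_kernel_def sgn_scaleR sgn_div_norm[of \<sigma>] inner_commute)+
  show ?thesis
    using nn_integral_collision_swap[OF m]
    by (simp add: F_def K1 cong: nn_integral_cong_simp)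
qed

text \<open>The measure-preserving exchange of pre- and post-collisional velocities, applied to the gain
  term, turns \<open>H\<close> at the outgoing pair into \<open>H\<close> at the incoming pair and moves the weight to the
  outgoing velocity.\<close>

lemma nn_integral_coll_abs:
  assumes [measurable]: "H \<in> borel_measurable borel" "w \<in> borel_measurable borel"
  shows "(\<integral>\<^sup>+x. coll_abs H x * w x \<partial>lborel) =
    (\<integral>\<^sup>+x. \<integral>\<^sup>+y. \<integral>\<^sup>+\<sigma>. ennreal \<bar>H (x, y)\<bar> * (w (post_velocity x y \<sigma>) + w x) * K (x - y) \<sigma> \<partial>S \<partial>lborel \<partial>lborel)"
proof -
  interpret S: sigma_finite_measure S by (rule sigma_finite_sphere)
  have [measurable]: "H \<in> borel_measurable (borel \<Otimes>\<^sub>M borel)" by (simp add: borel_prod)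
  have wm[measurable]: "(\<lambda>z. w (fst z)) \<in> borel_measurable (borel :: ((real^'n) \<times> (real^'n)) measure)"
    "(\<lambda>z. ennreal \<bar>H z\<bar>) \<in> borel_measurable (borel :: ((real^'n) \<times> (real^'n)) measure)"
    unfolding borel_prod[symmetric] by measurable
  have m1: "(\<lambda>(x, y). \<integral>\<^sup>+\<sigma>. ennreal \<bar>H (post_velocity x y \<sigma>, post_velocity_star x y \<sigma>)\<bar> * w x * K (x - y) \<sigma> \<partial>S) \<in> borel_measurable (borel \<Otimes>\<^sub>M borel)"
    unfolding post_velocity_def post_velocity_star_def by measurable
  have m2: "(\<lambda>(x, y). \<integral>\<^sup>+\<sigma>. ennreal \<bar>H (x, y)\<bar> * w x * K (x - y) \<sigma> \<partial>S) \<in> borel_measurable (borel \<Otimes>\<^sub>M borel)"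
    by measurable
  have m3: "(\<lambda>(x, y). \<integral>\<^sup>+\<sigma>. ennreal \<bar>H (x, y)\<bar> * w (post_velocity x y \<sigma>) * K (x - y) \<sigma> \<partial>S) \<in> borel_measurable (borel \<Otimes>\<^sub>M borel)"
    unfolding post_velocity_def post_velocity_star_def by measurable
  note [measurable] = m1 m2 m3
  have [measurable]: "(\<lambda>\<sigma>. ennreal \<bar>H (post_velocity x y \<sigma>, post_velocity_star x y \<sigma>)\<bar>) \<in> borel_measurable S"
     "(\<lambda>\<sigma>. w (post_velocity x y \<sigma>)) \<in> borel_measurable S" for x y
    unfolding post_velocity_def post_velocity_star_def by measurable
  have "(\<integral>\<^sup>+x. coll_abs H x * w x \<partial>lborel) =
    (\<integral>\<^sup>+x. \<integral>\<^sup>+y. \<integral>\<^sup>+\<sigma>. (ennreal \<bar>H (post_velocity x y \<sigma>, post_velocity_star x y \<sigma>)\<bar> * w x * K (x - y) \<sigma> + ennreal \<bar>H (x, y)\<bar> * w x * K (x - y) \<sigma>) \<partial>S \<partial>lborel \<partial>lborel)"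
  proof (intro nn_integral_cong)
    fix x :: "real^'n"
    have m4: "(\<lambda>y. \<integral>\<^sup>+\<sigma>. ennreal ((\<bar>H (post_velocity x y \<sigma>, post_velocity_star x y \<sigma>)\<bar> + \<bar>H (x, y)\<bar>) * K (x - y) \<sigma>) \<partial>S) \<in> borel_measurable lborel"
      unfolding post_velocity_def post_velocity_star_def by measurable
    show "coll_abs H x * w x = (\<integral>\<^sup>+y. \<integral>\<^sup>+\<sigma>. (ennreal \<bar>H (post_velocity x y \<sigma>, post_velocity_star x y \<sigma>)\<bar> * w x * K (x - y) \<sigma> + ennreal \<bar>H (x, y)\<bar> * w x * K (x - y) \<sigma>) \<partial>S \<partial>lborel)"
      unfolding coll_abs_def
      apply (subst nn_integral_multc[symmetric, OF m4])
      apply (intro nn_integral_cong)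
      apply (subst nn_integral_multc[symmetric])
      subgoal by (simp add: ennreal_mult' K_nonneg ennreal_plus del: ennreal_plus[symmetric]) 
      apply (intro nn_integral_cong)
      by (simp add: ennreal_mult K_nonneg distrib_left distrib_right ac_simps)
  qed
  also have "\<dots> = (\<integral>\<^sup>+x. \<integral>\<^sup>+y. \<integral>\<^sup>+\<sigma>. ennreal \<bar>H (post_velocity x y \<sigma>, post_velocity_star x y \<sigma>)\<bar> * w x * K (x - y) \<sigma> \<partial>S \<partial>lborel \<partial>lborel)
       + (\<integral>\<^sup>+x. \<integral>\<^sup>+y. \<integral>\<^sup>+\<sigma>. ennreal \<bar>H (x, y)\<bar> * w x * K (x - y) \<sigma> \<partial>S \<partial>lborel \<partial>lborel)"
    by (simp add: nn_integral_add)
  also have "(\<integral>\<^sup>+x. \<integral>\<^sup>+y. \<integral>\<^sup>+\<sigma>. ennreal \<bar>H (post_velocity x y \<sigma>, post_velocity_star x y \<sigma>)\<bar> * w x * K (x - y) \<sigma> \<partial>S \<partial>lborel \<partial>lborel) =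
      (\<integral>\<^sup>+x. \<integral>\<^sup>+y. \<integral>\<^sup>+\<sigma>. ennreal \<bar>H (x, y)\<bar> * w (post_velocity x y \<sigma>) * K (x - y) \<sigma> \<partial>S \<partial>lborel \<partial>lborel)"
    using nn_integral_collision_swap_kernel[OF wm(2,1)] by simp
  also have "\<dots> + (\<integral>\<^sup>+x. \<integral>\<^sup>+y. \<integral>\<^sup>+\<sigma>. ennreal \<bar>H (x, y)\<bar> * w x * K (x - y) \<sigma> \<partial>S \<partial>lborel \<partial>lborel) =
     (\<integral>\<^sup>+x. \<integral>\<^sup>+y. \<integral>\<^sup>+\<sigma>. ennreal \<bar>H (x, y)\<bar> * (w (post_velocity x y \<sigma>) + w x) * K (x - y) \<sigma> \<partial>S \<partial>lborel \<partial>lborel)"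
    by (simp add: nn_integral_add[symmetric] distrib_left distrib_right)
  finally show ?thesis .
qed

end


text \<open>Values in \<open>[0, \<infinity>]\<close> allow inequalities between weighted integrals before any of them is known
  to be finite.\<close>

definition wint :: "('a::euclidean_space \<Rightarrow> real) \<Rightarrow> ('a \<Rightarrow> real) \<Rightarrow> ennreal" where
  "wint w f = (\<integral>\<^sup>+x. ennreal (\<bar>f x\<bar> * w x) \<partial>lborel)"

abbreviation gauss :: "real \<Rightarrow> 'a::real_normed_vector \<Rightarrow> real" where
  "gauss a x \<equiv> exp (a * (norm x)\<^sup>2)"

lemma AE_lborel_shift:
  fixes v :: "'a::euclidean_space"
  assumes "AE x in lborel. P x"
  shows "AE x in lborel. P (x + v)"
proof -
  have "AE x in distr lborel borel ((+) v). P x"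
    unfolding lborel_distr_plus by (rule assms)
  then have "AE x in lborel. P (v + x)" by (rule AE_distrD[rotated]) simp
  then show ?thesis by (simp add: add.commute)
qed

context collision begin

text \<open>Exceptional null sets appear because the integral over pairs \<open>(y, \<sigma>)\<close> converges only for almost
  every velocity \<open>x\<close>.\<close>

definition represents :: "(real^'n \<Rightarrow> real) \<Rightarrow> ((real^'n) \<times> (real^'n) \<Rightarrow> real) \<Rightarrow> bool" where
  "represents q H \<longleftrightarrow> H \<in> borel_measurable borel \<and>
     (AE x in lborel. integrable (lborel \<Otimes>\<^sub>M S) (collision_integrand H x) \<and> q x = coll H x)"

lemma distr_lborel_sphere_shift:
  "distr (lborel \<Otimes>\<^sub>M S) (lborel \<Otimes>\<^sub>M S) (\<lambda>(y, \<sigma>). (v + y, \<sigma>)) = lborel \<Otimes>\<^sub>M S"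
proof -
  have "lborel \<Otimes>\<^sub>M S = distr lborel lborel ((+) v) \<Otimes>\<^sub>M distr S S (\<lambda>\<sigma>. \<sigma>)"
  proof -
    have "distr lborel lborel ((+) v) = distr lborel borel ((+) v)" by (rule distr_cong) auto
    then show ?thesis by (simp only: lborel_distr_plus distr_id)
  qed
  also have "\<dots> = distr (lborel \<Otimes>\<^sub>M S) (lborel \<Otimes>\<^sub>M S) (\<lambda>(y, \<sigma>). (v + y, \<sigma>))"
    by (rule pair_measure_distr) (auto simp: sigma_finite_sphere)
  finally show ?thesis ..
qed

lemma shift_pair_meas: "(\<lambda>(y, \<sigma>). (v + y, \<sigma>)) \<in> lborel \<Otimes>\<^sub>M S \<rightarrow>\<^sub>M lborel \<Otimes>\<^sub>M S"
  by measurable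

lemma meas_shift_pair:
  assumes "H \<in> borel_measurable (borel :: ((real^'n) \<times> (real^'n)) measure)"
  shows "(\<lambda>z. H (z + v)) \<in> borel_measurable borel"
  using assms by measurable

lemma represents_shift:
  assumes "represents q H"
  shows "represents (\<lambda>x. q (x + v)) (\<lambda>z. H (z + (v, v)))"
proof -
  have H: "H \<in> borel_measurable borel" using assms by (simp add: represents_def)
  have eq: "collision_integrand (\<lambda>z. H (z + (v, v))) x = (\<lambda>z. collision_integrand H (x + v) ((\<lambda>(y, \<sigma>). (v + y, \<sigma>)) z))" for x
  proof
    fix z :: "(real^'n) \<times> (real^'n)"
    obtain y \<sigma> where z: "z = (y, \<sigma>)" by force
    show "collision_integrand (\<lambda>z. H (z + (v, v))) x z = collision_integrand H (x + v) ((\<lambda>(y, \<sigma>). (v + y, \<sigma>)) z)"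
      unfolding collision_integrand_def z by (simp add: add.commute[of v] post_velocity_shift)
  qed
  have "integrable (lborel \<Otimes>\<^sub>M S) (collision_integrand (\<lambda>z. H (z + (v, v))) x) \<and> coll (\<lambda>z. H (z + (v, v))) x = coll H (x + v)"
    if "integrable (lborel \<Otimes>\<^sub>M S) (collision_integrand H (x + v))" for x
    unfolding coll_def eq
    using that integrable_distr[OF shift_pair_meas[of v], of "collision_integrand H (x + v)"]
      integral_distr[OF shift_pair_meas[of v] collision_integrand_meas[OF H], of "x + v"]
    by (simp add: distr_lborel_sphere_shift)
  moreover have "AE x in lborel. integrable (lborel \<Otimes>\<^sub>M S) (collision_integrand H (x + v)) \<and> q (x + v) = coll H (x + v)"
    using assms by (intro AE_lborel_shift) (simp add: represents_def)
  ultimately have "AE x in lborel. integrable (lborel \<Otimes>\<^sub>M S) (collision_integrand (\<lambda>z. H (z + (v, v))) x) \<and>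
      q (x + v) = coll (\<lambda>z. H (z + (v, v))) x"
    by (elim eventually_mono) simp
  with meas_shift_pair[OF H] show ?thesis unfolding represents_def by blast
qed

lemma represents_diff:
  assumes "represents p G" "represents q H"
  shows "represents (\<lambda>x. (p x - q x) / r) (\<lambda>z. (G z - H z) / r)"
proof -
  have H: "H \<in> borel_measurable borel" "G \<in> borel_measurable borel" using assms by (simp_all add: represents_def)
  have eq: "collision_integrand (\<lambda>z. (G z - H z) / r) x = (\<lambda>z. (collision_integrand G x z - collision_integrand H x z) / r)" for x
  proof -
    have "((g' - h') / r - (g - h) / r) * k = ((g' - g) * k - (h' - h) * k) / r" for g g' h h' k :: real
      by (cases "r = 0") (auto simp: field_simps)
    then show ?thesis by (auto simp: collision_integrand_def fun_eq_iff)
  qed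
  have "AE x in lborel. (integrable (lborel \<Otimes>\<^sub>M S) (collision_integrand G x) \<and> p x = coll G x) \<and>
      (integrable (lborel \<Otimes>\<^sub>M S) (collision_integrand H x) \<and> q x = coll H x)"
    using assms by (simp add: represents_def)
  then have "AE x in lborel. integrable (lborel \<Otimes>\<^sub>M S) (collision_integrand (\<lambda>z. (G z - H z) / r) x) \<and>
      (p x - q x) / r = coll (\<lambda>z. (G z - H z) / r) x"
    unfolding coll_def eq by (rule eventually_mono) simp
  then show ?thesis using H unfolding represents_def by simp
qed

lemma nn_integral_coll_abs_le:
  assumes H[measurable]: "H \<in> borel_measurable borel" and w[measurable]: "w \<in> borel_measurable borel"
    and [measurable]: "(\<lambda>(x, y). W x y) \<in> borel_measurable (borel \<Otimes>\<^sub>M borel)"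
    and W: "\<And>x y \<sigma>. \<sigma> \<in> sphere 0 1 \<Longrightarrow> w (post_velocity x y \<sigma>) + w x \<le> W x y"
  shows "(\<integral>\<^sup>+x. coll_abs H x * w x \<partial>lborel) \<le>
    (\<integral>\<^sup>+x. \<integral>\<^sup>+y. ennreal \<bar>H (x, y)\<bar> * W x y * norm (x - y) powr \<alpha> \<partial>lborel \<partial>lborel)"
proof -
  have [measurable]: "(\<lambda>\<sigma>. ennreal (K u \<sigma>)) \<in> borel_measurable S" for u by measurable
  have "(\<integral>\<^sup>+x. coll_abs H x * w x \<partial>lborel) \<le>
    (\<integral>\<^sup>+x. \<integral>\<^sup>+y. \<integral>\<^sup>+\<sigma>. (ennreal \<bar>H (x, y)\<bar> * W x y) * K (x - y) \<sigma> \<partial>S \<partial>lborel \<partial>lborel)"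
    unfolding nn_integral_coll_abs[OF H w]
    by (intro nn_integral_mono mult_right_mono mult_left_mono W) auto
  also have "\<dots> = (\<integral>\<^sup>+x. \<integral>\<^sup>+y. ennreal \<bar>H (x, y)\<bar> * W x y * norm (x - y) powr \<alpha> \<partial>lborel \<partial>lborel)"
    by (simp add: nn_integral_cmult nn_integral_K)
  finally show ?thesis .
qed

lemma AE_coll_abs_finite:
  assumes H: "H \<in> borel_measurable borel"
    and fin: "(\<integral>\<^sup>+x. \<integral>\<^sup>+y. ennreal \<bar>H (x, y)\<bar> * norm (x - y) powr \<alpha> \<partial>lborel \<partial>lborel) < \<infinity>"
  shows "AE x in lborel. coll_abs H x < \<infinity>"
proof -
  interpret S: sigma_finite_measure S by (rule sigma_finite_sphere)
  have Hm[measurable]: "H \<in> borel_measurable (borel \<Otimes>\<^sub>M borel)" using H by (simp add: borel_prod)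
  have m: "coll_abs H \<in> borel_measurable lborel"
    unfolding coll_abs_def post_velocity_def post_velocity_star_def by measurable
  have "(\<integral>\<^sup>+x. coll_abs H x \<partial>lborel) = (\<integral>\<^sup>+x. coll_abs H x * 1 \<partial>lborel)" by simp
  also have "\<dots> \<le> (\<integral>\<^sup>+x. \<integral>\<^sup>+y. ennreal \<bar>H (x, y)\<bar> * 2 * norm (x - y) powr \<alpha> \<partial>lborel \<partial>lborel)"
    by (rule nn_integral_coll_abs_le[OF H]) (auto simp: one_add_one)
  also have "\<dots> = 2 * (\<integral>\<^sup>+x. \<integral>\<^sup>+y. ennreal \<bar>H (x, y)\<bar> * norm (x - y) powr \<alpha> \<partial>lborel \<partial>lborel)"
    by (subst nn_integral_cmult[symmetric], measurable) (auto intro!: nn_integral_cong simp: nn_integral_cmult[symmetric] ac_simps)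
  also have "\<dots> < \<infinity>" using fin by (simp add: ennreal_mult_less_top)
  finally have "(\<integral>\<^sup>+x. coll_abs H x \<partial>lborel) \<noteq> \<infinity>" by simp
  from nn_integral_PInf_AE[OF m this] show ?thesis by (auto simp: top.not_eq_extremum)
qed

lemma represents_coll:
  assumes H: "H \<in> borel_measurable borel"
    and fin: "(\<integral>\<^sup>+x. \<integral>\<^sup>+y. ennreal \<bar>H (x, y)\<bar> * norm (x - y) powr \<alpha> \<partial>lborel \<partial>lborel) < \<infinity>"
  shows "represents (coll H) H"
  using AE_coll_abs_finite[OF H fin] integrable_collision_integrand[OF H] H
  by (auto simp: represents_def)

lemma collision_op_eq_coll:
  assumes "integrable (lborel \<Otimes>\<^sub>M S) (collision_integrand (\<lambda>(x, y). f x * g y) x)"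
  shows "collision_op \<alpha> h f g x = coll (\<lambda>(x, y). f x * g y) x"
proof -
  interpret S: sigma_finite_measure S by (rule sigma_finite_sphere)
  interpret P: pair_sigma_finite "lborel :: (real^'n) measure" S ..
  show ?thesis
    using P.integral_fst'[OF assms] unfolding collision_op_def coll_def by (simp add: collision_integrand_def)
qed

lemma represents_collision_op:
  assumes f: "f \<in> borel_measurable borel"
    and fin: "(\<integral>\<^sup>+x. \<integral>\<^sup>+y. ennreal \<bar>f x * f y\<bar> * norm (x - y) powr \<alpha> \<partial>lborel \<partial>lborel) < \<infinity>"
  shows "represents (collision_op \<alpha> h f f) (\<lambda>(x, y). f x * f y)"
proof -
  have H: "(\<lambda>(x, y). f x * f y) \<in> borel_measurable borel"
    using f unfolding borel_prod[symmetric] by measurable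
  have "represents (coll (\<lambda>(x, y). f x * f y)) (\<lambda>(x, y). f x * f y)"
    using fin by (intro represents_coll[OF H]) simp
  then show ?thesis unfolding represents_def
    by (auto elim!: eventually_mono simp: collision_op_eq_coll)
qed

lemma tensor_integral_le:
  fixes A B w :: "real^'n \<Rightarrow> real"
  assumes [measurable]: "A \<in> borel_measurable borel" "B \<in> borel_measurable borel"
    "w \<in> borel_measurable borel" and w: "\<And>x. 0 \<le> w x"
  shows "(\<integral>\<^sup>+x. \<integral>\<^sup>+y. ennreal (\<bar>A x\<bar> * \<bar>B y\<bar> * (w x * w y) * norm (x - y) powr \<alpha>) \<partial>lborel \<partial>lborel) \<le>
     wint (\<lambda>x. norm x powr \<alpha> * w x) A * wint w B + wint w A * wint (\<lambda>x. norm x powr \<alpha> * w x) B"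
proof -
  have "(\<integral>\<^sup>+x. \<integral>\<^sup>+y. ennreal (\<bar>A x\<bar> * \<bar>B y\<bar> * (w x * w y) * norm (x - y) powr \<alpha>) \<partial>lborel \<partial>lborel) \<le>
    (\<integral>\<^sup>+x. \<integral>\<^sup>+y. (ennreal (\<bar>A x\<bar> * (norm x powr \<alpha> * w x)) * ennreal (\<bar>B y\<bar> * w y)
        + ennreal (\<bar>A x\<bar> * w x) * ennreal (\<bar>B y\<bar> * (norm y powr \<alpha> * w y))) \<partial>lborel \<partial>lborel)"
  proof (intro nn_integral_mono)
    fix x y :: "real^'n"
    have "\<bar>A x\<bar> * \<bar>B y\<bar> * (w x * w y) * norm (x - y) powr \<alpha> \<le> \<bar>A x\<bar> * \<bar>B y\<bar> * (w x * w y) * (norm x powr \<alpha> + norm y powr \<alpha>)"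
      by (intro mult_left_mono powr_norm_diff_le alpha_pos alpha_le_1) (auto simp: w)
    also have "\<dots> = (\<bar>A x\<bar> * (norm x powr \<alpha> * w x)) * (\<bar>B y\<bar> * w y) + (\<bar>A x\<bar> * w x) * (\<bar>B y\<bar> * (norm y powr \<alpha> * w y))"
      by (simp add: algebra_simps)
    finally show "ennreal (\<bar>A x\<bar> * \<bar>B y\<bar> * (w x * w y) * norm (x - y) powr \<alpha>) \<le>
      ennreal (\<bar>A x\<bar> * (norm x powr \<alpha> * w x)) * ennreal (\<bar>B y\<bar> * w y)
        + ennreal (\<bar>A x\<bar> * w x) * ennreal (\<bar>B y\<bar> * (norm y powr \<alpha> * w y))"
      using w by (simp add: ennreal_mult[symmetric] ennreal_plus[symmetric] ennreal_leI del: ennreal_plus)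
  qed
  also have "\<dots> = wint (\<lambda>x. norm x powr \<alpha> * w x) A * wint w B + wint w A * wint (\<lambda>x. norm x powr \<alpha> * w x) B"
    unfolding wint_def by (simp add: nn_integral_add nn_integral_cmult nn_integral_multc)
  finally show ?thesis .
qed

text \<open>Each collision conserves energy, so \<open>|\<xi>'|\<^sup>2\<close> and \<open>|\<xi>|\<^sup>2\<close> are both at most \<open>|\<xi>|\<^sup>2 + |\<xi>\<^sub>*|\<^sup>2\<close>.\<close>

lemma gauss_post_le:
  fixes x y :: "real^'n"
  assumes "\<sigma> \<in> sphere 0 1" "0 \<le> a"
  shows "gauss a (post_velocity x y \<sigma>) + gauss a x \<le> 2 * (gauss a x * gauss a y)"
proof -
  have "(norm (post_velocity x y \<sigma>))\<^sup>2 \<le> (norm x)\<^sup>2 + (norm y)\<^sup>2"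
    using post_velocity_energy[OF assms(1), of x y] zero_le_power2[of "norm (post_velocity_star x y \<sigma>)"] by linarith
  then have "a * (norm (post_velocity x y \<sigma>))\<^sup>2 \<le> a * (norm x)\<^sup>2 + a * (norm y)\<^sup>2"
    using assms(2) by (metis distrib_left mult_left_mono)
  then have 1: "gauss a (post_velocity x y \<sigma>) \<le> gauss a x * gauss a y" by (simp add: exp_add[symmetric])
  have 2: "gauss a x \<le> gauss a x * gauss a y" using assms(2) by simp
  show ?thesis using 1 2 by linarith
qed

text \<open>The Gaussian weight factorizes over the two incoming velocities and
  \<open>|x - y|\<^sup>\<alpha> \<le> |x|\<^sup>\<alpha> + |y|\<^sup>\<alpha>\<close>; a bound of \<open>H\<close> by a sum of products therefore becomes a sum of products
  of one-particle integrals, only one factor of each carrying the extra \<open>|x|\<^sup>\<alpha>\<close>.\<close>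

lemma gauss_coll_le:
  assumes H: "H \<in> borel_measurable borel" and a: "0 \<le> a"
    and ps: "\<And>p. p \<in> set ps \<Longrightarrow> fst p \<in> borel_measurable borel \<and> snd p \<in> borel_measurable borel"
    and bound: "\<And>x y. \<bar>H (x, y)\<bar> \<le> (\<Sum>p\<leftarrow>ps. \<bar>fst p x\<bar> * \<bar>snd p y\<bar>)"
  shows "(\<integral>\<^sup>+x. coll_abs H x * gauss a x \<partial>lborel) \<le>
    2 * (\<Sum>p\<leftarrow>ps. wint (\<lambda>x. norm x powr \<alpha> * gauss a x) (fst p) * wint (gauss a) (snd p) +
              wint (gauss a) (fst p) * wint (\<lambda>x. norm x powr \<alpha> * gauss a x) (snd p))"
proof -
  have "(\<integral>\<^sup>+x. coll_abs H x * gauss a x \<partial>lborel) \<le>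
    (\<integral>\<^sup>+x. \<integral>\<^sup>+y. ennreal \<bar>H (x, y)\<bar> * ennreal (2 * (gauss a x * gauss a y)) * norm (x - y) powr \<alpha> \<partial>lborel \<partial>lborel)"
    using gauss_post_le[OF _ a]
    by (intro nn_integral_coll_abs_le[OF H]) (auto simp: ennreal_plus[symmetric] simp del: ennreal_plus intro!: ennreal_leI)
  also have "\<dots> \<le> (\<integral>\<^sup>+x. \<integral>\<^sup>+y. 2 * (\<Sum>i<length ps. ennreal (\<bar>fst (ps ! i) x\<bar> * \<bar>snd (ps ! i) y\<bar> * (gauss a x * gauss a y) * norm (x - y) powr \<alpha>)) \<partial>lborel \<partial>lborel)"
  proof (intro nn_integral_mono)
    fix x y :: "real^'n"
    have "\<bar>H (x, y)\<bar> * (2 * (gauss a x * gauss a y)) * norm (x - y) powr \<alpha> \<le>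
       (\<Sum>i<length ps. \<bar>fst (ps ! i) x\<bar> * \<bar>snd (ps ! i) y\<bar>) * (2 * (gauss a x * gauss a y)) * norm (x - y) powr \<alpha>"
      using bound[of x y] by (intro mult_right_mono) (auto simp: sum_list_sum_nth atLeast0LessThan)
    also have "\<dots> = 2 * (\<Sum>i<length ps. \<bar>fst (ps ! i) x\<bar> * \<bar>snd (ps ! i) y\<bar> * (gauss a x * gauss a y) * norm (x - y) powr \<alpha>)"
      by (simp add: sum_distrib_left sum_distrib_right ac_simps)
    finally show "ennreal \<bar>H (x, y)\<bar> * ennreal (2 * (gauss a x * gauss a y)) * ennreal (norm (x - y) powr \<alpha>) \<le>
      2 * (\<Sum>i<length ps. ennreal (\<bar>fst (ps ! i) x\<bar> * \<bar>snd (ps ! i) y\<bar> * (gauss a x * gauss a y) * norm (x - y) powr \<alpha>))"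
      by (subst sum_ennreal, simp)
        (metis (no_types, lifting) abs_ge_zero ennreal_leI ennreal_mult ennreal_numeral exp_ge_zero mult_nonneg_nonneg powr_ge_zero sum_nonneg zero_le_numeral)
  qed
  also have "\<dots> = 2 * (\<Sum>i<length ps. \<integral>\<^sup>+x. \<integral>\<^sup>+y. ennreal (\<bar>fst (ps ! i) x\<bar> * \<bar>snd (ps ! i) y\<bar> * (gauss a x * gauss a y) * norm (x - y) powr \<alpha>) \<partial>lborel \<partial>lborel)"
  proof -
    have ms: "fst (ps ! i) \<in> borel_measurable borel" "snd (ps ! i) \<in> borel_measurable borel" if "i < length ps" for i
      using ps[of "ps ! i"] that by auto
    have m: "(\<lambda>(x, y). ennreal (\<bar>fst (ps ! i) x\<bar> * \<bar>snd (ps ! i) y\<bar> * (gauss a x * gauss a y) * norm (x - y) powr \<alpha>)) \<in> borel_measurable (borel \<Otimes>\<^sub>M borel)"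
      if "i < length ps" for i
    proof -
      note [measurable] = ms[OF that]
      show ?thesis by measurable
    qed
    have m1: "(\<lambda>y. ennreal (\<bar>fst (ps ! i) x\<bar> * \<bar>snd (ps ! i) y\<bar> * (gauss a x * gauss a y) * norm (x - y) powr \<alpha>)) \<in> borel_measurable lborel"
      if "i < length ps" for i x
      using measurable_compose[OF measurable_Pair1' m[OF that], of x] by simp
    have m2: "(\<lambda>x. \<integral>\<^sup>+y. ennreal (\<bar>fst (ps ! i) x\<bar> * \<bar>snd (ps ! i) y\<bar> * (gauss a x * gauss a y) * norm (x - y) powr \<alpha>) \<partial>lborel) \<in> borel_measurable lborel"
      if "i < length ps" for i
    proof -
      note [measurable] = ms[OF that]
      show ?thesis by measurable
    qed
    have "(\<integral>\<^sup>+y. 2 * (\<Sum>i<length ps. ennreal (\<bar>fst (ps ! i) x\<bar> * \<bar>snd (ps ! i) y\<bar> * (gauss a x * gauss a y) * norm (x - y) powr \<alpha>)) \<partial>lborel) =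
       2 * (\<Sum>i<length ps. \<integral>\<^sup>+y. ennreal (\<bar>fst (ps ! i) x\<bar> * \<bar>snd (ps ! i) y\<bar> * (gauss a x * gauss a y) * norm (x - y) powr \<alpha>) \<partial>lborel)" for x
      by (rule trans[OF nn_integral_cmult arg_cong[where f="(*) 2", OF nn_integral_sum]])
        (rule borel_measurable_sum, rule m1, simp, rule m1, simp)
    then have "(\<integral>\<^sup>+x. \<integral>\<^sup>+y. 2 * (\<Sum>i<length ps. ennreal (\<bar>fst (ps ! i) x\<bar> * \<bar>snd (ps ! i) y\<bar> * (gauss a x * gauss a y) * norm (x - y) powr \<alpha>)) \<partial>lborel \<partial>lborel) =
       (\<integral>\<^sup>+x. 2 * (\<Sum>i<length ps. \<integral>\<^sup>+y. ennreal (\<bar>fst (ps ! i) x\<bar> * \<bar>snd (ps ! i) y\<bar> * (gauss a x * gauss a y) * norm (x - y) powr \<alpha>) \<partial>lborel) \<partial>lborel)"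
      by (simp only:)
    also have "\<dots> = 2 * (\<Sum>i<length ps. \<integral>\<^sup>+x. \<integral>\<^sup>+y. ennreal (\<bar>fst (ps ! i) x\<bar> * \<bar>snd (ps ! i) y\<bar> * (gauss a x * gauss a y) * norm (x - y) powr \<alpha>) \<partial>lborel \<partial>lborel)"
      by (rule trans[OF nn_integral_cmult arg_cong[where f="(*) 2", OF nn_integral_sum]])
        (rule borel_measurable_sum, rule m2, simp, rule m2, simp)
    finally show ?thesis .
  qed
  also have "\<dots> \<le> 2 * (\<Sum>p\<leftarrow>ps. wint (\<lambda>x. norm x powr \<alpha> * gauss a x) (fst p) * wint (gauss a) (snd p) +
              wint (gauss a) (fst p) * wint (\<lambda>x. norm x powr \<alpha> * gauss a x) (snd p))"
    unfolding sum_list_sum_nth length_map atLeast0LessThan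
    by (intro mult_left_mono sum_mono) (auto intro!: tensor_integral_le simp: ps)
  finally show ?thesis .
qed

end


context collision begin

lemma sigma_finite_lborel_sphere: "sigma_finite_measure ((lborel :: (real^'n) measure) \<Otimes>\<^sub>M S)"
proof -
  interpret S: sigma_finite_measure S by (rule sigma_finite_sphere)
  interpret P: pair_sigma_finite "lborel :: (real^'n) measure" S ..
  show ?thesis by (rule P.P.sigma_finite_measure_axioms)
qed

lemma coll_measurable:
  assumes H: "H \<in> borel_measurable borel"
  shows "coll H \<in> borel_measurable borel"
proof -
  have "sets (borel \<Otimes>\<^sub>M (lborel \<Otimes>\<^sub>M S)) = sets (borel \<Otimes>\<^sub>M (borel \<Otimes>\<^sub>M S))"
    by (intro sets_pair_measure_cong refl sets_lborel_sphere)
  then have "(\<lambda>(x, z). collision_integrand H x z) \<in> borel_measurable (borel \<Otimes>\<^sub>M (lborel \<Otimes>\<^sub>M S))"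
    using collision_integrand_meas2[OF H] by (simp cong: measurable_cong_sets)
  then show ?thesis
    unfolding coll_def
    by (rule sigma_finite_measure.borel_measurable_lebesgue_integral[OF sigma_finite_lborel_sphere])
qed

lemma collision_op_measurable:
  fixes f :: "real \<Rightarrow> real^'n \<Rightarrow> real"
  assumes [measurable]: "(\<lambda>(t, x). f t x) \<in> borel_measurable (borel \<Otimes>\<^sub>M borel)"
  shows "(\<lambda>(t, x). collision_op \<alpha> h (f t) (f t) x) \<in> borel_measurable ((borel :: real measure) \<Otimes>\<^sub>M borel)"
proof -
  interpret S: sigma_finite_measure S by (rule sigma_finite_sphere)
  show ?thesis
    unfolding collision_op_def post_velocity_def post_velocity_star_def by measurable
qed

text \<open>Splitting the collision integral into its nonnegative gain and loss parts gives its weak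
  formulation; exchanging the two colliding particles symmetrizes it.\<close>

lemma weak_collision_le:
  fixes f \<phi> :: "real^'n \<Rightarrow> real" and G :: "real^'n \<Rightarrow> real^'n \<Rightarrow> real"
  assumes f[measurable]: "f \<in> borel_measurable borel" and f0: "\<And>x. 0 \<le> f x"
    and \<phi>[measurable]: "\<phi> \<in> borel_measurable borel" and \<phi>0: "\<And>x. 0 \<le> \<phi> x" and \<phi>M: "\<And>x. \<phi> x \<le> M"
    and G[measurable]: "(\<lambda>(x, y). G x y) \<in> borel_measurable (borel \<Otimes>\<^sub>M borel)" and G0: "\<And>x y. 0 \<le> G x y"
    and fin: "(\<integral>\<^sup>+x. \<integral>\<^sup>+y. ennreal (f x * f y * norm (x - y) powr \<alpha>) \<partial>lborel \<partial>lborel) < \<infinity>"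
    and point: "\<And>x y \<sigma>. \<sigma> \<in> sphere 0 1 \<Longrightarrow> \<phi> (post_velocity x y \<sigma>) + \<phi> (post_velocity_star x y \<sigma>) \<le> \<phi> x + \<phi> y + G x y"
    and c: "(\<integral>\<^sup>+x. \<integral>\<^sup>+y. ennreal (f x * f y * G x y * norm (x - y) powr \<alpha>) \<partial>lborel \<partial>lborel) \<le> ennreal c" and c0: "0 \<le> c"
  shows "integrable lborel (\<lambda>x. coll (\<lambda>(x, y). f x * f y) x * \<phi> x)"
    and "(\<integral>x. coll (\<lambda>(x, y). f x * f y) x * \<phi> x \<partial>lborel) \<le> c / 2"
proof -
  interpret S: sigma_finite_measure S by (rule sigma_finite_sphere)
  define H where "H = (\<lambda>(x, y). f x * f y)"
  have Hm[measurable]: "H \<in> borel_measurable (borel \<Otimes>\<^sub>M borel)" unfolding H_def by measurable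
  then have H: "H \<in> borel_measurable borel" by (simp add: borel_prod)
  have H0: "0 \<le> H z" for z using f0 by (auto simp: H_def split: prod.split)
  define P where "P x = (\<integral>\<^sup>+y. \<integral>\<^sup>+\<sigma>. ennreal (H (post_velocity x y \<sigma>, post_velocity_star x y \<sigma>)) * K (x - y) \<sigma> \<partial>S \<partial>lborel)" for x
  define L where "L x = (\<integral>\<^sup>+y. \<integral>\<^sup>+\<sigma>. ennreal (H (x, y)) * K (x - y) \<sigma> \<partial>S \<partial>lborel)" for x
  have mP: "(\<lambda>(x, y, \<sigma>). ennreal (H (post_velocity x y \<sigma>, post_velocity_star x y \<sigma>)) * K (x - y) \<sigma>) \<in> borel_measurable (borel \<Otimes>\<^sub>M (borel \<Otimes>\<^sub>M S))"
    unfolding post_velocity_def post_velocity_star_def by measurable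
  have mL: "(\<lambda>(x, y, \<sigma>). ennreal (H (x, y)) * K (x - y) \<sigma>) \<in> borel_measurable (borel \<Otimes>\<^sub>M (borel \<Otimes>\<^sub>M S))"
    by measurable
  have mP2: "(\<lambda>(x, y). \<integral>\<^sup>+\<sigma>. ennreal (H (post_velocity x y \<sigma>, post_velocity_star x y \<sigma>)) * K (x - y) \<sigma> \<partial>S) \<in> borel_measurable (borel \<Otimes>\<^sub>M borel)"
    unfolding post_velocity_def post_velocity_star_def by measurable
  have mL2: "(\<lambda>(x, y). \<integral>\<^sup>+\<sigma>. ennreal (H (x, y)) * K (x - y) \<sigma> \<partial>S) \<in> borel_measurable (borel \<Otimes>\<^sub>M borel)"
    by measurable
  have [measurable]: "P \<in> borel_measurable borel" "L \<in> borel_measurable borel"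
    using mP2 mL2 unfolding P_def L_def by measurable
  have fin': "(\<integral>\<^sup>+x. \<integral>\<^sup>+y. ennreal \<bar>H (x, y)\<bar> * norm (x - y) powr \<alpha> \<partial>lborel \<partial>lborel) < \<infinity>"
    using fin f0 by (simp add: H_def ennreal_mult)
  have PL: "coll H x = enn2real (P x) - enn2real (L x)" "P x < \<infinity>" "L x < \<infinity>" if "coll_abs H x < \<infinity>" for x
  proof -
    define g where "g = (\<lambda>(y, \<sigma>). H (post_velocity x y \<sigma>, post_velocity_star x y \<sigma>) * K (x - y) \<sigma>)"
    define l where "l = (\<lambda>(y, \<sigma>). H (x, y) * K (x - y) \<sigma>)"
    have [measurable]: "g \<in> borel_measurable (borel \<Otimes>\<^sub>M S)" "l \<in> borel_measurable (borel \<Otimes>\<^sub>M S)"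
      unfolding g_def l_def post_velocity_def post_velocity_star_def by measurable
    have gm: "g \<in> borel_measurable (lborel \<Otimes>\<^sub>M S)" "l \<in> borel_measurable (lborel \<Otimes>\<^sub>M S)"
      by (simp_all add: measurable_cong_sets[OF sets_lborel_sphere refl])
    have g0: "0 \<le> g z" "0 \<le> l z" for z using H0 K_nonneg by (auto simp: g_def l_def split: prod.split)
    have Pg: "P x = (\<integral>\<^sup>+z. g z \<partial>(lborel \<Otimes>\<^sub>M S))" "L x = (\<integral>\<^sup>+z. l z \<partial>(lborel \<Otimes>\<^sub>M S))"
      using gm by (auto simp: S.nn_integral_fst[symmetric] P_def L_def g_def l_def ennreal_mult H0 K_nonneg)
    have "P x \<le> coll_abs H x" "L x \<le> coll_abs H x"
      unfolding P_def L_def coll_abs_def using H0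
      by (auto intro!: nn_integral_mono ennreal_leI mult_right_mono simp: ennreal_mult[symmetric] K_nonneg)
    then show fin: "P x < \<infinity>" "L x < \<infinity>" using that by auto
    have ig: "integrable (lborel \<Otimes>\<^sub>M S) g" "integrable (lborel \<Otimes>\<^sub>M S) l"
      using fin gm g0 by (auto simp: integrable_iff_bounded Pg)
    have "coll H x = (\<integral>z. g z - l z \<partial>(lborel \<Otimes>\<^sub>M S))"
      unfolding coll_def collision_integrand_def g_def l_def by (auto intro!: Bochner_Integration.integral_cong simp: left_diff_distrib)
    also have "\<dots> = (\<integral>z. g z \<partial>(lborel \<Otimes>\<^sub>M S)) - (\<integral>z. l z \<partial>(lborel \<Otimes>\<^sub>M S))"
      using ig by (rule Bochner_Integration.integral_diff)
    also have "\<dots> = enn2real (P x) - enn2real (L x)"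
      unfolding Pg using gm g0 by (simp add: integral_eq_nn_integral)
    finally show "coll H x = enn2real (P x) - enn2real (L x)" .
  qed
  define p where "p = (\<integral>\<^sup>+x. P x * \<phi> x \<partial>lborel)"
  define l where "l = (\<integral>\<^sup>+x. L x * \<phi> x \<partial>lborel)"
  have AEf: "AE x in lborel. coll_abs H x < \<infinity>" by (rule AE_coll_abs_finite[OF H fin'])
  have [measurable]: "(\<lambda>x. ennreal (\<phi> x)) \<in> borel_measurable borel" by measurable
  have \<phi>m: "(\<lambda>z. ennreal (\<phi> (fst z))) \<in> borel_measurable (borel :: ((real^'n) \<times> (real^'n)) measure)"
    "(\<lambda>z. ennreal (\<phi> (snd z))) \<in> borel_measurable (borel :: ((real^'n) \<times> (real^'n)) measure)"
    "(\<lambda>z. ennreal (H z)) \<in> borel_measurable (borel :: ((real^'n) \<times> (real^'n)) measure)"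
    unfolding borel_prod[symmetric] by measurable
  have in1: "P x * \<phi> x = (\<integral>\<^sup>+y. \<integral>\<^sup>+\<sigma>. ennreal (H (post_velocity x y \<sigma>, post_velocity_star x y \<sigma>)) * \<phi> x * K (x - y) \<sigma> \<partial>S \<partial>lborel)" for x
  proof -
    have m1: "(\<lambda>\<sigma>. ennreal (H (post_velocity x y \<sigma>, post_velocity_star x y \<sigma>)) * K (x - y) \<sigma>) \<in> borel_measurable S" for y
      using measurable_compose[OF measurable_Pair1' measurable_compose[OF measurable_Pair1' mP, of x], of y] by simp
    have m2: "(\<lambda>y. \<integral>\<^sup>+\<sigma>. ennreal (H (post_velocity x y \<sigma>, post_velocity_star x y \<sigma>)) * K (x - y) \<sigma> \<partial>S) \<in> borel_measurable lborel"
      using measurable_compose[OF measurable_Pair1' mP2, of x] by simp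
    show ?thesis unfolding P_def
      by (subst nn_integral_multc[OF m2, symmetric], intro nn_integral_cong, subst nn_integral_multc[OF m1, symmetric])
        (auto intro!: nn_integral_cong simp: ac_simps)
  qed
  have in2: "L x * \<phi> x = (\<integral>\<^sup>+y. \<integral>\<^sup>+\<sigma>. ennreal (H (x, y)) * \<phi> x * K (x - y) \<sigma> \<partial>S \<partial>lborel)" for x
  proof -
    have m1: "(\<lambda>\<sigma>. ennreal (H (x, y)) * K (x - y) \<sigma>) \<in> borel_measurable S" for y
      using measurable_compose[OF measurable_Pair1' measurable_compose[OF measurable_Pair1' mL, of x], of y] by simp
    have m2: "(\<lambda>y. \<integral>\<^sup>+\<sigma>. ennreal (H (x, y)) * K (x - y) \<sigma> \<partial>S) \<in> borel_measurable lborel"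
      using measurable_compose[OF measurable_Pair1' mL2, of x] by simp
    show ?thesis unfolding L_def
      by (subst nn_integral_multc[OF m2, symmetric], intro nn_integral_cong, subst nn_integral_multc[OF m1, symmetric])
        (auto intro!: nn_integral_cong simp: ac_simps)
  qed
  have p1: "p = (\<integral>\<^sup>+x. \<integral>\<^sup>+y. \<integral>\<^sup>+\<sigma>. ennreal (H (x, y)) * \<phi> (post_velocity x y \<sigma>) * K (x - y) \<sigma> \<partial>S \<partial>lborel \<partial>lborel)"
    unfolding p_def in1 using nn_integral_collision_swap_kernel[OF \<phi>m(3,1)] by simp
  have Hs: "H (y, x) = H (x, y)" for x y by (simp add: H_def)
  have Ks: "K (y - x) (- \<sigma>) = K (x - y) \<sigma>" for x y \<sigma>
  proof -
    have "sgn (y - x) = - sgn (x - y)" by (metis minus_diff_eq sgn_minus)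
    then show ?thesis by (simp add: collision_kernel_def norm_minus_commute)
  qed
  have m4: "(\<lambda>(x, y). \<integral>\<^sup>+\<sigma>. ennreal (H (x, y)) * \<phi> (post_velocity x y \<sigma>) * K (x - y) \<sigma> \<partial>S) \<in> borel_measurable (borel \<Otimes>\<^sub>M borel)"
    unfolding post_velocity_def by measurable
  have m4': "(\<lambda>(x, y). \<integral>\<^sup>+\<sigma>. ennreal (H (x, y)) * \<phi> (post_velocity_star x y \<sigma>) * K (x - y) \<sigma> \<partial>S) \<in> borel_measurable (borel \<Otimes>\<^sub>M borel)"
    unfolding post_velocity_star_def by measurable
  have m5: "(\<lambda>\<sigma>. ennreal (H (x, y)) * \<phi> (post_velocity x y \<sigma>) * K (x - y) \<sigma>) \<in> borel_measurable S" for x y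
    unfolding post_velocity_def by measurable
  have "p = (\<integral>\<^sup>+x. \<integral>\<^sup>+y. \<integral>\<^sup>+\<sigma>. ennreal (H (y, x)) * \<phi> (post_velocity y x \<sigma>) * K (y - x) \<sigma> \<partial>S \<partial>lborel \<partial>lborel)"
    unfolding p1 by (rule lborel_pair.Fubini'[symmetric]) (use m4 in simp)
  also have "\<dots> = (\<integral>\<^sup>+x. \<integral>\<^sup>+y. \<integral>\<^sup>+\<sigma>. ennreal (H (y, x)) * \<phi> (post_velocity y x (- \<sigma>)) * K (y - x) (- \<sigma>) \<partial>S \<partial>lborel \<partial>lborel)"
    by (intro nn_integral_cong nn_integral_sphere_uminus[OF m5, symmetric])
  finally have p2: "p = (\<integral>\<^sup>+x. \<integral>\<^sup>+y. \<integral>\<^sup>+\<sigma>. ennreal (H (x, y)) * \<phi> (post_velocity_star x y \<sigma>) * K (x - y) \<sigma> \<partial>S \<partial>lborel \<partial>lborel)"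
    unfolding post_velocity_swap Hs Ks .
  have l1: "l = (\<integral>\<^sup>+x. \<integral>\<^sup>+y. \<integral>\<^sup>+\<sigma>. ennreal (H (x, y)) * \<phi> x * K (x - y) \<sigma> \<partial>S \<partial>lborel \<partial>lborel)"
    unfolding l_def in2 ..
  have m6: "(\<lambda>(x, y). \<integral>\<^sup>+\<sigma>. ennreal (H (x, y)) * \<phi> x * K (x - y) \<sigma> \<partial>S) \<in> borel_measurable (borel \<Otimes>\<^sub>M borel)"
    by measurable
  have m6': "(\<lambda>(x, y). \<integral>\<^sup>+\<sigma>. ennreal (H (x, y)) * \<phi> y * K (x - y) \<sigma> \<partial>S) \<in> borel_measurable (borel \<Otimes>\<^sub>M borel)"
    by measurable
  have m7: "(\<lambda>\<sigma>. ennreal (H (x, y)) * \<phi> x * K (x - y) \<sigma>) \<in> borel_measurable S" for x y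
    by measurable
  have "l = (\<integral>\<^sup>+x. \<integral>\<^sup>+y. \<integral>\<^sup>+\<sigma>. ennreal (H (y, x)) * \<phi> y * K (y - x) \<sigma> \<partial>S \<partial>lborel \<partial>lborel)"
    unfolding l1 by (rule lborel_pair.Fubini'[symmetric]) (use m6 in simp)
  also have "\<dots> = (\<integral>\<^sup>+x. \<integral>\<^sup>+y. \<integral>\<^sup>+\<sigma>. ennreal (H (y, x)) * \<phi> y * K (y - x) (- \<sigma>) \<partial>S \<partial>lborel \<partial>lborel)"
    by (intro nn_integral_cong nn_integral_sphere_uminus[OF m7, symmetric])
  finally have l2: "l = (\<integral>\<^sup>+x. \<integral>\<^sup>+y. \<integral>\<^sup>+\<sigma>. ennreal (H (x, y)) * \<phi> y * K (x - y) \<sigma> \<partial>S \<partial>lborel \<partial>lborel)"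
    unfolding Hs Ks .
  have m8: "(\<lambda>\<sigma>. ennreal (H (x, y)) * \<phi> (post_velocity_star x y \<sigma>) * K (x - y) \<sigma>) \<in> borel_measurable S"
     "(\<lambda>\<sigma>. ennreal (H (x, y)) * \<phi> y * K (x - y) \<sigma>) \<in> borel_measurable S" 
     "(\<lambda>\<sigma>. ennreal (H (x, y)) * G x y * K (x - y) \<sigma>) \<in> borel_measurable S" for x y
    unfolding post_velocity_star_def by measurable
  have m9: "(\<lambda>(x, y). \<integral>\<^sup>+\<sigma>. ennreal (H (x, y)) * G x y * K (x - y) \<sigma> \<partial>S) \<in> borel_measurable (borel \<Otimes>\<^sub>M borel)"
    by measurable
  have add2: "(\<integral>\<^sup>+x. \<integral>\<^sup>+y. (g x y + k x y) \<partial>lborel \<partial>lborel) = (\<integral>\<^sup>+x. \<integral>\<^sup>+y. g x y \<partial>lborel \<partial>lborel) + (\<integral>\<^sup>+x. \<integral>\<^sup>+y. k x y \<partial>lborel \<partial>lborel)"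
    if g: "(\<lambda>(x, y). g x y) \<in> borel_measurable (borel \<Otimes>\<^sub>M borel)" and k: "(\<lambda>(x, y). k x y) \<in> borel_measurable (borel \<Otimes>\<^sub>M borel)"
    for g k :: "real^'n \<Rightarrow> real^'n \<Rightarrow> ennreal"
  proof -
    note [measurable] = g k
    have gs: "(\<lambda>y. g x y) \<in> borel_measurable lborel" "(\<lambda>y. k x y) \<in> borel_measurable lborel" for x
      using measurable_compose[OF measurable_Pair1' g, of x] measurable_compose[OF measurable_Pair1' k, of x] by simp_all
    have "(\<integral>\<^sup>+x. \<integral>\<^sup>+y. (g x y + k x y) \<partial>lborel \<partial>lborel) = (\<integral>\<^sup>+x. (\<integral>\<^sup>+y. g x y \<partial>lborel) + (\<integral>\<^sup>+y. k x y \<partial>lborel) \<partial>lborel)"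
      by (intro nn_integral_cong nn_integral_add gs)
    also have "\<dots> = (\<integral>\<^sup>+x. \<integral>\<^sup>+y. g x y \<partial>lborel \<partial>lborel) + (\<integral>\<^sup>+x. \<integral>\<^sup>+y. k x y \<partial>lborel \<partial>lborel)"
      by (rule nn_integral_add) measurable
    finally show ?thesis .
  qed
  have m66: "(\<lambda>(x, y). (\<integral>\<^sup>+\<sigma>. ennreal (H (x, y)) * \<phi> x * K (x - y) \<sigma> \<partial>S) + (\<integral>\<^sup>+\<sigma>. ennreal (H (x, y)) * \<phi> y * K (x - y) \<sigma> \<partial>S)) \<in> borel_measurable (borel \<Otimes>\<^sub>M borel)"
    by measurable
  have "p + p = (\<integral>\<^sup>+x. \<integral>\<^sup>+y. \<integral>\<^sup>+\<sigma>. (ennreal (H (x, y)) * \<phi> (post_velocity x y \<sigma>) * K (x - y) \<sigma> + ennreal (H (x, y)) * \<phi> (post_velocity_star x y \<sigma>) * K (x - y) \<sigma>) \<partial>S \<partial>lborel \<partial>lborel)"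
    by (subst (1) p1, subst p2) (simp only: nn_integral_add[OF m5 m8(1)] add2[OF m4 m4'])
  also have "\<dots> \<le> (\<integral>\<^sup>+x. \<integral>\<^sup>+y. \<integral>\<^sup>+\<sigma>. ((ennreal (H (x, y)) * \<phi> x * K (x - y) \<sigma> + ennreal (H (x, y)) * \<phi> y * K (x - y) \<sigma>) + ennreal (H (x, y)) * G x y * K (x - y) \<sigma>) \<partial>S \<partial>lborel \<partial>lborel)"
  proof (intro nn_integral_mono)
    fix x y \<sigma> assume "\<sigma> \<in> space S"
    then have "\<phi> (post_velocity x y \<sigma>) + \<phi> (post_velocity_star x y \<sigma>) \<le> \<phi> x + \<phi> y + G x y"
      using point by simp
    then have "ennreal (\<phi> (post_velocity x y \<sigma>)) + \<phi> (post_velocity_star x y \<sigma>) \<le> ennreal (\<phi> x) + \<phi> y + G x y"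
      using \<phi>0 G0 by (simp add: ennreal_plus[symmetric] ennreal_leI del: ennreal_plus)
    then have "ennreal (H (x, y)) * K (x - y) \<sigma> * (ennreal (\<phi> (post_velocity x y \<sigma>)) + \<phi> (post_velocity_star x y \<sigma>)) \<le> ennreal (H (x, y)) * K (x - y) \<sigma> * (ennreal (\<phi> x) + \<phi> y + G x y)"
      by (rule mult_left_mono) simp
    then show "ennreal (H (x, y)) * \<phi> (post_velocity x y \<sigma>) * K (x - y) \<sigma> + ennreal (H (x, y)) * \<phi> (post_velocity_star x y \<sigma>) * K (x - y) \<sigma> \<le>
      (ennreal (H (x, y)) * \<phi> x * K (x - y) \<sigma> + ennreal (H (x, y)) * \<phi> y * K (x - y) \<sigma>) + ennreal (H (x, y)) * G x y * K (x - y) \<sigma>"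
      by (simp add: distrib_left ac_simps)
  qed
  also have "\<dots> = l + l + (\<integral>\<^sup>+x. \<integral>\<^sup>+y. \<integral>\<^sup>+\<sigma>. ennreal (H (x, y)) * G x y * K (x - y) \<sigma> \<partial>S \<partial>lborel \<partial>lborel)"
    by (subst (1) l1, subst l2) (simp only: nn_integral_add[OF borel_measurable_add[OF m7 m8(2)] m8(3)] nn_integral_add[OF m7 m8(2)] add2[OF m66 m9] add2[OF m6 m6'])
  also have "(\<integral>\<^sup>+x. \<integral>\<^sup>+y. \<integral>\<^sup>+\<sigma>. ennreal (H (x, y)) * G x y * K (x - y) \<sigma> \<partial>S \<partial>lborel \<partial>lborel) =
     (\<integral>\<^sup>+x. \<integral>\<^sup>+y. ennreal (f x * f y * G x y * norm (x - y) powr \<alpha>) \<partial>lborel \<partial>lborel)"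
    by (simp add: nn_integral_cmult nn_integral_K H_def ennreal_mult f0 G0)
  finally have le: "p + p \<le> l + l + ennreal c" using c by (meson add_left_mono order_trans)
  have fin_l: "l < \<infinity>"
  proof -
    have "l = (\<integral>\<^sup>+x. \<integral>\<^sup>+y. ennreal (H (x, y)) * \<phi> x * norm (x - y) powr \<alpha> \<partial>lborel \<partial>lborel)"
      unfolding l1 by (simp add: nn_integral_cmult nn_integral_K)
    also have "\<dots> \<le> (\<integral>\<^sup>+x. \<integral>\<^sup>+y. ennreal M * ennreal (f x * f y * norm (x - y) powr \<alpha>) \<partial>lborel \<partial>lborel)"
    proof (intro nn_integral_mono)
      fix x y
      have "0 \<le> M" using \<phi>0[of x] \<phi>M[of x] by linarith
      moreover have "f x * f y * \<phi> x * norm (x - y) powr \<alpha> \<le> f x * f y * M * norm (x - y) powr \<alpha>"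
        using f0 \<phi>M by (intro mult_right_mono mult_left_mono) auto
      ultimately show "ennreal (H (x, y)) * \<phi> x * norm (x - y) powr \<alpha> \<le> ennreal M * ennreal (f x * f y * norm (x - y) powr \<alpha>)"
        using f0 \<phi>0 by (simp add: H_def ennreal_mult[symmetric] ennreal_leI ac_simps)
    qed
    also have "\<dots> = ennreal M * (\<integral>\<^sup>+x. \<integral>\<^sup>+y. ennreal (f x * f y * norm (x - y) powr \<alpha>) \<partial>lborel \<partial>lborel)"
      by (simp add: nn_integral_cmult)
    also have "\<dots> < \<infinity>" using fin by (simp add: ennreal_mult_less_top)
    finally show ?thesis .
  qed
  have fin_p: "p < \<infinity>"
  proof (rule ccontr)
    assume "\<not> p < \<infinity>"
    then have "p = top" by (simp add: less_top[symmetric])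
    with le have "l + l + ennreal c = top" by (simp add: top_unique)
    with fin_l show False by (simp add: ennreal_add_eq_top)
  qed
  have int: "integrable lborel (\<lambda>x. enn2real (P x) * \<phi> x)" "(\<integral>x. enn2real (P x) * \<phi> x \<partial>lborel) = enn2real p"
    "integrable lborel (\<lambda>x. enn2real (L x) * \<phi> x)" "(\<integral>x. enn2real (L x) * \<phi> x \<partial>lborel) = enn2real l"
  proof -
    have e: "(\<integral>\<^sup>+x. ennreal (enn2real (P x) * \<phi> x) \<partial>lborel) = p" "(\<integral>\<^sup>+x. ennreal (enn2real (L x) * \<phi> x) \<partial>lborel) = l"
      unfolding p_def l_def using AEf
      by (auto intro!: nn_integral_cong_AE elim!: eventually_mono simp: ennreal_mult \<phi>0 PL(2,3)[unfolded infinity_ennreal_def])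
    show "integrable lborel (\<lambda>x. enn2real (P x) * \<phi> x)" "integrable lborel (\<lambda>x. enn2real (L x) * \<phi> x)"
      using fin_p fin_l e \<phi>0 by (auto simp: integrable_iff_bounded)
    show "(\<integral>x. enn2real (P x) * \<phi> x \<partial>lborel) = enn2real p" "(\<integral>x. enn2real (L x) * \<phi> x \<partial>lborel) = enn2real l"
      by (auto simp: integral_eq_nn_integral \<phi>0 e)
  qed
  have ae: "AE x in lborel. coll H x * \<phi> x = enn2real (P x) * \<phi> x - enn2real (L x) * \<phi> x"
    using AEf by (auto elim!: eventually_mono simp: PL(1) left_diff_distrib)
  have cm: "coll H \<in> borel_measurable borel"
    by (rule coll_measurable[OF H])
  have i: "integrable lborel (\<lambda>x. coll H x * \<phi> x)"
    using int(1,3) ae cm by (subst integrable_cong_AE[OF _ _ ae]) auto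
  have "(\<integral>x. coll H x * \<phi> x \<partial>lborel) = enn2real p - enn2real l"
    using int cm by (subst integral_cong_AE[OF _ _ ae]) (auto simp: int)
  moreover have "enn2real p + enn2real p \<le> enn2real l + enn2real l + c"
  proof -
    have fin: "l + l + ennreal c < top" using fin_l by (simp add: ennreal_add_eq_top less_top)
    have "enn2real (p + p) \<le> enn2real (l + l + ennreal c)"
      by (rule enn2real_mono[OF le fin])
    then show ?thesis using fin_p fin_l c0 by (simp add: enn2real_plus)
  qed
  ultimately show "integrable lborel (\<lambda>x. coll (\<lambda>(x, y). f x * f y) x * \<phi> x)"
    "(\<integral>x. coll (\<lambda>(x, y). f x * f y) x * \<phi> x \<partial>lborel) \<le> c / 2"
    using i by (simp_all add: H_def)
qed

end


section \<open>Exponentials continued by their tangents\<close>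

text \<open>The function \<open>exp (a x) - 1\<close>, followed beyond \<open>R\<close> by its tangent at \<open>R\<close>.\<close>

definition tangent_exp :: "real \<Rightarrow> real \<Rightarrow> real \<Rightarrow> real" where
  "tangent_exp R a x = (if x \<le> R then exp (a * x) - 1 else exp (a * R) - 1 + a * exp (a * R) * (x - R))"

definition capped_exp :: "real \<Rightarrow> real \<Rightarrow> real \<Rightarrow> real" where
  "capped_exp R a x = exp (a * min x R) - 1"

text \<open>The distance of \<open>tangent_exp\<close> from its tangent at \<open>R\<close>.  With \<open>x = |\<xi>|\<^sup>2\<close> an affine function of \<open>x\<close> has a
  conserved integral, so this bounded function may replace \<open>tangent_exp\<close> in the weak formulation.\<close>

definition exp_defect :: "real \<Rightarrow> real \<Rightarrow> real \<Rightarrow> real" where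
  "exp_defect R a x = (if x \<le> R then exp (a * x) - exp (a * R) - a * exp (a * R) * (x - R) else 0)"

text \<open>Derivatives in the rate \<open>a\<close>, which varies in time.\<close>

definition tangent_exp_da :: "real \<Rightarrow> real \<Rightarrow> real \<Rightarrow> real" where
  "tangent_exp_da R a x = (if x \<le> R then x * exp (a * x) else exp (a * R) * (x + a * R * (x - R)))"

definition exp_defect_da :: "real \<Rightarrow> real \<Rightarrow> real \<Rightarrow> real" where
  "exp_defect_da R a x = tangent_exp_da R a x - (exp (a * R) * (1 + a * R) * x - a * R\<^sup>2 * exp (a * R))"

lemma tangent_exp_eq_defect:
  "tangent_exp R a x = a * exp (a * R) * x + (exp (a * R) - 1 - a * R * exp (a * R)) + exp_defect R a x"
  by (auto simp: tangent_exp_def exp_defect_def algebra_simps)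

lemma exp_minus_one_le: "exp (s::real) - 1 \<le> s * exp s"
proof -
  have "1 + (- s) \<le> exp (- s)" by (rule exp_ge_add_one_self)
  then have "(1 - s) * exp s \<le> exp (- s) * exp s" by (intro mult_right_mono) auto
  then show ?thesis by (simp add: exp_minus algebra_simps)
qed

lemma exp_defect_nonneg: "0 \<le> exp_defect R a x"
proof -
  have "1 + (a * x - a * R) \<le> exp (a * x - a * R)" by (rule exp_ge_add_one_self)
  then have "(1 + (a * x - a * R)) * exp (a * R) \<le> exp (a * x - a * R) * exp (a * R)" by (intro mult_right_mono) auto
  then show ?thesis by (simp add: exp_defect_def exp_add[symmetric] algebra_simps)
qed

lemma exp_defect_le:
  assumes "0 \<le> a" "0 \<le> x" "0 \<le> R"
  shows "exp_defect R a x \<le> a * exp (a * R) * R"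
proof (cases "x \<le> R")
  case True
  have "exp (a * x) \<le> exp (a * R)" using True assms by (simp add: mult_left_mono)
  moreover have "0 \<le> a * exp (a * R) * x" using assms by simp
  moreover have "exp_defect R a x = exp (a * x) - exp (a * R) - a * exp (a * R) * x + a * exp (a * R) * R"
    using True by (simp add: exp_defect_def right_diff_distrib)
  ultimately show ?thesis by linarith
qed (use assms in \<open>simp add: exp_defect_def\<close>)

text \<open>The next two lemmas play the role of the Povzner inequality: the function is superadditive,
  being convex and zero at the origin, and its defect of additivity is at most a product of two
  bounded functions.\<close>

lemma tangent_exp_superadditive:
  assumes a: "0 \<le> a" and R: "0 \<le> R" and x: "0 \<le> x" and y: "0 \<le> y"
  shows "tangent_exp R a x + tangent_exp R a y \<le> tangent_exp R a (x + y)"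
proof -
  have big: "tangent_exp R a z + tangent_exp R a w \<le> tangent_exp R a (z + w)" if z: "R < z" and w: "0 \<le> w" for z w
  proof -
    have "tangent_exp R a (z + w) - tangent_exp R a z = a * exp (a * R) * w"
      using z w by (simp add: tangent_exp_def algebra_simps)
    moreover have "tangent_exp R a w \<le> a * exp (a * R) * w"
    proof (cases "w \<le> R")
      case True
      have "exp (a * w) - 1 \<le> a * w * exp (a * w)" using exp_minus_one_le[of "a * w"] .
      also have "\<dots> \<le> a * w * exp (a * R)" using True a w by (intro mult_left_mono) (auto intro: mult_left_mono)
      finally show ?thesis using True by (simp add: tangent_exp_def ac_simps)
    next
      case False
      have "exp (a * R) - 1 \<le> a * R * exp (a * R)" using exp_minus_one_le[of "a * R"] .
      then show ?thesis using False by (simp add: tangent_exp_def algebra_simps)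
    qed
    ultimately show ?thesis by linarith
  qed
  consider "R < x" | "R < y" | "x + y \<le> R" | "x \<le> R" "y \<le> R" "R < x + y" by linarith
  then show ?thesis
  proof cases
    case 1
    then show ?thesis using big[of x y] y by simp
  next
    case 2
    then show ?thesis using big[of y x] x by (simp add: add.commute)
  next
    case 3
    have "0 \<le> (exp (a * x) - 1) * (exp (a * y) - 1)" using a x y by simp
    then show ?thesis using 3 x y by (simp add: tangent_exp_def algebra_simps exp_add)
  next
    case 4
    define s where "s = x + y - R"
    have "0 \<le> (exp (a * R) - exp (a * x)) * (1 - exp (a * (y - R)))"
      using a 4 by (intro mult_nonneg_nonneg) (auto intro: mult_left_mono mult_nonneg_nonpos)
    also have "\<dots> = exp (a * R) + exp (a * s) - exp (a * x) - exp (a * y)"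
    proof -
      have "exp (a * R) * exp (a * (y - R)) = exp (a * y)" "exp (a * x) * exp (a * (y - R)) = exp (a * s)"
        by (simp_all add: exp_add[symmetric] s_def algebra_simps)
      then show ?thesis by (simp add: algebra_simps)
    qed
    finally have 1: "exp (a * x) + exp (a * y) \<le> exp (a * R) + exp (a * s)" by simp
    have "exp (a * s) - 1 \<le> a * s * exp (a * s)" using exp_minus_one_le[of "a * s"] .
    also have "\<dots> \<le> a * s * exp (a * R)"
      using a 4 by (intro mult_left_mono) (auto simp: s_def intro!: mult_left_mono)
    finally show ?thesis using 1 4 by (simp add: tangent_exp_def s_def algebra_simps)
  qed
qed

lemma tangent_exp_add_le:
  assumes a: "0 \<le> a" and R: "0 \<le> R" and x: "0 \<le> x" and y: "0 \<le> y"
  shows "tangent_exp R a (x + y) \<le> tangent_exp R a x + tangent_exp R a y + capped_exp R a x * capped_exp R a y"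
proof -
  have one: "tangent_exp R a (z + w) \<le> tangent_exp R a z + tangent_exp R a w + capped_exp R a z * capped_exp R a w"
    if z: "R < z" and w: "0 \<le> w" for z w
  proof (cases "w \<le> R")
    case True
    have "a * w * exp (a * R) \<le> (exp (a * w) - 1) * exp (a * R)"
      by (intro mult_right_mono) (use exp_ge_add_one_self[of "a * w"] in linarith, simp)
    then show ?thesis using z w True by (simp add: tangent_exp_def capped_exp_def algebra_simps)
  next
    case False
    have "a * R * exp (a * R) \<le> (exp (a * R) - 1) * exp (a * R)"
      by (intro mult_right_mono) (use exp_ge_add_one_self[of "a * R"] in linarith, simp)
    then show ?thesis using z w False by (simp add: tangent_exp_def capped_exp_def algebra_simps)
  qed
  consider "R < x" | "R < y" | "x + y \<le> R" | "x \<le> R" "y \<le> R" "R < x + y" by linarith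
  then show ?thesis
  proof cases
    case 1
    then show ?thesis using one[of x y] y by simp
  next
    case 2
    then show ?thesis using one[of y x] x by (simp add: ac_simps)
  next
    case 3
    then show ?thesis using x y by (simp add: tangent_exp_def capped_exp_def algebra_simps exp_add)
  next
    case 4
    have "(1 + a * (x + y - R)) * exp (a * R) \<le> exp (a * (x + y - R)) * exp (a * R)"
      by (intro mult_right_mono exp_ge_add_one_self) auto
    also have "\<dots> = exp (a * x) * exp (a * y)" by (simp add: exp_add[symmetric] algebra_simps)
    finally show ?thesis using 4 by (simp add: tangent_exp_def capped_exp_def algebra_simps)
  qed
qed

lemma capped_exp_nonneg: "0 \<le> a \<Longrightarrow> 0 \<le> R \<Longrightarrow> 0 \<le> x \<Longrightarrow> 0 \<le> capped_exp R a x"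
  by (simp add: capped_exp_def)

lemma capped_exp_le: "0 \<le> a \<Longrightarrow> capped_exp R a x \<le> exp (a * R)"
proof -
  assume "0 \<le> a"
  then have "exp (a * min x R) \<le> exp (a * R)" by (simp add: mult_left_mono)
  then show ?thesis unfolding capped_exp_def by linarith
qed

lemma capped_exp_le_tangent_exp: "0 \<le> a \<Longrightarrow> capped_exp R a x \<le> tangent_exp R a x"
  by (simp add: capped_exp_def tangent_exp_def)

lemma tangent_exp_le:
  assumes "0 \<le> a" "0 \<le> R" "0 \<le> x"
  shows "tangent_exp R a x \<le> a * exp (a * R) * x" "tangent_exp R a x \<le> a * x * exp (a * x)"
proof -
  have e: "exp (a * x) - 1 \<le> a * x * exp (a * x)" by (rule exp_minus_one_le)
  show "tangent_exp R a x \<le> a * exp (a * R) * x"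
  proof (cases "x \<le> R")
    case True
    note e
    also have "a * x * exp (a * x) \<le> a * x * exp (a * R)" using True assms by (intro mult_left_mono) (auto intro: mult_left_mono)
    finally show ?thesis using True by (simp add: tangent_exp_def ac_simps)
  next
    case False
    have "exp (a * R) - 1 \<le> a * R * exp (a * R)" using exp_minus_one_le[of "a * R"] .
    then show ?thesis using False by (simp add: tangent_exp_def algebra_simps)
  qed
  then show "tangent_exp R a x \<le> a * x * exp (a * x)"
  proof (cases "x \<le> R")
    case False
    then have "a * exp (a * R) * x \<le> a * exp (a * x) * x"
      using assms by (intro mult_right_mono mult_left_mono) (auto intro: mult_left_mono)
    then show ?thesis using \<open>tangent_exp R a x \<le> a * exp (a * R) * x\<close> by (simp add: ac_simps)
  qed (use e in \<open>simp add: tangent_exp_def\<close>)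
qed

lemma tangent_exp_nonneg: "0 \<le> a \<Longrightarrow> 0 \<le> R \<Longrightarrow> 0 \<le> x \<Longrightarrow> 0 \<le> tangent_exp R a x"
  by (rule order_trans[OF capped_exp_nonneg capped_exp_le_tangent_exp])

lemma tangent_exp_da_ge:
  assumes "0 \<le> a" "0 \<le> R" "0 \<le> x"
  shows "x * capped_exp R a x \<le> tangent_exp_da R a x"
proof (cases "x \<le> R")
  case False
  then have "0 \<le> exp (a * R) * (a * R * (x - R))" using assms by simp
  then show ?thesis using False assms by (simp add: tangent_exp_da_def capped_exp_def algebra_simps)
qed (use assms in \<open>simp add: tangent_exp_da_def capped_exp_def algebra_simps\<close>)

lemma tangent_exp_da_bounds:
  assumes "0 \<le> a" "0 \<le> R" "0 \<le> x"
  shows "0 \<le> tangent_exp_da R a x" "tangent_exp_da R a x \<le> exp (a * R) * (1 + a * R) * x"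
proof -
  show "0 \<le> tangent_exp_da R a x" using assms by (simp add: tangent_exp_da_def)
  show "tangent_exp_da R a x \<le> exp (a * R) * (1 + a * R) * x"
  proof (cases "x \<le> R")
    case True
    have "x * exp (a * x) \<le> x * exp (a * R)" using True assms by (intro mult_left_mono) (auto intro: mult_left_mono)
    moreover have "0 \<le> exp (a * R) * (a * R) * x" using assms by simp
    ultimately show ?thesis using True by (simp add: tangent_exp_da_def algebra_simps)
  next
    case False
    have "0 \<le> exp (a * R) * (a * R) * R" using assms by simp
    then show ?thesis using False by (simp add: tangent_exp_da_def algebra_simps)
  qed
qed

lemma exp_defect_deriv: "((\<lambda>a. exp_defect R a x) has_real_derivative exp_defect_da R a x) (at a)"
proof (cases "x \<le> R")
  case True
  then show ?thesis unfolding exp_defect_def exp_defect_da_def tangent_exp_da_def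
    by (auto intro!: derivative_eq_intros simp: algebra_simps power2_eq_square)
next
  case False
  then have "exp_defect_da R a x = 0" by (simp add: exp_defect_da_def tangent_exp_da_def algebra_simps power2_eq_square)
  then show ?thesis using False by (simp add: exp_defect_def)
qed

lemma exp_defect_da_bound:
  assumes "0 \<le> a" "0 \<le> R" "0 \<le> x"
  shows "\<bar>exp_defect_da R a x\<bar> \<le> 2 * exp (a * R) * (1 + a * R) * x + a * R\<^sup>2 * exp (a * R)"
proof -
  define A where "A = exp (a * R) * (1 + a * R) * x"
  define B where "B = a * R\<^sup>2 * exp (a * R)"
  define D where "D = tangent_exp_da R a x"
  have "0 \<le> A" "0 \<le> B" "0 \<le> D" "D \<le> A"
    using assms tangent_exp_da_bounds[OF assms] by (auto simp: A_def B_def D_def)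
  then have "\<bar>D - (A - B)\<bar> \<le> 2 * A + B" by linarith
  then show ?thesis by (simp add: exp_defect_da_def A_def B_def D_def)
qed

section \<open>Integration in time\<close>

text \<open>Integration by parts for an indefinite Lebesgue integral, by exchanging the order of integration.\<close>

lemma weighted_integral_by_parts:
  fixes q \<phi> \<phi>' :: "real \<Rightarrow> real" and init :: real
  assumes t: "0 \<le> t" and q: "set_integrable lborel {0..t} q"
    and d: "\<And>s. s \<in> {0..t} \<Longrightarrow> (\<phi> has_real_derivative \<phi>' s) (at s)"
    and isc: "\<And>s. isCont \<phi>' s" and m[measurable]: "\<phi>' \<in> borel_measurable borel" "\<phi> \<in> borel_measurable borel"
  defines "F \<equiv> \<lambda>s. init + (LINT r:{0..s}|lborel. q r)"
  shows "set_integrable lborel {0..t} (\<lambda>s. \<phi> s * q s)" "set_integrable lborel {0..t} (\<lambda>s. \<phi>' s * F s)"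
    and "\<phi> t * F t = \<phi> 0 * init + (LINT s:{0..t}|lborel. \<phi> s * q s) + (LINT s:{0..t}|lborel. \<phi>' s * F s)"
proof -
  have c: "continuous_on {0..t} \<phi>'" using isc by (simp add: continuous_at_imp_continuous_on)
  define p where "p = (\<lambda>r. indicator {0..t} r * q r)"
  have p: "integrable lborel p" using q by (simp add: set_integrable_def p_def)
  then have [measurable]: "p \<in> borel_measurable borel" by auto
  have "bounded (\<phi>' ` {0..t})" by (intro compact_imp_bounded compact_continuous_image c) auto
  then obtain M where M: "\<And>s. s \<in> {0..t} \<Longrightarrow> \<bar>\<phi>' s\<bar> \<le> M"
    unfolding bounded_iff by (metis imageI real_norm_def)
  have M0: "0 \<le> M" using M[of 0] t by auto
  have cphi: "continuous_on {0..t} \<phi>"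
    using d by (intro DERIV_continuous_on) (auto intro: has_field_derivative_at_within)
  have "bounded (\<phi> ` {0..t})" by (intro compact_imp_bounded compact_continuous_image cphi) auto
  then obtain M2 where M2: "\<And>s. s \<in> {0..t} \<Longrightarrow> \<bar>\<phi> s\<bar> \<le> M2"
    unfolding bounded_iff by (metis imageI real_norm_def)
  have i1: "integrable lborel (\<lambda>s. \<phi> s * p s)"
  proof (rule Bochner_Integration.integrable_bound[of _ "\<lambda>s. M2 * p s"])
    show "AE s in lborel. norm (\<phi> s * p s) \<le> norm (M2 * p s)"
      using M2 by (auto simp: p_def abs_mult intro!: AE_I2 mult_right_mono split: split_indicator) (meson abs_ge_self order_trans)
  qed (use p in auto)
  then show "set_integrable lborel {0..t} (\<lambda>s. \<phi> s * q s)" by (simp add: set_integrable_def p_def ac_simps)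
  define k where "k = (\<lambda>(s, r). indicator {0..t} s * indicator {0..s} r * \<phi>' s * p r)"
  have km[measurable]: "k \<in> borel_measurable (borel \<Otimes>\<^sub>M borel)"
  proof -
    have "k = (\<lambda>(s, r). indicator {0..t} s * (if 0 \<le> r \<and> r \<le> s then 1 else 0) * \<phi>' s * p r)"
      by (auto simp: k_def fun_eq_iff split: split_indicator)
    then show ?thesis by simp
  qed
  have kb: "\<bar>k (s, r)\<bar> \<le> indicator {0..t} s * M * \<bar>p r\<bar>" for s r
    using M[of s] M0 by (auto simp: k_def abs_mult intro!: mult_right_mono split: split_indicator)
  have ki: "integrable (lborel \<Otimes>\<^sub>M lborel) k"
  proof (rule Bochner_Integration.integrable_bound)
    show "integrable (lborel \<Otimes>\<^sub>M lborel) (\<lambda>(s, r). (indicator {0..t} s * M) * \<bar>p r\<bar>)"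
    proof (rule lborel_pair.Fubini_integrable)
      have "integrable lborel (\<lambda>s. indicator {0..t} s * (M * (\<integral>r. \<bar>p r\<bar> \<partial>lborel)))"
        using integrable_real_indicator[of "{0..t}" lborel] by (intro integrable_mult_left) (simp add: emeasure_lborel_Icc_eq)
      then show "integrable lborel (\<lambda>s. \<integral>r. norm (case (s, r) of (s, r) \<Rightarrow> indicator {0..t} s * M * \<bar>p r\<bar>) \<partial>lborel)"
        using M0 by (simp add: abs_mult mult.assoc)
    qed (use p in auto)
    show "AE x in lborel \<Otimes>\<^sub>M lborel. norm (k x) \<le> norm (case x of (s, r) \<Rightarrow> indicator {0..t} s * M * \<bar>p r\<bar>)"
      using kb M0 by (auto intro!: AE_I2 simp: abs_mult)
  qed auto
  have in1: "(LINT r|lborel. k (s, r)) = indicator {0..t} s * \<phi>' s * (LINT r:{0..s}|lborel. q r)" for s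
    unfolding k_def set_lebesgue_integral_def
    by (cases "s \<in> {0..t}")
      (auto simp: p_def mult.assoc integral_mult_right_zero[symmetric] simp del: integral_mult_right_zero
        intro!: Bochner_Integration.integral_cong split: split_indicator)
  have in2: "(LINT s|lborel. k (s, r)) = (\<phi> t - \<phi> r) * p r" for r
  proof (cases "r \<in> {0..t}")
    case True
    have "(LINT s|lborel. k (s, r)) = (LINT s|lborel. (\<phi>' s * indicator {r..t} s) * p r)"
      using True by (intro Bochner_Integration.integral_cong) (auto simp: k_def split: split_indicator)
    also have "\<dots> = (LINT s|lborel. \<phi>' s * indicator {r..t} s) * p r" by simp
    also have "(LINT s|lborel. \<phi>' s * indicator {r..t} s) = \<phi> t - \<phi> r"
      using True d by (intro integral_FTC_Icc_real) (auto intro: isc)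
    finally show ?thesis .
  next
    case False
    then show ?thesis by (simp add: k_def p_def)
  qed
  have fub: "(LINT s|lborel. LINT r|lborel. k (s, r)) = (LINT r|lborel. LINT s|lborel. k (s, r))"
    using lborel_pair.Fubini_integral[of "\<lambda>s r. k (s, r)"] ki by simp
  have i2: "integrable lborel (\<lambda>s. indicator {0..t} s * \<phi>' s * (LINT r:{0..s}|lborel. q r))"
    using lborel_pair.integrable_fst'[OF ki] by (simp add: in1)
  have i3: "integrable lborel (\<lambda>s. \<phi>' s * indicator {0..t} s)"
    using borel_integrable_atLeastAtMost'[OF c] by (simp add: set_integrable_def ac_simps)
  have Fi: "integrable lborel (\<lambda>s. indicator {0..t} s * (\<phi>' s * F s))"
    using Bochner_Integration.integrable_add[OF integrable_mult_left[OF i3, of init] i2] unfolding F_def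
    by (simp only: distrib_left mult.assoc mult.left_commute[of "indicator _ _"])
  then show "set_integrable lborel {0..t} (\<lambda>s. \<phi>' s * F s)" by (simp add: set_integrable_def)
  have "(LINT s:{0..t}|lborel. \<phi>' s * F s) = (LINT s|lborel. \<phi>' s * indicator {0..t} s * init + indicator {0..t} s * \<phi>' s * (LINT r:{0..s}|lborel. q r))"
    unfolding set_lebesgue_integral_def F_def by (intro Bochner_Integration.integral_cong) (auto simp: algebra_simps)
  also have "\<dots> = (LINT s|lborel. \<phi>' s * indicator {0..t} s) * init + (LINT s|lborel. indicator {0..t} s * \<phi>' s * (LINT r:{0..s}|lborel. q r))"
    by (subst Bochner_Integration.integral_add[OF integrable_mult_left[OF i3] i2]) simp
  also have "(LINT s|lborel. \<phi>' s * indicator {0..t} s) = \<phi> t - \<phi> 0"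
    using t d by (intro integral_FTC_Icc_real) (auto intro: isc)
  also have "(LINT s|lborel. indicator {0..t} s * \<phi>' s * (LINT r:{0..s}|lborel. q r)) = (LINT r|lborel. (\<phi> t - \<phi> r) * p r)"
    using fub by (simp add: in1 in2)
  also have "\<dots> = \<phi> t * (LINT r|lborel. p r) - (LINT r|lborel. \<phi> r * p r)"
    using p i1 by (simp add: left_diff_distrib)
  finally show "\<phi> t * F t = \<phi> 0 * init + (LINT s:{0..t}|lborel. \<phi> s * q s) + (LINT s:{0..t}|lborel. \<phi>' s * F s)"
    by (simp add: F_def set_lebesgue_integral_def p_def algebra_simps)
qed

text \<open>At the first time where \<open>X\<close> reaches \<open>2 B\<close> its increment is at most \<open>\<kappa> T < B\<close>, starting from at most \<open>B\<close>.\<close>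

lemma continuity_bootstrap:
  fixes X J :: "real \<Rightarrow> real"
  assumes T: "0 \<le> T" and cont: "continuous_on {0..T} X" and B: "X 0 \<le> B" "0 < B" and \<kappa>: "0 \<le> \<kappa>" "\<kappa> * T < B"
    and X: "\<And>t. t \<in> {0..T} \<Longrightarrow> X t = X 0 + (LINT s:{0..t}|lborel. J s)"
    and Ji: "set_integrable lborel {0..T} J"
    and J: "\<And>s. s \<in> {0..T} \<Longrightarrow> X s \<le> 2 * B \<Longrightarrow> J s \<le> \<kappa>"
    and t: "t \<in> {0..T}"
  shows "X t \<le> 2 * B"
proof (rule ccontr)
  assume "\<not> X t \<le> 2 * B"
  define Z where "Z = {s \<in> {0..T}. 2 * B \<le> X s}"
  have "Z = {0..T} \<inter> X -` {2 * B..}" by (auto simp: Z_def)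
  then have "closed Z" using continuous_closed_preimage[OF cont closed_atLeastAtMost closed_atLeast] by simp
  moreover have "t \<in> Z" using t \<open>\<not> X t \<le> 2 * B\<close> by (auto simp: Z_def)
  moreover have "bdd_below Z" by (auto simp: Z_def bdd_below_def)
  ultimately have i: "Inf Z \<in> Z" by (intro closed_contains_Inf) auto
  define \<tau> where "\<tau> = Inf Z"
  have \<tau>: "\<tau> \<in> {0..T}" "2 * B \<le> X \<tau>" using i by (auto simp: Z_def \<tau>_def)
  have before: "X s \<le> 2 * B" if "s \<in> {0..<\<tau>}" for s
  proof (rule ccontr)
    assume "\<not> X s \<le> 2 * B"
    then have "s \<in> Z" using that \<tau> by (auto simp: Z_def)
    then have "\<tau> \<le> s" unfolding \<tau>_def by (rule cInf_lower) (auto simp: Z_def bdd_below_def)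
    then show False using that by simp
  qed
  have sub: "set_integrable lborel {0..\<tau>} J" by (rule set_integrable_subset[OF Ji]) (use \<tau> in auto)
  have "(LINT s:{0..\<tau>}|lborel. J s) \<le> (LINT s:{0..\<tau>}|lborel. \<kappa>)"
    unfolding set_lebesgue_integral_def
  proof (rule integral_mono_AE)
    show "AE s in lborel. indicator {0..\<tau>} s *\<^sub>R J s \<le> indicator {0..\<tau>} s *\<^sub>R \<kappa>"
      using AE_lborel_singleton[of \<tau>]
    proof eventually_elim
      case (elim s)
      then show ?case using J[of s] before[of s] \<tau> by (auto split: split_indicator)
    qed
  qed (use sub integrable_real_indicator[of "{0..\<tau>}" lborel] in \<open>auto simp: set_integrable_def emeasure_lborel_Icc_eq\<close>)
  also have "\<dots> = \<kappa> * \<tau>" using \<tau> by (simp add: set_lebesgue_integral_def)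
  also have "\<dots> \<le> \<kappa> * T" using \<tau> \<kappa> by (intro mult_left_mono) auto
  finally show False using X[OF \<tau>(1)] \<tau>(2) B \<kappa> by simp
qed


section \<open>Balance laws for a solution\<close>

lemma powr_le_one_plus_square:
  assumes "0 < \<alpha>" "\<alpha> \<le> 1" "0 \<le> (s::real)"
  shows "s powr \<alpha> \<le> 1 + s\<^sup>2"
proof (cases "s \<le> 1")
  case True
  then have "s powr \<alpha> \<le> 1 powr \<alpha>" using assms by (intro powr_mono2) auto
  moreover have "0 \<le> s\<^sup>2" by simp
  ultimately show ?thesis using True by (simp only: powr_one_eq_one)
next
  case False
  then have "s powr \<alpha> \<le> s powr 2" using assms by (intro powr_mono) auto
  then show ?thesis using False by (simp add: powr_numeral)
qed

lemma powr_le_young: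
  assumes "0 < \<alpha>" "\<alpha> \<le> 1" "0 \<le> (s::real)" "0 < \<epsilon>"
  shows "s powr \<alpha> \<le> \<epsilon> * s\<^sup>2 + (1 + 1 / \<epsilon>)"
proof (cases "s \<le> 1")
  case True
  then have "s powr \<alpha> \<le> 1 powr \<alpha>" using assms by (intro powr_mono2) auto
  moreover have "0 \<le> \<epsilon> * s\<^sup>2 + 1 / \<epsilon>" using assms by simp
  ultimately show ?thesis by simp
next
  case False
  then have "s powr \<alpha> \<le> s powr 1" using assms by (intro powr_mono) auto
  moreover have "s \<le> \<epsilon> * s\<^sup>2 + 1 / \<epsilon>"
  proof (cases "\<epsilon> * s \<ge> 1")
    case True
    have "1 * s \<le> (\<epsilon> * s) * s" using True assms by (intro mult_right_mono) auto
    moreover have "0 \<le> 1 / \<epsilon>" using assms by simp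
    moreover have "(\<epsilon> * s) * s = \<epsilon> * s\<^sup>2" by (simp add: power2_eq_square)
    ultimately show ?thesis by linarith
  next
    case False
    then have "s \<le> 1 / \<epsilon>" using assms by (simp add: field_simps)
    moreover have "0 \<le> \<epsilon> * s\<^sup>2" using assms by simp
    ultimately show ?thesis by linarith
  qed
  ultimately show ?thesis using False by simp
qed

text \<open>Only the values at \<open>t \<ge> 0\<close> belong to the solution; the others serve to state joint measurability
  on the full product space.  Mass \<open>1\<close> and energy \<open>E\<close> are conserved.\<close>

locale boltzmann_flow = collision \<alpha> h dim
  for \<alpha> :: real and h :: "real \<Rightarrow> real" and dim :: "'n::finite itself" +
  fixes f :: "real \<Rightarrow> real^'n \<Rightarrow> real" and E :: real
  assumes f_meas2 [measurable]: "(\<lambda>(t, x). f t x) \<in> borel_measurable (borel \<Otimes>\<^sub>M borel)"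
    and f_nonneg: "\<And>t x. 0 \<le> f t x"
    and f_eq: "\<And>t. 0 \<le> t \<Longrightarrow> AE x in lborel.
        set_integrable lborel {0..t} (\<lambda>s. collision_op \<alpha> h (f s) (f s) x) \<and>
        f t x = f 0 x + (LINT s:{0..t}|lborel. collision_op \<alpha> h (f s) (f s) x)"
    and f_mass: "\<And>t. 0 \<le> t \<Longrightarrow> has_bochner_integral lborel (f t) 1"
    and f_energy: "\<And>t. 0 \<le> t \<Longrightarrow> has_bochner_integral lborel (\<lambda>x. f t x * (norm x)\<^sup>2) E"
begin

abbreviation q :: "real \<Rightarrow> real^'n \<Rightarrow> real" where "q t x \<equiv> collision_op \<alpha> h (f t) (f t) x"

lemma f_meas [measurable]: "f t \<in> borel_measurable borel"
  using measurable_compose[OF measurable_Pair1' f_meas2, of t] by simp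

lemma q_meas2 [measurable]: "(\<lambda>(t, x). q t x) \<in> borel_measurable (borel \<Otimes>\<^sub>M borel)"
  by (rule collision_op_measurable[OF f_meas2])

lemma q_meas [measurable]: "q t \<in> borel_measurable borel"
  using measurable_compose[OF measurable_Pair1' q_meas2, of t] by simp

lemma E_nonneg: "0 \<le> E"
  using f_energy[of 0] f_nonneg by (auto simp: has_bochner_integral_iff intro!: integral_nonneg_AE)

lemma f_integrable: "0 \<le> t \<Longrightarrow> integrable lborel (f t)" "0 \<le> t \<Longrightarrow> integrable lborel (\<lambda>x. f t x * (norm x)\<^sup>2)"
  and f_integral: "0 \<le> t \<Longrightarrow> (\<integral>x. f t x \<partial>lborel) = 1" "0 \<le> t \<Longrightarrow> (\<integral>x. f t x * (norm x)\<^sup>2 \<partial>lborel) = E"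
  using f_mass[of t] f_energy[of t] by (auto simp: has_bochner_integral_iff)

lemma f_integral2: "0 \<le> t \<Longrightarrow> integrable lborel (\<lambda>x. (1 + (norm x)\<^sup>2) * f t x)"
  "0 \<le> t \<Longrightarrow> (\<integral>x. (1 + (norm x)\<^sup>2) * f t x \<partial>lborel) = 1 + E"
  using f_integrable[of t] f_integral[of t]
    Bochner_Integration.integral_add[of lborel "f t" "\<lambda>x. f t x * (norm x)\<^sup>2"] Bochner_Integration.integrable_add[of lborel "f t" "\<lambda>x. f t x * (norm x)\<^sup>2"]
  by (simp_all add: algebra_simps)

lemma nn_integral_f2: "0 \<le> t \<Longrightarrow> (\<integral>\<^sup>+x. ennreal ((1 + (norm x)\<^sup>2) * f t x) \<partial>lborel) = ennreal (1 + E)"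
  using f_integral2[of t] f_nonneg by (subst nn_integral_eq_integral) auto

lemma interaction_finite:
  assumes t: "0 \<le> t"
  shows "(\<integral>\<^sup>+x. \<integral>\<^sup>+y. ennreal (f t x * f t y * norm (x - y) powr \<alpha>) \<partial>lborel \<partial>lborel) \<le> ennreal (2 * (1 + E))"
proof -
  have w1: "wint (\<lambda>x. 1) (f t) = 1"
    unfolding wint_def using f_integrable(1)[OF t] f_integral(1)[OF t] f_nonneg by (simp add: nn_integral_eq_integral)
  have "wint (\<lambda>x. norm x powr \<alpha> * 1) (f t) \<le> (\<integral>\<^sup>+x. ennreal ((1 + (norm x)\<^sup>2) * f t x) \<partial>lborel)"
    unfolding wint_def using f_nonneg alpha_pos alpha_le_1
    by (intro nn_integral_mono ennreal_leI) (auto simp: mult.commute[of _ "f t _"] intro!: mult_left_mono powr_le_one_plus_square)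
  then have w2: "wint (\<lambda>x. norm x powr \<alpha> * 1) (f t) \<le> ennreal (1 + E)" by (simp add: nn_integral_f2 t)
  have "(\<integral>\<^sup>+x. \<integral>\<^sup>+y. ennreal (f t x * f t y * norm (x - y) powr \<alpha>) \<partial>lborel \<partial>lborel) \<le>
     wint (\<lambda>x. norm x powr \<alpha> * 1) (f t) * wint (\<lambda>x. 1) (f t) + wint (\<lambda>x. 1) (f t) * wint (\<lambda>x. norm x powr \<alpha> * 1) (f t)"
    using tensor_integral_le[of "f t" "f t" "\<lambda>x. 1"] f_nonneg by simp
  also have "\<dots> \<le> ennreal (1 + E) + ennreal (1 + E)"
    unfolding w1 using w2 by (simp add: add_mono)
  also have "\<dots> = ennreal (2 * (1 + E))" using E_nonneg by (simp add: ennreal_plus[symmetric] del: ennreal_plus)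
  finally show ?thesis .
qed

lemma interaction_finite': "0 \<le> t \<Longrightarrow> (\<integral>\<^sup>+x. \<integral>\<^sup>+y. ennreal (f t x * f t y * norm (x - y) powr \<alpha>) \<partial>lborel \<partial>lborel) < \<infinity>"
  using interaction_finite[of t] by (auto intro: le_less_trans)

lemma represents_q: "0 \<le> t \<Longrightarrow> represents (q t) (\<lambda>(x, y). f t x * f t y)"
  using interaction_finite'[of t] f_nonneg by (intro represents_collision_op) (auto simp: ennreal_mult)

lemma q_integral_bound:
  assumes t: "0 \<le> t"
  shows "(\<integral>\<^sup>+x. ennreal \<bar>q t x\<bar> \<partial>lborel) \<le> ennreal (4 * (1 + E))"
proof -
  let ?H = "\<lambda>(x, y). f t x * f t y"
  have H: "?H \<in> borel_measurable borel" using represents_q[OF t] by (simp add: represents_def)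
  have "(\<integral>\<^sup>+x. ennreal \<bar>q t x\<bar> \<partial>lborel) \<le> (\<integral>\<^sup>+x. coll_abs ?H x * 1 \<partial>lborel)"
  proof (intro nn_integral_mono_AE)
    have "AE x in lborel. q t x = coll ?H x" using represents_q[OF t] by (simp add: represents_def)
    then show "AE x in lborel. ennreal \<bar>q t x\<bar> \<le> coll_abs ?H x * 1"
      by (rule eventually_mono) (simp add: abs_coll_le[OF H])
  qed
  also have "\<dots> \<le> (\<integral>\<^sup>+x. \<integral>\<^sup>+y. ennreal \<bar>?H (x, y)\<bar> * 2 * norm (x - y) powr \<alpha> \<partial>lborel \<partial>lborel)"
    by (rule nn_integral_coll_abs_le[OF H]) (auto simp: one_add_one)
  also have "\<dots> = 2 * (\<integral>\<^sup>+x. \<integral>\<^sup>+y. ennreal (f t x * f t y * norm (x - y) powr \<alpha>) \<partial>lborel \<partial>lborel)"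
    by (subst nn_integral_cmult[symmetric], measurable)
      (auto intro!: nn_integral_cong simp: nn_integral_cmult[symmetric] ennreal_mult f_nonneg ac_simps)
  also have "\<dots> \<le> 2 * ennreal (2 * (1 + E))" by (intro mult_left_mono interaction_finite t) auto
  also have "\<dots> = ennreal (4 * (1 + E))"
  proof -
    have "2 * ennreal (2 * (1 + E)) = ennreal 2 * ennreal (2 * (1 + E))" by simp
    also have "\<dots> = ennreal (4 * (1 + E))" by (subst ennreal_mult[symmetric]) (use E_nonneg in auto)
    finally show ?thesis .
  qed
  finally show ?thesis .
qed

text \<open>For almost every velocity, the density is at almost every time equal to an absolutely
  continuous function of time.\<close>

lemma f_eq_AE_time:
  assumes t: "0 \<le> t"
  shows "AE x in lborel. set_integrable lborel {0..t} (\<lambda>s. q s x) \<and>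
    f t x = f 0 x + (LINT s:{0..t}|lborel. q s x) \<and>
    (AE s in lborel. s \<in> {0..t} \<longrightarrow> f s x = f 0 x + (LINT r:{0..s}|lborel. q r x))"
proof -
  define P where "P s x \<longleftrightarrow> (s \<in> {0..t} \<longrightarrow> f s x = f 0 x + (LINT r:{0..s}|lborel. q r x))" for s x
  have m: "(\<lambda>(s, x). LINT r:{0..s}|lborel. q r x) \<in> borel_measurable (borel \<Otimes>\<^sub>M borel)"
  proof -
    have "(\<lambda>(s, x). LINT r|lborel. (if 0 \<le> r \<and> r \<le> s then 1 else 0) * q r x) \<in> borel_measurable ((borel :: real measure) \<Otimes>\<^sub>M borel)"
      by measurable
    moreover have "(\<lambda>(s, x). LINT r|lborel. (if 0 \<le> r \<and> r \<le> s then 1 else 0) * q r x) = (\<lambda>(s, x). LINT r:{0..s}|lborel. q r x)"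
      by (auto simp: fun_eq_iff set_lebesgue_integral_def intro!: Bochner_Integration.integral_cong split: split_indicator)
    ultimately show ?thesis by simp
  qed
  note [measurable] = m
  have "{z \<in> space (lborel \<Otimes>\<^sub>M lborel). P (fst z) (snd z)} \<in> sets (lborel \<Otimes>\<^sub>M lborel)"
    unfolding P_def by measurable
  then have "(AE x in lborel. AE s in lborel. P s x) \<longleftrightarrow> (AE s in lborel. AE x in lborel. P s x)"
    by (intro lborel_pair.AE_commute[symmetric])
  moreover have "AE x in lborel. P s x" for s
  proof (cases "s \<in> {0..t}")
    case True
    then show ?thesis using f_eq[of s] by (auto simp: P_def elim!: eventually_mono)
  next
    case False
    then show ?thesis unfolding P_def by (simp only: simp_thms eventually_True)
  qed
  ultimately have "AE x in lborel. AE s in lborel. P s x" by simp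
  with f_eq[OF t] show ?thesis unfolding P_def by eventually_elim auto
qed

text \<open>Tested with a time-dependent weight, the equation holds for almost every velocity by integration by
  parts in time; Fubini's theorem then exchanges the two integrations.  The weight must be bounded
  because \<open>q\<close> is only known to be integrable, while its time derivative may grow like the energy
  density.\<close>

lemma weighted_balance:
  fixes \<phi> \<phi>' :: "real \<Rightarrow> real^'n \<Rightarrow> real"
  assumes t: "0 \<le> t"
    and m[measurable]: "(\<lambda>(s, x). \<phi> s x) \<in> borel_measurable (borel \<Otimes>\<^sub>M borel)" "(\<lambda>(s, x). \<phi>' s x) \<in> borel_measurable (borel \<Otimes>\<^sub>M borel)"
    and d: "\<And>s x. s \<in> {0..t} \<Longrightarrow> ((\<lambda>s. \<phi> s x) has_real_derivative \<phi>' s x) (at s)"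
    and c: "\<And>s x. isCont (\<lambda>s. \<phi>' s x) s"
    and b: "\<And>s x. s \<in> {0..t} \<Longrightarrow> \<bar>\<phi> s x\<bar> \<le> M" and b': "\<And>s x. s \<in> {0..t} \<Longrightarrow> \<bar>\<phi>' s x\<bar> \<le> M' * (1 + (norm x)\<^sup>2)"
  shows "set_integrable lborel {0..t} (\<lambda>s. (\<integral>x. \<phi> s x * q s x \<partial>lborel) + (\<integral>x. \<phi>' s x * f s x \<partial>lborel))"
    and "(\<integral>x. \<phi> t x * f t x \<partial>lborel) = (\<integral>x. \<phi> 0 x * f 0 x \<partial>lborel) +
      (LINT s:{0..t}|lborel. ((\<integral>x. \<phi> s x * q s x \<partial>lborel) + (\<integral>x. \<phi>' s x * f s x \<partial>lborel)))"
proof -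
  have sect[measurable]: "\<phi> s \<in> borel_measurable borel" "\<phi>' s \<in> borel_measurable borel"
     "(\<lambda>s. \<phi> s x) \<in> borel_measurable borel" "(\<lambda>s. \<phi>' s x) \<in> borel_measurable borel"
     "(\<lambda>s. f s x) \<in> borel_measurable borel" "(\<lambda>s. q s x) \<in> borel_measurable borel" for s x
    using measurable_compose[OF measurable_Pair1' m(1), of s] measurable_compose[OF measurable_Pair1' m(2), of s]
      measurable_compose[OF measurable_Pair2' m(1), of x] measurable_compose[OF measurable_Pair2' m(2), of x]
      measurable_compose[OF measurable_Pair2' f_meas2, of x] measurable_compose[OF measurable_Pair2' q_meas2, of x]
    by simp_all
  have M0: "0 \<le> M" using b[of t 0] t by auto
  have "0 \<le> M' * (1 + (norm (0::real^'n))\<^sup>2)" using b'[of t 0] t by (meson abs_ge_zero atLeastAtMost_iff order_refl order_trans)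
  then have M'0: "0 \<le> M'" by simp
  have qi: "integrable lborel (q s)" if "0 \<le> s" for s
    using q_integral_bound[OF that] by (auto simp: integrable_iff_bounded intro: le_less_trans)
  have qn: "(\<integral>x. \<bar>q s x\<bar> \<partial>lborel) \<le> 4 * (1 + E)" if "0 \<le> s" for s
  proof -
    have "ennreal (\<integral>x. \<bar>q s x\<bar> \<partial>lborel) \<le> ennreal (4 * (1 + E))"
      using q_integral_bound[OF that] qi[OF that] by (simp add: nn_integral_eq_integral)
    then show ?thesis using E_nonneg by (subst (asm) ennreal_le_iff) auto
  qed
  have i1: "integrable lborel (\<lambda>x. \<phi> s x * q s x)" if "s \<in> {0..t}" for s
    using that b by (intro Bochner_Integration.integrable_bound[OF integrable_mult_right[OF qi[of s], of M]])
      (auto simp: abs_mult intro!: AE_I2 mult_right_mono intro: order_trans[OF _ abs_ge_self])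
  have i2: "integrable lborel (\<lambda>x. \<phi>' s x * f s x)" if "s \<in> {0..t}" for s
  proof (rule Bochner_Integration.integrable_bound[OF integrable_mult_right[OF f_integral2(1)[of s], of M']])
    have "\<bar>\<phi>' s x\<bar> * f s x \<le> M' * (1 + (norm x)\<^sup>2) * f s x" for x
      using b'[OF that] f_nonneg by (intro mult_right_mono)
    then show "AE x in lborel. norm (\<phi>' s x * f s x) \<le> norm (M' * ((1 + (norm x)\<^sup>2) * f s x))"
      using f_nonneg[of s] M'0 by (auto simp: abs_mult mult.assoc)
  qed (use that in auto)
  define z where "z = (\<lambda>(s, x). indicator {0..t} s * (\<phi> s x * q s x + \<phi>' s x * f s x))"
  have zm[measurable]: "z \<in> borel_measurable (borel \<Otimes>\<^sub>M borel)" unfolding z_def by measurable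
  define C where "C = M * (4 * (1 + E)) + M' * (1 + E)"
  have zi: "integrable (lborel \<Otimes>\<^sub>M lborel) z"
  proof (rule lborel_pair.Fubini_integrable)
    show "z \<in> borel_measurable (lborel \<Otimes>\<^sub>M lborel)" by simp
    show "AE s in lborel. integrable lborel (\<lambda>x. z (s, x))"
      using i1 i2 by (intro AE_I2) (auto simp: z_def split: split_indicator)
    show "integrable lborel (\<lambda>s. \<integral>x. norm (z (s, x)) \<partial>lborel)"
    proof (rule Bochner_Integration.integrable_bound[of _ "\<lambda>s. indicator {0..t} s * C"])
      show "integrable lborel (\<lambda>s. indicator {0..t} s * C)"
        using integrable_real_indicator[of "{0..t}" lborel] by (intro integrable_mult_left) (simp add: emeasure_lborel_Icc_eq)
      have "(\<integral>x. \<bar>z (s, x)\<bar> \<partial>lborel) \<le> indicator {0..t} s * C" for s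
      proof (cases "s \<in> {0..t}")
        case True
        then have s: "0 \<le> s" by simp
        have "(\<integral>x. \<bar>z (s, x)\<bar> \<partial>lborel) \<le> (\<integral>x. M * \<bar>q s x\<bar> + M' * ((1 + (norm x)\<^sup>2) * f s x) \<partial>lborel)"
        proof (rule integral_mono)
          show "integrable lborel (\<lambda>x. \<bar>z (s, x)\<bar>)" using i1[OF True] i2[OF True] True by (simp add: z_def)
          show "integrable lborel (\<lambda>x. M * \<bar>q s x\<bar> + M' * ((1 + (norm x)\<^sup>2) * f s x))"
            using qi[OF s] f_integral2(1)[OF s] by simp
          fix x
          have "\<bar>z (s, x)\<bar> \<le> \<bar>\<phi> s x\<bar> * \<bar>q s x\<bar> + \<bar>\<phi>' s x\<bar> * f s x"
            using True f_nonneg[of s x] abs_triangle_ineq[of "\<phi> s x * q s x" "\<phi>' s x * f s x"] by (simp add: z_def abs_mult)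
          also have "\<dots> \<le> M * \<bar>q s x\<bar> + (M' * (1 + (norm x)\<^sup>2)) * f s x"
            using b[OF True] b'[OF True] f_nonneg[of s x] by (intro add_mono mult_right_mono) auto
          finally show "\<bar>z (s, x)\<bar> \<le> M * \<bar>q s x\<bar> + M' * ((1 + (norm x)\<^sup>2) * f s x)" by (simp add: mult.assoc)
        qed
        also have "\<dots> = M * (\<integral>x. \<bar>q s x\<bar> \<partial>lborel) + M' * (1 + E)"
          using qi[OF s] f_integral2[OF s] by simp
        also have "\<dots> \<le> C" unfolding C_def using qn[OF s] M0 M'0 by (intro add_mono mult_left_mono) auto
        finally show ?thesis using True by simp
      qed (simp add: z_def)
      then show "AE s in lborel. norm (\<integral>x. norm (z (s, x)) \<partial>lborel) \<le> norm (indicator {0..t} s * C)"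
        by (intro AE_I2) (simp add: integral_nonneg_AE, smt (verit) integral_nonneg_AE AE_I2 abs_ge_zero)
    qed (simp add: measurable_lborel1)
  qed
  have in1: "(\<integral>x. z (s, x) \<partial>lborel) = indicator {0..t} s * ((\<integral>x. \<phi> s x * q s x \<partial>lborel) + (\<integral>x. \<phi>' s x * f s x \<partial>lborel))" for s
    using i1[of s] i2[of s] by (cases "s \<in> {0..t}") (auto simp: z_def)
  show "set_integrable lborel {0..t} (\<lambda>s. (\<integral>x. \<phi> s x * q s x \<partial>lborel) + (\<integral>x. \<phi>' s x * f s x \<partial>lborel))"
    using lborel_pair.integrable_fst'[OF zi] by (simp add: in1 set_integrable_def)
  have ae: "AE x in lborel. \<phi> t x * f t x = \<phi> 0 x * f 0 x + (\<integral>s. z (s, x) \<partial>lborel)"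
    using f_eq_AE_time[OF t]
  proof eventually_elim
    case (elim x)
    note P = weighted_integral_by_parts(1)[OF t elim[THEN conjunct1] d[of _ x] c[of _ x] sect(4,3)]
      weighted_integral_by_parts(2,3)[where init="f 0 x", OF t elim[THEN conjunct1] d[of _ x] c[of _ x] sect(4,3)]
    have "(LINT s:{0..t}|lborel. \<phi>' s x * f s x) = (LINT s:{0..t}|lborel. \<phi>' s x * (f 0 x + (LINT r:{0..s}|lborel. q r x)))"
      and "set_integrable lborel {0..t} (\<lambda>s. \<phi>' s x * f s x)"
    proof -
      have m: "(\<lambda>s. indicator {0..t} s * (\<phi>' s x * (f 0 x + (LINT r:{0..s}|lborel. q r x)))) \<in> borel_measurable lborel"
        using P(2) by (auto simp: set_integrable_def)
      have e: "AE s in lborel. indicator {0..t} s * (\<phi>' s x * f s x) = indicator {0..t} s * (\<phi>' s x * (f 0 x + (LINT r:{0..s}|lborel. q r x)))"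
        using elim by (auto elim!: eventually_mono split: split_indicator)
      show "(LINT s:{0..t}|lborel. \<phi>' s x * f s x) = (LINT s:{0..t}|lborel. \<phi>' s x * (f 0 x + (LINT r:{0..s}|lborel. q r x)))"
        unfolding set_lebesgue_integral_def real_scaleR_def by (rule integral_cong_AE[OF _ m[unfolded set_lebesgue_integral_def real_scaleR_def] e[unfolded set_lebesgue_integral_def real_scaleR_def]]) simp
      show "set_integrable lborel {0..t} (\<lambda>s. \<phi>' s x * f s x)"
        using P(2) unfolding set_integrable_def real_scaleR_def
        by (subst integrable_cong_AE[OF _ m e]) auto
    qed
    then show ?case using P(1,3) elim
      by (simp add: z_def set_lebesgue_integral_def set_integrable_def distrib_left)
  qed
  have fi: "integrable lborel (\<lambda>x. \<phi> 0 x * f 0 x)"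
    using t b[of 0] f_nonneg by (intro Bochner_Integration.integrable_bound[OF integrable_mult_right[OF f_integrable(1)[of 0], of M]])
      (auto simp: abs_mult intro!: AE_I2 mult_right_mono intro: order_trans[OF _ abs_ge_self])
  have "(\<integral>x. \<phi> t x * f t x \<partial>lborel) = (\<integral>x. \<phi> 0 x * f 0 x + (\<integral>s. z (s, x) \<partial>lborel) \<partial>lborel)"
    by (rule integral_cong_AE[OF _ _ ae]) auto
  also have "\<dots> = (\<integral>x. \<phi> 0 x * f 0 x \<partial>lborel) + (\<integral>x. \<integral>s. z (s, x) \<partial>lborel \<partial>lborel)"
    using lborel_pair.integrable_snd[of "\<lambda>s x. z (s, x)"] zi by (intro Bochner_Integration.integral_add fi) simp
  also have "(\<integral>x. \<integral>s. z (s, x) \<partial>lborel \<partial>lborel) = (\<integral>s. \<integral>x. z (s, x) \<partial>lborel \<partial>lborel)"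
    using lborel_pair.Fubini_integral[of "\<lambda>s x. z (s, x)"] zi by simp
  finally show "(\<integral>x. \<phi> t x * f t x \<partial>lborel) = (\<integral>x. \<phi> 0 x * f 0 x \<partial>lborel) +
      (LINT s:{0..t}|lborel. ((\<integral>x. \<phi> s x * q s x \<partial>lborel) + (\<integral>x. \<phi>' s x * f s x \<partial>lborel)))"
    by (simp add: in1 set_lebesgue_integral_def)
qed

end


section \<open>Propagation of Gaussian moments of the density\<close>

lemma continuous_indefinite_lebesgue_integral:
  fixes J :: "real \<Rightarrow> real"
  assumes "set_integrable lborel {0..T} J"
  shows "continuous_on {0..T} (\<lambda>t. LINT s:{0..t}|lborel. J s)"
proof -
  have "continuous_on {0..T} (\<lambda>t. integral {0..t} J)"
    using set_borel_integral_eq_integral(1)[OF assms] by (rule indefinite_integral_continuous_1)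
  moreover have "integral {0..t} J = (LINT s:{0..t}|lborel. J s)" if "t \<in> {0..T}" for t
    using that by (intro set_borel_integral_eq_integral(2)[symmetric] set_integrable_subset[OF assms]) auto
  ultimately show ?thesis by (rule continuous_on_eq)
qed

context boltzmann_flow begin

lemma f_weighted_integrable:
  assumes s: "0 \<le> s" and [measurable]: "w \<in> borel_measurable borel" and w: "\<And>x. \<bar>w x\<bar> \<le> C * (1 + (norm x)\<^sup>2)"
  shows "integrable lborel (\<lambda>x. w x * f s x)"
proof (rule Bochner_Integration.integrable_bound[OF integrable_mult_right[OF f_integral2(1)[OF s], of C]])
  have C: "0 \<le> C" using w[of 0] by (simp add: order_trans[OF abs_ge_zero])
  have "\<bar>w x\<bar> * f s x \<le> C * (1 + (norm x)\<^sup>2) * f s x" for x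
    using w f_nonneg by (intro mult_right_mono)
  then show "AE x in lborel. norm (w x * f s x) \<le> norm (C * ((1 + (norm x)\<^sup>2) * f s x))"
    using f_nonneg[of s] C by (auto simp: abs_mult mult.assoc)
qed simp

text \<open>By the two Povzner type inequalities a collision increases the weight by at most a product of capped
  exponentials.  The factor \<open>|\<xi>|\<^sup>\<alpha>\<close> of the kernel is split by Young's inequality into a small multiple of
  \<open>|\<xi>|\<^sup>2\<close>, which is controlled by the derivative \<open>Y\<close> of the moment in the rate, and a constant.\<close>

lemma collision_dissipation:
  assumes s: "0 \<le> s" and a: "0 \<le> a" and R: "0 \<le> R" and \<epsilon>: "0 < \<epsilon>"
  defines "v \<equiv> \<integral>x. capped_exp R a ((norm x)\<^sup>2) * f s x \<partial>lborel"
    and "Y \<equiv> \<integral>x. tangent_exp_da R a ((norm x)\<^sup>2) * f s x \<partial>lborel"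
  shows "(\<integral>x. exp_defect R a ((norm x)\<^sup>2) * q s x \<partial>lborel) \<le> (\<epsilon> * Y + (1 + 1 / \<epsilon>) * v) * v"
proof -
  define V where "V x = capped_exp R a ((norm x)\<^sup>2)" for x :: "real^'n"
  have Vm[measurable]: "V \<in> borel_measurable borel" unfolding V_def capped_exp_def by measurable
  have dm[measurable]: "(\<lambda>x::real^'n. tangent_exp_da R a ((norm x)\<^sup>2)) \<in> borel_measurable borel"
    unfolding tangent_exp_da_def by measurable
  have \<theta>m[measurable]: "(\<lambda>x::real^'n. exp_defect R a ((norm x)\<^sup>2)) \<in> borel_measurable borel"
    unfolding exp_defect_def by measurable
  have V0: "0 \<le> V x" for x using a R by (simp add: V_def capped_exp_nonneg)
  have Vle: "V x \<le> exp (a * R)" for x using a by (simp add: V_def capped_exp_le)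
  have Vi: "integrable lborel (\<lambda>x. V x * f s x)"
    by (rule f_weighted_integrable[OF s Vm, of "exp (a * R)"])
      (use V0 Vle in \<open>auto simp: distrib_left intro: add_increasing2\<close>)
  have Wi: "integrable lborel (\<lambda>x. (norm x powr \<alpha> * V x) * f s x)"
  proof (rule f_weighted_integrable[OF s, of _ "exp (a * R)"])
    fix x :: "real^'n"
    have "norm x powr \<alpha> * V x \<le> (1 + (norm x)\<^sup>2) * exp (a * R)"
      using V0 Vle alpha_pos alpha_le_1 by (intro mult_mono powr_le_one_plus_square) auto
    then show "\<bar>norm x powr \<alpha> * V x\<bar> \<le> exp (a * R) * (1 + (norm x)\<^sup>2)" using V0 by (simp add: abs_mult ac_simps)
  qed simp
  have Yi: "integrable lborel (\<lambda>x. tangent_exp_da R a ((norm x)\<^sup>2) * f s x)"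
  proof (rule f_weighted_integrable[OF s dm, of "exp (a * R) * (1 + a * R)"])
    fix x :: "real^'n"
    have "0 \<le> exp (a * R) * (1 + a * R)" using a R by simp
    then have "exp (a * R) * (1 + a * R) * (norm x)\<^sup>2 \<le> exp (a * R) * (1 + a * R) * (1 + (norm x)\<^sup>2)"
      by (intro mult_left_mono) auto
    then show "\<bar>tangent_exp_da R a ((norm x)\<^sup>2)\<bar> \<le> exp (a * R) * (1 + a * R) * (1 + (norm x)\<^sup>2)"
      using tangent_exp_da_bounds[OF a R zero_le_power2, of "norm x"] by linarith
  qed
  define W where "W = (\<integral>x. (norm x powr \<alpha> * V x) * f s x \<partial>lborel)"
  have v: "v = (\<integral>x. V x * f s x \<partial>lborel)" by (simp add: v_def V_def)
  have v0: "0 \<le> v" and W0: "0 \<le> W" unfolding v W_def using V0 f_nonneg by (auto intro!: integral_nonneg_AE)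
  have wv: "wint V (f s) = ennreal v" "wint (\<lambda>x. norm x powr \<alpha> * V x) (f s) = ennreal W"
    unfolding wint_def v W_def using V0 f_nonneg Vi Wi
    by (auto simp: nn_integral_eq_integral[symmetric] mult.commute intro!: nn_integral_cong)
  have c: "(\<integral>\<^sup>+x. \<integral>\<^sup>+y. ennreal (f s x * f s y * (V x * V y) * norm (x - y) powr \<alpha>) \<partial>lborel \<partial>lborel) \<le> ennreal (2 * (W * v))"
  proof -
    have "(\<integral>\<^sup>+x. \<integral>\<^sup>+y. ennreal (f s x * f s y * (V x * V y) * norm (x - y) powr \<alpha>) \<partial>lborel \<partial>lborel) \<le> ennreal W * ennreal v + ennreal v * ennreal W"
      using tensor_integral_le[of "f s" "f s" V] V0 f_nonneg by (simp add: wv)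
    also have "\<dots> = ennreal (2 * (W * v))"
      using v0 W0 by (simp add: ennreal_mult[symmetric] ennreal_plus[symmetric] mult.commute del: ennreal_plus)
    finally show ?thesis .
  qed
  have point: "exp_defect R a ((norm (post_velocity x y \<sigma>))\<^sup>2) + exp_defect R a ((norm (post_velocity_star x y \<sigma>))\<^sup>2)
      \<le> exp_defect R a ((norm x)\<^sup>2) + exp_defect R a ((norm y)\<^sup>2) + V x * V y"
    if "\<sigma> \<in> sphere 0 1" for x y \<sigma> :: "real^'n"
  proof -
    define x' where "x' = (norm (post_velocity x y \<sigma>))\<^sup>2"
    define y' where "y' = (norm (post_velocity_star x y \<sigma>))\<^sup>2"
    have e: "x' + y' = (norm x)\<^sup>2 + (norm y)\<^sup>2" unfolding x'_def y'_def by (rule post_velocity_energy[OF that])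
    have "tangent_exp R a x' + tangent_exp R a y' \<le> tangent_exp R a (x' + y')"
      by (rule tangent_exp_superadditive[OF a R]) (auto simp: x'_def y'_def)
    also have "\<dots> \<le> tangent_exp R a ((norm x)\<^sup>2) + tangent_exp R a ((norm y)\<^sup>2) + V x * V y"
      unfolding e V_def by (rule tangent_exp_add_le[OF a R]) auto
    finally have "a * exp (a * R) * (x' + y') + exp_defect R a x' + exp_defect R a y' \<le>
      a * exp (a * R) * ((norm x)\<^sup>2 + (norm y)\<^sup>2) + exp_defect R a ((norm x)\<^sup>2) + exp_defect R a ((norm y)\<^sup>2) + V x * V y"
      by (simp add: tangent_exp_eq_defect distrib_left)
    then show ?thesis unfolding e by (simp add: x'_def y'_def)
  qed
  have Gm: "(\<lambda>(x, y). V x * V y) \<in> borel_measurable (borel \<Otimes>\<^sub>M borel)" by measurable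
  have "(\<integral>x. exp_defect R a ((norm x)\<^sup>2) * q s x \<partial>lborel) = (\<integral>x. coll (\<lambda>(x, y). f s x * f s y) x * exp_defect R a ((norm x)\<^sup>2) \<partial>lborel)"
  proof (rule integral_cong_AE)
    have "AE x in lborel. q s x = coll (\<lambda>(x, y). f s x * f s y) x" using represents_q[OF s] by (simp add: represents_def)
    then show "AE x in lborel. exp_defect R a ((norm x)\<^sup>2) * q s x = coll (\<lambda>(x, y). f s x * f s y) x * exp_defect R a ((norm x)\<^sup>2)"
      by (rule eventually_mono) simp
    have "coll (\<lambda>(x, y). f s x * f s y) \<in> borel_measurable borel"
      using represents_q[OF s] by (intro coll_measurable) (simp add: represents_def)
    then show "(\<lambda>x. coll (\<lambda>(x, y). f s x * f s y) x * exp_defect R a ((norm x)\<^sup>2)) \<in> borel_measurable lborel" by simp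
  qed simp
  also have "\<dots> \<le> 2 * (W * v) / 2"
    by (rule weak_collision_le(2)[OF f_meas f_nonneg \<theta>m exp_defect_nonneg _ Gm _ interaction_finite'[OF s] point c, where M="a * exp (a * R) * R"])
      (use V0 v0 W0 a R in \<open>auto intro!: exp_defect_le\<close>)
  also have "\<dots> = W * v" by simp
  also have "\<dots> \<le> (\<epsilon> * Y + (1 + 1 / \<epsilon>) * v) * v"
  proof (intro mult_right_mono v0)
    have "W \<le> (\<integral>x. \<epsilon> * (tangent_exp_da R a ((norm x)\<^sup>2) * f s x) + (1 + 1 / \<epsilon>) * (V x * f s x) \<partial>lborel)"
      unfolding W_def
    proof (rule integral_mono[OF Wi])
      fix x :: "real^'n"
      have "norm x powr \<alpha> * V x \<le> (\<epsilon> * (norm x)\<^sup>2 + (1 + 1 / \<epsilon>)) * V x"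
        using V0 \<epsilon> alpha_pos alpha_le_1 by (intro mult_right_mono powr_le_young) auto
      also have "\<dots> = \<epsilon> * ((norm x)\<^sup>2 * V x) + (1 + 1 / \<epsilon>) * V x" by (simp add: algebra_simps)
      also have "\<dots> \<le> \<epsilon> * tangent_exp_da R a ((norm x)\<^sup>2) + (1 + 1 / \<epsilon>) * V x"
        using \<epsilon> a R by (intro add_right_mono mult_left_mono) (auto simp: V_def tangent_exp_da_ge)
      finally have "norm x powr \<alpha> * V x * f s x \<le> (\<epsilon> * tangent_exp_da R a ((norm x)\<^sup>2) + (1 + 1 / \<epsilon>) * V x) * f s x"
        using f_nonneg by (rule mult_right_mono)
      then show "norm x powr \<alpha> * V x * f s x \<le> \<epsilon> * (tangent_exp_da R a ((norm x)\<^sup>2) * f s x) + (1 + 1 / \<epsilon>) * (V x * f s x)"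
        by (simp add: algebra_simps)
    qed (use Vi Yi in auto)
    also have "\<dots> = \<epsilon> * Y + (1 + 1 / \<epsilon>) * v"
      unfolding Y_def v using Vi Yi by simp
    finally show "W \<le> \<epsilon> * Y + (1 + 1 / \<epsilon>) * v" .
  qed
  finally show ?thesis .
qed

text \<open>The rate falls from \<open>a0\<close> to \<open>a0 / 2\<close> with speed \<open>a0 / (2 T)\<close>.  The first smallness condition lets the
  resulting damping dominate the production proportional to \<open>Y\<close>, the second one keeps the remaining
  production from doubling the moment before time \<open>T\<close>.  The bound does not depend on \<open>R\<close>.\<close>

lemma tangent_exp_moment_bound:
  assumes T: "0 < T" and a0: "0 < a0" and B: "0 < B" and \<epsilon>: "0 < \<epsilon>" and R: "0 < R"
    and small: "2 * B * \<epsilon> \<le> a0 / (2 * T)" "(1 + 1 / \<epsilon>) * (2 * B)\<^sup>2 * T < B"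
    and init: "(\<integral>x. tangent_exp R a0 ((norm x)\<^sup>2) * f 0 x \<partial>lborel) \<le> B"
    and t: "t \<in> {0..T}"
  shows "(\<integral>x. tangent_exp R (a0 - a0 / (2 * T) * t) ((norm x)\<^sup>2) * f t x \<partial>lborel) \<le> 2 * B"
proof -
  define l where "l = a0 / (2 * T)"
  have l: "0 < l" using T a0 by (simp add: l_def)
  define a where "a s = a0 - l * s" for s
  have a: "0 \<le> a s" "a s \<le> a0" if "s \<in> {0..T}" for s
  proof -
    have "l * s \<le> l * T" using that l by (intro mult_left_mono) auto
    also have "l * T = a0 / 2" using T by (simp add: l_def)
    finally show "0 \<le> a s" "a s \<le> a0" using that l a0 by (auto simp: a_def)
  qed
  have R0: "0 \<le> R" using R by simp
  have [measurable]: "a \<in> borel_measurable borel" unfolding a_def by measurable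
  define \<phi> where "\<phi> s x = exp_defect R (a s) ((norm x)\<^sup>2)" for s and x :: "real^'n"
  define \<phi>' where "\<phi>' s x = - l * exp_defect_da R (a s) ((norm x)\<^sup>2)" for s and x :: "real^'n"
  define M where "M = a0 * exp (a0 * R) * R"
  define M' where "M' = l * (2 * exp (a0 * R) * (1 + a0 * R) + a0 * R\<^sup>2 * exp (a0 * R))"
  have b: "\<bar>\<phi> s x\<bar> \<le> M" if "s \<in> {0..T}" for s x
  proof -
    have "exp_defect R (a s) ((norm x)\<^sup>2) \<le> a s * exp (a s * R) * R" using a[OF that] R by (intro exp_defect_le) auto
    also have "\<dots> \<le> M" unfolding M_def using a[OF that] R a0 by (intro mult_mono) auto
    finally show ?thesis using exp_defect_nonneg by (simp add: \<phi>_def)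
  qed
  have b': "\<bar>\<phi>' s x\<bar> \<le> M' * (1 + (norm x)\<^sup>2)" if "s \<in> {0..T}" for s x
  proof -
    have "\<bar>exp_defect_da R (a s) ((norm x)\<^sup>2)\<bar> \<le> 2 * exp (a s * R) * (1 + a s * R) * (norm x)\<^sup>2 + a s * R\<^sup>2 * exp (a s * R)"
      using a[OF that] R by (intro exp_defect_da_bound) auto
    also have "\<dots> \<le> 2 * exp (a0 * R) * (1 + a0 * R) * (1 + (norm x)\<^sup>2) + a0 * R\<^sup>2 * exp (a0 * R) * (1 + (norm x)\<^sup>2)"
    proof (intro add_mono)
      show "2 * exp (a s * R) * (1 + a s * R) * (norm x)\<^sup>2 \<le> 2 * exp (a0 * R) * (1 + a0 * R) * (1 + (norm x)\<^sup>2)"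
        using a[OF that] R a0 by (intro mult_mono) auto
      have "a s * R\<^sup>2 * exp (a s * R) * 1 \<le> a0 * R\<^sup>2 * exp (a0 * R) * (1 + (norm x)\<^sup>2)"
        using a[OF that] R a0 by (intro mult_mono) auto
      then show "a s * R\<^sup>2 * exp (a s * R) \<le> a0 * R\<^sup>2 * exp (a0 * R) * (1 + (norm x)\<^sup>2)" by simp
    qed
    finally have "l * \<bar>exp_defect_da R (a s) ((norm x)\<^sup>2)\<bar> \<le> l * (2 * exp (a0 * R) * (1 + a0 * R) * (1 + (norm x)\<^sup>2) + a0 * R\<^sup>2 * exp (a0 * R) * (1 + (norm x)\<^sup>2))"
      using l by (intro mult_left_mono) auto
    then show ?thesis using l by (simp add: \<phi>'_def M'_def abs_mult algebra_simps)
  qed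
  have d: "((\<lambda>s. \<phi> s x) has_real_derivative \<phi>' s x) (at s)" for s x
  proof -
    have "(a has_real_derivative - l) (at s)" unfolding a_def by (auto intro!: derivative_eq_intros)
    from DERIV_chain2[OF exp_defect_deriv this] show ?thesis by (simp add: \<phi>_def \<phi>'_def mult.commute)
  qed
  have c: "isCont (\<lambda>s. \<phi>' s x) s" for s x
  proof -
    have ac: "isCont a s" unfolding a_def by (intro continuous_intros)
    show ?thesis unfolding \<phi>'_def exp_defect_da_def tangent_exp_da_def
      by (cases "(norm x)\<^sup>2 \<le> R") (auto intro!: continuous_intros ac)
  qed
  have m: "(\<lambda>(s, x). \<phi> s x) \<in> borel_measurable (borel \<Otimes>\<^sub>M borel)" "(\<lambda>(s, x). \<phi>' s x) \<in> borel_measurable (borel \<Otimes>\<^sub>M borel)"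
    unfolding \<phi>_def \<phi>'_def exp_defect_def exp_defect_da_def tangent_exp_da_def by measurable
  define J1 where "J1 s = (\<integral>x. \<phi> s x * q s x \<partial>lborel) + (\<integral>x. \<phi>' s x * f s x \<partial>lborel)" for s
  have bal: "set_integrable lborel {0..t} J1" "(\<integral>x. \<phi> t x * f t x \<partial>lborel) = (\<integral>x. \<phi> 0 x * f 0 x \<partial>lborel) + (LINT s:{0..t}|lborel. J1 s)"
    if "t \<in> {0..T}" for t
    unfolding J1_def using that by (auto intro!: weighted_balance m d c b b')
  \<comment> \<open>The integral of the affine part of the weight, an explicit function of the conserved mass and energy.\<close>
  define G where "G s = a s * exp (a s * R) * E + (exp (a s * R) - 1 - a s * R * exp (a s * R))" for s
  define G' where "G' s = - l * (exp (a s * R) * (1 + a s * R) * E - a s * R\<^sup>2 * exp (a s * R))" for s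
  have Gd: "(G has_real_derivative G' s) (at s)" for s
    unfolding G_def G'_def a_def by (auto intro!: derivative_eq_intros simp: algebra_simps power2_eq_square)
  have Gc: "isCont G' s" for s unfolding G'_def a_def by (intro continuous_intros)
  have Gi: "set_integrable lborel {0..t} G'" "(LINT s:{0..t}|lborel. G' s) = G t - G 0" if "t \<in> {0..T}" for t
    using that has_bochner_integral_FTC_Icc_real[of 0 t G G'] integral_FTC_Icc_real[of 0 t G G'] Gd Gc
    by (auto simp: set_integrable_def set_lebesgue_integral_def has_bochner_integral_iff mult.commute)
  have \<phi>i: "integrable lborel (\<lambda>x. \<phi> s x * f s x)" if "s \<in> {0..T}" for s
  proof (rule f_weighted_integrable[where C=M])
    show "\<phi> s \<in> borel_measurable borel" using measurable_compose[OF measurable_Pair1' m(1), of s] by simp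
    show "\<bar>\<phi> s x\<bar> \<le> M * (1 + (norm x)\<^sup>2)" for x
    proof -
      have "M * 1 \<le> M * (1 + (norm x)\<^sup>2)" using a0 R by (intro mult_left_mono) (auto simp: M_def)
      then show ?thesis using b[OF that, of x] by simp
    qed
  qed (use that in auto)
  define X where "X s = (\<integral>x. tangent_exp R (a s) ((norm x)\<^sup>2) * f s x \<partial>lborel)" for s
  have X: "X s = G s + (\<integral>x. \<phi> s x * f s x \<partial>lborel)" if "s \<in> {0..T}" for s
  proof -
    have s: "0 \<le> s" using that by simp
    have "X s = (\<integral>x. a s * exp (a s * R) * (f s x * (norm x)\<^sup>2) + (exp (a s * R) - 1 - a s * R * exp (a s * R)) * f s x + \<phi> s x * f s x \<partial>lborel)"
      unfolding X_def by (intro Bochner_Integration.integral_cong) (auto simp: tangent_exp_eq_defect \<phi>_def algebra_simps)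
    also have "\<dots> = a s * exp (a s * R) * E + (exp (a s * R) - 1 - a s * R * exp (a s * R)) * 1 + (\<integral>x. \<phi> s x * f s x \<partial>lborel)"
      using f_integrable[OF s] f_integral[OF s] \<phi>i[OF that] by simp
    finally show ?thesis by (simp add: G_def)
  qed
  define J where "J s = J1 s + G' s" for s
  have Ji: "set_integrable lborel {0..t} J" if "t \<in> {0..T}" for t
    using bal(1)[OF that] Gi(1)[OF that] unfolding J_def by (rule set_integral_add)
  have XJ: "X t = X 0 + (LINT s:{0..t}|lborel. J s)" if "t \<in> {0..T}" for t
  proof -
    have "(LINT s:{0..t}|lborel. J s) = (LINT s:{0..t}|lborel. J1 s) + (G t - G 0)"
      unfolding J_def using set_integral_add(2)[OF bal(1)[OF that] Gi(1)[OF that]] Gi(2)[OF that] by simp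
    then show ?thesis using bal(2)[OF that] X[OF that] X[of 0] T by simp
  qed
  have da_i: "integrable lborel (\<lambda>x. tangent_exp_da R (a s) ((norm x)\<^sup>2) * f s x)" if "s \<in> {0..T}" for s
  proof (rule f_weighted_integrable[where C="exp (a s * R) * (1 + a s * R)"])
    show "\<bar>tangent_exp_da R (a s) ((norm x)\<^sup>2)\<bar> \<le> exp (a s * R) * (1 + a s * R) * (1 + (norm x)\<^sup>2)" for x :: "real^'n"
      using tangent_exp_da_bounds[OF a(1)[OF that] R0, of "(norm x)\<^sup>2"] a(1)[OF that] R0 by (simp add: distrib_left add_increasing)
  qed (use that in \<open>auto simp: tangent_exp_da_def\<close>)
  have te_i: "integrable lborel (\<lambda>x. tangent_exp R (a s) ((norm x)\<^sup>2) * f s x)"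
    and ce_i: "integrable lborel (\<lambda>x. capped_exp R (a s) ((norm x)\<^sup>2) * f s x)" if "s \<in> {0..T}" for s
  proof -
    have le: "tangent_exp R (a s) ((norm x)\<^sup>2) \<le> a s * exp (a s * R) * (1 + (norm x)\<^sup>2)" for x :: "real^'n"
      using tangent_exp_le(1)[OF a(1)[OF that] R0, of "(norm x)\<^sup>2"] a(1)[OF that] by (simp add: distrib_left add_increasing)
    show "integrable lborel (\<lambda>x. tangent_exp R (a s) ((norm x)\<^sup>2) * f s x)"
      by (rule f_weighted_integrable[where C="a s * exp (a s * R)"])
        (use that le tangent_exp_nonneg[OF a(1)[OF that] R0] in \<open>auto simp: tangent_exp_def\<close>)
    show "integrable lborel (\<lambda>x. capped_exp R (a s) ((norm x)\<^sup>2) * f s x)"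
      by (rule f_weighted_integrable[where C="a s * exp (a s * R)"])
        (use that order_trans[OF capped_exp_le_tangent_exp[OF a(1)[OF that]] le] capped_exp_nonneg[OF a(1)[OF that] R0] in \<open>auto simp: capped_exp_def\<close>)
  qed
  have Jle: "J s \<le> (1 + 1 / \<epsilon>) * (2 * B)\<^sup>2" if s: "s \<in> {0..T}" and XB: "X s \<le> 2 * B" for s
  proof -
    have s0: "0 \<le> s" using s by simp
    define Y where "Y = (\<integral>x. tangent_exp_da R (a s) ((norm x)\<^sup>2) * f s x \<partial>lborel)"
    define v where "v = (\<integral>x. capped_exp R (a s) ((norm x)\<^sup>2) * f s x \<partial>lborel)"
    have Y0: "0 \<le> Y" unfolding Y_def using f_nonneg tangent_exp_da_bounds(1)[OF a(1)[OF s] R0] by (auto intro!: integral_nonneg_AE)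
    have v0: "0 \<le> v" unfolding v_def using f_nonneg capped_exp_nonneg[OF a(1)[OF s] R0] by (auto intro!: integral_nonneg_AE)
    have "v \<le> X s" unfolding v_def X_def
      using te_i[OF s] ce_i[OF s] f_nonneg capped_exp_le_tangent_exp[OF a(1)[OF s]] by (intro integral_mono mult_right_mono) auto
    with XB have vB: "v \<le> 2 * B" by simp
    have "(\<integral>x. \<phi>' s x * f s x \<partial>lborel) = (\<integral>x. - l * (tangent_exp_da R (a s) ((norm x)\<^sup>2) * f s x)
         + l * (exp (a s * R) * (1 + a s * R)) * (f s x * (norm x)\<^sup>2) - l * (a s * R\<^sup>2 * exp (a s * R)) * f s x \<partial>lborel)"
      by (intro Bochner_Integration.integral_cong) (auto simp: \<phi>'_def exp_defect_da_def algebra_simps)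
    also have "\<dots> = - l * Y + l * (exp (a s * R) * (1 + a s * R)) * E - l * (a s * R\<^sup>2 * exp (a s * R)) * 1"
      unfolding Y_def f_integral(1)[OF s0, symmetric] f_integral(2)[OF s0, symmetric]
      using f_integrable[OF s0] da_i[OF s]
      by (simp only: Bochner_Integration.integral_add Bochner_Integration.integral_diff integral_mult_right_zero
        integrable_mult_right Bochner_Integration.integrable_add)
    also have "\<dots> = - l * Y - G' s" by (simp add: G'_def algebra_simps)
    finally have "J s = (\<integral>x. \<phi> s x * q s x \<partial>lborel) - l * Y" by (simp add: J_def J1_def)
    also have "\<dots> \<le> (\<epsilon> * Y + (1 + 1 / \<epsilon>) * v) * v - l * Y"
      using collision_dissipation[OF s0 a(1)[OF s] R0 \<epsilon>] by (simp add: \<phi>_def Y_def v_def)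
    also have "\<dots> \<le> (\<epsilon> * Y + (1 + 1 / \<epsilon>) * (2 * B)) * (2 * B) - l * Y"
      using vB v0 Y0 \<epsilon> B by (intro diff_right_mono mult_mono add_left_mono mult_left_mono) auto
    also have "\<dots> = (2 * B * \<epsilon> - l) * Y + (1 + 1 / \<epsilon>) * (2 * B)\<^sup>2"
      by (simp add: algebra_simps power2_eq_square)
    also have "\<dots> \<le> (1 + 1 / \<epsilon>) * (2 * B)\<^sup>2"
      using small(1) Y0 by (simp add: l_def mult_nonpos_nonneg)
    finally show ?thesis .
  qed
  have "X t \<le> 2 * B"
  proof (rule continuity_bootstrap[where X=X and J=J and T=T and \<kappa>="(1 + 1 / \<epsilon>) * (2 * B)\<^sup>2"])
    have "continuous_on {0..T} (\<lambda>t. X 0 + (LINT s:{0..t}|lborel. J s))"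
      using T by (intro continuous_intros continuous_indefinite_lebesgue_integral Ji) auto
    then show "continuous_on {0..T} X"
      by (rule continuous_on_eq) (rule XJ[symmetric])
    show "X 0 \<le> B" using init by (simp add: X_def a_def)
    show "set_integrable lborel {0..T} J" using T by (intro Ji) auto
    show "X t = X 0 + (LINT s:{0..t}|lborel. J s)" if "t \<in> {0..T}" for t by (rule XJ[OF that])
    show "0 \<le> (1 + 1 / \<epsilon>) * (2 * B)\<^sup>2" using \<epsilon> by simp
    show "0 \<le> T" using T by simp
    show "0 < B" by (rule B)
    show "(1 + 1 / \<epsilon>) * (2 * B)\<^sup>2 * T < B" by (rule small(2))
    show "J s \<le> (1 + 1 / \<epsilon>) * (2 * B)\<^sup>2" if "s \<in> {0..T}" "X s \<le> 2 * B" for s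
      using that by (rule Jle)
    show "t \<in> {0..T}" by (rule t)
  qed
  then show ?thesis by (simp add: X_def a_def l_def)
qed

text \<open>The estimate \<open>tangent_exp R a0 x \<le> a0 x exp (a0 x)\<close> makes the initial moment
  of size \<open>a0\<close>, while the production is quadratic in the moment and hence of size \<open>a0\<^sup>2\<close>, so that a small
  initial rate satisfies the smallness conditions for any given \<open>T\<close>.\<close>

theorem gaussian_propagation:
  assumes T: "0 < T" and a1: "0 < a1" and fin: "(\<integral>\<^sup>+x. ennreal (f 0 x * ((norm x)\<^sup>2 * gauss a1 x)) \<partial>lborel) < \<infinity>"
  shows "\<exists>a>0. \<exists>C\<ge>0. \<forall>t\<in>{0..T}. wint (gauss a) (f t) \<le> ennreal C"
proof -
  define I where "I = enn2real (\<integral>\<^sup>+x. ennreal (f 0 x * ((norm x)\<^sup>2 * gauss a1 x)) \<partial>lborel)"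
  define D where "D = 1 + I"
  have I0: "0 \<le> I" by (simp add: I_def)
  then have D: "0 < D" by (simp add: D_def)
  have i: "integrable lborel (\<lambda>x. f 0 x * ((norm x)\<^sup>2 * gauss a1 x))"
    using fin f_nonneg by (intro integrableI_bounded) (auto simp: abs_mult)
  have Ii: "(\<integral>x. f 0 x * ((norm x)\<^sup>2 * gauss a1 x) \<partial>lborel) = I"
    unfolding I_def using f_nonneg by (intro integral_eq_nn_integral) auto
  \<comment> \<open>With \<open>B = a0 D\<close> the first smallness condition fixes \<open>\<epsilon> = 1 / (4 D T)\<close>, and the second becomes \<open>4 a0 D T (1 + 4 D T) < 1\<close>.\<close>
  define a0 where "a0 = min a1 (1 / (8 * D * T * (1 + 4 * D * T)))"
  have pos: "0 < 8 * D * T * (1 + 4 * D * T)" using D T by (simp add: add_pos_pos)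
  have a0: "0 < a0" using a1 pos by (simp add: a0_def)
  define B where "B = a0 * D"
  have B: "0 < B" using a0 D by (simp add: B_def)
  define \<epsilon> where "\<epsilon> = 1 / (4 * D * T)"
  have \<epsilon>: "0 < \<epsilon>" using D T by (simp add: \<epsilon>_def)
  have s1: "2 * B * \<epsilon> \<le> a0 / (2 * T)" using D T by (simp add: B_def \<epsilon>_def field_simps)
  have s2: "(1 + 1 / \<epsilon>) * (2 * B)\<^sup>2 * T < B"
  proof -
    have "a0 * (8 * D * T * (1 + 4 * D * T)) \<le> 1 / (8 * D * T * (1 + 4 * D * T)) * (8 * D * T * (1 + 4 * D * T))"
      using pos by (intro mult_right_mono) (auto simp: a0_def)
    also have "\<dots> = 1" using pos by (metis less_irrefl nonzero_eq_divide_eq)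
    finally have "a0 * (4 * D * T * (1 + 4 * D * T)) \<le> 1 / 2" by simp
    then have "B * (a0 * (4 * D * T * (1 + 4 * D * T))) \<le> B * (1 / 2)" using B by (intro mult_left_mono) auto
    also have "\<dots> < B" using B by simp
    finally show ?thesis by (simp add: B_def \<epsilon>_def power2_eq_square algebra_simps)
  qed
  define a where "a = a0 / 2"
  have bound: "(\<integral>\<^sup>+x. ennreal (f t x * exp (a * min ((norm x)\<^sup>2) (real (Suc k)))) \<partial>lborel) \<le> ennreal (1 + 2 * B)"
    if t: "t \<in> {0..T}" for t k
  proof -
    define R where "R = real (Suc k)"
    have R: "0 < R" "0 \<le> R" by (simp_all add: R_def)
    have init: "(\<integral>x. tangent_exp R a0 ((norm x)\<^sup>2) * f 0 x \<partial>lborel) \<le> B"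
    proof -
      have "(\<integral>x. tangent_exp R a0 ((norm x)\<^sup>2) * f 0 x \<partial>lborel) \<le> (\<integral>x. a0 * (f 0 x * ((norm x)\<^sup>2 * gauss a1 x)) \<partial>lborel)"
      proof (rule integral_mono')
        fix x :: "real^'n"
        have "tangent_exp R a0 ((norm x)\<^sup>2) \<le> a0 * (norm x)\<^sup>2 * exp (a0 * (norm x)\<^sup>2)"
          using a0 R by (intro tangent_exp_le) auto
        also have "\<dots> \<le> a0 * (norm x)\<^sup>2 * gauss a1 x"
          using a0 by (intro mult_left_mono) (auto simp: a0_def intro!: mult_right_mono)
        finally have "tangent_exp R a0 ((norm x)\<^sup>2) * f 0 x \<le> a0 * (norm x)\<^sup>2 * gauss a1 x * f 0 x"
          using f_nonneg by (rule mult_right_mono)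
        then show "tangent_exp R a0 ((norm x)\<^sup>2) * f 0 x \<le> a0 * (f 0 x * ((norm x)\<^sup>2 * gauss a1 x))" by (simp add: ac_simps)
        show "0 \<le> a0 * (f 0 x * ((norm x)\<^sup>2 * gauss a1 x))" using a0 f_nonneg by simp
      qed (use i in simp)
      also have "\<dots> = a0 * I" by (simp add: Ii)
      also have "\<dots> \<le> B" using a0 I0 by (simp add: B_def D_def)
      finally show ?thesis .
    qed
    define as where "as = a0 - a0 / (2 * T) * t"
    have as: "a \<le> as" "0 \<le> as" "0 \<le> a"
    proof -
      have "a0 / (2 * T) * t \<le> a0 / (2 * T) * T" using t a0 T by (intro mult_left_mono) auto
      also have "\<dots> = a0 / 2" using T by simp
      finally show "a \<le> as" "0 \<le> as" "0 \<le> a" using a0 by (auto simp: as_def a_def)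
    qed
    have t0: "0 \<le> t" using t by simp
    have te_i: "integrable lborel (\<lambda>x. tangent_exp R as ((norm x)\<^sup>2) * f t x)"
    proof (rule f_weighted_integrable[OF t0, where C="as * exp (as * R)"])
      show "\<bar>tangent_exp R as ((norm x)\<^sup>2)\<bar> \<le> as * exp (as * R) * (1 + (norm x)\<^sup>2)" for x :: "real^'n"
        using tangent_exp_le(1)[OF as(2) R(2), of "(norm x)\<^sup>2"] tangent_exp_nonneg[OF as(2) R(2), of "(norm x)\<^sup>2"] as(2)
        by (simp add: distrib_left add_increasing)
    qed (simp add: tangent_exp_def)
    have i2: "integrable lborel (\<lambda>x. f t x + tangent_exp R as ((norm x)\<^sup>2) * f t x)"
      using te_i f_integrable(1)[OF t0] by simp
    have "(\<integral>\<^sup>+x. ennreal (f t x * exp (a * min ((norm x)\<^sup>2) R)) \<partial>lborel) \<le> (\<integral>\<^sup>+x. ennreal (f t x + tangent_exp R as ((norm x)\<^sup>2) * f t x) \<partial>lborel)"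
    proof (intro nn_integral_mono ennreal_leI)
      fix x :: "real^'n"
      have "exp (a * min ((norm x)\<^sup>2) R) \<le> exp (as * min ((norm x)\<^sup>2) R)"
        using as R by (auto intro!: mult_right_mono)
      also have "\<dots> \<le> 1 + tangent_exp R as ((norm x)\<^sup>2)"
        using capped_exp_le_tangent_exp[OF as(2), of R "(norm x)\<^sup>2"] by (simp add: capped_exp_def)
      finally have "f t x * exp (a * min ((norm x)\<^sup>2) R) \<le> f t x * (1 + tangent_exp R as ((norm x)\<^sup>2))"
        using f_nonneg by (rule mult_left_mono)
      then show "f t x * exp (a * min ((norm x)\<^sup>2) R) \<le> f t x + tangent_exp R as ((norm x)\<^sup>2) * f t x"
        by (simp add: algebra_simps)
    qed
    also have "\<dots> = ennreal (\<integral>x. f t x + tangent_exp R as ((norm x)\<^sup>2) * f t x \<partial>lborel)"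
      using i2 f_nonneg tangent_exp_nonneg[OF as(2) R(2)] by (intro nn_integral_eq_integral) auto
    also have "(\<integral>x. f t x + tangent_exp R as ((norm x)\<^sup>2) * f t x \<partial>lborel) = 1 + (\<integral>x. tangent_exp R as ((norm x)\<^sup>2) * f t x \<partial>lborel)"
      using te_i f_integrable(1)[OF t0] f_integral(1)[OF t0] by simp
    also have "ennreal \<dots> \<le> ennreal (1 + 2 * B)"
      using tangent_exp_moment_bound[OF T a0 B \<epsilon> R(1) s1 s2 init t] by (intro ennreal_leI) (simp add: as_def)
    finally show ?thesis by (simp add: R_def)
  qed
  have "wint (gauss a) (f t) \<le> ennreal (1 + 2 * B)" if t: "t \<in> {0..T}" for t
  proof -
    have a_nn: "0 \<le> a" using a0 by (simp add: a_def)
    have "wint (gauss a) (f t) \<le> (\<integral>\<^sup>+x. (SUP k. ennreal (f t x * exp (a * min ((norm x)\<^sup>2) (real (Suc k))))) \<partial>lborel)"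
      unfolding wint_def
    proof (intro nn_integral_mono)
      fix x :: "real^'n"
      obtain k where "(norm x)\<^sup>2 \<le> real k" using real_arch_simple by blast
      then have "(norm x)\<^sup>2 \<le> real (Suc k)" by simp
      then have "ennreal (\<bar>f t x\<bar> * gauss a x) = ennreal (f t x * exp (a * min ((norm x)\<^sup>2) (real (Suc k))))"
        using f_nonneg by (simp only: min_absorb1 abs_of_nonneg)
      then show "ennreal (\<bar>f t x\<bar> * gauss a x) \<le> (SUP k. ennreal (f t x * exp (a * min ((norm x)\<^sup>2) (real (Suc k)))))"
        by (metis SUP_upper UNIV_I)
    qed
    also have "\<dots> = (SUP k. \<integral>\<^sup>+x. ennreal (f t x * exp (a * min ((norm x)\<^sup>2) (real (Suc k)))) \<partial>lborel)"
    proof (rule nn_integral_monotone_convergence_SUP)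
      show "incseq (\<lambda>k x. ennreal (f t x * exp (a * min ((norm x)\<^sup>2) (real (Suc k)))))"
        unfolding incseq_def le_fun_def
        by (intro allI impI ennreal_leI mult_left_mono f_nonneg) (auto intro!: mult_left_mono a_nn)
    qed simp
    also have "\<dots> \<le> ennreal (1 + 2 * B)" using bound[OF t] by (intro SUP_least) auto
    finally show ?thesis .
  qed
  then show ?thesis using a0 B by (intro exI[of _ a] conjI exI[of _ "1 + 2 * B"]) (auto simp: a_def)
qed

end


section \<open>Finite differences\<close>

text \<open>A word over the letters \<open>(True, i)\<close> and \<open>(False, i)\<close> stands for a composition of difference
  quotients and translations with the common step \<open>r\<close> in the directions \<open>e i\<close>.  Translations are
  needed because they occur in the product rule for difference quotients.\<close>

fun fdiff :: "('i \<Rightarrow> 'b::real_vector) \<Rightarrow> real \<Rightarrow> (bool \<times> 'i) list \<Rightarrow> ('b \<Rightarrow> real) \<Rightarrow> 'b \<Rightarrow> real" where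
  "fdiff e r [] F = F"
| "fdiff e r ((d, i) # W) F = (\<lambda>x. if d then (fdiff e r W F (x + r *\<^sub>R e i) - fdiff e r W F x) / r
      else fdiff e r W F (x + r *\<^sub>R e i))"

text \<open>The pairs of words that occur when a word is distributed over a product; the discrete product rule
  \<open>D(f g) = (D f) (S g) + f (D g)\<close> contains the shift \<open>S\<close>.\<close>

fun splits :: "(bool \<times> 'i) list \<Rightarrow> ((bool \<times> 'i) list \<times> (bool \<times> 'i) list) list" where
  "splits [] = [([], [])]"
| "splits ((d, i) # W) = map (\<lambda>(A, B). ((d, i) # A, (False, i) # B)) (splits W) @
      (if d then map (\<lambda>(A, B). (A, (True, i) # B)) (splits W) else [])"

abbreviation word_order :: "(bool \<times> 'i) list \<Rightarrow> nat" where
  "word_order W \<equiv> length (filter fst W)"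

abbreviation unit_step :: "'n \<Rightarrow> real^'n::finite" where "unit_step i \<equiv> axis i 1"

text \<open>The collision operator commutes with translations of the velocity space, which act on pairs of
  velocities along the diagonal.\<close>

abbreviation diag_step :: "'n \<Rightarrow> (real^'n::finite) \<times> (real^'n)" where "diag_step i \<equiv> (axis i 1, axis i 1)"

lemma fdiff_leibniz:
  "fdiff diag_step r W (\<lambda>(x, y). f x * g y) (x, y) =
    (\<Sum>(A, B)\<leftarrow>splits W. fdiff unit_step r A f x * fdiff unit_step r B g y)"
proof (induction W arbitrary: x y)
  case (Cons l W)
  obtain d i where l: "l = (d, i)" by force
  define x' where "x' = x + r *\<^sub>R unit_step i"
  define y' where "y' = y + r *\<^sub>R unit_step i"
  have IH: "fdiff diag_step r W (\<lambda>(x, y). f x * g y) ((x, y) + r *\<^sub>R diag_step i) =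
     (\<Sum>(A, B)\<leftarrow>splits W. fdiff unit_step r A f x' * fdiff unit_step r B g y')"
    using Cons.IH[of x' y'] by (simp add: x'_def y'_def)
  show ?case
  proof (cases d)
    case True
    have "(\<Sum>(A, B)\<leftarrow>L. fdiff unit_step r A f x' * fdiff unit_step r B g y') - (\<Sum>(A, B)\<leftarrow>L. fdiff unit_step r A f x * fdiff unit_step r B g y)
      = (\<Sum>(A, B)\<leftarrow>L. (fdiff unit_step r A f x' - fdiff unit_step r A f x) * fdiff unit_step r B g y')
        + (\<Sum>(A, B)\<leftarrow>L. fdiff unit_step r A f x * (fdiff unit_step r B g y' - fdiff unit_step r B g y))" for L
      by (induction L) (auto simp: algebra_simps)
    moreover have "(\<Sum>(A, B)\<leftarrow>L. (fdiff unit_step r A f x' - fdiff unit_step r A f x) / r * fdiff unit_step r B g y')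
       = (\<Sum>(A, B)\<leftarrow>L. (fdiff unit_step r A f x' - fdiff unit_step r A f x) * fdiff unit_step r B g y') / r" for L
      by (induction L) (auto simp: add_divide_distrib)
    moreover have "(\<Sum>(A, B)\<leftarrow>L. fdiff unit_step r A f x * ((fdiff unit_step r B g y' - fdiff unit_step r B g y) / r))
       = (\<Sum>(A, B)\<leftarrow>L. fdiff unit_step r A f x * (fdiff unit_step r B g y' - fdiff unit_step r B g y)) / r" for L
      by (induction L) (auto simp: add_divide_distrib)
    ultimately show ?thesis
      using True IH Cons.IH[of x y] by (simp add: l comp_def split_def x'_def y'_def add_divide_distrib)
  next
    case False
    then show ?thesis using IH by (simp add: l comp_def split_def x'_def y'_def)
  qed
qed simp

lemma splits_order: "(A, B) \<in> set (splits W) \<Longrightarrow> word_order A + word_order B = word_order W"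
  by (induction W arbitrary: A B rule: splits.induct) (auto split: if_splits)

lemma splits_count:
  "(A, B) \<in> set (splits W) \<Longrightarrow> count_list A (True, i) + count_list B (True, i) = count_list W (True, i)"
  by (induction W arbitrary: A B rule: splits.induct) (auto split: if_splits)

lemma splits_left: "(A, B) \<in> set (splits W) \<Longrightarrow> word_order B = 0 \<Longrightarrow> A = W"
  by (induction W arbitrary: A B rule: splits.induct) (auto split: if_splits)

lemma splits_right: "(A, B) \<in> set (splits W) \<Longrightarrow> word_order A = 0 \<Longrightarrow> B = W"
proof (induction W arbitrary: A B rule: splits.induct)
  case (2 d i W)
  then show ?case by (cases d) auto
qed auto

lemma fdiff_measurable2:
  fixes F :: "real \<Rightarrow> 'b::euclidean_space \<Rightarrow> real"
  assumes F: "(\<lambda>(t, x). F t x) \<in> borel_measurable (borel \<Otimes>\<^sub>M borel)"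
  shows "(\<lambda>(t, x). fdiff e r W (F t) x) \<in> borel_measurable (borel \<Otimes>\<^sub>M borel)"
proof (induction W)
  case (Cons l W)
  obtain d i where l: "l = (d, i)" by force
  have [measurable]: "(\<lambda>(t, x). fdiff e r W (F t) (x + v)) \<in> borel_measurable (borel \<Otimes>\<^sub>M borel)" for v
  proof -
    have "(\<lambda>(t, x). (t, x + v)) \<in> (borel :: real measure) \<Otimes>\<^sub>M (borel :: 'b measure) \<rightarrow>\<^sub>M borel \<Otimes>\<^sub>M borel" by measurable
    from measurable_compose[OF this Cons.IH] show ?thesis by (simp add: split_def)
  qed
  note [measurable] = Cons.IH
  show ?case by (cases d) (simp_all add: l)
qed (use F in simp)

lemma fdiff_measurable:
  fixes F :: "'b::euclidean_space \<Rightarrow> real"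
  assumes F: "F \<in> borel_measurable borel"
  shows "fdiff e r W F \<in> borel_measurable borel"
proof (induction W)
  case (Cons l W)
  obtain d i where l: "l = (d, i)" by force
  note [measurable] = Cons.IH
  show ?case by (cases d) (simp_all add: l)
qed (use F in simp)

section \<open>Gaussian weights\<close>

lemma wint_mono: "(\<And>x. \<bar>f x\<bar> * w x \<le> \<bar>g x\<bar> * v x) \<Longrightarrow> wint w f \<le> wint v g"
  unfolding wint_def by (intro nn_integral_mono ennreal_leI)

lemma wint_gauss_mono: "a \<le> b \<Longrightarrow> wint (gauss a) f \<le> wint (gauss b) f"
  by (intro wint_mono mult_left_mono) (auto intro: mult_right_mono)

lemma wint_cmult:
  assumes "0 \<le> c" and [measurable]: "f \<in> borel_measurable borel" "w \<in> borel_measurable borel"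
  shows "wint (\<lambda>x. c * w x) f = ennreal c * wint w f"
proof -
  have "wint (\<lambda>x. c * w x) f = (\<integral>\<^sup>+x. ennreal c * ennreal (\<bar>f x\<bar> * w x) \<partial>lborel)"
    unfolding wint_def using assms(1) by (auto intro!: nn_integral_cong simp: ennreal_mult'[symmetric] ac_simps)
  then show ?thesis by (simp add: wint_def nn_integral_cmult)
qed

lemma gauss_shift_le:
  fixes x v :: "'a::real_inner"
  assumes "0 \<le> a"
  shows "gauss a x \<le> exp (2 * a * (norm v)\<^sup>2) * gauss (2 * a) (x + v)"
proof -
  have "norm x \<le> norm (x + v) + norm v" using norm_triangle_ineq4[of "x + v" v] by simp
  then have "(norm x)\<^sup>2 \<le> (norm (x + v) + norm v)\<^sup>2" by (intro power_mono) auto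
  also have "\<dots> \<le> 2 * (norm (x + v))\<^sup>2 + 2 * (norm v)\<^sup>2"
    using sum_squares_bound[of "norm (x + v)" "norm v"] by (simp add: power2_sum)
  finally have "a * (norm x)\<^sup>2 \<le> a * (2 * (norm (x + v))\<^sup>2 + 2 * (norm v)\<^sup>2)" using assms by (rule mult_left_mono)
  then show ?thesis by (simp add: exp_add[symmetric] algebra_simps)
qed

text \<open>Translations cost half of the Gaussian rate, with a constant uniform for bounded shifts.\<close>

lemma wint_gauss_shift:
  fixes F :: "'a::euclidean_space \<Rightarrow> real"
  assumes a: "0 \<le> a" and [measurable]: "F \<in> borel_measurable borel"
  shows "wint (gauss a) (\<lambda>x. F (x + v)) \<le> ennreal (exp (2 * a * (norm v)\<^sup>2)) * wint (gauss (2 * a)) F"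
proof -
  have "wint (gauss a) (\<lambda>x. F (x + v)) \<le> (\<integral>\<^sup>+x. ennreal (exp (2 * a * (norm v)\<^sup>2) * (\<bar>F (x + v)\<bar> * gauss (2 * a) (x + v))) \<partial>lborel)"
    unfolding wint_def
  proof (intro nn_integral_mono ennreal_leI)
    fix x
    show "\<bar>F (x + v)\<bar> * gauss a x \<le> exp (2 * a * (norm v)\<^sup>2) * (\<bar>F (x + v)\<bar> * gauss (2 * a) (x + v))"
      using mult_left_mono[OF gauss_shift_le[OF a, of x v], of "\<bar>F (x + v)\<bar>"] by (simp add: ac_simps)
  qed
  also have "\<dots> = (\<integral>\<^sup>+x. ennreal (exp (2 * a * (norm v)\<^sup>2) * (\<bar>F x\<bar> * gauss (2 * a) x)) \<partial>lborel)"
    by (rule nn_integral_lborel_shift) measurable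
  also have "\<dots> = ennreal (exp (2 * a * (norm v)\<^sup>2)) * wint (gauss (2 * a)) F"
    unfolding wint_def by (simp add: ennreal_mult nn_integral_cmult)
  finally show ?thesis .
qed

lemma wint_triangle:
  assumes [measurable]: "f \<in> borel_measurable borel" "g \<in> borel_measurable borel" "w \<in> borel_measurable borel"
    and w: "\<And>x. 0 \<le> w x" and r: "0 < r"
  shows "wint w (\<lambda>x. (f x - g x) / r) \<le> ennreal (1 / r) * (wint w f + wint w g)"
proof -
  have "wint w (\<lambda>x. (f x - g x) / r) \<le> (\<integral>\<^sup>+x. ennreal (1 / r) * (ennreal (\<bar>f x\<bar> * w x) + ennreal (\<bar>g x\<bar> * w x)) \<partial>lborel)"
    unfolding wint_def
  proof (intro nn_integral_mono)
    fix x
    have "\<bar>(f x - g x) / r\<bar> * w x \<le> 1 / r * (\<bar>f x\<bar> * w x + \<bar>g x\<bar> * w x)"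
      using r w[of x] abs_triangle_ineq4[of "f x" "g x"]
      by (simp add: field_simps) (metis distrib_left mult.commute mult_left_mono)
    then show "ennreal (\<bar>(f x - g x) / r\<bar> * w x) \<le> ennreal (1 / r) * (ennreal (\<bar>f x\<bar> * w x) + ennreal (\<bar>g x\<bar> * w x))"
      using r w[of x] by (simp add: ennreal_mult'[symmetric] ennreal_plus[symmetric] ennreal_leI del: ennreal_plus)
  qed
  also have "\<dots> = ennreal (1 / r) * (wint w f + wint w g)"
    unfolding wint_def by (simp add: nn_integral_cmult nn_integral_add)
  finally show ?thesis .
qed

lemma poly_gauss_le:
  assumes a: "0 < a"
  shows "(1 + (norm x)\<^sup>2) * gauss a x \<le> (1 + 1 / a) * gauss (2 * a) x"
proof -
  have "a * (norm x)\<^sup>2 \<le> gauss a x" using exp_ge_add_one_self[of "a * (norm x)\<^sup>2"] by linarith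
  then have "(norm x)\<^sup>2 \<le> 1 / a * gauss a x" using a by (simp add: field_simps)
  moreover have "1 \<le> gauss a x" using a by simp
  ultimately have "1 + (norm x)\<^sup>2 \<le> (1 + 1 / a) * gauss a x" unfolding distrib_right by linarith
  then have "(1 + (norm x)\<^sup>2) * gauss a x \<le> ((1 + 1 / a) * gauss a x) * gauss a x" by (intro mult_right_mono) auto
  also have "\<dots> = (1 + 1 / a) * gauss (2 * a) x" by (simp add: exp_add[symmetric] algebra_simps)
  finally show ?thesis .
qed

text \<open>The constant degenerates as \<open>r \<rightarrow> 0\<close>; the lemma only provides the finiteness needed for absorbing
  damped terms.\<close>

lemma fdiff_gauss_fixed_step:
  fixes e :: "'i \<Rightarrow> 'b::euclidean_space"
  assumes r: "0 < r" and a: "0 \<le> a"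
    and Fm: "\<And>t. t \<in> I \<Longrightarrow> F t \<in> borel_measurable borel"
    and F: "\<And>t. t \<in> I \<Longrightarrow> wint (gauss (2 ^ length W * a)) (F t) \<le> ennreal C"
  shows "\<exists>C'. \<forall>t\<in>I. wint (gauss a) (fdiff e r W (F t)) \<le> ennreal C'"
  using a F
proof (induction W arbitrary: a)
  case (Cons l W)
  obtain d i where l: "l = (d, i)" by force
  have "\<exists>C'. \<forall>t\<in>I. wint (gauss (2 * a)) (fdiff e r W (F t)) \<le> ennreal C'"
    using Cons.prems by (intro Cons.IH) (auto simp: ac_simps)
  then obtain C1 where C1: "\<And>t. t \<in> I \<Longrightarrow> wint (gauss (2 * a)) (fdiff e r W (F t)) \<le> ennreal C1" by blast
  define k where "k = exp (2 * a * (norm (r *\<^sub>R e i))\<^sup>2)"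
  have sh: "wint (gauss a) (\<lambda>x. fdiff e r W (F t) (x + r *\<^sub>R e i)) \<le> ennreal (k * \<bar>C1\<bar>)" if "t \<in> I" for t
  proof -
    have "wint (gauss a) (\<lambda>x. fdiff e r W (F t) (x + r *\<^sub>R e i)) \<le> ennreal k * wint (gauss (2 * a)) (fdiff e r W (F t))"
      unfolding k_def by (intro wint_gauss_shift fdiff_measurable Fm that Cons.prems)
    also have "\<dots> \<le> ennreal k * ennreal \<bar>C1\<bar>"
      using C1[OF that] by (intro mult_left_mono) (auto intro: order_trans ennreal_leI)
    finally show ?thesis by (simp add: ennreal_mult k_def)
  qed
  have un: "wint (gauss a) (fdiff e r W (F t)) \<le> ennreal \<bar>C1\<bar>" if "t \<in> I" for t
    using order_trans[OF wint_gauss_mono C1[OF that], of a] Cons.prems(1) by (auto intro: order_trans ennreal_leI)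
  show ?case
  proof (cases d)
    case True
    have "wint (gauss a) (fdiff e r (l # W) (F t)) \<le> ennreal (1 / r * (k * \<bar>C1\<bar> + \<bar>C1\<bar>))" if "t \<in> I" for t
    proof -
      have m: "fdiff e r W (F t) \<in> borel_measurable borel" by (intro fdiff_measurable Fm that)
      then have m': "(\<lambda>x. fdiff e r W (F t) (x + r *\<^sub>R e i)) \<in> borel_measurable borel" by measurable
      have "wint (gauss a) (fdiff e r (l # W) (F t)) = wint (gauss a) (\<lambda>x. (fdiff e r W (F t) (x + r *\<^sub>R e i) - fdiff e r W (F t) x) / r)"
        using True by (simp add: l)
      also have "\<dots> \<le> ennreal (1 / r) * (wint (gauss a) (\<lambda>x. fdiff e r W (F t) (x + r *\<^sub>R e i)) + wint (gauss a) (fdiff e r W (F t)))"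
        using m m' r by (intro wint_triangle) auto
      also have "\<dots> \<le> ennreal (1 / r) * (ennreal (k * \<bar>C1\<bar>) + ennreal \<bar>C1\<bar>)"
        by (intro mult_left_mono add_mono sh un that) auto
      also have "\<dots> = ennreal (1 / r * (k * \<bar>C1\<bar> + \<bar>C1\<bar>))"
        using r by (simp add: k_def ennreal_mult'[symmetric] ennreal_plus[symmetric] del: ennreal_plus)
      finally show ?thesis .
    qed
    then show ?thesis by blast
  next
    case False
    then show ?thesis using sh by (auto simp: l)
  qed
qed auto

section \<open>Evolution of weighted integrals\<close>

definition evolves :: "(real \<Rightarrow> 'b::euclidean_space \<Rightarrow> real) \<Rightarrow> (real \<Rightarrow> 'b \<Rightarrow> real) \<Rightarrow> bool" where
  "evolves G Q \<longleftrightarrow> (\<lambda>(t, x). G t x) \<in> borel_measurable (borel \<Otimes>\<^sub>M borel) \<and>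
     (\<lambda>(t, x). Q t x) \<in> borel_measurable (borel \<Otimes>\<^sub>M borel) \<and>
     (\<forall>t\<ge>0. AE x in lborel. set_integrable lborel {0..t} (\<lambda>s. Q s x) \<and> G t x = G 0 x + (LINT s:{0..t}|lborel. Q s x))"

text \<open>Null sets are translation invariant, so the pointwise equations may be combined at the finitely many
  translates that a word involves.\<close>

lemma evolves_fdiff:
  assumes "evolves G Q"
  shows "evolves (\<lambda>t. fdiff e r W (G t)) (\<lambda>t. fdiff e r W (Q t))"
proof -
  have "AE x in lborel. set_integrable lborel {0..t} (\<lambda>s. fdiff e r W (Q s) x) \<and>
      fdiff e r W (G t) x = fdiff e r W (G 0) x + (LINT s:{0..t}|lborel. fdiff e r W (Q s) x)" if "0 \<le> t" for t
  proof (induction W)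
    case Nil
    then show ?case using assms that by (simp add: evolves_def)
  next
    case (Cons l W)
    obtain d i where l: "l = (d, i)" by force
    show ?case using Cons.IH AE_lborel_shift[OF Cons.IH, of "r *\<^sub>R e i"]
      by eventually_elim (auto simp: l set_integral_diff diff_divide_distrib set_integral_divide_zero add_divide_distrib intro!: set_integrable_divide)
  qed
  then show ?thesis using assms fdiff_measurable2[of G e r W] fdiff_measurable2[of Q e r W] by (simp add: evolves_def)
qed

text \<open>A weight that decreases in time produces a damping term on the left.\<close>

lemma evolves_weighted:
  fixes G Q :: "real \<Rightarrow> 'b::euclidean_space \<Rightarrow> real" and \<rho> :: "'b \<Rightarrow> real"
  assumes ev: "evolves G Q" and t: "0 \<le> t" and \<rho>: "\<And>x. 0 \<le> \<rho> x" and [measurable]: "\<rho> \<in> borel_measurable borel" "w0 \<in> borel_measurable borel"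
    and w0: "\<And>x. 0 \<le> w0 x"
  defines "w \<equiv> \<lambda>s x. w0 x * exp (- s * \<rho> x)"
  shows "wint (w t) (G t) + (\<integral>\<^sup>+s. indicator {0..t} s * wint (\<lambda>x. \<rho> x * w s x) (G s) \<partial>lborel) \<le>
    wint w0 (G 0) + (\<integral>\<^sup>+s. indicator {0..t} s * wint (w s) (Q s) \<partial>lborel)"
proof -
  have Gm[measurable]: "(\<lambda>(t, x). G t x) \<in> borel_measurable (borel \<Otimes>\<^sub>M borel)"
    and Qm[measurable]: "(\<lambda>(t, x). Q t x) \<in> borel_measurable (borel \<Otimes>\<^sub>M borel)" using ev by (auto simp: evolves_def)
  have wm[measurable]: "(\<lambda>(s, x). w s x) \<in> borel_measurable (borel \<Otimes>\<^sub>M borel)" unfolding w_def by measurable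
  have [measurable]: "G s \<in> borel_measurable borel" "Q s \<in> borel_measurable borel" "w s \<in> borel_measurable borel"
    "(\<lambda>s. Q s x) \<in> borel_measurable borel" "(\<lambda>s. w s x) \<in> borel_measurable borel" for s x
    using measurable_compose[OF measurable_Pair1' Gm, of s] measurable_compose[OF measurable_Pair1' Qm, of s]
      measurable_compose[OF measurable_Pair1' wm, of s] measurable_compose[OF measurable_Pair2' Qm, of x]
      measurable_compose[OF measurable_Pair2' wm, of x] by simp_all
  have w_nn: "0 \<le> w s x" for s x by (simp add: w_def w0)
  have w_00: "w 0 x = w0 x" for x by (simp add: w_def)
  define R where "R s x = \<bar>G 0 x\<bar> + (LINT r:{0..s}|lborel. \<bar>Q r x\<bar>)" for s x
  have R0: "0 \<le> R s x" for s x unfolding R_def set_lebesgue_integral_def by (auto intro!: add_nonneg_nonneg integral_nonneg_AE)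
  have Rm[measurable]: "(\<lambda>(s, x). R s x) \<in> borel_measurable (borel \<Otimes>\<^sub>M borel)"
  proof -
    have "(\<lambda>(s, x). \<bar>G 0 x\<bar> + (LINT r|lborel. (if 0 \<le> r \<and> r \<le> s then 1 else 0) * \<bar>Q r x\<bar>)) \<in> borel_measurable ((borel :: real measure) \<Otimes>\<^sub>M borel)"
      by measurable
    moreover have "(\<lambda>(s, x). \<bar>G 0 x\<bar> + (LINT r|lborel. (if 0 \<le> r \<and> r \<le> s then 1 else 0) * \<bar>Q r x\<bar>)) = (\<lambda>(s, x). R s x)"
      by (auto simp: fun_eq_iff R_def set_lebesgue_integral_def intro!: Bochner_Integration.integral_cong split: split_indicator)
    ultimately show ?thesis by simp
  qed
  have [measurable]: "R s \<in> borel_measurable borel" "(\<lambda>s. R s x) \<in> borel_measurable borel" for s x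
    using measurable_compose[OF measurable_Pair1' Rm, of s] measurable_compose[OF measurable_Pair2' Rm, of x] by simp_all
  have GR: "AE x in lborel. \<bar>G s x\<bar> \<le> R s x" if "0 \<le> s" for s
  proof -
    have "AE x in lborel. set_integrable lborel {0..s} (\<lambda>s. Q s x) \<and> G s x = G 0 x + (LINT s:{0..s}|lborel. Q s x)"
      using ev that by (simp add: evolves_def)
    then show ?thesis
    proof eventually_elim
      case (elim x)
      have "\<bar>LINT r:{0..s}|lborel. Q r x\<bar> \<le> (LINT r:{0..s}|lborel. \<bar>Q r x\<bar>)"
        using set_integral_norm_bound[OF conjunct1[OF elim]] by simp
      then show ?case using elim by (simp add: R_def)
    qed
  qed
  have point: "AE x in lborel. ennreal (R t x * w t x) + (\<integral>\<^sup>+s. ennreal (indicator {0..t} s * (R s x * (\<rho> x * w s x))) \<partial>lborel) =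
     ennreal (\<bar>G 0 x\<bar> * w0 x) + (\<integral>\<^sup>+s. ennreal (indicator {0..t} s * (\<bar>Q s x\<bar> * w s x)) \<partial>lborel)"
  proof -
    have "AE x in lborel. set_integrable lborel {0..t} (\<lambda>s. Q s x) \<and> G t x = G 0 x + (LINT s:{0..t}|lborel. Q s x)"
      using ev t by (simp add: evolves_def)
    then show ?thesis
    proof eventually_elim
      case (elim x)
      have Qi: "set_integrable lborel {0..t} (\<lambda>s. \<bar>Q s x\<bar>)"
        using elim set_integrable_abs by blast
      have d: "((\<lambda>s. w s x) has_real_derivative - \<rho> x * w s x) (at s)" for s
        unfolding w_def by (auto intro!: derivative_eq_intros)
      have c: "isCont (\<lambda>s. - \<rho> x * w s x) s" for s
        unfolding w_def by (intro continuous_intros)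
      have m: "(\<lambda>s. - \<rho> x * w s x) \<in> borel_measurable borel" "(\<lambda>s. w s x) \<in> borel_measurable borel" by measurable
      note P = weighted_integral_by_parts(1)[OF t Qi d c m] weighted_integral_by_parts(2,3)[where init="\<bar>G 0 x\<bar>", OF t Qi d c m]
      have i1: "integrable lborel (\<lambda>s. indicator {0..t} s * (\<bar>Q s x\<bar> * w s x))"
        using P(1) by (simp add: set_integrable_def ac_simps)
      have i2: "integrable lborel (\<lambda>s. indicator {0..t} s * (R s x * (\<rho> x * w s x)))"
        using P(2)[unfolded set_integrable_def, THEN integrable_minus] by (simp add: R_def ac_simps)
      have "(LINT s:{0..t}|lborel. - \<rho> x * w s x * (\<bar>G 0 x\<bar> + (LINT r:{0..s}|lborel. \<bar>Q r x\<bar>))) =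
          - (LINT s|lborel. indicator {0..t} s * (R s x * (\<rho> x * w s x)))"
        unfolding set_lebesgue_integral_def[of lborel "{0..t}"] R_def
        by (subst Bochner_Integration.integral_minus[symmetric]) (auto intro!: Bochner_Integration.integral_cong)
      moreover have "(LINT s:{0..t}|lborel. w s x * \<bar>Q s x\<bar>) = (LINT s|lborel. indicator {0..t} s * (\<bar>Q s x\<bar> * w s x))"
        unfolding set_lebesgue_integral_def by (auto intro!: Bochner_Integration.integral_cong)
      ultimately have "R t x * w t x + (LINT s|lborel. indicator {0..t} s * (R s x * (\<rho> x * w s x))) =
          \<bar>G 0 x\<bar> * w0 x + (LINT s|lborel. indicator {0..t} s * (\<bar>Q s x\<bar> * w s x))"
        using P(3) w_00 by (simp add: R_def[of t] mult.commute)
      then show ?case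
        using i1 i2 R0 w_nn \<rho> w0
        by (simp add: nn_integral_eq_integral ennreal_plus[symmetric] integral_nonneg_AE del: ennreal_plus)
    qed
  qed
  have tonelli: "(\<integral>\<^sup>+x. \<integral>\<^sup>+s. ennreal (indicator {0..t} s * (k s x)) \<partial>lborel \<partial>lborel) = (\<integral>\<^sup>+s. indicator {0..t} s * (\<integral>\<^sup>+x. ennreal (k s x) \<partial>lborel) \<partial>lborel)"
    if [measurable]: "(\<lambda>(s, x). k s x) \<in> borel_measurable (borel \<Otimes>\<^sub>M borel)" for k :: "real \<Rightarrow> 'b \<Rightarrow> real"
  proof -
    have "(\<integral>\<^sup>+x. \<integral>\<^sup>+s. ennreal (indicator {0..t} s * (k s x)) \<partial>lborel \<partial>lborel) = (\<integral>\<^sup>+s. \<integral>\<^sup>+x. ennreal (indicator {0..t} s * (k s x)) \<partial>lborel \<partial>lborel)"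
      by (rule lborel_pair.Fubini') measurable
    also have "\<dots> = (\<integral>\<^sup>+s. indicator {0..t} s * (\<integral>\<^sup>+x. ennreal (k s x) \<partial>lborel) \<partial>lborel)"
      by (intro nn_integral_cong) (auto split: split_indicator)
    finally show ?thesis .
  qed
  have "wint (w t) (G t) + (\<integral>\<^sup>+s. indicator {0..t} s * wint (\<lambda>x. \<rho> x * w s x) (G s) \<partial>lborel) \<le>
     (\<integral>\<^sup>+x. ennreal (R t x * w t x) \<partial>lborel) + (\<integral>\<^sup>+s. indicator {0..t} s * (\<integral>\<^sup>+x. ennreal (R s x * (\<rho> x * w s x)) \<partial>lborel) \<partial>lborel)"
  proof (intro add_mono nn_integral_mono)
    show "wint (w t) (G t) \<le> (\<integral>\<^sup>+x. ennreal (R t x * w t x) \<partial>lborel)"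
      unfolding wint_def using GR[OF t] by (intro nn_integral_mono_AE) (auto elim!: eventually_mono intro!: ennreal_leI mult_right_mono w_nn)
    show "indicator {0..t} s * wint (\<lambda>x. \<rho> x * w s x) (G s) \<le> indicator {0..t} s * (\<integral>\<^sup>+x. ennreal (R s x * (\<rho> x * w s x)) \<partial>lborel)" for s
    proof (cases "s \<in> {0..t}")
      case True
      then have "AE x in lborel. \<bar>G s x\<bar> \<le> R s x" by (intro GR) auto
      then have "wint (\<lambda>x. \<rho> x * w s x) (G s) \<le> (\<integral>\<^sup>+x. ennreal (R s x * (\<rho> x * w s x)) \<partial>lborel)"
        unfolding wint_def by (intro nn_integral_mono_AE) (auto elim!: eventually_mono intro!: ennreal_leI mult_right_mono mult_nonneg_nonneg w_nn \<rho>)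
      then show ?thesis by (rule mult_left_mono) simp
    qed simp
  qed
  also have "\<dots> = (\<integral>\<^sup>+x. ennreal (R t x * w t x) \<partial>lborel) + (\<integral>\<^sup>+x. \<integral>\<^sup>+s. ennreal (indicator {0..t} s * (R s x * (\<rho> x * w s x))) \<partial>lborel \<partial>lborel)"
    by (subst tonelli) auto
  also have "\<dots> = (\<integral>\<^sup>+x. ennreal (R t x * w t x) + (\<integral>\<^sup>+s. ennreal (indicator {0..t} s * (R s x * (\<rho> x * w s x))) \<partial>lborel) \<partial>lborel)"
    by (rule nn_integral_add[symmetric]) measurable
  also have "\<dots> = (\<integral>\<^sup>+x. ennreal (\<bar>G 0 x\<bar> * w0 x) + (\<integral>\<^sup>+s. ennreal (indicator {0..t} s * (\<bar>Q s x\<bar> * w s x)) \<partial>lborel) \<partial>lborel)"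
    by (rule nn_integral_cong_AE[OF point])
  also have "\<dots> = (\<integral>\<^sup>+x. ennreal (\<bar>G 0 x\<bar> * w0 x) \<partial>lborel) + (\<integral>\<^sup>+x. \<integral>\<^sup>+s. ennreal (indicator {0..t} s * (\<bar>Q s x\<bar> * w s x)) \<partial>lborel \<partial>lborel)"
    by (rule nn_integral_add) measurable
  also have "\<dots> = wint w0 (G 0) + (\<integral>\<^sup>+s. indicator {0..t} s * wint (w s) (Q s) \<partial>lborel)"
    by (subst tonelli) (auto simp: wint_def)
  finally show ?thesis .
qed


section \<open>Propagation of Gaussian moments of finite differences\<close>

context boltzmann_flow begin

abbreviation fd :: "real \<Rightarrow> (bool \<times> 'n) list \<Rightarrow> real \<Rightarrow> real^'n \<Rightarrow> real" where
  "fd r W t \<equiv> fdiff unit_step r W (f t)"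

text \<open>The rate and the constant are uniform in the step \<open>r\<close>, which is what survives the limit \<open>r \<rightarrow> 0\<close>.\<close>

definition bounded_differences :: "real \<Rightarrow> (bool \<times> 'n) list \<Rightarrow> bool" where
  "bounded_differences T W \<longleftrightarrow> (\<exists>a>0. \<exists>C\<ge>0. \<forall>r\<in>{0<..1}. \<forall>t\<in>{0..T}. wint (gauss a) (fd r W t) \<le> ennreal C)"

lemma fd_measurable [measurable]: "fd r W t \<in> borel_measurable borel"
  by (rule fdiff_measurable[OF f_meas])

lemma evolves_f: "evolves f q"
  using f_eq by (simp add: evolves_def f_meas2 q_meas2)

lemma represents_fdiff:
  assumes "represents p H"
  shows "represents (fdiff unit_step r W p) (fdiff diag_step r W H)"
proof (induction W)
  case (Cons l W)
  obtain d i where l: "l = (d, i)" by force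
  have "represents (\<lambda>x. fdiff unit_step r W p (x + r *\<^sub>R unit_step i)) (\<lambda>z. fdiff diag_step r W H (z + r *\<^sub>R diag_step i))"
    using represents_shift[OF Cons.IH, of "r *\<^sub>R unit_step i"] by simp
  then show ?case using represents_diff[OF _ Cons.IH] by (cases d) (simp_all add: l)
qed (use assms in simp)

text \<open>All terms of the product rule in which both factors are of lower order are controlled by
  known quantities; the remaining terms contain \<open>fd r W\<close> once.\<close>

lemma wint_fdiff_collision:
  assumes s: "0 \<le> s" and a: "0 \<le> a" and C: "1 \<le> C" and ord: "0 < word_order W"
    and low: "\<And>A. A \<in> fst ` set (splits W) \<union> snd ` set (splits W) \<Longrightarrow> word_order A < word_order W \<Longrightarrow>
       wint (gauss a) (fd r A s) \<le> ennreal C \<and> wint (\<lambda>x. norm x powr \<alpha> * gauss a x) (fd r A s) \<le> ennreal C"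
  defines "L \<equiv> 4 * real (length (splits W)) * C\<^sup>2"
  shows "wint (gauss a) (fdiff unit_step r W (q s)) \<le>
    ennreal L * (wint (\<lambda>x. norm x powr \<alpha> * gauss a x) (fd r W s) + wint (gauss a) (fd r W s)) + ennreal L"
proof -
  define H where "H = fdiff diag_step r W (\<lambda>(x, y). f s x * f s y)"
  have rep: "represents (fdiff unit_step r W (q s)) H"
    unfolding H_def by (rule represents_fdiff[OF represents_q[OF s]])
  then have Hm: "H \<in> borel_measurable borel" by (simp add: represents_def)
  define ps where "ps = map (\<lambda>(A, B). (fd r A s, fd r B s)) (splits W)"
  define Na where "Na A = wint (\<lambda>x. norm x powr \<alpha> * gauss a x) (fd r A s)" for A
  define N0 where "N0 A = wint (gauss a) (fd r A s)" for A
  define Z where "Z = Na W + N0 W"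
  have bound: "\<bar>H (x, y)\<bar> \<le> (\<Sum>p\<leftarrow>ps. \<bar>fst p x\<bar> * \<bar>snd p y\<bar>)" for x y
  proof -
    have "\<bar>\<Sum>(A, B)\<leftarrow>L. fd r A s x * fd r B s y\<bar> \<le> (\<Sum>(A, B)\<leftarrow>L. \<bar>fd r A s x\<bar> * \<bar>fd r B s y\<bar>)" for L
      by (induction L) (auto simp: abs_mult[symmetric] intro: order_trans[OF abs_triangle_ineq])
    then show ?thesis unfolding H_def fdiff_leibniz ps_def by (simp add: comp_def split_def)
  qed
  have "wint (gauss a) (fdiff unit_step r W (q s)) \<le> (\<integral>\<^sup>+x. coll_abs H x * gauss a x \<partial>lborel)"
    unfolding wint_def
  proof (rule nn_integral_mono_AE)
    have "AE x in lborel. fdiff unit_step r W (q s) x = coll H x" using rep by (simp add: represents_def)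
    then show "AE x in lborel. ennreal (\<bar>fdiff unit_step r W (q s) x\<bar> * gauss a x) \<le> coll_abs H x * ennreal (gauss a x)"
      by (rule eventually_mono) (simp add: ennreal_mult mult_right_mono abs_coll_le[OF Hm])
  qed
  also have "\<dots> \<le> 2 * (\<Sum>p\<leftarrow>ps. wint (\<lambda>x. norm x powr \<alpha> * gauss a x) (fst p) * wint (gauss a) (snd p) +
              wint (gauss a) (fst p) * wint (\<lambda>x. norm x powr \<alpha> * gauss a x) (snd p))"
    by (rule gauss_coll_le[OF Hm a _ bound]) (auto simp: ps_def)
  also have "\<dots> = 2 * (\<Sum>(A, B)\<leftarrow>splits W. Na A * N0 B + N0 A * Na B)"
    by (simp add: ps_def comp_def split_def Na_def N0_def)
  also have "\<dots> \<le> 2 * (\<Sum>(A, B)\<leftarrow>splits W. ennreal (2 * C\<^sup>2) * Z + ennreal (2 * C\<^sup>2))"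
  proof (intro mult_left_mono sum_list_mono)
    fix p assume p: "p \<in> set (splits W)"
    obtain A B where AB: "p = (A, B)" by force
    have o: "word_order A + word_order B = word_order W" using splits_order p AB by blast
    have lA: "N0 A \<le> ennreal C \<and> Na A \<le> ennreal C" if "word_order A < word_order W"
      unfolding N0_def Na_def using low[of A] that p AB by force
    have lB: "N0 B \<le> ennreal C \<and> Na B \<le> ennreal C" if "word_order B < word_order W"
      unfolding N0_def Na_def using low[of B] that p AB by force
    have CC: "ennreal C \<le> ennreal (2 * C\<^sup>2)"
    proof (rule ennreal_leI)
      have "C * 1 \<le> C * C" using C by (intro mult_left_mono) auto
      then show "C \<le> 2 * C\<^sup>2" using C unfolding power2_eq_square by linarith
    qed
    have CC2: "ennreal C * ennreal C + ennreal C * ennreal C \<le> ennreal (2 * C\<^sup>2)"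
      using C by (simp add: ennreal_mult[symmetric] ennreal_plus[symmetric] power2_eq_square del: ennreal_plus)
    consider "word_order A = 0" | "word_order B = 0" | "word_order A < word_order W" "word_order B < word_order W"
      using o by linarith
    then have "Na A * N0 B + N0 A * Na B \<le> ennreal (2 * C\<^sup>2) * Z + ennreal (2 * C\<^sup>2)"
    proof cases
      case 1
      then have B: "B = W" using splits_right p AB by blast
      have "Na A * N0 B + N0 A * Na B \<le> ennreal C * N0 W + ennreal C * Na W"
        unfolding B using lA 1 ord by (intro add_mono mult_right_mono) auto
      also have "\<dots> = ennreal C * Z" by (simp add: Z_def distrib_left add.commute)
      also have "\<dots> \<le> ennreal (2 * C\<^sup>2) * Z" by (intro mult_right_mono CC) auto
      finally show ?thesis by (rule order_trans) simp
    next
      case 2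
      then have A: "A = W" using splits_left p AB by blast
      have "Na A * N0 B + N0 A * Na B \<le> Na W * ennreal C + N0 W * ennreal C"
        unfolding A using lB 2 ord by (intro add_mono mult_left_mono) auto
      also have "\<dots> = ennreal C * Z" by (simp add: Z_def distrib_left mult.commute)
      also have "\<dots> \<le> ennreal (2 * C\<^sup>2) * Z" by (intro mult_right_mono CC) auto
      finally show ?thesis by (rule order_trans) simp
    next
      case 3
      then have "Na A * N0 B + N0 A * Na B \<le> ennreal C * ennreal C + ennreal C * ennreal C"
        using lA lB by (intro add_mono mult_mono) auto
      also note CC2
      finally show ?thesis by (rule order_trans) simp
    qed
    then show "(case p of (A, B) \<Rightarrow> Na A * N0 B + N0 A * Na B) \<le> (case p of (A, B) \<Rightarrow> ennreal (2 * C\<^sup>2) * Z + ennreal (2 * C\<^sup>2))"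
      by (simp add: AB)
  qed simp
  also have "\<dots> = ennreal L * Z + ennreal L"
  proof -
    have 1: "(\<Sum>(A, B)\<leftarrow>l. k) = of_nat (length l) * k" for k :: ennreal and l :: "((bool \<times> 'n) list \<times> (bool \<times> 'n) list) list"
      by (induction l) (auto simp: distrib_right)
    have 2: "2 * (of_nat m * ennreal (2 * C\<^sup>2)) = ennreal (4 * real m * C\<^sup>2)" for m
    proof -
      have "2 * (of_nat m * ennreal (2 * C\<^sup>2)) = ennreal 2 * (ennreal (real m) * ennreal (2 * C\<^sup>2))"
        by (simp add: ennreal_of_nat_eq_real_of_nat)
      also have "\<dots> = ennreal (2 * (real m * (2 * C\<^sup>2)))"
        by (subst ennreal_mult[symmetric], simp, simp, subst ennreal_mult[symmetric]) simp_all
      finally show ?thesis by (simp add: ac_simps)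
    qed
    show ?thesis unfolding 1 L_def 2[symmetric] by (simp add: distrib_left mult.assoc)
  qed
  finally show ?thesis by (simp add: Z_def Na_def N0_def)
qed

lemma bounded_differences_order_0:
  assumes f: "\<exists>a>0. \<exists>C\<ge>0. \<forall>t\<in>{0..T}. wint (gauss a) (f t) \<le> ennreal C" and "word_order W = 0"
  shows "bounded_differences T W"
  using assms(2)
proof (induction W)
  case Nil
  then show ?case using f by (auto simp: bounded_differences_def)
next
  case (Cons l W)
  obtain d i where l: "l = (d, i)" by force
  have d: "\<not> d" using Cons.prems by (auto simp: l split: if_splits)
  have "bounded_differences T W" using Cons by (auto simp: l split: if_splits)
  then obtain a C where a: "0 < a" and C: "0 \<le> C" and
    b: "\<And>r t. r \<in> {0<..1} \<Longrightarrow> t \<in> {0..T} \<Longrightarrow> wint (gauss a) (fd r W t) \<le> ennreal C"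
    by (auto simp: bounded_differences_def)
  have "wint (gauss (a / 2)) (fd r (l # W) t) \<le> ennreal (exp a * C)" if r: "r \<in> {0<..1}" and t: "t \<in> {0..T}" for r t
  proof -
    have "wint (gauss (a / 2)) (\<lambda>x. fd r W t (x + r *\<^sub>R unit_step i)) \<le>
        ennreal (exp (2 * (a / 2) * (norm (r *\<^sub>R (unit_step i :: real^'n)))\<^sup>2)) * wint (gauss (2 * (a / 2))) (fd r W t)"
      using a by (intro wint_gauss_shift) auto
    also have "\<dots> \<le> ennreal (exp a) * ennreal C"
    proof (intro mult_mono ennreal_leI)
      have "r\<^sup>2 \<le> 1" using r by (simp add: power_le_one)
      then show "exp (2 * (a / 2) * (norm (r *\<^sub>R (unit_step i :: real^'n)))\<^sup>2) \<le> exp a"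
        using a by (simp add: norm_axis_1)
    qed (use b[OF r t] in auto)
    finally show ?thesis using d C by (simp add: l ennreal_mult)
  qed
  then show ?case unfolding bounded_differences_def using a C
    by (intro exI[of _ "a / 2"] conjI exI[of _ "exp a * C"]) auto
qed

text \<open>Finitely many Gaussian rates have a positive minimum.\<close>

lemma uniform_gauss_bound:
  assumes "finite Ls" "\<And>A. A \<in> Ls \<Longrightarrow> \<exists>a>0. \<exists>C\<ge>0. \<forall>z\<in>Z. wint (gauss a) (F A z) \<le> ennreal C"
  shows "\<exists>a>0. \<exists>C\<ge>0. \<forall>A\<in>Ls. \<forall>z\<in>Z. wint (gauss a) (F A z) \<le> ennreal C"
  using assms
proof (induction Ls rule: finite_induct)
  case empty
  then show ?case by (intro exI[of _ 1]) auto
next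
  case (insert A Ls)
  then obtain a C where a: "0 < a" "0 \<le> C" "\<And>B z. B \<in> Ls \<Longrightarrow> z \<in> Z \<Longrightarrow> wint (gauss a) (F B z) \<le> ennreal C" by force
  obtain a' C' where a': "0 < a'" "0 \<le> C'" "\<And>z. z \<in> Z \<Longrightarrow> wint (gauss a') (F A z) \<le> ennreal C'"
    using insert.prems[of A] by auto
  have "wint (gauss (min a a')) (F B z) \<le> ennreal (max C C')" if "B \<in> insert A Ls" "z \<in> Z" for B z
  proof (cases "B = A")
    case True
    have "wint (gauss (min a a')) (F A z) \<le> wint (gauss a') (F A z)" by (rule wint_gauss_mono) simp
    also have "\<dots> \<le> ennreal C'" by (rule a'(3)[OF that(2)])
    also have "\<dots> \<le> ennreal (max C C')" by (rule ennreal_leI) simp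
    finally show ?thesis using True by simp
  next
    case False
    then have "B \<in> Ls" using that by simp
    have "wint (gauss (min a a')) (F B z) \<le> wint (gauss a) (F B z)" by (rule wint_gauss_mono) simp
    also have "\<dots> \<le> ennreal C" by (rule a(3)[OF \<open>B \<in> Ls\<close> that(2)])
    also have "\<dots> \<le> ennreal (max C C')" by (rule ennreal_leI) simp
    finally show ?thesis .
  qed
  then show ?case using a a' by (intro exI[of _ "min a a'"] conjI exI[of _ "max C C'"]) auto
qed

text \<open>In the product rule the word \<open>W\<close> itself occurs in at most one factor of each term, so the production
  is linear in the unknown, with the extra weight \<open>|\<xi>|\<^sup>\<alpha> + 1\<close>.  The time-dependent weight
  \<open>exp (a0 |\<xi>|\<^sup>2 - t \<rho>(\<xi>))\<close> has a damping rate \<open>\<rho>\<close> chosen to dominate this production completely.\<close>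

lemma bounded_differences_step:
  assumes T: "0 < T" and f: "\<exists>a>0. \<exists>C\<ge>0. \<forall>t\<in>{0..T}. wint (gauss a) (f t) \<le> ennreal C"
    and ord: "0 < word_order W"
    and low: "\<And>A. A \<in> fst ` set (splits W) \<union> snd ` set (splits W) \<Longrightarrow> word_order A < word_order W \<Longrightarrow> bounded_differences T A"
    and init: "\<exists>a>0. \<exists>C\<ge>0. \<forall>r\<in>{0<..1}. wint (gauss a) (fd r W 0) \<le> ennreal C"
  shows "bounded_differences T W"
proof -
  define Ls where "Ls = {A \<in> fst ` set (splits W) \<union> snd ` set (splits W). word_order A < word_order W}"
  have "\<exists>a>0. \<exists>C\<ge>0. \<forall>A\<in>Ls. \<forall>z\<in>{0<..1} \<times> {0..T}. wint (gauss a) ((\<lambda>A (r, t). fd r A t) A z) \<le> ennreal C"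
  proof (rule uniform_gauss_bound)
    show "finite Ls" unfolding Ls_def by simp
    show "\<exists>a>0. \<exists>C\<ge>0. \<forall>z\<in>{0<..1} \<times> {0..T}. wint (gauss a) (case z of (r, t) \<Rightarrow> fd r A t) \<le> ennreal C" if "A \<in> Ls" for A
      using low[of A] that by (fastforce simp: Ls_def bounded_differences_def)
  qed
  then obtain a1 C1 where a1: "0 < a1" "0 \<le> C1"
    and b1: "\<And>A r t. A \<in> Ls \<Longrightarrow> r \<in> {0<..1} \<Longrightarrow> t \<in> {0..T} \<Longrightarrow> wint (gauss a1) (fd r A t) \<le> ennreal C1"
    by fastforce
  obtain a2 C2 where a2: "0 < a2" "0 \<le> C2" and b2: "\<And>r. r \<in> {0<..1} \<Longrightarrow> wint (gauss a2) (fd r W 0) \<le> ennreal C2"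
    using init by auto
  obtain a3 C3 where a3: "0 < a3" "0 \<le> C3" and b3: "\<And>t. t \<in> {0..T} \<Longrightarrow> wint (gauss a3) (f t) \<le> ennreal C3"
    using f by auto
  define a0 where "a0 = min (a1 / 2) (min a2 (a3 / (2 ^ length W * 2)))"
  have "a0 \<le> a3 / (2 ^ length W * 2)" by (simp add: a0_def)
  then have a0: "0 < a0" "2 * a0 \<le> a1" "a0 \<le> a2" "2 ^ length W * (2 * a0) \<le> a3"
    using a1 a2 a3 by (auto simp: a0_def pos_le_divide_eq ac_simps)
  define C where "C = max 1 ((1 + 1 / a0) * C1)"
  have C: "1 \<le> C" by (simp add: C_def)
  define L where "L = 4 * real (length (splits W)) * C\<^sup>2"
  have "splits W \<noteq> []" by (induction W rule: splits.induct) auto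
  then have L: "0 < L" using C by (simp add: L_def)
  define l where "l = a0 / (2 * T)"
  have l: "0 < l" using a0 T by (simp add: l_def)
  define \<epsilon> where "\<epsilon> = l / L"
  have \<epsilon>: "0 < \<epsilon>" using l L by (simp add: \<epsilon>_def)
  define c where "c = L * (1 + 1 / \<epsilon>) + L"
  have c: "0 < c" using L \<epsilon> by (auto simp: c_def intro!: add_pos_pos mult_pos_pos)
  \<comment> \<open>The part \<open>l |x|\<^sup>2\<close> lowers the rate from \<open>a0\<close> to \<open>a0 / 2\<close>, the part \<open>c\<close> costs the factor \<open>exp (c T)\<close>.\<close>
  define \<rho> where "\<rho> x = l * (norm x)\<^sup>2 + c" for x :: "real^'n"
  have \<rho>0: "0 \<le> \<rho> x" for x using l c by (simp add: \<rho>_def)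
  have \<rho>m[measurable]: "\<rho> \<in> borel_measurable borel" unfolding \<rho>_def by measurable
  have absorb: "L * (norm x powr \<alpha> + 1) \<le> \<rho> x" for x
  proof -
    have "L * (norm x powr \<alpha> + 1) \<le> L * (\<epsilon> * (norm x)\<^sup>2 + (1 + 1 / \<epsilon>) + 1)"
      using L \<epsilon> alpha_pos alpha_le_1 by (intro mult_left_mono add_right_mono powr_le_young) auto
    also have "\<dots> = \<rho> x" using L by (simp add: \<rho>_def c_def \<epsilon>_def algebra_simps)
    finally show ?thesis .
  qed
  define w where "w s x = gauss a0 x * exp (- s * \<rho> x)" for s x
  have w_eq: "w s x = exp (- c * s) * gauss (a0 - l * s) x" for s x
    by (simp add: w_def \<rho>_def exp_add[symmetric] algebra_simps)
  have w0: "0 \<le> w s x" for s x by (simp add: w_def)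
  have wm[measurable]: "w s \<in> borel_measurable borel" for s unfolding w_def by measurable
  have as: "a0 / 2 \<le> a0 - l * s" "a0 - l * s \<le> a0" if "s \<in> {0..T}" for s
  proof -
    have "l * s \<le> l * T" using that l by (intro mult_left_mono) auto
    also have "l * T = a0 / 2" using T by (simp add: l_def)
    finally show "a0 / 2 \<le> a0 - l * s" "a0 - l * s \<le> a0" using that l a0 by auto
  qed
  have "wint (gauss (a0 / 2)) (fd r W t) \<le> ennreal (exp (c * T) * (C2 + L * T))" if r: "r \<in> {0<..1}" and t: "t \<in> {0..T}" for r t
  proof -
    have t0: "0 \<le> t" using t by simp
    obtain C4 where C4: "\<And>s. s \<in> {0..T} \<Longrightarrow> wint (gauss (2 * a0)) (fd r W s) \<le> ennreal C4"
    proof -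
      have "\<exists>C'. \<forall>t\<in>{0..T}. wint (gauss (2 * a0)) (fd r W t) \<le> ennreal C'"
        using r a0 b3 order_trans[OF wint_gauss_mono[OF a0(4)] b3]
        by (intro fdiff_gauss_fixed_step[where C=C3]) auto
      then show ?thesis using that by blast
    qed
    have ev: "evolves (fd r W) (\<lambda>t. fdiff unit_step r W (q t))" by (rule evolves_fdiff[OF evolves_f])
    note main = evolves_weighted[OF ev t0 \<rho>0 \<rho>m, of "gauss a0", folded w_def]
    have Q: "wint (w s) (fdiff unit_step r W (q s)) \<le> wint (\<lambda>x. \<rho> x * w s x) (fd r W s) + ennreal L" if s: "s \<in> {0..T}" for s
    proof -
      define as where "as = a0 - l * s"
      have as0: "0 \<le> as" "as \<le> a0" using as[OF s] a0 by (auto simp: as_def)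
      have s0: "0 \<le> s" using s by simp
      have lw: "wint (gauss as) (fd r A s) \<le> ennreal C \<and> wint (\<lambda>x. norm x powr \<alpha> * gauss as x) (fd r A s) \<le> ennreal C"
        if "A \<in> fst ` set (splits W) \<union> snd ` set (splits W)" "word_order A < word_order W" for A
      proof -
        have A: "A \<in> Ls" using that by (simp add: Ls_def)
        have "wint v (fd r A s) \<le> ennreal C" if v: "\<And>x. 0 \<le> v x" "\<And>x. v x \<le> (1 + (norm x)\<^sup>2) * gauss as x" for v
        proof -
          have "wint v (fd r A s) \<le> wint (\<lambda>x. (1 + 1 / a0) * gauss a1 x) (fd r A s)"
          proof (rule wint_mono, rule mult_left_mono)
            fix x :: "real^'n"
            have "v x \<le> (1 + (norm x)\<^sup>2) * gauss as x" by (rule v(2))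
            also have "\<dots> \<le> (1 + (norm x)\<^sup>2) * gauss a0 x" using as0 by (intro mult_left_mono) (auto intro: mult_right_mono)
            also have "\<dots> \<le> (1 + 1 / a0) * gauss (2 * a0) x" by (rule poly_gauss_le[OF a0(1)])
            also have "\<dots> \<le> (1 + 1 / a0) * gauss a1 x"
            proof (rule mult_left_mono)
              show "gauss (2 * a0) x \<le> gauss a1 x" using mult_right_mono[OF a0(2), of "(norm x)\<^sup>2"] by simp
            qed (use a0 in auto)
            finally show "v x \<le> (1 + 1 / a0) * gauss a1 x" .
          qed simp
          also have "\<dots> = ennreal (1 + 1 / a0) * wint (gauss a1) (fd r A s)" using a0 by (intro wint_cmult) auto
          also have "\<dots> \<le> ennreal (1 + 1 / a0) * ennreal C1" by (intro mult_left_mono b1[OF A r s]) auto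
          also have "\<dots> = ennreal ((1 + 1 / a0) * C1)" using a0 a1 by (simp add: ennreal_mult)
          also have "\<dots> \<le> ennreal C" by (intro ennreal_leI) (simp add: C_def)
          finally show ?thesis .
        qed
        note b = this
        show ?thesis
        proof (intro conjI b)
          show "gauss as x \<le> (1 + (norm x)\<^sup>2) * gauss as x" for x :: "real^'n" by (simp add: distrib_right)
          show "norm x powr \<alpha> * gauss as x \<le> (1 + (norm x)\<^sup>2) * gauss as x" for x :: "real^'n"
            using alpha_pos alpha_le_1 by (intro mult_right_mono powr_le_one_plus_square) auto
        qed auto
      qed
      have *: "wint (gauss as) (fdiff unit_step r W (q s)) \<le>
        ennreal L * (wint (\<lambda>x. norm x powr \<alpha> * gauss as x) (fd r W s) + wint (gauss as) (fd r W s)) + ennreal L"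
        unfolding L_def by (rule wint_fdiff_collision[OF s0 as0(1) C ord lw])
      have "wint (\<lambda>x. norm x powr \<alpha> * gauss as x) (fd r W s) + wint (gauss as) (fd r W s) = wint (\<lambda>x. (norm x powr \<alpha> + 1) * gauss as x) (fd r W s)"
        unfolding wint_def by (subst nn_integral_add[symmetric]) (auto intro!: nn_integral_cong simp: ennreal_plus[symmetric] algebra_simps simp del: ennreal_plus)
      then have "ennreal L * (wint (\<lambda>x. norm x powr \<alpha> * gauss as x) (fd r W s) + wint (gauss as) (fd r W s)) = wint (\<lambda>x. L * ((norm x powr \<alpha> + 1) * gauss as x)) (fd r W s)"
        using L by (subst wint_cmult) auto
      also have "\<dots> \<le> wint (\<lambda>x. \<rho> x * gauss as x) (fd r W s)"
      proof (rule wint_mono, rule mult_left_mono)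
        show "L * ((norm x powr \<alpha> + 1) * gauss as x) \<le> \<rho> x * gauss as x" for x
          using mult_right_mono[OF absorb[of x], of "gauss as x"] by (simp add: mult.assoc)
      qed simp
      finally have "wint (gauss as) (fdiff unit_step r W (q s)) \<le> wint (\<lambda>x. \<rho> x * gauss as x) (fd r W s) + ennreal L"
        using * by (meson add_right_mono order_trans)
      then have "ennreal (exp (- c * s)) * wint (gauss as) (fdiff unit_step r W (q s)) \<le> ennreal (exp (- c * s)) * (wint (\<lambda>x. \<rho> x * gauss as x) (fd r W s) + ennreal L)"
        by (rule mult_left_mono) simp
      also have "\<dots> \<le> ennreal (exp (- c * s)) * wint (\<lambda>x. \<rho> x * gauss as x) (fd r W s) + ennreal L"
      proof -
        have "ennreal (exp (- c * s)) * ennreal L \<le> 1 * ennreal L"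
          using c s0 by (intro mult_right_mono) (auto simp: ennreal_le_1)
        then show ?thesis by (simp add: distrib_left add_left_mono)
      qed
      also have "ennreal (exp (- c * s)) * wint (\<lambda>x. \<rho> x * gauss as x) (fd r W s) = wint (\<lambda>x. \<rho> x * w s x) (fd r W s)"
        by (subst wint_cmult[symmetric]) (auto simp: w_eq as_def ac_simps)
      also have "ennreal (exp (- c * s)) * wint (gauss as) (fdiff unit_step r W (q s)) = wint (w s) (fdiff unit_step r W (q s))"
        by (subst wint_cmult[symmetric]) (auto simp: w_eq[abs_def] as_def fdiff_measurable)
      finally show ?thesis .
    qed
    define I where "I = (\<integral>\<^sup>+s. indicator {0..t} s * wint (\<lambda>x. \<rho> x * w s x) (fd r W s) \<partial>lborel)"
    have Wm: "(\<lambda>s. wint (\<lambda>x. \<rho> x * w s x) (fd r W s)) \<in> borel_measurable borel"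
    proof -
      have [measurable]: "(\<lambda>(t, x). fd r W t x) \<in> borel_measurable (borel \<Otimes>\<^sub>M borel)" by (rule fdiff_measurable2[OF f_meas2])
      show ?thesis unfolding wint_def w_def by measurable
    qed
    \<comment> \<open>The damping integral \<open>I\<close> appears on both sides and is cancelled; its finiteness, for this fixed step, rests on \<open>C4\<close>.\<close>
    have I_fin: "I < \<infinity>"
    proof -
      have "I \<le> (\<integral>\<^sup>+s. indicator {0..t} s * ennreal ((l + c) * (1 + 1 / a0) * \<bar>C4\<bar>) \<partial>lborel)"
        unfolding I_def
      proof (rule nn_integral_mono)
        fix s
        show "indicator {0..t} s * wint (\<lambda>x. \<rho> x * w s x) (fd r W s) \<le> indicator {0..t} s * ennreal ((l + c) * (1 + 1 / a0) * \<bar>C4\<bar>)"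
        proof (cases "s \<in> {0..t}")
          case True
          then have s: "s \<in> {0..T}" using t by auto
          have "wint (\<lambda>x. \<rho> x * w s x) (fd r W s) \<le> wint (\<lambda>x. (l + c) * (1 + 1 / a0) * gauss (2 * a0) x) (fd r W s)"
          proof (rule wint_mono, rule mult_left_mono)
            fix x :: "real^'n"
            have "w s x \<le> gauss a0 x * 1"
              unfolding w_def using s \<rho>0[of x] by (intro mult_left_mono) auto
            then have "\<rho> x * w s x \<le> \<rho> x * gauss a0 x" using \<rho>0 by (intro mult_left_mono) auto
            also have "\<dots> \<le> ((l + c) * (1 + (norm x)\<^sup>2)) * gauss a0 x"
              using l c by (intro mult_right_mono) (auto simp: \<rho>_def algebra_simps)
            also have "\<dots> \<le> (l + c) * ((1 + 1 / a0) * gauss (2 * a0) x)"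
              unfolding mult.assoc[of "l + c"] using l c by (intro mult_left_mono poly_gauss_le[OF a0(1)]) auto
            finally show "\<rho> x * w s x \<le> (l + c) * (1 + 1 / a0) * gauss (2 * a0) x" by (simp add: mult.assoc)
          qed simp
          also have "\<dots> = ennreal ((l + c) * (1 + 1 / a0)) * wint (gauss (2 * a0)) (fd r W s)"
            using l c a0 by (intro wint_cmult) auto
          also have "\<dots> \<le> ennreal ((l + c) * (1 + 1 / a0)) * ennreal \<bar>C4\<bar>"
            using C4[OF s] by (intro mult_left_mono) (auto intro: order_trans ennreal_leI)
          also have "\<dots> = ennreal ((l + c) * (1 + 1 / a0) * \<bar>C4\<bar>)" using l c a0 by (subst ennreal_mult) auto
          finally show ?thesis by (rule mult_left_mono) simp
        qed simp
      qed
      also have "\<dots> = ennreal ((l + c) * (1 + 1 / a0) * \<bar>C4\<bar>) * ennreal t"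
        using t0 by (subst nn_integral_multc) (auto simp: mult.commute)
      also have "\<dots> < \<infinity>" by (simp add: ennreal_mult_less_top)
      finally show ?thesis .
    qed
    have "(\<integral>\<^sup>+s. indicator {0..t} s * wint (w s) (fdiff unit_step r W (q s)) \<partial>lborel) \<le>
       (\<integral>\<^sup>+s. indicator {0..t} s * wint (\<lambda>x. \<rho> x * w s x) (fd r W s) + indicator {0..t} s * ennreal L \<partial>lborel)"
    proof (rule nn_integral_mono)
      fix s
      show "indicator {0..t} s * wint (w s) (fdiff unit_step r W (q s)) \<le> indicator {0..t} s * wint (\<lambda>x. \<rho> x * w s x) (fd r W s) + indicator {0..t} s * ennreal L"
        using Q[of s] t by (auto split: split_indicator)
    qed
    also have "\<dots> = I + ennreal L * ennreal t"
    proof -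
      have "(\<integral>\<^sup>+s. indicator {0..t} s * ennreal L \<partial>lborel) = ennreal L * ennreal t"
        using t0 by (subst nn_integral_multc) (auto simp: mult.commute)
      then show ?thesis unfolding I_def using Wm by (subst nn_integral_add) auto
    qed
    also have "\<dots> \<le> I + ennreal (L * T)"
      using L t by (intro add_left_mono) (auto simp: ennreal_mult[symmetric] intro!: ennreal_leI)
    finally have "(\<integral>\<^sup>+s. indicator {0..t} s * wint (w s) (fdiff unit_step r W (q s)) \<partial>lborel) \<le> I + ennreal (L * T)" .
    moreover have "wint (w t) (fd r W t) + I \<le> wint (gauss a0) (fd r W 0) + (\<integral>\<^sup>+s. indicator {0..t} s * wint (w s) (fdiff unit_step r W (q s)) \<partial>lborel)"
      using main by (simp add: I_def)
    moreover have "wint (gauss a0) (fd r W 0) \<le> ennreal C2"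
      using order_trans[OF wint_gauss_mono[OF a0(3)] b2[OF r]] .
    ultimately have "wint (w t) (fd r W t) + I \<le> ennreal C2 + (I + ennreal (L * T))"
      by (blast intro: order_trans add_mono)
    then have "I + wint (w t) (fd r W t) \<le> I + (ennreal C2 + ennreal (L * T))"
      by (simp only: ac_simps)
    then have "wint (w t) (fd r W t) \<le> ennreal C2 + ennreal (L * T)"
      using I_fin by (auto simp: ennreal_add_left_cancel_le)
    then have wt: "wint (w t) (fd r W t) \<le> ennreal (C2 + L * T)" using a2 L T by simp
    have "wint (gauss (a0 / 2)) (fd r W t) \<le> wint (\<lambda>x. exp (c * T) * w t x) (fd r W t)"
    proof (rule wint_mono, rule mult_left_mono)
      fix x :: "real^'n"
      have "gauss (a0 / 2) x \<le> gauss (a0 - l * t) x" using mult_right_mono[OF as(1)[OF t], of "(norm x)\<^sup>2"] by simp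
      also have "\<dots> = 1 * gauss (a0 - l * t) x" by simp
      also have "\<dots> \<le> (exp (c * T) * exp (- c * t)) * gauss (a0 - l * t) x"
        using c t by (intro mult_right_mono) (auto simp: exp_add[symmetric])
      finally show "gauss (a0 / 2) x \<le> exp (c * T) * w t x" by (simp add: w_eq mult.assoc)
    qed simp
    also have "\<dots> = ennreal (exp (c * T)) * wint (w t) (fd r W t)" by (intro wint_cmult) auto
    also have "\<dots> \<le> ennreal (exp (c * T)) * ennreal (C2 + L * T)" by (intro mult_left_mono wt) auto
    also have "\<dots> = ennreal (exp (c * T) * (C2 + L * T))" using a2 L T by (simp add: ennreal_mult)
    finally show ?thesis .
  qed
  then show ?thesis unfolding bounded_differences_def using a0 a2 L T
    by (intro exI[of _ "a0 / 2"] conjI exI[of _ "exp (c * T) * (C2 + L * T)"]) auto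
qed

text \<open>Induction on the order: the words that occur in the product rule contain no letter \<open>(True, i)\<close> more
  often than the given word does.\<close>

theorem finite_difference_propagation:
  assumes T: "0 < T" and f: "\<exists>a>0. \<exists>C\<ge>0. \<forall>t\<in>{0..T}. wint (gauss a) (f t) \<le> ennreal C"
    and init: "\<And>W. (\<And>i. count_list W (True, i) \<le> \<eta> i) \<Longrightarrow> \<exists>a>0. \<exists>C\<ge>0. \<forall>r\<in>{0<..1}. wint (gauss a) (fd r W 0) \<le> ennreal C"
    and W: "\<And>i. count_list W (True, i) \<le> \<eta> i"
  shows "bounded_differences T W"
  using W
proof (induction "word_order W" arbitrary: W rule: less_induct)
  case less
  show ?case
  proof (cases "word_order W = 0")
    case True
    then show ?thesis by (rule bounded_differences_order_0[OF f])
  next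
    case False
    show ?thesis
    proof (rule bounded_differences_step[OF T f])
      show "0 < word_order W" using False by simp
      show "\<exists>a>0. \<exists>C\<ge>0. \<forall>r\<in>{0<..1}. wint (gauss a) (fd r W 0) \<le> ennreal C" by (rule init[OF less.prems])
      fix A assume A: "A \<in> fst ` set (splits W) \<union> snd ` set (splits W)" "word_order A < word_order W"
      have "count_list A (True, i) \<le> \<eta> i" for i
        using A(1) splits_count[of _ _ W i] less.prems[of i] by fastforce
      then show "bounded_differences T A" using less.hyps A(2) by blast
    qed
  qed
qed

end


section \<open>Test functions\<close>

text \<open>Smoothness on the line, as membership in a set of functions closed under differentiation.\<close>

definition smooth_on_line :: "(real \<Rightarrow> real) \<Rightarrow> bool" where
  "smooth_on_line f \<longleftrightarrow> (\<exists>\<A>. f \<in> \<A> \<and> (\<forall>g\<in>\<A>. \<exists>g'\<in>\<A>. \<forall>x. (g has_real_derivative g' x) (at x)))"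

lemma smooth_on_lineI:
  assumes "f \<in> \<A>" "\<And>g. g \<in> \<A> \<Longrightarrow> \<exists>g'\<in>\<A>. \<forall>x. (g has_real_derivative g' x) (at x)"
  shows "smooth_on_line f"
  using assms unfolding smooth_on_line_def by blast

lemma smooth_on_line_deriv:
  assumes "smooth_on_line f"
  obtains f' where "smooth_on_line f'" "\<And>x. (f has_real_derivative f' x) (at x)"
  using assms unfolding smooth_on_line_def by metis

text \<open>Closed under differentiation by the product rule, and hence a witness for the smoothness of products.\<close>

inductive_set product_sums :: "(real \<Rightarrow> real) set" where
  prod: "smooth_on_line f \<Longrightarrow> smooth_on_line g \<Longrightarrow> (\<lambda>x. f x * g x) \<in> product_sums"
| sum: "f \<in> product_sums \<Longrightarrow> g \<in> product_sums \<Longrightarrow> (\<lambda>x. f x + g x) \<in> product_sums"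

lemma smooth_on_line_mult:
  assumes "smooth_on_line f" "smooth_on_line g"
  shows "smooth_on_line (\<lambda>x. f x * g x)"
proof (rule smooth_on_lineI)
  show "(\<lambda>x. f x * g x) \<in> product_sums" using assms by (rule product_sums.prod)
  fix k assume "k \<in> product_sums"
  then show "\<exists>k'\<in>product_sums. \<forall>x. (k has_real_derivative k' x) (at x)"
  proof induction
    case (prod f g)
    obtain f' where f': "smooth_on_line f'" "\<And>x. (f has_real_derivative f' x) (at x)" using smooth_on_line_deriv[OF prod(1)] by blast
    obtain g' where g': "smooth_on_line g'" "\<And>x. (g has_real_derivative g' x) (at x)" using smooth_on_line_deriv[OF prod(2)] by blast
    have "(\<lambda>x. f' x * g x + f x * g' x) \<in> product_sums" using f' g' prod by (intro product_sums.intros)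
    moreover have "((\<lambda>x. f x * g x) has_real_derivative f' x * g x + f x * g' x) (at x)" for x
      using f'(2) g'(2) by (auto intro!: derivative_eq_intros)
    ultimately show ?case by (intro bexI[of _ "\<lambda>x. f' x * g x + f x * g' x"] allI)
  next
    case (sum f g)
    then obtain f' g' where "f' \<in> product_sums" "g' \<in> product_sums"
      "\<And>x. (f has_real_derivative f' x) (at x)" "\<And>x. (g has_real_derivative g' x) (at x)" by blast
    then show ?case by (intro bexI[of _ "\<lambda>x. f' x + g' x"]) (auto intro!: DERIV_add product_sums.sum)
  qed
qed

lemma smooth_on_line_affine:
  assumes "smooth_on_line f"
  shows "smooth_on_line (\<lambda>x. f (c * x + d))"
proof (rule smooth_on_lineI)
  show "(\<lambda>x. f (c * x + d)) \<in> {(\<lambda>x. k * f (c * x + d)) |k f. smooth_on_line f}"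
    using assms by (auto intro!: exI[of _ 1] exI[of _ f])
  fix g assume "g \<in> {(\<lambda>x. k * f (c * x + d)) |k f. smooth_on_line f}"
  then obtain k f where g: "g = (\<lambda>x. k * f (c * x + d))" "smooth_on_line f" by blast
  obtain f' where f': "smooth_on_line f'" "\<And>x. (f has_real_derivative f' x) (at x)" using smooth_on_line_deriv[OF g(2)] by blast
  have "((\<lambda>x. k * f (c * x + d)) has_real_derivative (k * c) * f' (c * x + d)) (at x)" for x
  proof -
    have "((\<lambda>x. c * x + d) has_real_derivative c) (at x)" by (auto intro!: derivative_eq_intros)
    from DERIV_cmult[OF DERIV_chain2[OF f'(2) this], of k] show ?thesis by (simp only: ac_simps)
  qed
  then show "\<exists>g'\<in>{(\<lambda>x. k * f (c * x + d)) |k f. smooth_on_line f}. \<forall>x. (g has_real_derivative g' x) (at x)"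
    unfolding g using f' by (intro bexI[of _ "\<lambda>x. (k * c) * f' (c * x + d)"]) auto
qed

text \<open>The polynomial factor in \<open>1 / x\<close> makes this family, which contains the flat function
  \<open>exp (- 1 / x)\<close>, closed under differentiation.\<close>

definition flat_exp :: "real poly \<Rightarrow> real \<Rightarrow> real" where
  "flat_exp p x = (if 0 < x then poly p (1 / x) * exp (- (1 / x)) else 0)"

lemma flat_exp_tendsto_0: "(flat_exp p \<longlongrightarrow> 0) (at_right 0)"
proof -
  have "((\<lambda>y. \<Sum>i\<le>degree p. coeff p i * (y ^ i / exp y)) \<longlongrightarrow> (\<Sum>i\<le>degree p. coeff p i * 0)) at_top"
    by (intro tendsto_intros tendsto_power_div_exp_0)
  then have "((\<lambda>y. poly p y * exp (- y)) \<longlongrightarrow> 0) at_top"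
    by (simp add: poly_altdef sum_distrib_right exp_minus divide_inverse mult.assoc)
  then have "((\<lambda>x. poly p (inverse x) * exp (- inverse x)) \<longlongrightarrow> 0) (at_right 0)"
    by (rule filterlim_compose[OF _ filterlim_inverse_at_top_right])
  moreover have "\<forall>\<^sub>F x in at_right 0. poly p (inverse x) * exp (- inverse x) = flat_exp p x"
    using eventually_at_right_less[of 0] by eventually_elim (simp add: flat_exp_def inverse_eq_divide)
  ultimately show ?thesis by (rule Lim_transform_eventually)
qed

lemma flat_exp_deriv: "(flat_exp p has_real_derivative flat_exp ([:0, 0, 1:] * (p - pderiv p)) x) (at x)"
proof -
  consider "0 < x" | "x < 0" | "x = 0" by linarith
  then show ?thesis
  proof cases
    case 1
    have "((\<lambda>x. poly p (1 / x) * exp (- (1 / x))) has_real_derivative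
       (poly (pderiv p) (1 / x) * (- (1 / x\<^sup>2))) * exp (- (1 / x)) + poly p (1 / x) * (exp (- (1 / x)) * (1 / x\<^sup>2))) (at x)"
      using 1 by (auto intro!: derivative_eq_intros DERIV_chain2[OF poly_DERIV] simp: power2_eq_square)
    also have "(poly (pderiv p) (1 / x) * (- (1 / x\<^sup>2))) * exp (- (1 / x)) + poly p (1 / x) * (exp (- (1 / x)) * (1 / x\<^sup>2)) =
       flat_exp ([:0, 0, 1:] * (p - pderiv p)) x"
      using 1 by (simp add: flat_exp_def power2_eq_square algebra_simps)
    finally show ?thesis
      by (rule has_field_derivative_transform_within_open[where S="{0<..}"]) (use 1 in \<open>auto simp: flat_exp_def\<close>)
  next
    case 2
    have "((\<lambda>x. 0) has_real_derivative flat_exp ([:0, 0, 1:] * (p - pderiv p)) x) (at x)"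
      using 2 by (simp add: flat_exp_def)
    then show ?thesis
      by (rule has_field_derivative_transform_within_open[where S="{..<0}"]) (use 2 in \<open>auto simp: flat_exp_def\<close>)
  next
    case 3
    have r: "((\<lambda>k. (flat_exp p (0 + k) - flat_exp p 0) / k) \<longlongrightarrow> 0) (at_right 0)"
    proof -
      have "\<forall>\<^sub>F k in at_right 0. flat_exp (pCons 0 p) k = (flat_exp p (0 + k) - flat_exp p 0) / k"
        using eventually_at_right_less[of 0] by eventually_elim (simp add: flat_exp_def)
      then show ?thesis by (rule Lim_transform_eventually[OF flat_exp_tendsto_0])
    qed
    have l: "((\<lambda>k. (flat_exp p (0 + k) - flat_exp p 0) / k) \<longlongrightarrow> 0) (at_left 0)"
    proof -
      have "\<forall>\<^sub>F k in at_left (0::real). k < 0" by (simp add: eventually_at_filter)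
      then have "\<forall>\<^sub>F k in at_left 0. 0 = (flat_exp p (0 + k) - flat_exp p 0) / k"
        by eventually_elim (simp add: flat_exp_def)
      then show ?thesis by (rule Lim_transform_eventually[OF tendsto_const])
    qed
    have "((\<lambda>k. (flat_exp p (0 + k) - flat_exp p 0) / k) \<longlongrightarrow> 0) (at 0)"
      by (rule filterlim_split_at[OF l r])
    then show ?thesis using 3 by (simp add: DERIV_def flat_exp_def)
  qed
qed

lemma smooth_flat_exp: "smooth_on_line (flat_exp p)"
  by (rule smooth_on_lineI[of _ "range flat_exp"]) (use flat_exp_deriv in auto)

text \<open>A smooth approximation to the indicator of \<open>{a<..<b}\<close> as \<open>m\<close> grows.\<close>

definition bump :: "real \<Rightarrow> real \<Rightarrow> nat \<Rightarrow> real \<Rightarrow> real" where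
  "bump a b m x = flat_exp 1 (real m * x + (- real m * a)) * flat_exp 1 ((- real m) * x + real m * b)"

lemma smooth_bump: "smooth_on_line (bump a b m)"
  unfolding bump_def[abs_def] by (intro smooth_on_line_mult smooth_on_line_affine smooth_flat_exp)

lemma flat_exp_1_range: "0 \<le> flat_exp 1 x" "flat_exp 1 x \<le> 1"
  by (auto simp: flat_exp_def)

lemma bump_range: "0 \<le> bump a b m x" "bump a b m x \<le> 1"
  using flat_exp_1_range by (auto simp: bump_def intro: mult_le_one)

lemma bump_eq_0:
  assumes "x \<notin> {a<..<b}"
  shows "bump a b m x = 0"
proof -
  have "real m * (x - a) \<le> 0 \<or> real m * (b - x) \<le> 0" using assms by (auto simp: not_less mult_nonneg_nonpos)
  then show ?thesis by (auto simp: bump_def flat_exp_def algebra_simps)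
qed

lemma flat_exp_1_tendsto: "0 < y \<Longrightarrow> (\<lambda>m. flat_exp 1 (real m * y)) \<longlonglongrightarrow> 1"
proof -
  assume y: "0 < y"
  have "(\<lambda>m. exp (- (1 / y) * (1 / real m))) \<longlonglongrightarrow> exp (- (1 / y) * 0)"
    by (intro tendsto_intros lim_1_over_n)
  moreover have "\<forall>\<^sub>F m in sequentially. exp (- (1 / y) * (1 / real m)) = flat_exp 1 (real m * y)"
    using eventually_gt_at_top[of 0] by eventually_elim (use y in \<open>simp add: flat_exp_def\<close>)
  ultimately show ?thesis by (auto intro: Lim_transform_eventually)
qed

lemma bump_tendsto: "(\<lambda>m. bump a b m x) \<longlonglongrightarrow> indicator {a<..<b} x"
proof (cases "x \<in> {a<..<b}")
  case True
  then have "(\<lambda>m. flat_exp 1 (real m * (x - a)) * flat_exp 1 (real m * (b - x))) \<longlonglongrightarrow> 1 * 1"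
    by (intro tendsto_mult flat_exp_1_tendsto) auto
  moreover have "flat_exp 1 (real m * (x - a)) * flat_exp 1 (real m * (b - x)) = bump a b m x" for m
    by (simp add: bump_def algebra_simps)
  ultimately show ?thesis using True by simp
qed (simp add: bump_eq_0)

lemma tensor_derivative:
  fixes \<beta> :: "'n::finite \<Rightarrow> real \<Rightarrow> real"
  assumes "\<And>i x. (\<beta> i has_real_derivative \<beta>' i x) (at x)"
  shows "(\<lambda>x::real^'n. \<Prod>i\<in>UNIV. \<beta> i (x $ i)) differentiable (at x)"
    and "partial j (\<lambda>x::real^'n. \<Prod>i\<in>UNIV. \<beta> i (x $ i)) x = (\<Prod>i\<in>UNIV. (\<beta>(j := \<beta>' j)) i (x $ i))"
proof -
  have "((\<lambda>x::real^'n. \<beta> i (x $ i)) has_derivative (\<lambda>y. \<beta>' i (x $ i) * (y $ i))) (at x)" for i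
  proof -
    have "((\<lambda>x::real^'n. x $ i) has_derivative (\<lambda>y. y $ i)) (at x)"
      by (rule bounded_linear.has_derivative[OF bounded_linear_vec_nth has_derivative_ident])
    from has_derivative_compose[OF this, of "\<beta> i" "\<lambda>y. \<beta>' i (x $ i) * y"] show ?thesis
      using assms[of i "x $ i"] by (simp add: has_field_derivative_def)
  qed
  then have d: "((\<lambda>x::real^'n. \<Prod>i\<in>UNIV. \<beta> i (x $ i)) has_derivative
      (\<lambda>y. \<Sum>i\<in>UNIV. (\<beta>' i (x $ i) * (y $ i)) * (\<Prod>k\<in>UNIV - {i}. \<beta> k (x $ k)))) (at x)"
    by (rule has_derivative_prod)
  then show "(\<lambda>x::real^'n. \<Prod>i\<in>UNIV. \<beta> i (x $ i)) differentiable (at x)" by (rule differentiableI)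
  have "partial j (\<lambda>x::real^'n. \<Prod>i\<in>UNIV. \<beta> i (x $ i)) x =
      (\<Sum>i\<in>UNIV. (\<beta>' i (x $ i) * (axis j 1 $ i)) * (\<Prod>k\<in>UNIV - {i}. \<beta> k (x $ k)))"
    unfolding partial_def frechet_derivative_at[OF d, symmetric] by (rule refl)
  also have "\<dots> = (\<Sum>i\<in>UNIV. if i = j then \<beta>' j (x $ j) * (\<Prod>k\<in>UNIV - {j}. \<beta> k (x $ k)) else 0)"
    by (intro sum.cong) (auto simp: axis_def)
  also have "\<dots> = \<beta>' j (x $ j) * (\<Prod>k\<in>UNIV - {j}. \<beta> k (x $ k))" by simp
  also have "(\<Prod>k\<in>UNIV - {j}. \<beta> k (x $ k)) = (\<Prod>k\<in>UNIV - {j}. (\<beta>(j := \<beta>' j)) k (x $ k))"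
    by (intro prod.cong) auto
  also have "\<beta>' j (x $ j) * (\<Prod>k\<in>UNIV - {j}. (\<beta>(j := \<beta>' j)) k (x $ k)) = (\<Prod>i\<in>UNIV. (\<beta>(j := \<beta>' j)) i (x $ i))"
    by (subst prod.remove[of UNIV j]) auto
  finally show "partial j (\<lambda>x::real^'n. \<Prod>i\<in>UNIV. \<beta> i (x $ i)) x = (\<Prod>i\<in>UNIV. (\<beta>(j := \<beta>' j)) i (x $ i))" .
qed

lemma tensor_smooth:
  fixes \<beta> :: "'n::finite \<Rightarrow> real \<Rightarrow> real"
  assumes "\<And>i. smooth_on_line (\<beta> i)"
  shows "\<exists>\<beta>'. (\<forall>i. smooth_on_line (\<beta>' i)) \<and> foldr partial is (\<lambda>x::real^'n. \<Prod>i\<in>UNIV. \<beta> i (x $ i)) = (\<lambda>x. \<Prod>i\<in>UNIV. \<beta>' i (x $ i))"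
proof (induction "is")
  case Nil
  then show ?case using assms by auto
next
  case (Cons j js)
  then obtain \<beta>' where b: "\<And>i. smooth_on_line (\<beta>' i)"
    "foldr partial js (\<lambda>x::real^'n. \<Prod>i\<in>UNIV. \<beta> i (x $ i)) = (\<lambda>x. \<Prod>i\<in>UNIV. \<beta>' i (x $ i))" by blast
  have "\<exists>d. smooth_on_line d \<and> (\<forall>x. (\<beta>' i has_real_derivative d x) (at x))" for i
    using smooth_on_line_deriv[OF b(1)[of i]] by metis
  then obtain d where d: "\<And>i. smooth_on_line (d i)" "\<And>i x. (\<beta>' i has_real_derivative d i x) (at x)" by metis
  have "foldr partial (j # js) (\<lambda>x::real^'n. \<Prod>i\<in>UNIV. \<beta> i (x $ i)) = (\<lambda>x. \<Prod>i\<in>UNIV. (\<beta>'(j := d j)) i (x $ i))"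
    using tensor_derivative(2)[OF d(2), of j] by (auto simp: b(2))
  then show ?case using b(1) d(1) by (intro exI[of _ "\<beta>'(j := d j)"]) auto
qed

lemma test_function_tensor:
  fixes a b :: "real^'n"
  shows "test_function (\<lambda>x::real^'n. \<Prod>i\<in>UNIV. bump (a $ i) (b $ i) m (x $ i))" (is "test_function ?\<phi>")
  unfolding test_function_def
proof (intro conjI allI)
  fix "is" and x :: "real^'n"
  obtain \<beta>' where b: "\<And>i. smooth_on_line (\<beta>' i)" "foldr partial is ?\<phi> = (\<lambda>x. \<Prod>i\<in>UNIV. \<beta>' i (x $ i))"
    using tensor_smooth[of "\<lambda>i. bump (a $ i) (b $ i) m" "is"] smooth_bump by blast
  have "\<exists>d. (\<forall>x. (\<beta>' i has_real_derivative d x) (at x))" for i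
    using smooth_on_line_deriv[OF b(1)[of i]] by metis
  then obtain d where d: "\<And>i x. (\<beta>' i has_real_derivative d i x) (at x)" by metis
  show "foldr partial is ?\<phi> differentiable at x" unfolding b(2) by (rule tensor_derivative(1)[OF d])
next
  have "{x. ?\<phi> x \<noteq> 0} \<subseteq> cbox a b"
  proof (rule subsetI)
    fix x assume "x \<in> {x. ?\<phi> x \<noteq> 0}"
    then have "bump (a $ i) (b $ i) m (x $ i) \<noteq> 0" for i by (auto simp: prod_zero_iff)
    then have "x $ i \<in> {a $ i<..<b $ i}" for i using bump_eq_0 by blast
    then show "x \<in> cbox a b" by (simp add: mem_box_cart less_imp_le)
  qed
  then have "closure {x. ?\<phi> x \<noteq> 0} \<subseteq> cbox a b" by (rule closure_minimal) (rule closed_cbox)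
  then show "compact (closure {x. ?\<phi> x \<noteq> 0})"
    by (meson bounded_cbox bounded_subset closed_closure compact_eq_bounded_closed)
qed

lemma test_function_partial:
  assumes "test_function \<phi>"
  shows "test_function (partial i \<phi>)"
  unfolding test_function_def
proof (intro conjI allI)
  fix "is" x
  have "foldr partial (is @ [i]) \<phi> differentiable at x" using assms unfolding test_function_def by blast
  then show "foldr partial is (partial i \<phi>) differentiable at x" by simp
next
  have "{x. partial i \<phi> x \<noteq> 0} \<subseteq> closure {x. \<phi> x \<noteq> 0}"
  proof (rule subsetI, rule ccontr)
    fix x assume x: "x \<in> {x. partial i \<phi> x \<noteq> 0}" "x \<notin> closure {x. \<phi> x \<noteq> 0}"
    have dz: "((\<lambda>x. 0::real) has_derivative (\<lambda>h. 0)) (at x)" by simp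
    have xin: "x \<in> - closure {x. \<phi> x \<noteq> 0}" using x(2) by simp
    have "\<phi> y = 0" if "y \<in> - closure {x. \<phi> x \<noteq> 0}" for y
      using that closure_subset[of "{x. \<phi> x \<noteq> 0}"] by blast
    note nz = this[symmetric]
    have "(\<phi> has_derivative (\<lambda>h. 0)) (at x)"
      by (rule has_derivative_transform_within_open[OF dz open_Compl[OF closed_closure] xin nz])
    then have "partial i \<phi> x = 0" unfolding partial_def by (metis frechet_derivative_at)
    then show False using x by simp
  qed
  then have "closure {x. partial i \<phi> x \<noteq> 0} \<subseteq> closure {x. \<phi> x \<noteq> 0}" by (rule closure_minimal) simp
  then show "compact (closure {x. partial i \<phi> x \<noteq> 0})"
    using assms unfolding test_function_def by (meson bounded_subset closed_closure compact_eq_bounded_closed)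
qed

lemma test_function_differentiable: "test_function \<phi> \<Longrightarrow> \<phi> differentiable (at x)"
  unfolding test_function_def by (metis foldr.simps(1) id_apply)

lemma test_function_continuous: "test_function \<phi> \<Longrightarrow> continuous_on UNIV \<phi>"
  by (simp add: continuous_on_eq_continuous_within differentiable_imp_continuous_within test_function_differentiable)

lemma test_function_measurable: "test_function \<phi> \<Longrightarrow> \<phi> \<in> borel_measurable borel"
  by (intro borel_measurable_continuous_onI test_function_continuous)

lemma test_function_bounded:
  assumes "test_function \<phi>"
  obtains M where "\<And>x. \<bar>\<phi> x\<bar> \<le> M"
proof -
  let ?S = "closure {x. \<phi> x \<noteq> 0}"
  have "compact (\<phi> ` ?S)"
    using assms by (intro compact_continuous_image continuous_on_subset[OF test_function_continuous])
      (auto simp: test_function_def)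
  then have "bounded (\<phi> ` ?S)" by (rule compact_imp_bounded)
  then obtain M where M: "\<And>y. y \<in> \<phi> ` ?S \<Longrightarrow> \<bar>y\<bar> \<le> M" unfolding bounded_iff real_norm_def by blast
  have "\<bar>\<phi> x\<bar> \<le> \<bar>M\<bar>" for x
  proof (cases "x \<in> ?S")
    case True
    then have "\<bar>\<phi> x\<bar> \<le> M" using M by blast
    then show ?thesis by simp
  next
    case False
    then have "\<phi> x = 0" using closure_subset[of "{x. \<phi> x \<noteq> 0}"] by blast
    then show ?thesis by simp
  qed
  then show ?thesis using that by blast
qed

lemma frechet_shift:
  assumes "\<phi> differentiable (at (x + v))"
  shows "(\<lambda>x. \<phi> (x + v)) differentiable (at x)"
    and "frechet_derivative (\<lambda>x. \<phi> (x + v)) (at x) = frechet_derivative \<phi> (at (x + v))"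
proof -
  have "(\<phi> has_derivative frechet_derivative \<phi> (at (x + v))) (at (x + v))"
    using assms by (simp add: frechet_derivative_works[symmetric])
  moreover have "((\<lambda>x. x + v) has_derivative (\<lambda>h. h)) (at x)" by (auto intro!: derivative_eq_intros)
  ultimately have "((\<lambda>x. \<phi> (x + v)) has_derivative frechet_derivative \<phi> (at (x + v))) (at x)"
    using has_derivative_compose[of "\<lambda>x. x + v" "\<lambda>h. h" x UNIV \<phi>] by simp
  then show "(\<lambda>x. \<phi> (x + v)) differentiable (at x)"
    "frechet_derivative (\<lambda>x. \<phi> (x + v)) (at x) = frechet_derivative \<phi> (at (x + v))"
    by (auto intro: differentiableI simp: frechet_derivative_at[symmetric])
qed

lemma partial_shift: "test_function \<phi> \<Longrightarrow> partial i (\<lambda>x. \<phi> (x + v)) x = partial i \<phi> (x + v)"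
  unfolding partial_def by (simp add: frechet_shift test_function_differentiable)

lemma test_function_shift:
  assumes "test_function \<phi>"
  shows "test_function (\<lambda>x. \<phi> (x + v))"
  unfolding test_function_def
proof (intro conjI allI)
  fix "is" x
  have test: "test_function (foldr partial is \<phi>)" for "is"
    using assms by (induction "is") (auto intro: test_function_partial)
  have "foldr partial is (\<lambda>x. \<phi> (x + v)) = (\<lambda>x. foldr partial is \<phi> (x + v))" for "is"
  proof (induction "is")
    case (Cons i "is")
    have "foldr partial (i # is) (\<lambda>x. \<phi> (x + v)) = partial i (\<lambda>x. foldr partial is \<phi> (x + v))" by (simp add: Cons.IH)
    also have "\<dots> = (\<lambda>x. foldr partial (i # is) \<phi> (x + v))" by (rule ext) (simp add: partial_shift[OF test])
    finally show ?case .
  qed simp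
  then show "foldr partial is (\<lambda>x. \<phi> (x + v)) differentiable at x"
    using frechet_shift(1)[OF test_function_differentiable[OF test]] by simp
next
  have c: "compact (closure {x. \<phi> x \<noteq> 0})" using assms by (simp add: test_function_def)
  have "{x. \<phi> (x + v) \<noteq> 0} \<subseteq> (\<lambda>x. x - v) ` closure {x. \<phi> x \<noteq> 0}"
    using closure_subset[of "{x. \<phi> x \<noteq> 0}"] by (auto intro!: image_eqI[where x="_ + v"])
  moreover have k: "compact ((\<lambda>x. x - v) ` closure {x. \<phi> x \<noteq> 0})"
    by (intro compact_continuous_image c continuous_intros)
  ultimately have "closure {x. \<phi> (x + v) \<noteq> 0} \<subseteq> (\<lambda>x. x - v) ` closure {x. \<phi> x \<noteq> 0}"
    by (intro closure_minimal compact_imp_closed)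
  then show "compact (closure {x. \<phi> (x + v) \<noteq> 0})"
    using k by (meson bounded_subset closed_closure compact_eq_bounded_closed)
qed

text \<open>Products of bumps converge boundedly to indicators of boxes, and boxes generate the Borel sets.\<close>

lemma AE_zero_if_test_integrals_zero:
  fixes u :: "real^'n \<Rightarrow> real"
  assumes u: "integrable lborel u" and z: "\<And>\<phi>. test_function \<phi> \<Longrightarrow> (\<integral>x. u x * \<phi> x \<partial>lborel) = 0"
  shows "AE x in lborel. u x = 0"
proof -
  have um[measurable]: "u \<in> borel_measurable borel" using u by auto
  have box: "(\<integral>x. u x * indicator (box a b) x \<partial>lborel) = 0" for a b
  proof -
    let ?\<phi> = "\<lambda>m x. \<Prod>i\<in>UNIV. bump (a $ i) (b $ i) m (x $ i)"
    have "(\<lambda>m. \<integral>x. u x * ?\<phi> m x \<partial>lborel) \<longlonglongrightarrow> (\<integral>x. u x * indicator (box a b) x \<partial>lborel)"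
    proof (rule integral_dominated_convergence[where w="\<lambda>x. \<bar>u x\<bar>"])
      show "AE x in lborel. (\<lambda>m. u x * ?\<phi> m x) \<longlonglongrightarrow> u x * indicator (box a b) x"
      proof (intro AE_I2 tendsto_mult tendsto_const)
        fix x :: "real^'n"
        have "(\<lambda>m. ?\<phi> m x) \<longlonglongrightarrow> (\<Prod>i\<in>UNIV. indicator {a $ i<..<b $ i} (x $ i))"
          by (intro tendsto_prod bump_tendsto)
        also have "(\<Prod>i\<in>UNIV. indicator {a $ i<..<b $ i} (x $ i)) = (indicator (box a b) x :: real)"
          by (auto simp: indicator_def mem_box_cart prod_zero_iff)
        finally show "(\<lambda>m. ?\<phi> m x) \<longlonglongrightarrow> indicator (box a b) x" .
      qed
      show "AE x in lborel. norm (u x * ?\<phi> m x) \<le> \<bar>u x\<bar>" for m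
      proof (intro AE_I2)
        fix x :: "real^'n"
        have "\<bar>?\<phi> m x\<bar> \<le> 1" using bump_range by (auto simp: abs_prod intro!: prod_le_1)
        then have "\<bar>u x\<bar> * \<bar>?\<phi> m x\<bar> \<le> \<bar>u x\<bar> * 1" by (rule mult_left_mono) simp
        then show "norm (u x * ?\<phi> m x) \<le> \<bar>u x\<bar>" by (simp add: abs_mult)
      qed
      show "(\<lambda>x. u x * ?\<phi> m x) \<in> borel_measurable lborel" for m
        using test_function_measurable[OF test_function_tensor[of a b m]] by simp
    qed (use u in auto)
    then have "(\<lambda>m. 0) \<longlonglongrightarrow> (\<integral>x. u x * indicator (box a b) x \<partial>lborel)"
      by (simp add: z[OF test_function_tensor])
    then show ?thesis by (simp add: LIMSEQ_const_iff)
  qed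
  define p where "p x = ennreal (u x)" for x
  define n where "n x = ennreal (- u x)" for x
  have [measurable]: "p \<in> borel_measurable borel" "n \<in> borel_measurable borel" unfolding p_def n_def by measurable
  have fin: "(\<integral>\<^sup>+x. p x * indicator A x \<partial>lborel) < \<infinity>" "(\<integral>\<^sup>+x. n x * indicator A x \<partial>lborel) < \<infinity>" for A
  proof -
    have "(\<integral>\<^sup>+x. ennreal (norm (u x)) \<partial>lborel) < \<infinity>" using u by (simp add: integrable_iff_bounded)
    moreover have "(\<integral>\<^sup>+x. p x * indicator A x \<partial>lborel) \<le> (\<integral>\<^sup>+x. ennreal (norm (u x)) \<partial>lborel)"
      "(\<integral>\<^sup>+x. n x * indicator A x \<partial>lborel) \<le> (\<integral>\<^sup>+x. ennreal (norm (u x)) \<partial>lborel)"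
      by (auto intro!: nn_integral_mono ennreal_leI simp: p_def n_def split: split_indicator)
    ultimately show "(\<integral>\<^sup>+x. p x * indicator A x \<partial>lborel) < \<infinity>" "(\<integral>\<^sup>+x. n x * indicator A x \<partial>lborel) < \<infinity>" by auto
  qed
  have "density lborel p = density lborel n"
  proof (rule measure_eqI_generator_eq[where E="range (\<lambda>(a, b). box a b)" and \<Omega>=UNIV and A="\<lambda>i::nat. box (- (real i *\<^sub>R One)) (real i *\<^sub>R One)"])
    show "Int_stable (range (\<lambda>(a, b). box a b :: (real^'n) set))"
      by (auto simp: Int_stable_def box_Int_box)
    show "sets (density lborel p) = sigma_sets UNIV (range (\<lambda>(a, b). box a b))"
      "sets (density lborel n) = sigma_sets UNIV (range (\<lambda>(a, b). box a b))"
      by (simp_all add: borel_eq_box)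
    show "(\<Union>i::nat. box (- (real i *\<^sub>R One)) (real i *\<^sub>R One)) = (UNIV :: (real^'n) set)"
      unfolding UN_box_eq_UNIV[symmetric] by auto
    fix X assume "X \<in> range (\<lambda>(a, b). box a b :: (real^'n) set)"
    then obtain a b where X: "X = box a b" by auto
    have i: "integrable lborel (\<lambda>x. u x * indicator X x)"
      using u unfolding X by (intro integrable_real_mult_indicator) auto
    have e: "ennreal (u x * indicator X x) = p x * indicator X x" "ennreal (- (u x * indicator X x)) = n x * indicator X x" for x
      by (auto simp: p_def n_def split: split_indicator)
    have "enn2real (\<integral>\<^sup>+x. p x * indicator X x \<partial>lborel) - enn2real (\<integral>\<^sup>+x. n x * indicator X x \<partial>lborel) = 0"
      using real_lebesgue_integral_def[OF i] box[of a b] unfolding e by (simp add: X)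
    then have "(\<integral>\<^sup>+x. p x * indicator X x \<partial>lborel) = (\<integral>\<^sup>+x. n x * indicator X x \<partial>lborel)"
      using fin[of X] by (metis ennreal_enn2real eq_iff_diff_eq_0 infinity_ennreal_def)
    then show "emeasure (density lborel p) X = emeasure (density lborel n) X"
      unfolding X by (simp add: emeasure_density)
  next
    show "emeasure (density lborel p) (box (- (real i *\<^sub>R One)) (real i *\<^sub>R One)) \<noteq> \<infinity>" for i :: nat
      using fin by (simp add: emeasure_density less_top)
  qed auto
  then have "AE x in lborel. p x = n x"
    using fin(1)[of UNIV] by (intro finite_density_unique[THEN iffD1]) auto
  then show ?thesis
  proof eventually_elim
    case (elim x)
    show ?case
    proof (cases "0 \<le> u x")
      case True
      then have "n x = 0" by (simp add: n_def ennreal_neg)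
      then show ?thesis using elim True by (simp add: p_def)
    next
      case False
      then have "p x = 0" by (simp add: p_def ennreal_neg)
      then show ?thesis using elim False by (simp add: n_def)
    qed
  qed
qed


section \<open>Weak derivatives of integrable functions\<close>

text \<open>A first derivative of an integrable function, with integrable derivative.  Higher derivatives are
  handled one letter at a time, each as a first derivative of the preceding one.\<close>

definition weak_partial :: "'n \<Rightarrow> (real^'n \<Rightarrow> real) \<Rightarrow> (real^'n \<Rightarrow> real) \<Rightarrow> bool" where
  "weak_partial i G d \<longleftrightarrow> integrable lborel G \<and> integrable lborel d \<and>
     (\<forall>\<phi>. test_function \<phi> \<longrightarrow> (\<integral>x. G x * partial i \<phi> x \<partial>lborel) = - (\<integral>x. d x * \<phi> x \<partial>lborel))"

lemma exists_list_with_counts: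
  fixes \<nu> :: "'n::finite \<Rightarrow> nat"
  shows "\<exists>is. \<forall>i. count_list is i = \<nu> i"
proof -
  obtain xs :: "'n list" where xs: "set xs = UNIV" "distinct xs" using finite_distinct_list[OF finite_class.finite_UNIV] by blast
  have rep: "count_list (replicate m i) j = (if i = j then m else 0)" for m and i j :: 'n
    by (induction m) auto
  have "count_list (concat (map (\<lambda>i. replicate (\<nu> i) i) ys)) j = (if j \<in> set ys then \<nu> j else 0)" if "distinct ys" for ys j
    using that by (induction ys) (auto simp: count_list_append rep)
  then show ?thesis using xs by (metis UNIV_I)
qed

text \<open>Both functions are weak derivatives of the same \<open>f\<close>; testing the first identity with \<open>\<partial>\<^sub>i \<phi>\<close> and the
  second with \<open>\<phi>\<close> gives the same integral of \<open>f\<close>, up to the sign.\<close>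

lemma weak_partial_of_weak_deriv:
  fixes f :: "real^'n \<Rightarrow> real"
  assumes g: "has_weak_deriv \<mu> f g" and d: "has_weak_deriv (\<mu>(i := Suc (\<mu> i))) f d"
    and int: "integrable lborel g" "integrable lborel d"
  shows "weak_partial i g d"
  unfolding weak_partial_def
proof (intro conjI allI impI int)
  fix \<phi> :: "real^'n \<Rightarrow> real" assume \<phi>: "test_function \<phi>"
  obtain "is" where l: "\<And>j. count_list is j = \<mu> j" using exists_list_with_counts by metis
  have o: "multi_order (\<mu>(i := Suc (\<mu> i))) = Suc (multi_order \<mu>)"
  proof -
    have "multi_order (\<mu>(i := Suc (\<mu> i))) = (\<Sum>j\<in>UNIV. \<mu> j + (if j = i then 1 else 0))"
      unfolding multi_order_def by (intro sum.cong) auto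
    then show ?thesis by (simp add: sum.distrib multi_order_def)
  qed
  have "(\<integral>x. f x * foldr partial is (partial i \<phi>) x \<partial>lborel) = (- 1) ^ multi_order \<mu> * (\<integral>x. g x * partial i \<phi> x \<partial>lborel)"
    using g test_function_partial[OF \<phi>] l unfolding has_weak_deriv_def by blast
  moreover have "(\<integral>x. f x * foldr partial (is @ [i]) \<phi> x \<partial>lborel) = (- 1) ^ Suc (multi_order \<mu>) * (\<integral>x. d x * \<phi> x \<partial>lborel)"
  proof -
    have "\<forall>j. count_list (is @ [i]) j = (\<mu>(i := Suc (\<mu> i))) j" using l by auto
    then show ?thesis using d \<phi> unfolding has_weak_deriv_def o by blast
  qed
  ultimately show "(\<integral>x. g x * partial i \<phi> x \<partial>lborel) = - (\<integral>x. d x * \<phi> x \<partial>lborel)"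
    by (cases "even (multi_order \<mu>)") simp_all
qed

lemma integrable_lborel_shift:
  fixes G :: "'a::euclidean_space \<Rightarrow> real"
  assumes "integrable lborel G"
  shows "integrable lborel (\<lambda>x. G (x + v))" "(\<integral>x. G (x + v) \<partial>lborel) = (\<integral>x. G x \<partial>lborel)"
proof -
  have "integrable (distr lborel borel ((+) v)) G" unfolding lborel_distr_plus by (rule assms)
  then have "integrable lborel (\<lambda>x. G (v + x))" by (rule integrable_distr[rotated]) simp
  then show "integrable lborel (\<lambda>x. G (x + v))" by (simp add: add.commute)
  have "(\<integral>x. G x \<partial>lborel) = (\<integral>x. G x \<partial>distr lborel borel ((+) v))" unfolding lborel_distr_plus ..
  also have "\<dots> = (\<integral>x. G (v + x) \<partial>lborel)" using assms by (intro integral_distr) auto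
  finally show "(\<integral>x. G (x + v) \<partial>lborel) = (\<integral>x. G x \<partial>lborel)" by (simp add: add.commute)
qed

lemma integrable_times_test:
  fixes G \<phi> :: "real^'n \<Rightarrow> real"
  assumes "integrable lborel G" "test_function \<phi>"
  shows "integrable lborel (\<lambda>x. G x * \<phi> x)"
proof -
  obtain M where M: "\<And>x. \<bar>\<phi> x\<bar> \<le> M" using test_function_bounded[OF assms(2)] by blast
  have M0: "0 \<le> M" using M[of 0] by linarith
  note [measurable] = test_function_measurable[OF assms(2)]
  show ?thesis
  proof (rule Bochner_Integration.integrable_bound[of _ "\<lambda>x. M * G x"])
    show "AE x in lborel. norm (G x * \<phi> x) \<le> norm (M * G x)"
      using M M0 by (intro AE_I2) (auto simp: abs_mult mult.commute[of _ "\<bar>G _\<bar>"] intro!: mult_left_mono)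
  qed (use assms(1) in auto)
qed

lemma weak_partial_shift:
  fixes G d :: "real^'n \<Rightarrow> real"
  assumes "weak_partial i G d"
  shows "weak_partial i (\<lambda>x. G (x + v)) (\<lambda>x. d (x + v))"
  unfolding weak_partial_def
proof (intro conjI allI impI)
  have G: "integrable lborel G" "integrable lborel d" using assms by (auto simp: weak_partial_def)
  then show "integrable lborel (\<lambda>x. G (x + v))" "integrable lborel (\<lambda>x. d (x + v))" by (auto intro: integrable_lborel_shift)
  fix \<phi> :: "real^'n \<Rightarrow> real" assume \<phi>: "test_function \<phi>"
  define \<psi> where "\<psi> x = \<phi> (x + (- v))" for x
  have \<psi>: "test_function \<psi>" unfolding \<psi>_def[abs_def] by (rule test_function_shift[OF \<phi>])
  have p: "partial i \<psi> (x + v) = partial i \<phi> x" for x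
    unfolding \<psi>_def[abs_def] using partial_shift[OF \<phi>, of i "- v" "x + v"] by simp
  have "(\<integral>x. G (x + v) * partial i \<phi> x \<partial>lborel) = (\<integral>x. G (x + v) * partial i \<psi> (x + v) \<partial>lborel)" by (simp add: p)
  also have "\<dots> = (\<integral>x. G x * partial i \<psi> x \<partial>lborel)"
    by (rule integrable_lborel_shift(2)[OF integrable_times_test[OF G(1) test_function_partial[OF \<psi>]]])
  also have "\<dots> = - (\<integral>x. d x * \<psi> x \<partial>lborel)" using assms \<psi> by (simp add: weak_partial_def)
  also have "(\<integral>x. d x * \<psi> x \<partial>lborel) = (\<integral>x. d (x + v) * \<psi> (x + v) \<partial>lborel)"
    by (rule integrable_lborel_shift(2)[OF integrable_times_test[OF G(2) \<psi>], symmetric])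
  finally show "(\<integral>x. G (x + v) * partial i \<phi> x \<partial>lborel) = - (\<integral>x. d (x + v) * \<phi> x \<partial>lborel)" by (simp add: \<psi>_def)
qed

lemma weak_partial_diff:
  fixes G d G' d' :: "real^'n \<Rightarrow> real"
  assumes "weak_partial i G d" "weak_partial i G' d'"
  shows "weak_partial i (\<lambda>x. (G x - G' x) / r) (\<lambda>x. (d x - d' x) / r)"
  unfolding weak_partial_def
proof (intro conjI allI impI)
  have G: "integrable lborel G" "integrable lborel d" "integrable lborel G'" "integrable lborel d'"
    using assms by (auto simp: weak_partial_def)
  then show "integrable lborel (\<lambda>x. (G x - G' x) / r)" "integrable lborel (\<lambda>x. (d x - d' x) / r)" by auto
  fix \<phi> :: "real^'n \<Rightarrow> real" assume \<phi>: "test_function \<phi>"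
  have e: "(\<integral>x. (u x - u' x) / r * \<psi> x \<partial>lborel) = ((\<integral>x. u x * \<psi> x \<partial>lborel) - (\<integral>x. u' x * \<psi> x \<partial>lborel)) / r"
    if "integrable lborel u" "integrable lborel u'" "test_function \<psi>" for u u' \<psi> :: "real^'n \<Rightarrow> real"
  proof -
    have "(\<integral>x. (u x - u' x) / r * \<psi> x \<partial>lborel) = (\<integral>x. (u x * \<psi> x - u' x * \<psi> x) / r \<partial>lborel)"
      by (intro Bochner_Integration.integral_cong) (auto simp: left_diff_distrib)
    then show ?thesis using integrable_times_test[OF that(1,3)] integrable_times_test[OF that(2,3)] by simp
  qed
  show "(\<integral>x. (G x - G' x) / r * partial i \<phi> x \<partial>lborel) = - (\<integral>x. (d x - d' x) / r * \<phi> x \<partial>lborel)"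
    unfolding e[OF G(1,3) test_function_partial[OF \<phi>]] e[OF G(2,4) \<phi>]
    using assms \<phi> by (simp add: weak_partial_def diff_divide_distrib)
qed

lemma weak_partial_fdiff:
  fixes G d :: "real^'n \<Rightarrow> real"
  assumes "weak_partial i G d"
  shows "weak_partial i (fdiff e r W G) (fdiff e r W d)"
proof (induction W)
  case (Cons l W)
  obtain k j where l: "l = (k, j)" by force
  show ?case using weak_partial_diff[OF weak_partial_shift[OF Cons.IH] Cons.IH] weak_partial_shift[OF Cons.IH]
    by (cases k) (simp_all add: l)
qed (use assms in simp)

lemma partial_along_line:
  fixes \<phi> :: "real^'n \<Rightarrow> real"
  assumes "test_function \<phi>"
  shows "((\<lambda>s. \<phi> (x - s *\<^sub>R axis i 1)) has_real_derivative - partial i \<phi> (x - s *\<^sub>R axis i 1)) (at s)"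
proof -
  have 1: "(\<phi> has_derivative frechet_derivative \<phi> (at (x - s *\<^sub>R axis i 1))) (at (x - s *\<^sub>R axis i 1))"
    using test_function_differentiable[OF assms] by (simp add: frechet_derivative_works[symmetric])
  have 2: "((\<lambda>s. x - s *\<^sub>R axis i 1) has_derivative (\<lambda>k. - (k *\<^sub>R axis i 1))) (at s)"
    by (auto intro!: derivative_eq_intros)
  have "((\<lambda>s. \<phi> (x - s *\<^sub>R axis i 1)) has_derivative (\<lambda>k. frechet_derivative \<phi> (at (x - s *\<^sub>R axis i 1)) (- (k *\<^sub>R axis i 1)))) (at s)"
    by (rule has_derivative_compose[OF 2 1])
  moreover have "frechet_derivative \<phi> (at (x - s *\<^sub>R axis i 1)) (- (k *\<^sub>R axis i 1)) = - partial i \<phi> (x - s *\<^sub>R axis i 1) * k" for k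
    using linear_frechet_derivative[OF test_function_differentiable[OF assms], of "x - s *\<^sub>R axis i 1"]
    by (simp add: partial_def linear_neg linear_cmul)
  ultimately have "((\<lambda>s. \<phi> (x - s *\<^sub>R axis i 1)) has_derivative (\<lambda>k. - partial i \<phi> (x - s *\<^sub>R axis i 1) * k)) (at s)"
    by (simp only:)
  then show ?thesis unfolding has_field_derivative_def .
qed

text \<open>The fundamental theorem of calculus along a coordinate direction: tested against \<open>\<phi>\<close>, the
  increment of \<open>G\<close> becomes an increment of \<open>\<phi>\<close>, which is an integral of \<open>partial i \<phi>\<close>.\<close>

lemma weak_partial_increment:
  fixes G d :: "real^'n \<Rightarrow> real"
  assumes wp: "weak_partial i G d" and r: "0 < r"
  shows "AE x in lborel. G (x + r *\<^sub>R axis i 1) - G x = (LINT s:{0..r}|lborel. d (x + s *\<^sub>R axis i 1))"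
proof -
  have Gi: "integrable lborel G" and di: "integrable lborel d" using wp by (auto simp: weak_partial_def)
  have [measurable]: "G \<in> borel_measurable borel" "d \<in> borel_measurable borel" using Gi di by auto
  let ?e = "axis i 1 :: real^'n"
  have fub: "integrable (lborel \<Otimes>\<^sub>M lborel) (\<lambda>(s, x). indicator {0..r} s * (u (x + s *\<^sub>R a) * \<psi> (x + s *\<^sub>R b)))"
    if u: "integrable lborel u" and \<psi>: "test_function \<psi>" for u \<psi> and a b :: "real^'n"
  proof -
    obtain M where M: "\<And>x. \<bar>\<psi> x\<bar> \<le> M" using test_function_bounded[OF \<psi>] by blast
    have M0: "0 \<le> M" using M[of 0] by linarith
    note [measurable] = test_function_measurable[OF \<psi>]
    have [measurable]: "u \<in> borel_measurable borel" using u by auto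
    have us: "integrable lborel (\<lambda>x. u (x + v))" for v by (rule integrable_lborel_shift(1)[OF u])
    have ui: "integrable lborel (\<lambda>x. u (x + v) * \<psi> (x + v'))" for v v'
    proof (rule Bochner_Integration.integrable_bound[of _ "\<lambda>x. M * u (x + v)"])
      show "AE x in lborel. norm (u (x + v) * \<psi> (x + v')) \<le> norm (M * u (x + v))"
        using M M0 by (intro AE_I2) (auto simp: abs_mult mult.commute[of _ "\<bar>u _\<bar>"] intro!: mult_left_mono)
    qed (use us in auto)
    show ?thesis
    proof (rule lborel_pair.Fubini_integrable)
      show "(\<lambda>(s, x). indicator {0..r} s * (u (x + s *\<^sub>R a) * \<psi> (x + s *\<^sub>R b))) \<in> borel_measurable (lborel \<Otimes>\<^sub>M lborel)"
        by measurable
      show "AE s in lborel. integrable lborel (\<lambda>x. case (s, x) of (s, x) \<Rightarrow> indicator {0..r} s * (u (x + s *\<^sub>R a) * \<psi> (x + s *\<^sub>R b)))"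
        using ui by auto
      show "integrable lborel (\<lambda>s. \<integral>x. norm (case (s, x) of (s, x) \<Rightarrow> indicator {0..r} s * (u (x + s *\<^sub>R a) * \<psi> (x + s *\<^sub>R b))) \<partial>lborel)"
      proof (rule Bochner_Integration.integrable_bound[of _ "\<lambda>s. indicator {0..r} s * (M * (\<integral>x. \<bar>u x\<bar> \<partial>lborel))"])
        show "integrable lborel (\<lambda>s. indicator {0..r} s * (M * (\<integral>x. \<bar>u x\<bar> \<partial>lborel)))"
          using integrable_real_indicator[of "{0..r}" lborel] by (intro integrable_mult_left) (simp add: emeasure_lborel_Icc_eq)
        have le: "(\<integral>x. \<bar>u (x + s *\<^sub>R a) * \<psi> (x + s *\<^sub>R b)\<bar> \<partial>lborel) \<le> M * (\<integral>x. \<bar>u x\<bar> \<partial>lborel)" for s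
        proof -
          have "(\<integral>x. \<bar>u (x + s *\<^sub>R a) * \<psi> (x + s *\<^sub>R b)\<bar> \<partial>lborel) \<le> (\<integral>x. M * \<bar>u (x + s *\<^sub>R a)\<bar> \<partial>lborel)"
          proof (rule integral_mono)
            show "integrable lborel (\<lambda>x. \<bar>u (x + s *\<^sub>R a) * \<psi> (x + s *\<^sub>R b)\<bar>)" by (rule integrable_abs[OF ui])
            show "integrable lborel (\<lambda>x. M * \<bar>u (x + s *\<^sub>R a)\<bar>)" by (rule integrable_mult_right[OF integrable_abs[OF us]])
            show "\<bar>u (x + s *\<^sub>R a) * \<psi> (x + s *\<^sub>R b)\<bar> \<le> M * \<bar>u (x + s *\<^sub>R a)\<bar>" for x
              using mult_left_mono[OF M[of "x + s *\<^sub>R b"], of "\<bar>u (x + s *\<^sub>R a)\<bar>"] by (simp add: abs_mult mult.commute)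
          qed
          also have "\<dots> = M * (\<integral>x. \<bar>u x\<bar> \<partial>lborel)"
            using integrable_lborel_shift(2)[OF integrable_abs[OF u], of "s *\<^sub>R a"] by simp
          finally show ?thesis .
        qed
        show "AE s in lborel. norm (\<integral>x. norm (case (s, x) of (s, x) \<Rightarrow> indicator {0..r} s * (u (x + s *\<^sub>R a) * \<psi> (x + s *\<^sub>R b))) \<partial>lborel)
            \<le> norm (indicator {0..r} s * (M * (\<integral>x. \<bar>u x\<bar> \<partial>lborel)))"
          using le M0 by (intro AE_I2) (auto split: split_indicator simp: abs_of_nonneg integral_nonneg_AE)
      qed measurable
    qed
  qed
  have swap: "(\<integral>x. (LINT s:{0..r}|lborel. u (x + s *\<^sub>R a) * \<psi> (x + s *\<^sub>R b)) \<partial>lborel) =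
      (LINT s:{0..r}|lborel. (\<integral>x. u (x + s *\<^sub>R a) * \<psi> (x + s *\<^sub>R b) \<partial>lborel))"
    if u: "integrable lborel u" and \<psi>: "test_function \<psi>" for u \<psi> and a b :: "real^'n"
    using lborel_pair.Fubini_integral[of "\<lambda>s x. indicator {0..r} s * (u (x + s *\<^sub>R a) * \<psi> (x + s *\<^sub>R b))"] fub[OF that, of a b]
    by (simp add: set_lebesgue_integral_def)
  define D where "D x = (LINT s:{0..r}|lborel. d (x + s *\<^sub>R ?e))" for x
  have dm: "integrable (lborel \<Otimes>\<^sub>M lborel) (\<lambda>(s, x). indicator {0..r} s * d (x + s *\<^sub>R ?e))"
  proof (rule lborel_pair.Fubini_integrable)
    show "AE s in lborel. integrable lborel (\<lambda>x. case (s, x) of (s, x) \<Rightarrow> indicator {0..r} s * d (x + s *\<^sub>R ?e))"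
      using integrable_lborel_shift(1)[OF di] by auto
    have "(\<integral>x. norm (case (s, x) of (s, x) \<Rightarrow> indicator {0..r} s * d (x + s *\<^sub>R ?e)) \<partial>lborel) = indicator {0..r} s * (\<integral>x. \<bar>d x\<bar> \<partial>lborel)" for s
      using integrable_lborel_shift(2)[OF integrable_abs[OF di], of "s *\<^sub>R ?e"] by (simp add: abs_mult)
    then show "integrable lborel (\<lambda>s. \<integral>x. norm (case (s, x) of (s, x) \<Rightarrow> indicator {0..r} s * d (x + s *\<^sub>R ?e)) \<partial>lborel)"
      using integrable_real_indicator[of "{0..r}" lborel] by (simp only:) (intro integrable_mult_left, simp add: emeasure_lborel_Icc_eq)
  qed measurable
  have Di: "integrable lborel D"
    using lborel_pair.integrable_snd[of "\<lambda>s x. indicator {0..r} s * d (x + s *\<^sub>R ?e)"] dm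
    unfolding D_def[abs_def] set_lebesgue_integral_def by simp
  have "AE x in lborel. (G (x + r *\<^sub>R ?e) - G x) - D x = 0"
  proof (rule AE_zero_if_test_integrals_zero)
    have G': "integrable lborel (\<lambda>x. G (x + r *\<^sub>R ?e))" by (rule integrable_lborel_shift(1)[OF Gi])
    then show "integrable lborel (\<lambda>x. (G (x + r *\<^sub>R ?e) - G x) - D x)" using Gi Di by simp
    fix \<phi> :: "real^'n \<Rightarrow> real" assume \<phi>: "test_function \<phi>"
    have line: "(LINT s:{0..r}|lborel. partial i \<phi> (x - s *\<^sub>R ?e)) = \<phi> x - \<phi> (x - r *\<^sub>R ?e)" for x
    proof -
      have c: "isCont (\<lambda>s. - partial i \<phi> (x - s *\<^sub>R ?e)) s" for s
      proof -
        have "isCont (partial i \<phi>) y" for y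
          using test_function_continuous[OF test_function_partial[OF \<phi>]] by (simp add: continuous_on_eq_continuous_at)
        moreover have "isCont (\<lambda>s. x - s *\<^sub>R ?e) s" by (intro continuous_intros)
        ultimately have "isCont (\<lambda>s. partial i \<phi> (x - s *\<^sub>R ?e)) s" by (rule isCont_o2[rotated])
        then show ?thesis by (rule continuous_minus)
      qed
      have "(LINT s|lborel. - partial i \<phi> (x - s *\<^sub>R ?e) * indicator {0..r} s) = \<phi> (x - r *\<^sub>R ?e) - \<phi> (x - 0 *\<^sub>R ?e)"
        using r c partial_along_line[OF \<phi>] by (intro integral_FTC_Icc_real[where F="\<lambda>s. \<phi> (x - s *\<^sub>R ?e)"]) auto
      then show ?thesis by (simp add: set_lebesgue_integral_def mult.commute)
    qed
    have "(\<integral>x. G (x + r *\<^sub>R ?e) * \<phi> x \<partial>lborel) = (\<integral>x. G x * \<phi> (x - r *\<^sub>R ?e) \<partial>lborel)"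
      using integrable_lborel_shift(2)[OF integrable_times_test[OF Gi test_function_shift[OF \<phi>, of "- (r *\<^sub>R ?e)"]], of "r *\<^sub>R ?e"] by simp
    then have "(\<integral>x. G (x + r *\<^sub>R ?e) * \<phi> x \<partial>lborel) - (\<integral>x. G x * \<phi> x \<partial>lborel) = (\<integral>x. G x * \<phi> (x - r *\<^sub>R ?e) - G x * \<phi> x \<partial>lborel)"
      using integrable_times_test[OF Gi \<phi>] integrable_times_test[OF Gi test_function_shift[OF \<phi>, of "- (r *\<^sub>R ?e)"]] by simp
    also have "\<dots> = (\<integral>x. - (LINT s:{0..r}|lborel. G (x + s *\<^sub>R 0) * partial i \<phi> (x + s *\<^sub>R (- ?e))) \<partial>lborel)"
    proof (intro Bochner_Integration.integral_cong refl)
      fix x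
      have "(LINT s:{0..r}|lborel. G (x + s *\<^sub>R 0) * partial i \<phi> (x + s *\<^sub>R (- ?e))) = G x * (LINT s:{0..r}|lborel. partial i \<phi> (x - s *\<^sub>R ?e))"
        by simp
      then show "G x * \<phi> (x - r *\<^sub>R ?e) - G x * \<phi> x = - (LINT s:{0..r}|lborel. G (x + s *\<^sub>R 0) * partial i \<phi> (x + s *\<^sub>R (- ?e)))"
        by (simp add: line right_diff_distrib)
    qed
    also have "\<dots> = - (LINT s:{0..r}|lborel. (\<integral>x. G (x + s *\<^sub>R 0) * partial i \<phi> (x + s *\<^sub>R (- ?e)) \<partial>lborel))"
      by (subst swap[OF Gi test_function_partial[OF \<phi>], symmetric]) simp
    also have "\<dots> = (LINT s:{0..r}|lborel. (\<integral>x. d (x + s *\<^sub>R ?e) * \<phi> (x + s *\<^sub>R 0) \<partial>lborel))"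
    proof -
      have "(\<integral>x. G (x + s *\<^sub>R 0) * partial i \<phi> (x + s *\<^sub>R (- ?e)) \<partial>lborel) = - (\<integral>x. d (x + s *\<^sub>R ?e) * \<phi> (x + s *\<^sub>R 0) \<partial>lborel)" for s
      proof -
        have \<phi>s: "test_function (\<lambda>x. \<phi> (x + - (s *\<^sub>R ?e)))" by (rule test_function_shift[OF \<phi>])
        have "(\<integral>x. G (x + s *\<^sub>R 0) * partial i \<phi> (x + s *\<^sub>R (- ?e)) \<partial>lborel) = (\<integral>x. G x * partial i (\<lambda>x. \<phi> (x + - (s *\<^sub>R ?e))) x \<partial>lborel)"
          by (simp add: partial_shift[OF \<phi>, of i "- (s *\<^sub>R ?e)", simplified])
        also have "\<dots> = - (\<integral>x. d x * \<phi> (x + - (s *\<^sub>R ?e)) \<partial>lborel)"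
          using wp \<phi>s unfolding weak_partial_def by blast
        also have "(\<integral>x. d x * \<phi> (x + - (s *\<^sub>R ?e)) \<partial>lborel) = (\<integral>x. d (x + s *\<^sub>R ?e) * \<phi> (x + s *\<^sub>R 0) \<partial>lborel)"
          using integrable_lborel_shift(2)[OF integrable_times_test[OF di \<phi>s], of "s *\<^sub>R ?e"] by simp
        finally show ?thesis .
      qed
      then show ?thesis by (simp add: set_lebesgue_integral_def)
    qed
    also have "\<dots> = (\<integral>x. (LINT s:{0..r}|lborel. d (x + s *\<^sub>R ?e) * \<phi> (x + s *\<^sub>R 0)) \<partial>lborel)"
      by (rule swap[OF di \<phi>, symmetric])
    also have "\<dots> = (\<integral>x. D x * \<phi> x \<partial>lborel)" by (simp add: D_def)
    finally show "(\<integral>x. (G (x + r *\<^sub>R ?e) - G x - D x) * \<phi> x \<partial>lborel) = 0"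
      using integrable_times_test[OF Gi \<phi>] integrable_times_test[OF G' \<phi>] integrable_times_test[OF Di \<phi>]
      by (simp add: left_diff_distrib)
  qed
  then show ?thesis by (simp add: D_def)
qed

text \<open>A difference quotient is an average of translates of the weak derivative.\<close>

lemma wint_difference_quotient_le:
  fixes G d g :: "real^'n \<Rightarrow> real"
  assumes wp: "weak_partial i G d" and r: "0 < r" and [measurable]: "w \<in> borel_measurable borel" and w: "\<And>x. 0 \<le> w x"
    and g[measurable]: "g \<in> borel_measurable borel"
    and B: "\<And>s. s \<in> {0..r} \<Longrightarrow> wint w (\<lambda>x. d (x + s *\<^sub>R axis i 1) - g x) \<le> B"
  shows "wint w (\<lambda>x. (G (x + r *\<^sub>R axis i 1) - G x) / r - g x) \<le> B"
proof -
  let ?e = "axis i 1 :: real^'n"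
  have di: "integrable lborel d" using wp by (auto simp: weak_partial_def)
  have [measurable]: "d \<in> borel_measurable borel" using di by auto
  have point: "AE x in lborel. ennreal (\<bar>(G (x + r *\<^sub>R ?e) - G x) / r - g x\<bar> * w x) \<le>
     ennreal (1 / r) * (\<integral>\<^sup>+s. indicator {0..r} s * ennreal (\<bar>d (x + s *\<^sub>R ?e) - g x\<bar> * w x) \<partial>lborel)"
    using weak_partial_increment[OF wp r]
  proof eventually_elim
    case (elim x)
    define p where "p s = d (x + s *\<^sub>R ?e) - g x" for s
    have [measurable]: "p \<in> borel_measurable borel" unfolding p_def by measurable
    have rhs: "(\<integral>\<^sup>+s. indicator {0..r} s * ennreal (\<bar>p s\<bar> * w x) \<partial>lborel) = (\<integral>\<^sup>+s. ennreal \<bar>indicator {0..r} s * p s\<bar> \<partial>lborel) * ennreal (w x)"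
      by (subst nn_integral_multc[symmetric]) (auto intro!: nn_integral_cong simp: ennreal_mult' w split: split_indicator)
    show ?case
    proof (cases "integrable lborel (\<lambda>s. indicator {0..r} s * p s)")
      case True
      have c: "integrable lborel (\<lambda>s::real. indicator {0..r} s * g x)" "(LINT s|lborel. indicator {0..r} s * g x) = r * g x"
        using integrable_real_indicator[of "{0..r}" lborel] r by (auto simp: emeasure_lborel_Icc_eq)
      have "(LINT s|lborel. indicator {0..r} s * p s) + r * g x = (LINT s|lborel. indicator {0..r} s * p s + indicator {0..r} s * g x)"
        by (subst Bochner_Integration.integral_add[OF True c(1)]) (simp only: c(2))
      also have "\<dots> = G (x + r *\<^sub>R ?e) - G x"
        unfolding elim set_lebesgue_integral_def by (intro Bochner_Integration.integral_cong) (auto simp: p_def right_diff_distrib)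
      finally have e: "(G (x + r *\<^sub>R ?e) - G x) / r - g x = (LINT s|lborel. indicator {0..r} s * p s) / r"
        using r by (simp add: field_simps)
      have "ennreal \<bar>LINT s|lborel. indicator {0..r} s * p s\<bar> \<le> (\<integral>\<^sup>+s. ennreal \<bar>indicator {0..r} s * p s\<bar> \<partial>lborel)"
        using integral_norm_bound_ennreal[OF True] by simp
      then have "ennreal (1 / r) * (ennreal \<bar>LINT s|lborel. indicator {0..r} s * p s\<bar> * ennreal (w x)) \<le>
         ennreal (1 / r) * ((\<integral>\<^sup>+s. ennreal \<bar>indicator {0..r} s * p s\<bar> \<partial>lborel) * ennreal (w x))"
        by (intro mult_left_mono mult_right_mono) auto
      moreover have "ennreal (1 / r) * (ennreal \<bar>LINT s|lborel. indicator {0..r} s * p s\<bar> * ennreal (w x)) =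
         ennreal (\<bar>(G (x + r *\<^sub>R ?e) - G x) / r - g x\<bar> * w x)"
        unfolding e using r w by (simp add: ennreal_mult[symmetric])
      ultimately show ?thesis using rhs by (simp add: p_def)
    next
      case False
      then have "(\<integral>\<^sup>+s. ennreal \<bar>indicator {0..r} s * p s\<bar> \<partial>lborel) = \<infinity>"
        by (auto simp: integrable_iff_bounded less_top[symmetric])
      then show ?thesis
      proof (cases "w x = 0")
        case False
        then have "0 < w x" using w[of x] by simp
        then show ?thesis using rhs r \<open>(\<integral>\<^sup>+s. ennreal \<bar>indicator {0..r} s * p s\<bar> \<partial>lborel) = \<infinity>\<close>
          by (simp add: p_def ennreal_top_mult ennreal_mult_top)
      qed simp
    qed
  qed
  have "wint w (\<lambda>x. (G (x + r *\<^sub>R ?e) - G x) / r - g x) \<le>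
     (\<integral>\<^sup>+x. ennreal (1 / r) * (\<integral>\<^sup>+s. indicator {0..r} s * ennreal (\<bar>d (x + s *\<^sub>R ?e) - g x\<bar> * w x) \<partial>lborel) \<partial>lborel)"
    unfolding wint_def by (rule nn_integral_mono_AE[OF point])
  also have "\<dots> = ennreal (1 / r) * (\<integral>\<^sup>+x. \<integral>\<^sup>+s. indicator {0..r} s * ennreal (\<bar>d (x + s *\<^sub>R ?e) - g x\<bar> * w x) \<partial>lborel \<partial>lborel)"
    by (rule nn_integral_cmult) measurable
  also have "(\<integral>\<^sup>+x. \<integral>\<^sup>+s. indicator {0..r} s * ennreal (\<bar>d (x + s *\<^sub>R ?e) - g x\<bar> * w x) \<partial>lborel \<partial>lborel) =
     (\<integral>\<^sup>+s. \<integral>\<^sup>+x. indicator {0..r} s * ennreal (\<bar>d (x + s *\<^sub>R ?e) - g x\<bar> * w x) \<partial>lborel \<partial>lborel)"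
    by (rule lborel_pair.Fubini') measurable
  also have "\<dots> = (\<integral>\<^sup>+s. indicator {0..r} s * wint w (\<lambda>x. d (x + s *\<^sub>R ?e) - g x) \<partial>lborel)"
  proof (intro nn_integral_cong)
    fix s
    have "(\<lambda>x. d (x + s *\<^sub>R ?e)) \<in> borel_measurable borel"
      by (rule measurable_compose[OF _ \<open>d \<in> borel_measurable borel\<close>]) simp
    then have "(\<lambda>x. ennreal (\<bar>d (x + s *\<^sub>R ?e) - g x\<bar> * w x)) \<in> borel_measurable lborel"
      by simp
    then show "(\<integral>\<^sup>+x. indicator {0..r} s * ennreal (\<bar>d (x + s *\<^sub>R ?e) - g x\<bar> * w x) \<partial>lborel) =
        indicator {0..r} s * wint w (\<lambda>x. d (x + s *\<^sub>R ?e) - g x)"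
      unfolding wint_def by (rule nn_integral_cmult)
  qed
  also have "\<dots> \<le> (\<integral>\<^sup>+s. indicator {0..r} s * B \<partial>lborel)"
    using B by (intro nn_integral_mono) (auto split: split_indicator)
  also have "\<dots> = ennreal r * B"
    using r by (subst nn_integral_multc) auto
  also have "ennreal (1 / r) * (ennreal r * B) = B"
    using r by (simp add: mult.assoc[symmetric] ennreal_mult[symmetric])
  finally show ?thesis by (simp add: mult_left_mono)
qed

section \<open>Continuity of translations\<close>

text \<open>By density it suffices to consider the indicator of a Borel set of finite measure, which is
  approximated from outside by an open set; for an open set the indicators converge pointwise.\<close>

lemma translation_L1:
  fixes g :: "'a::euclidean_space \<Rightarrow> real" and v :: "nat \<Rightarrow> 'a"
  assumes g: "integrable lborel g" and v: "v \<longlonglongrightarrow> 0"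
  shows "(\<lambda>n. wint (\<lambda>x. 1) (\<lambda>x. g (x + v n) - g x)) \<longlonglongrightarrow> 0"
  using g
proof (induction rule: integrable_induct)
  case (base A c)
  have A[measurable]: "A \<in> sets borel" using base by simp
  show ?case
  proof (rule tendsto_zero_ennreal)
    fix \<epsilon> :: real assume \<epsilon>: "0 < \<epsilon>"
    define \<delta> where "\<delta> = \<epsilon> / (4 * (1 + \<bar>c\<bar>))"
    have \<delta>: "0 < \<delta>" using \<epsilon> by (simp add: \<delta>_def)
    obtain U where U: "open U" "A \<subseteq> U" "emeasure lebesgue (U - A) < ennreal \<delta>"
      using sets_lebesgue_outer_open[of A \<delta>] \<delta> A by (metis sets_completionI_sets sets_lborel)
    have Um[measurable]: "U \<in> sets borel" using U by simp
    have UA: "emeasure lborel (U - A) \<le> ennreal \<delta>" using U(3) by simp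
    have Ufin: "emeasure lborel U < \<infinity>"
    proof -
      have "emeasure lborel U \<le> emeasure lborel A + emeasure lborel (U - A)"
        using U(2) emeasure_subadditive[of A lborel "U - A"] by (simp add: Un_absorb1)
      also have "\<dots> < \<infinity>" using base UA by (auto simp: ennreal_add_less_top less_top[symmetric] top_unique)
      finally show ?thesis .
    qed
    have lim: "(\<lambda>n. \<integral>\<^sup>+x. ennreal (indicator U x * (1 - indicator U (x + v n))) \<partial>lborel) \<longlonglongrightarrow> (\<integral>\<^sup>+x. 0 \<partial>(lborel :: 'a measure))"
    proof (rule nn_integral_dominated_convergence[where w="\<lambda>x. indicator U x"])
      show "AE x in lborel. (\<lambda>n. ennreal (indicator U x * (1 - indicator U (x + v n)))) \<longlonglongrightarrow> 0"
      proof (rule AE_I2)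
        fix x
        show "(\<lambda>n. ennreal (indicator U x * (1 - indicator U (x + v n)))) \<longlonglongrightarrow> 0"
        proof (cases "x \<in> U")
          case True
          have "(\<lambda>n. x + v n) \<longlonglongrightarrow> x + 0" by (intro tendsto_intros v)
          then have "\<forall>\<^sub>F n in sequentially. x + v n \<in> U" using True U(1) by (intro topological_tendstoD) auto
          then have "\<forall>\<^sub>F n in sequentially. 0 = ennreal (indicator U x * (1 - indicator U (x + v n)))"
            by eventually_elim simp
          then show ?thesis by (rule Lim_transform_eventually[OF tendsto_const])
        qed simp
      qed
      show "AE x in lborel. ennreal (indicator U x * (1 - indicator U (x + v n))) \<le> indicator U x" for n
        by (intro AE_I2) (auto split: split_indicator)
    qed (use Ufin in auto)
    have half: "(\<integral>\<^sup>+x. ennreal \<bar>indicator U (x + v n) - indicator U x\<bar> \<partial>lborel) \<le> 2 * (\<integral>\<^sup>+x. ennreal (indicator U x * (1 - indicator U (x + v n))) \<partial>lborel)" for n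
    proof -
      let ?P = "\<integral>\<^sup>+x. ennreal (indicator U x * (1 - indicator U (x + v n))) \<partial>lborel"
      let ?N = "\<integral>\<^sup>+x. ennreal (indicator U (x + v n) * (1 - indicator U x)) \<partial>lborel"
      let ?I = "\<integral>\<^sup>+x. ennreal (indicator U x * indicator U (x + v n)) \<partial>lborel"
      have "?P + ?I = (\<integral>\<^sup>+x. ennreal (indicator U x) \<partial>lborel)"
        by (subst nn_integral_add[symmetric]) (auto intro!: nn_integral_cong split: split_indicator)
      also have "\<dots> = (\<integral>\<^sup>+x. ennreal (indicator U (x + v n)) \<partial>lborel)"
        by (rule nn_integral_lborel_shift[symmetric]) measurable
      also have "\<dots> = ?N + ?I"
        by (subst nn_integral_add[symmetric]) (auto intro!: nn_integral_cong split: split_indicator)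
      finally have PN: "?I + ?P = ?I + ?N" by (simp only: add.commute)
      have "?I \<le> (\<integral>\<^sup>+x. indicator U x \<partial>lborel)" by (intro nn_integral_mono) (auto split: split_indicator)
      then have "?I \<noteq> top" using Ufin by (auto simp: top_unique)
      then have PN': "?N = ?P" using PN by (auto simp: ennreal_add_left_cancel)
      have "(\<integral>\<^sup>+x. ennreal \<bar>indicator U (x + v n) - indicator U x\<bar> \<partial>lborel) = ?P + ?N"
        by (subst nn_integral_add[symmetric]) (auto intro!: nn_integral_cong split: split_indicator)
      then show ?thesis unfolding PN' by (simp add: mult_2)
    qed
    have main: "wint (\<lambda>x. 1) (\<lambda>x. indicator A (x + v n) *\<^sub>R c - indicator A x *\<^sub>R c) \<le>
        ennreal \<bar>c\<bar> * (ennreal (2 * \<delta>) + 2 * (\<integral>\<^sup>+x. ennreal (indicator U x * (1 - indicator U (x + v n))) \<partial>lborel))" for n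
    proof -
      have "wint (\<lambda>x. 1) (\<lambda>x. indicator A (x + v n) *\<^sub>R c - indicator A x *\<^sub>R c) \<le>
         (\<integral>\<^sup>+x. ennreal \<bar>c\<bar> * ((indicator (U - A) (x + v n) + indicator (U - A) x) + ennreal \<bar>indicator U (x + v n) - indicator U x\<bar>) \<partial>lborel)"
        unfolding wint_def
      proof (rule nn_integral_mono)
        fix x
        have "ennreal (\<bar>indicator A (x + v n) *\<^sub>R c - indicator A x *\<^sub>R c\<bar> * 1) = ennreal \<bar>c\<bar> * ennreal \<bar>indicator A (x + v n) - indicator A x\<bar>"
          by (auto split: split_indicator)
        also have "\<dots> \<le> ennreal \<bar>c\<bar> * ((indicator (U - A) (x + v n) + indicator (U - A) x) + ennreal \<bar>indicator U (x + v n) - indicator U x\<bar>)"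
          using U(2) by (intro mult_left_mono) (auto split: split_indicator)
        finally show "ennreal (\<bar>indicator A (x + v n) *\<^sub>R c - indicator A x *\<^sub>R c\<bar> * 1) \<le>
          ennreal \<bar>c\<bar> * ((indicator (U - A) (x + v n) + indicator (U - A) x) + ennreal \<bar>indicator U (x + v n) - indicator U x\<bar>)" .
      qed
      also have "\<dots> = ennreal \<bar>c\<bar> * (((\<integral>\<^sup>+x. indicator (U - A) (x + v n) \<partial>lborel) + (\<integral>\<^sup>+x. indicator (U - A) x \<partial>lborel)) + (\<integral>\<^sup>+x. ennreal \<bar>indicator U (x + v n) - indicator U x\<bar> \<partial>lborel))"
        by (simp add: nn_integral_cmult nn_integral_add del: nn_integral_indicator)
      also have "(\<integral>\<^sup>+x. indicator (U - A) (x + v n) \<partial>lborel) = (\<integral>\<^sup>+x. indicator (U - A) x \<partial>lborel)"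
        by (rule nn_integral_lborel_shift) measurable
      also have "(\<integral>\<^sup>+x. indicator (U - A) x \<partial>lborel) = emeasure lborel (U - A)" by simp
      also have "ennreal \<bar>c\<bar> * ((emeasure lborel (U - A) + emeasure lborel (U - A)) + (\<integral>\<^sup>+x. ennreal \<bar>indicator U (x + v n) - indicator U x\<bar> \<partial>lborel)) \<le>
         ennreal \<bar>c\<bar> * ((ennreal \<delta> + ennreal \<delta>) + 2 * (\<integral>\<^sup>+x. ennreal (indicator U x * (1 - indicator U (x + v n))) \<partial>lborel))"
        by (intro mult_left_mono add_mono UA half) auto
      also have "ennreal \<delta> + ennreal \<delta> = ennreal (2 * \<delta>)" using \<delta> by (simp add: ennreal_plus[symmetric] del: ennreal_plus)
      finally show ?thesis .
    qed
    have "(\<lambda>n. ennreal \<bar>c\<bar> * (ennreal (2 * \<delta>) + 2 * (\<integral>\<^sup>+x. ennreal (indicator U x * (1 - indicator U (x + v n))) \<partial>lborel)))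
        \<longlonglongrightarrow> ennreal \<bar>c\<bar> * (ennreal (2 * \<delta>) + 2 * (\<integral>\<^sup>+x. 0 \<partial>(lborel :: 'a measure)))"
      by (intro ennreal_tendsto_cmult tendsto_add tendsto_const lim) auto
    moreover have "ennreal \<bar>c\<bar> * (ennreal (2 * \<delta>) + 2 * (\<integral>\<^sup>+x. 0 \<partial>(lborel :: 'a measure))) < ennreal \<epsilon>"
    proof -
      have "\<bar>c\<bar> * (2 * \<delta>) < \<epsilon>" using \<epsilon> by (simp add: \<delta>_def field_simps add_pos_nonneg)
      then show ?thesis using \<epsilon> \<delta> by (simp add: ennreal_mult[symmetric] ennreal_lessI)
    qed
    ultimately have "\<forall>\<^sub>F n in sequentially. ennreal \<bar>c\<bar> * (ennreal (2 * \<delta>) + 2 * (\<integral>\<^sup>+x. ennreal (indicator U x * (1 - indicator U (x + v n))) \<partial>lborel)) < ennreal \<epsilon>"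
      by (rule order_tendstoD(2))
    then show "\<forall>\<^sub>F n in sequentially. wint (\<lambda>x. 1) (\<lambda>x. indicator A (x + v n) *\<^sub>R c - indicator A x *\<^sub>R c) < ennreal \<epsilon>"
      by eventually_elim (rule le_less_trans[OF main])
  qed
next
  case (add f g)
  have [measurable]: "f \<in> borel_measurable borel" "g \<in> borel_measurable borel" using add by auto
  have le: "wint (\<lambda>x. 1) (\<lambda>x. f (x + v n) + g (x + v n) - (f x + g x)) \<le> wint (\<lambda>x. 1) (\<lambda>x. f (x + v n) - f x) + wint (\<lambda>x. 1) (\<lambda>x. g (x + v n) - g x)" for n
    unfolding wint_def
    by (subst nn_integral_add[symmetric]) (auto intro!: nn_integral_mono ennreal_leI simp: ennreal_plus[symmetric] simp del: ennreal_plus)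
  have "(\<lambda>n. wint (\<lambda>x. 1) (\<lambda>x. f (x + v n) - f x) + wint (\<lambda>x. 1) (\<lambda>x. g (x + v n) - g x)) \<longlonglongrightarrow> 0 + 0"
    by (intro tendsto_add add.IH)
  then have lm: "(\<lambda>n. wint (\<lambda>x. 1) (\<lambda>x. f (x + v n) - f x) + wint (\<lambda>x. 1) (\<lambda>x. g (x + v n) - g x)) \<longlonglongrightarrow> 0"
    by simp
  show ?case
    by (rule tendsto_sandwich[OF always_eventually[OF allI] always_eventually[OF allI] tendsto_const lm])
      (simp, rule le)
next
  case (lim f s)
  have fm[measurable]: "f \<in> borel_measurable borel" and sm[measurable]: "\<And>i. s i \<in> borel_measurable borel" using lim by auto
  have s0: "(\<lambda>i. \<integral>\<^sup>+x. ennreal \<bar>s i x - f x\<bar> \<partial>lborel) \<longlonglongrightarrow> (\<integral>\<^sup>+x. 0 \<partial>(lborel :: 'a measure))"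
  proof (rule nn_integral_dominated_convergence[where w="\<lambda>x. ennreal (3 * \<bar>f x\<bar>)"])
    show "(\<integral>\<^sup>+x. ennreal (3 * \<bar>f x\<bar>) \<partial>lborel) < \<infinity>"
    proof -
      have "(\<integral>\<^sup>+x. ennreal (3 * \<bar>f x\<bar>) \<partial>lborel) = ennreal 3 * (\<integral>\<^sup>+x. ennreal \<bar>f x\<bar> \<partial>lborel)"
        by (subst nn_integral_cmult[symmetric]) (auto simp: ennreal_mult)
      also have "\<dots> < \<infinity>" using lim.hyps(4) by (simp add: integrable_iff_bounded ennreal_mult_less_top)
      finally show ?thesis .
    qed
    show "AE x in lborel. ennreal \<bar>s i x - f x\<bar> \<le> ennreal (3 * \<bar>f x\<bar>)" for i
    proof (intro AE_I2 ennreal_leI)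
      fix x :: 'a
      have "\<bar>s i x\<bar> \<le> 2 * \<bar>f x\<bar>" using lim.hyps(3)[of x i] by simp
      then show "\<bar>s i x - f x\<bar> \<le> 3 * \<bar>f x\<bar>" by linarith
    qed
    show "AE x in lborel. (\<lambda>i. ennreal \<bar>s i x - f x\<bar>) \<longlonglongrightarrow> 0"
    proof (rule AE_I2)
      fix x :: 'a
      have "(\<lambda>i. \<bar>s i x - f x\<bar>) \<longlonglongrightarrow> \<bar>f x - f x\<bar>" using lim.hyps(2)[of x] by (intro tendsto_intros) auto
      then have "(\<lambda>i. ennreal \<bar>s i x - f x\<bar>) \<longlonglongrightarrow> ennreal \<bar>f x - f x\<bar>" by (rule tendsto_ennrealI)
      then show "(\<lambda>i. ennreal \<bar>s i x - f x\<bar>) \<longlonglongrightarrow> 0" by simp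
    qed
  qed auto
  show ?case
  proof (rule tendsto_zero_ennreal)
    fix \<epsilon> :: real assume \<epsilon>: "0 < \<epsilon>"
    have "\<forall>\<^sub>F i in sequentially. (\<integral>\<^sup>+x. ennreal \<bar>s i x - f x\<bar> \<partial>lborel) < ennreal (\<epsilon> / 4)"
      using order_tendstoD(2)[OF s0, of "ennreal (\<epsilon> / 4)"] \<epsilon> by simp
    then obtain i where i: "(\<integral>\<^sup>+x. ennreal \<bar>s i x - f x\<bar> \<partial>lborel) < ennreal (\<epsilon> / 4)"
      using eventually_happens'[OF sequentially_bot] by blast
    have le: "wint (\<lambda>x. 1) (\<lambda>x. f (x + v n) - f x) \<le> ennreal (\<epsilon> / 4) + ennreal (\<epsilon> / 4) + wint (\<lambda>x. 1) (\<lambda>x. s i (x + v n) - s i x)" for n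
    proof -
      have "wint (\<lambda>x. 1) (\<lambda>x. f (x + v n) - f x) \<le> (\<integral>\<^sup>+x. (ennreal \<bar>s i (x + v n) - f (x + v n)\<bar> + ennreal \<bar>s i x - f x\<bar>) + ennreal \<bar>s i (x + v n) - s i x\<bar> \<partial>lborel)"
        unfolding wint_def by (auto intro!: nn_integral_mono ennreal_leI simp: ennreal_plus[symmetric] simp del: ennreal_plus)
      also have "\<dots> = ((\<integral>\<^sup>+x. ennreal \<bar>s i (x + v n) - f (x + v n)\<bar> \<partial>lborel) + (\<integral>\<^sup>+x. ennreal \<bar>s i x - f x\<bar> \<partial>lborel)) + wint (\<lambda>x. 1) (\<lambda>x. s i (x + v n) - s i x)"
        by (simp add: nn_integral_add wint_def)
      also have "(\<integral>\<^sup>+x. ennreal \<bar>s i (x + v n) - f (x + v n)\<bar> \<partial>lborel) = (\<integral>\<^sup>+x. ennreal \<bar>s i x - f x\<bar> \<partial>lborel)"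
        by (rule nn_integral_lborel_shift) measurable
      also have "((\<integral>\<^sup>+x. ennreal \<bar>s i x - f x\<bar> \<partial>lborel) + (\<integral>\<^sup>+x. ennreal \<bar>s i x - f x\<bar> \<partial>lborel)) + wint (\<lambda>x. 1) (\<lambda>x. s i (x + v n) - s i x) \<le>
         (ennreal (\<epsilon> / 4) + ennreal (\<epsilon> / 4)) + wint (\<lambda>x. 1) (\<lambda>x. s i (x + v n) - s i x)"
        using i by (intro add_right_mono add_mono) auto
      finally show ?thesis .
    qed
    have "(\<lambda>n. (ennreal (\<epsilon> / 4) + ennreal (\<epsilon> / 4)) + wint (\<lambda>x. 1) (\<lambda>x. s i (x + v n) - s i x)) \<longlonglongrightarrow> (ennreal (\<epsilon> / 4) + ennreal (\<epsilon> / 4)) + 0"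
      by (intro tendsto_add tendsto_const lim.IH)
    moreover have "(ennreal (\<epsilon> / 4) + ennreal (\<epsilon> / 4)) + 0 < ennreal \<epsilon>"
      using \<epsilon> by (simp add: ennreal_plus[symmetric] ennreal_lessI del: ennreal_plus)
    ultimately have "\<forall>\<^sub>F n in sequentially. (ennreal (\<epsilon> / 4) + ennreal (\<epsilon> / 4)) + wint (\<lambda>x. 1) (\<lambda>x. s i (x + v n) - s i x) < ennreal \<epsilon>"
      by (rule order_tendstoD(2))
    then show "\<forall>\<^sub>F n in sequentially. wint (\<lambda>x. 1) (\<lambda>x. f (x + v n) - f x) < ennreal \<epsilon>"
      by eventually_elim (rule le_less_trans[OF le])
  qed
qed


section \<open>Finite differences and weak derivatives\<close>

text \<open>This keeps of the notion of a weak derivative of higher order only the relations between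
  neighbouring multi-indices, which is the form in which difference quotients use it.\<close>

definition derivative_family :: "('n::finite \<Rightarrow> nat) \<Rightarrow> (('n \<Rightarrow> nat) \<Rightarrow> real^'n \<Rightarrow> real) \<Rightarrow> bool" where
  "derivative_family \<eta> g \<longleftrightarrow> (\<forall>\<mu>\<le>\<eta>. integrable lborel (g \<mu>)) \<and>
     (\<forall>\<mu> i. \<mu>(i := Suc (\<mu> i)) \<le> \<eta> \<longrightarrow> weak_partial i (g \<mu>) (g (\<mu>(i := Suc (\<mu> i)))))"

lemma derivative_familyI:
  assumes "\<And>\<mu>. \<mu> \<le> \<eta> \<Longrightarrow> has_weak_deriv \<mu> f (g \<mu>)" and "\<And>\<mu>. \<mu> \<le> \<eta> \<Longrightarrow> integrable lborel (g \<mu>)"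
  shows "derivative_family \<eta> g"
  unfolding derivative_family_def
proof (intro conjI allI impI assms(2))
  fix \<mu> i assume le: "\<mu>(i := Suc (\<mu> i)) \<le> \<eta>"
  have "\<mu> \<le> \<eta>"
  proof (rule le_funI)
    fix j show "\<mu> j \<le> \<eta> j" using le_funD[OF le, of j] by (cases "j = i") auto
  qed
  then show "weak_partial i (g \<mu>) (g (\<mu>(i := Suc (\<mu> i))))"
    using le assms by (intro weak_partial_of_weak_deriv[of \<mu> f]) auto
qed

definition word_index :: "(bool \<times> 'n) list \<Rightarrow> 'n \<Rightarrow> nat" where
  "word_index W i = count_list W (True, i)"

lemma word_index_Cons: "word_index ((True, i) # W) = (word_index W)(i := Suc (word_index W i))"
  by (auto simp: word_index_def fun_eq_iff)

lemma word_index_Cons_False: "word_index ((False, i) # W) = word_index W"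
  by (auto simp: word_index_def fun_eq_iff)

lemma add_index_Cons:
  "(\<lambda>j. \<mu> j + word_index ((True, i) # W) j) = (\<lambda>j. (\<mu>(i := Suc (\<mu> i))) j + word_index W j)"
  by (auto simp: word_index_Cons fun_eq_iff)

text \<open>Each difference quotient is an average of translates of a derivative, and each letter halves the rate.
  Steps at most \<open>1\<close> keep the constants uniform.\<close>

lemma fdiff_gauss_bound:
  assumes fam: "derivative_family \<eta> g"
    and gb: "\<And>\<mu>. \<mu> \<le> \<eta> \<Longrightarrow> \<exists>a>0. \<exists>C\<ge>0. wint (gauss a) (g \<mu>) \<le> ennreal C"
    and le: "(\<lambda>i. \<mu> i + word_index W i) \<le> \<eta>"
  shows "\<exists>a>0. \<exists>C\<ge>0. \<forall>r\<in>{0<..1}. wint (gauss a) (fdiff unit_step r W (g \<mu>)) \<le> ennreal C"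
  using le
proof (induction W arbitrary: \<mu>)
  case Nil
  then show ?case using gb[of \<mu>] by (auto simp: word_index_def)
next
  case (Cons l W)
  obtain d i where l: "l = (d, i)" by force
  have gm: "g \<nu> \<in> borel_measurable borel" if "\<nu> \<le> \<eta>" for \<nu>
    using fam that unfolding derivative_family_def by (auto dest: borel_measurable_integrable)
  have unit: "exp (2 * (a / 2) * (norm (s *\<^sub>R (unit_step i :: real^'a)))\<^sup>2) \<le> exp a" if "0 < a" "s \<in> {0..1}" for a s
  proof -
    have "s\<^sup>2 \<le> 1" using that by (simp add: power_le_one)
    then show ?thesis using that by (simp add: norm_axis_1)
  qed
  show ?case
  proof (cases d)
    case True
    define \<mu>' where "\<mu>' = \<mu>(i := Suc (\<mu> i))"
    have le': "(\<lambda>j. \<mu>' j + word_index W j) \<le> \<eta>"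
      using Cons.prems unfolding l True[simplified] \<mu>'_def by (simp add: True add_index_Cons)
    then have mle: "\<mu>' \<le> \<eta>" unfolding le_fun_def by (metis add_leD1)
    obtain a C where a: "0 < a" "0 \<le> C" and b: "\<And>r. r \<in> {0<..1} \<Longrightarrow> wint (gauss a) (fdiff unit_step r W (g \<mu>')) \<le> ennreal C"
      using Cons.IH[OF le'] by blast
    have wp: "weak_partial i (g \<mu>) (g \<mu>')"
      using fam mle unfolding derivative_family_def \<mu>'_def by blast
    have "wint (gauss (a / 2)) (fdiff unit_step r (l # W) (g \<mu>)) \<le> ennreal (exp a * C)" if r: "r \<in> {0<..1}" for r
    proof -
      let ?F = "fdiff unit_step r W (g \<mu>)" and ?d = "fdiff unit_step r W (g \<mu>')"
      have dm: "?d \<in> borel_measurable borel" by (rule fdiff_measurable[OF gm[OF mle]])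
      have "wint (gauss (a / 2)) (\<lambda>x. (?F (x + r *\<^sub>R axis i 1) - ?F x) / r - 0) \<le> ennreal (exp a * C)"
      proof (rule wint_difference_quotient_le[OF weak_partial_fdiff[OF wp]])
        fix s assume s: "s \<in> {0..r}"
        have "wint (gauss (a / 2)) (\<lambda>x. ?d (x + s *\<^sub>R axis i 1)) \<le>
          ennreal (exp (2 * (a / 2) * (norm (s *\<^sub>R (unit_step i :: real^'a)))\<^sup>2)) * wint (gauss (2 * (a / 2))) ?d"
          using a by (intro wint_gauss_shift dm) auto
        also have "\<dots> \<le> ennreal (exp a) * ennreal C"
          using a b[OF r] s r by (intro mult_mono ennreal_leI unit) auto
        finally show "wint (gauss (a / 2)) (\<lambda>x. ?d (x + s *\<^sub>R axis i 1) - 0) \<le> ennreal (exp a * C)"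
          using a by (simp add: ennreal_mult)
      qed (use r in auto)
      then show ?thesis using True by (simp add: l)
    qed
    then show ?thesis using a by (intro exI[of _ "a / 2"] conjI exI[of _ "exp a * C"]) auto
  next
    case False
    have le': "(\<lambda>j. \<mu> j + word_index W j) \<le> \<eta>" using Cons.prems False by (simp add: l word_index_Cons_False)
    then have mle: "\<mu> \<le> \<eta>" unfolding le_fun_def by (metis add_leD1)
    obtain a C where a: "0 < a" "0 \<le> C" and b: "\<And>r. r \<in> {0<..1} \<Longrightarrow> wint (gauss a) (fdiff unit_step r W (g \<mu>)) \<le> ennreal C"
      using Cons.IH[OF le'] by blast
    have "wint (gauss (a / 2)) (fdiff unit_step r (l # W) (g \<mu>)) \<le> ennreal (exp a * C)" if r: "r \<in> {0<..1}" for r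
    proof -
      let ?F = "fdiff unit_step r W (g \<mu>)"
      have "wint (gauss (a / 2)) (\<lambda>x. ?F (x + r *\<^sub>R axis i 1)) \<le>
          ennreal (exp (2 * (a / 2) * (norm (r *\<^sub>R (unit_step i :: real^'a)))\<^sup>2)) * wint (gauss (2 * (a / 2))) ?F"
        using a by (intro wint_gauss_shift fdiff_measurable gm mle) auto
      also have "\<dots> \<le> ennreal (exp a) * ennreal C"
        using a b[OF r] r by (intro mult_mono ennreal_leI unit) auto
      finally show ?thesis using False a by (simp add: l ennreal_mult)
    qed
    then show ?thesis using a by (intro exI[of _ "a / 2"] conjI exI[of _ "exp a * C"]) auto
  qed
qed

lemma uniform_translation_L1:
  fixes g :: "'a::euclidean_space \<Rightarrow> real"
  assumes g: "integrable lborel g" and \<epsilon>: "0 < \<epsilon>"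
  shows "\<exists>\<delta>>0. \<forall>s\<in>{0..\<delta>}. wint (\<lambda>x. 1) (\<lambda>x. g (x + s *\<^sub>R e) - g x) \<le> ennreal \<epsilon>"
proof (rule ccontr)
  assume neg: "\<not> ?thesis"
  have "\<exists>s. s \<in> {0..inverse (real (Suc n))} \<and> \<not> wint (\<lambda>x. 1) (\<lambda>x. g (x + s *\<^sub>R e) - g x) \<le> ennreal \<epsilon>" for n
    using neg by (auto dest!: spec[of _ "inverse (real (Suc n))"])
  then obtain s where s: "\<And>n. s n \<in> {0..inverse (real (Suc n))}"
    "\<And>n. \<not> wint (\<lambda>x. 1) (\<lambda>x. g (x + s n *\<^sub>R e) - g x) \<le> ennreal \<epsilon>" by metis
  have "s \<longlonglongrightarrow> 0"
    by (rule tendsto_sandwich[OF always_eventually[OF allI] always_eventually[OF allI] tendsto_const LIMSEQ_inverse_real_of_nat])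
      (use s(1) in auto)
  then have "(\<lambda>n. s n *\<^sub>R e) \<longlonglongrightarrow> 0 *\<^sub>R e" by (intro tendsto_intros)
  then have "(\<lambda>n. wint (\<lambda>x. 1) (\<lambda>x. g (x + s n *\<^sub>R e) - g x)) \<longlonglongrightarrow> 0"
    by (intro translation_L1[OF g]) simp
  then have "\<forall>\<^sub>F n in sequentially. wint (\<lambda>x. 1) (\<lambda>x. g (x + s n *\<^sub>R e) - g x) < ennreal \<epsilon>"
    using \<epsilon> by (intro order_tendstoD(2)) auto
  then obtain n where "wint (\<lambda>x. 1) (\<lambda>x. g (x + s n *\<^sub>R e) - g x) < ennreal \<epsilon>"
    using eventually_happens'[OF sequentially_bot] by blast
  then show False using s(2)[of n] by simp
qed

text \<open>A difference quotient of \<open>fdiff r W (g \<mu>)\<close> is an average of translates by at most \<open>r\<close> of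
  \<open>fdiff r W\<close> applied to the derivative of \<open>g \<mu>\<close>.  The latter converges by induction, and translations are
  continuous on \<open>L\<^sup>1\<close>.\<close>

lemma fdiff_tendsto_derivative:
  assumes fam: "derivative_family \<eta> g"
    and W: "\<forall>l\<in>set W. fst l" and le: "(\<lambda>i. \<mu> i + word_index W i) \<le> \<eta>"
  shows "(\<lambda>n. wint (\<lambda>x. 1) (\<lambda>x. fdiff unit_step (inverse (real (Suc n))) W (g \<mu>) x - g (\<lambda>i. \<mu> i + word_index W i) x)) \<longlonglongrightarrow> 0"
  using W le
proof (induction W arbitrary: \<mu>)
  case Nil
  then show ?case by (simp add: word_index_def wint_def)
next
  case (Cons l W)
  obtain i where l: "l = (True, i)" using Cons.prems(1) by (cases l) auto
  define \<mu>' where "\<mu>' = \<mu>(i := Suc (\<mu> i))"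
  define h where "h = g (\<lambda>i. \<mu>' i + word_index W i)"
  have le': "(\<lambda>j. \<mu>' j + word_index W j) \<le> \<eta>"
    using Cons.prems(2) unfolding l add_index_Cons \<mu>'_def .
  then have mle: "\<mu>' \<le> \<eta>" unfolding le_fun_def by (metis add_leD1)
  have hi: "integrable lborel h" using fam le' by (simp add: derivative_family_def h_def)
  then have hm[measurable]: "h \<in> borel_measurable borel" by auto
  have gm: "g \<mu>' \<in> borel_measurable borel"
    using fam mle unfolding derivative_family_def by (auto dest: borel_measurable_integrable)
  have wp: "weak_partial i (g \<mu>) (g \<mu>')"
    using fam mle unfolding derivative_family_def \<mu>'_def by blast
  define d where "d n = fdiff unit_step (inverse (real (Suc n))) W (g \<mu>')" for n
  have dm[measurable]: "d n \<in> borel_measurable borel" for n unfolding d_def by (rule fdiff_measurable[OF gm])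
  have IH: "(\<lambda>n. wint (\<lambda>x. 1) (\<lambda>x. d n x - h x)) \<longlonglongrightarrow> 0"
    unfolding d_def h_def using Cons.prems(1) le' by (intro Cons.IH) auto
  have eq: "(\<lambda>i. \<mu> i + word_index (l # W) i) = (\<lambda>i. \<mu>' i + word_index W i)"
    unfolding l add_index_Cons \<mu>'_def ..
  show ?case
  proof (rule tendsto_zero_ennreal)
    fix \<epsilon> :: real assume \<epsilon>: "0 < \<epsilon>"
    obtain \<delta> where \<delta>: "0 < \<delta>" "\<And>s. s \<in> {0..\<delta>} \<Longrightarrow> wint (\<lambda>x. 1) (\<lambda>x. h (x + s *\<^sub>R axis i 1) - h x) \<le> ennreal (\<epsilon> / 3)"
      using uniform_translation_L1[OF hi, of "\<epsilon> / 3" "axis i 1"] \<epsilon> by auto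
    have "\<forall>\<^sub>F n in sequentially. wint (\<lambda>x. 1) (\<lambda>x. d n x - h x) < ennreal (\<epsilon> / 3)"
      using \<epsilon> by (intro order_tendstoD(2)[OF IH]) simp
    moreover have "\<forall>\<^sub>F n in sequentially. inverse (real (Suc n)) < \<delta>"
      by (rule order_tendstoD(2)[OF LIMSEQ_inverse_real_of_nat \<delta>(1)])
    ultimately show "\<forall>\<^sub>F n in sequentially. wint (\<lambda>x. 1) (\<lambda>x. fdiff unit_step (inverse (real (Suc n))) (l # W) (g \<mu>) x - g (\<lambda>i. \<mu> i + word_index (l # W) i) x) < ennreal \<epsilon>"
    proof eventually_elim
      case (elim n)
      define r where "r = inverse (real (Suc n))"
      have r: "0 < r" "r < \<delta>" using elim by (simp_all add: r_def)
      let ?F = "fdiff unit_step r W (g \<mu>)"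
      have "wint (\<lambda>x. 1) (\<lambda>x. (?F (x + r *\<^sub>R axis i 1) - ?F x) / r - h x) \<le> ennreal (\<epsilon> / 3) + ennreal (\<epsilon> / 3)"
      proof (rule wint_difference_quotient_le[OF weak_partial_fdiff[OF wp] r(1)])
        fix s assume s: "s \<in> {0..r}"
        have "wint (\<lambda>x. 1) (\<lambda>x. d n (x + s *\<^sub>R axis i 1) - h x) \<le>
            (\<integral>\<^sup>+x. ennreal \<bar>d n (x + s *\<^sub>R axis i 1) - h (x + s *\<^sub>R axis i 1)\<bar> + ennreal \<bar>h (x + s *\<^sub>R axis i 1) - h x\<bar> \<partial>lborel)"
          unfolding wint_def by (auto intro!: nn_integral_mono ennreal_leI simp: ennreal_plus[symmetric] simp del: ennreal_plus)
        also have "\<dots> = (\<integral>\<^sup>+x. ennreal \<bar>d n (x + s *\<^sub>R axis i 1) - h (x + s *\<^sub>R axis i 1)\<bar> \<partial>lborel) + wint (\<lambda>x. 1) (\<lambda>x. h (x + s *\<^sub>R axis i 1) - h x)"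
          by (simp add: wint_def nn_integral_add)
        also have "(\<integral>\<^sup>+x. ennreal \<bar>d n (x + s *\<^sub>R axis i 1) - h (x + s *\<^sub>R axis i 1)\<bar> \<partial>lborel) = wint (\<lambda>x. 1) (\<lambda>x. d n x - h x)"
          unfolding wint_def mult_1_right by (rule nn_integral_lborel_shift) measurable
        also have "wint (\<lambda>x. 1) (\<lambda>x. d n x - h x) + wint (\<lambda>x. 1) (\<lambda>x. h (x + s *\<^sub>R axis i 1) - h x) \<le> ennreal (\<epsilon> / 3) + ennreal (\<epsilon> / 3)"
          using elim(1) s r by (intro add_mono \<delta>(2)) auto
        finally show "wint (\<lambda>x. 1) (\<lambda>x. fdiff unit_step r W (g \<mu>') (x + s *\<^sub>R axis i 1) - h x) \<le> ennreal (\<epsilon> / 3) + ennreal (\<epsilon> / 3)"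
          by (simp add: d_def r_def)
      qed auto
      also have "\<dots> < ennreal \<epsilon>" using \<epsilon> by (simp add: ennreal_plus[symmetric] ennreal_lessI del: ennreal_plus)
      finally show ?case unfolding eq h_def[symmetric] by (simp add: l r_def)
    qed
  qed
qed

text \<open>On a ball the weight is bounded and the bound passes to the \<open>L\<^sup>1\<close> limit; monotone convergence removes
  the ball.\<close>

lemma wint_gauss_L1_limit:
  fixes F :: "nat \<Rightarrow> 'a::euclidean_space \<Rightarrow> real"
  assumes a: "0 \<le> a" and Fm[measurable]: "\<And>n. F n \<in> borel_measurable borel" and gm[measurable]: "g \<in> borel_measurable borel"
    and C: "\<And>n. wint (gauss a) (F n) \<le> C" and lim: "(\<lambda>n. wint (\<lambda>x. 1) (\<lambda>x. F n x - g x)) \<longlonglongrightarrow> 0"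
  shows "wint (gauss a) g \<le> C"
proof -
  define B where "B k = cball (0::'a) (real k)" for k
  have Bm[measurable]: "B k \<in> sets borel" for k by (simp add: B_def)
  have ball: "(\<integral>\<^sup>+x. ennreal (\<bar>g x\<bar> * gauss a x) * indicator (B k) x \<partial>lborel) \<le> C" for k
  proof (rule LIMSEQ_le_const)
    have "(\<lambda>n. C + ennreal (exp (a * (real k)\<^sup>2)) * wint (\<lambda>x. 1) (\<lambda>x. F n x - g x)) \<longlonglongrightarrow> C + ennreal (exp (a * (real k)\<^sup>2)) * 0"
      by (intro tendsto_add tendsto_const ennreal_tendsto_cmult lim) auto
    then show "(\<lambda>n. C + ennreal (exp (a * (real k)\<^sup>2)) * wint (\<lambda>x. 1) (\<lambda>x. F n x - g x)) \<longlonglongrightarrow> C" by simp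
    have "(\<integral>\<^sup>+x. ennreal (\<bar>g x\<bar> * gauss a x) * indicator (B k) x \<partial>lborel) \<le> C + ennreal (exp (a * (real k)\<^sup>2)) * wint (\<lambda>x. 1) (\<lambda>x. F n x - g x)" for n
    proof -
      have "(\<integral>\<^sup>+x. ennreal (\<bar>g x\<bar> * gauss a x) * indicator (B k) x \<partial>lborel) \<le>
        (\<integral>\<^sup>+x. ennreal (\<bar>F n x\<bar> * gauss a x) + ennreal (exp (a * (real k)\<^sup>2)) * ennreal (\<bar>F n x - g x\<bar> * 1) \<partial>lborel)"
      proof (rule nn_integral_mono)
        fix x :: 'a
        show "ennreal (\<bar>g x\<bar> * gauss a x) * indicator (B k) x \<le> ennreal (\<bar>F n x\<bar> * gauss a x) + ennreal (exp (a * (real k)\<^sup>2)) * ennreal (\<bar>F n x - g x\<bar> * 1)"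
        proof (cases "x \<in> B k")
          case True
          then have "(norm x)\<^sup>2 \<le> (real k)\<^sup>2" by (simp add: B_def power_mono)
          then have ge: "gauss a x \<le> exp (a * (real k)\<^sup>2)" using a by (simp add: mult_left_mono)
          have "\<bar>g x\<bar> * gauss a x \<le> (\<bar>F n x\<bar> + \<bar>F n x - g x\<bar>) * gauss a x" by (intro mult_right_mono) auto
          also have "\<dots> = \<bar>F n x\<bar> * gauss a x + \<bar>F n x - g x\<bar> * gauss a x" by (rule distrib_right)
          also have "\<dots> \<le> \<bar>F n x\<bar> * gauss a x + \<bar>F n x - g x\<bar> * exp (a * (real k)\<^sup>2)"
            by (intro add_left_mono mult_left_mono ge) simp
          finally show ?thesis using True by (simp add: ennreal_mult[symmetric] ennreal_plus[symmetric] ennreal_leI mult.commute del: ennreal_plus)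
        qed simp
      qed
      also have "\<dots> = wint (gauss a) (F n) + ennreal (exp (a * (real k)\<^sup>2)) * wint (\<lambda>x. 1) (\<lambda>x. F n x - g x)"
        unfolding wint_def by (simp add: nn_integral_add nn_integral_cmult)
      also have "\<dots> \<le> C + ennreal (exp (a * (real k)\<^sup>2)) * wint (\<lambda>x. 1) (\<lambda>x. F n x - g x)" by (intro add_right_mono C)
      finally show ?thesis .
    qed
    then show "\<exists>N. \<forall>n\<ge>N. (\<integral>\<^sup>+x. ennreal (\<bar>g x\<bar> * gauss a x) * indicator (B k) x \<partial>lborel) \<le> C + ennreal (exp (a * (real k)\<^sup>2)) * wint (\<lambda>x. 1) (\<lambda>x. F n x - g x)"
      by blast
  qed
  have "wint (gauss a) g \<le> (\<integral>\<^sup>+x. (SUP k. ennreal (\<bar>g x\<bar> * gauss a x) * indicator (B k) x) \<partial>lborel)"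
    unfolding wint_def
  proof (rule nn_integral_mono)
    fix x :: 'a
    obtain k where "norm x \<le> real k" using real_arch_simple by blast
    then have "ennreal (\<bar>g x\<bar> * gauss a x) \<le> ennreal (\<bar>g x\<bar> * gauss a x) * indicator (B k) x" by (simp add: B_def)
    then show "ennreal (\<bar>g x\<bar> * gauss a x) \<le> (SUP k. ennreal (\<bar>g x\<bar> * gauss a x) * indicator (B k) x)"
      by (rule SUP_upper2[OF UNIV_I])
  qed
  also have "\<dots> = (SUP k. \<integral>\<^sup>+x. ennreal (\<bar>g x\<bar> * gauss a x) * indicator (B k) x \<partial>lborel)"
  proof (rule nn_integral_monotone_convergence_SUP)
    show "incseq (\<lambda>k x. ennreal (\<bar>g x\<bar> * gauss a x) * indicator (B k) x)"
    proof (intro incseq_SucI le_funI mult_left_mono)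
      fix k and x :: 'a
      have "B k \<subseteq> B (Suc k)" by (auto simp: B_def)
      then show "indicator (B k) x \<le> (indicator (B (Suc k)) x :: ennreal)" by (auto split: split_indicator)
    qed simp
  qed measurable
  also have "\<dots> \<le> C" by (intro SUP_least ball)
  finally show ?thesis .
qed

lemma word_with_index:
  fixes \<nu> :: "'n::finite \<Rightarrow> nat"
  obtains W where "\<forall>l\<in>set W. fst l" "word_index W = \<nu>"
proof -
  obtain "is" where l: "\<And>i. count_list is i = \<nu> i" using exists_list_with_counts by metis
  have "count_list (map (\<lambda>i. (True, i)) js) (True, i) = count_list js i" for js :: "'n list" and i
    by (induction js) auto
  then have "word_index (map (\<lambda>i. (True, i)) is) = \<nu>" using l by (auto simp: word_index_def fun_eq_iff)
  then show ?thesis using that[of "map (\<lambda>i. (True, i)) is"] by auto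
qed

context boltzmann_flow begin

text \<open>The initial derivatives control the initial difference quotients, these control the later ones
  uniformly in the step, and the limit of vanishing step recovers the derivatives.\<close>

theorem derivative_propagation:
  assumes T: "0 < T"
    and fam: "\<And>t. t \<in> {0..T} \<Longrightarrow> derivative_family \<eta> (g t)" and g0: "\<And>t. g t (\<lambda>_. 0) = f t"
    and gb: "\<And>\<mu>. \<mu> \<le> \<eta> \<Longrightarrow> \<exists>a>0. \<exists>C\<ge>0. wint (gauss a) (g 0 \<mu>) \<le> ennreal C"
    and \<nu>: "\<nu> \<le> \<eta>"
  shows "\<exists>a>0. \<exists>C\<ge>0. \<forall>t\<in>{0..T}. wint (gauss a) (g t \<nu>) \<le> ennreal C"
proof -
  have f: "\<exists>a>0. \<exists>C\<ge>0. \<forall>t\<in>{0..T}. wint (gauss a) (f t) \<le> ennreal C"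
  proof -
    have "(\<lambda>_. 0) \<le> \<eta>" by (simp add: le_fun_def)
    from gb[OF this] obtain a C where a: "0 < a" "0 \<le> C" "wint (gauss a) (f 0) \<le> ennreal C" unfolding g0 by blast
    have "(\<integral>\<^sup>+x. ennreal (f 0 x * ((norm x)\<^sup>2 * gauss (a / 2) x)) \<partial>lborel) \<le> wint (\<lambda>x. (1 + 1 / (a / 2)) * gauss a x) (f 0)"
      unfolding wint_def
    proof (intro nn_integral_mono ennreal_leI)
      fix x :: "real^'n"
      have "(norm x)\<^sup>2 * gauss (a / 2) x \<le> (1 + (norm x)\<^sup>2) * gauss (a / 2) x" by (intro mult_right_mono) auto
      also have "\<dots> \<le> (1 + 1 / (a / 2)) * gauss (2 * (a / 2)) x"
        using a by (intro poly_gauss_le) auto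
      finally have "f 0 x * ((norm x)\<^sup>2 * gauss (a / 2) x) \<le> f 0 x * ((1 + 1 / (a / 2)) * gauss (2 * (a / 2)) x)"
        using f_nonneg by (rule mult_left_mono)
      then show "f 0 x * ((norm x)\<^sup>2 * gauss (a / 2) x) \<le> \<bar>f 0 x\<bar> * ((1 + 1 / (a / 2)) * gauss a x)"
        using f_nonneg by simp
    qed
    also have "\<dots> = ennreal (1 + 1 / (a / 2)) * wint (gauss a) (f 0)" using a by (intro wint_cmult) auto
    also have "\<dots> \<le> ennreal (1 + 1 / (a / 2)) * ennreal C" using a by (intro mult_left_mono) auto
    also have "\<dots> < \<infinity>" by (simp add: ennreal_mult_less_top)
    finally show ?thesis using a by (intro gaussian_propagation[OF T, of "a / 2"]) auto
  qed
  have T0: "0 \<in> {0..T}" using T by simp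
  have init: "\<exists>a>0. \<exists>C\<ge>0. \<forall>r\<in>{0<..1}. wint (gauss a) (fd r W 0) \<le> ennreal C"
    if "\<And>i. count_list W (True, i) \<le> \<eta> i" for W
    using fdiff_gauss_bound[OF fam[OF T0] gb, of "\<lambda>_. 0" W] that by (simp add: g0 le_fun_def word_index_def)
  \<comment> \<open>A word without translations, so that its limit as the step tends to \<open>0\<close> is the derivative itself.\<close>
  obtain W where W: "\<forall>l\<in>set W. fst l" "word_index W = \<nu>" using word_with_index by blast
  have "bounded_differences T W"
  proof (rule finite_difference_propagation[where \<eta>=\<eta>, OF T f init])
    show "count_list W (True, i) \<le> \<eta> i" for i
      using le_funD[OF \<nu>, of i] fun_cong[OF W(2), of i] by (simp add: word_index_def)
  qed
  then obtain a C where a: "0 < a" "0 \<le> C" and b: "\<And>r t. r \<in> {0<..1} \<Longrightarrow> t \<in> {0..T} \<Longrightarrow> wint (gauss a) (fd r W t) \<le> ennreal C"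
    unfolding bounded_differences_def by blast
  have "wint (gauss a) (g t \<nu>) \<le> ennreal C" if t: "t \<in> {0..T}" for t
  proof (rule wint_gauss_L1_limit[where F="\<lambda>n. fd (inverse (real (Suc n))) W t"])
    show "g t \<nu> \<in> borel_measurable borel"
      using fam[OF t] \<nu> unfolding derivative_family_def by (auto dest: borel_measurable_integrable)
    show "wint (gauss a) (fd (inverse (real (Suc n))) W t) \<le> ennreal C" for n
      by (rule b[OF _ t]) (simp add: inverse_le_1_iff)
    show "(\<lambda>n. wint (\<lambda>x. 1) (\<lambda>x. fd (inverse (real (Suc n))) W t x - g t \<nu> x)) \<longlonglongrightarrow> 0"
      using fdiff_tendsto_derivative[OF fam[OF t] W(1), of "\<lambda>_. 0"] \<nu> by (simp add: W(2) g0)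
  qed (use a in auto)
  then show ?thesis using a by blast
qed

end


section \<open>Reduction to a nonnegative Borel angular kernel\<close>

lemma locally_integrable_measurable:
  fixes d :: "real^'n \<Rightarrow> real"
  assumes "locally_integrable d"
  shows "d \<in> borel_measurable borel"
proof (rule borel_measurable_LIMSEQ_real)
  fix x :: "real^'n"
  obtain k where k: "norm x \<le> real k" using real_arch_simple by blast
  have "\<forall>\<^sub>F n in sequentially. d x = indicator (cball 0 (real n)) x * d x"
    using eventually_ge_at_top[of k] by (rule eventually_mono) (use k in \<open>simp split: split_indicator\<close>)
  then show "(\<lambda>n. indicator (cball 0 (real n)) x * d x) \<longlonglongrightarrow> d x"
    by (rule Lim_transform_eventually[OF tendsto_const])
next
  fix n
  have "set_integrable lborel (cball 0 (real n)) d" using assms by (simp add: locally_integrable_def)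
  then show "(\<lambda>x. indicator (cball 0 (real n)) x * d x) \<in> borel_measurable borel"
    by (auto simp: set_integrable_def)
qed

text \<open>The cone over a point lies in a line, a null set in dimension at least two.\<close>

lemma emeasure_sphere_singleton:
  fixes e :: "real^'n"
  assumes n: "2 \<le> CARD('n)" and e: "norm e = 1"
  shows "emeasure sphere_measure {e} = 0"
proof -
  have es: "{e} \<in> sets (sphere_measure :: (real^'n) measure)"
    using e by (simp add: sets_restrict_space) (metis Int_absorb1 empty_subsetI insert_subset mem_sphere_0 closed_singleton borel_closed image_eqI)
  have sub: "{x \<in> ball 0 1 - {0}. sgn x \<in> {e}} \<subseteq> span {e}"
  proof
    fix x assume "x \<in> {x \<in> ball 0 1 - {0::real^'n}. sgn x \<in> {e}}"
    then have "x = norm x *\<^sub>R e" by (auto simp: sgn_div_norm)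
    then show "x \<in> span {e}" by (metis span_base span_scale singletonI)
  qed
  have "dim (span {e}) < DIM(real^'n)"
    using n dim_le_card[of "{e}" "{e}"] by (simp add: dim_span)
  then have "negligible (span {e})" by (rule negligible_lowdim)
  then have "negligible {x \<in> ball 0 1 - {0}. sgn x \<in> {e}}" using sub by (rule negligible_subset)
  then have "emeasure lebesgue {x \<in> ball 0 1 - {0}. sgn x \<in> {e}} = 0" by (simp add: negligible_iff_emeasure0 negligible_imp_sets)
  moreover have "{x \<in> ball 0 1 - {0}. sgn x \<in> {e}} \<in> sets lborel"
  proof -
    have "{x \<in> ball 0 1 - {0::real^'n}. sgn x \<in> {e}} = {x. x \<noteq> 0 \<and> norm x \<in> {..<1} \<and> sgn x \<in> {e}}" by auto
    then show ?thesis using sets_cone[OF es, of "{..<1}"] by simp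
  qed
  ultimately show ?thesis using emeasure_sphere_measure[OF es] by (simp add: emeasure_completion)
qed

lemma AE_sphere_not_pole:
  fixes e :: "real^'n"
  assumes n: "2 \<le> CARD('n)" and e: "norm e = 1"
  shows "AE \<sigma> in sphere_measure. e \<bullet> \<sigma> \<in> {-1<..<1}"
proof -
  have s: "{u} \<in> sets (sphere_measure :: (real^'n) measure)" if "norm u = 1" for u
    using that by (simp add: sets_restrict_space) (metis Int_absorb1 empty_subsetI insert_subset mem_sphere_0 closed_singleton borel_closed image_eqI)
  have ae: "AE \<sigma> in sphere_measure. \<sigma> \<notin> {u}" if "norm u = 1" for u :: "real^'n"
    by (intro AE_not_in null_setsI emeasure_sphere_singleton[OF n that] s[OF that])
  have "AE \<sigma> in sphere_measure. \<sigma> \<notin> {- e}" using e by (intro ae) simp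
  with ae[OF e] AE_space show ?thesis
  proof eventually_elim
    case (elim \<sigma>)
    then have ne: "\<sigma> \<notin> {e} \<and> \<sigma> \<notin> {- e}" and ns: "norm \<sigma> = 1" using e by auto
    have sq: "(norm (\<sigma> - e))\<^sup>2 = 2 - 2 * (e \<bullet> \<sigma>)" "(norm (\<sigma> + e))\<^sup>2 = 2 + 2 * (e \<bullet> \<sigma>)"
      using dot_norm[of e \<sigma>] dot_norm_neg[of e \<sigma>] ns e by (simp_all add: norm_minus_commute add.commute field_simps)
    have "\<sigma> - e \<noteq> 0" "\<sigma> + e \<noteq> 0" using ne eq_neg_iff_add_eq_0[of \<sigma> e] by simp_all
    then have "0 < (norm (\<sigma> - e))\<^sup>2" "0 < (norm (\<sigma> + e))\<^sup>2" by simp_all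
    then show "e \<bullet> \<sigma> \<in> {-1<..<1}" unfolding sq by simp
  qed
qed

lemma one_dimensional_collision:
  fixes x y \<sigma> :: "real^'n"
  assumes n: "CARD('n) = 1" and \<sigma>: "norm \<sigma> = 1"
  shows "f (post_velocity x y \<sigma>) * f (post_velocity_star x y \<sigma>) = (f x * f y :: real)"
proof -
  obtain i :: 'n where i: "UNIV = {i}" using card_1_singletonE[OF n] by blast
  have all: "(\<forall>j. P j) \<longleftrightarrow> P i" for P :: "'n \<Rightarrow> bool" using i by (metis UNIV_I singletonD)
  have nrm: "norm v = \<bar>v $ i\<bar>" for v :: "real^'n"
    by (simp add: norm_vec_def L2_set_def i)
  have "norm (x - y) *\<^sub>R \<sigma> = x - y \<or> norm (x - y) *\<^sub>R \<sigma> = - (x - y)"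
    using \<sigma> unfolding vec_eq_iff all nrm by (auto simp: abs_if split: if_splits)
  then show ?thesis
  proof
    assume "norm (x - y) *\<^sub>R \<sigma> = x - y"
    then show ?thesis by (simp add: post_velocity_def post_velocity_star_def)
  next
    assume e: "norm (x - y) *\<^sub>R \<sigma> = - (x - y)"
    have "x + (1/2) *\<^sub>R (- (x - y) - (x - y)) = y" "y - (1/2) *\<^sub>R (- (x - y) - (x - y)) = x"
      by (simp_all add: vec_eq_iff field_simps)
    then show ?thesis by (simp add: post_velocity_def post_velocity_star_def e mult.commute)
  qed
qed

text \<open>The hypotheses on \<open>h\<close> concern the open interval \<open>(-1, 1)\<close>.  In dimension at least two the
  remaining values are attained on the two poles, a null set of the sphere, and are replaced by \<open>0\<close>.  In
  dimension one the sphere consists of the poles, but every collision exchanges or preserves the two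
  velocities; \<open>Q(f, f)\<close> vanishes for any kernel, and a normalized constant can be taken.\<close>

lemma regular_kernel_exists:
  assumes \<alpha>: "0 < \<alpha>" "\<alpha> \<le> 1" and ker: "angular_kernel TYPE('n::finite) h"
  obtains h' where "collision TYPE('n) \<alpha> h'"
    "\<And>(f :: real^'n \<Rightarrow> real) x. f \<in> borel_measurable borel \<Longrightarrow> collision_op \<alpha> h f f x = collision_op \<alpha> h' f f x"
proof -
  have norm1: "has_bochner_integral sphere_measure (\<lambda>\<sigma>. h (e \<bullet> \<sigma>)) 1" if "norm e = 1" for e :: "real^'n"
    using ker that by (simp add: angular_kernel_def)
  show ?thesis
  proof (cases "CARD('n) = 1")
    case True
    have zero: "collision_op \<alpha> k f f x = 0" for k and f :: "real^'n \<Rightarrow> real" and x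
    proof -
      have "(\<integral>\<sigma>. (f (post_velocity x y \<sigma>) * f (post_velocity_star x y \<sigma>) - f x * f y) * collision_kernel \<alpha> k (x - y) \<sigma> \<partial>sphere_measure) = (\<integral>\<sigma>. 0 \<partial>(sphere_measure :: (real^'n) measure))" for y
        by (intro Bochner_Integration.integral_cong) (auto simp: one_dimensional_collision[OF True])
      then show ?thesis by (simp add: collision_op_def)
    qed
    define m where "m = emeasure (sphere_measure :: (real^'n) measure) (sphere 0 1)"
    have m_fin: "m \<noteq> \<infinity>" unfolding m_def by (rule finite_measure.emeasure_finite[OF finite_measure_sphere, unfolded infinity_ennreal_def[symmetric]])
    have m_pos: "m \<noteq> 0"
    proof
      assume "m = 0"
      then have "AE \<sigma> in (sphere_measure :: (real^'n) measure). False"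
        unfolding m_def using sets.top[of "sphere_measure :: (real^'n) measure"]
        by (intro AE_I'[of "sphere 0 1"]) (auto intro!: null_setsI)
      then have "(\<integral>\<sigma>. h (e \<bullet> \<sigma>) \<partial>sphere_measure) = 0" for e :: "real^'n"
        by (intro integral_eq_zero_AE) (auto elim: eventually_mono)
      moreover have "norm (axis undefined 1 :: real^'n) = 1" by (simp add: norm_axis_1)
      ultimately show False using norm1[of "axis undefined 1"] by (simp add: has_bochner_integral_iff)
    qed
    define c where "c = 1 / enn2real m"
    have mr: "m = ennreal (enn2real m)" "0 < enn2real m" using m_fin m_pos by (auto simp: enn2real_positive_iff less_top zero_less_iff_neq_zero)
    have "(\<integral>\<^sup>+\<sigma>. ennreal c \<partial>(sphere_measure :: (real^'n) measure)) = 1"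
    proof -
      have "(\<integral>\<^sup>+\<sigma>. ennreal c \<partial>(sphere_measure :: (real^'n) measure)) = ennreal c * m" by (simp add: m_def)
      also have "\<dots> = ennreal (c * enn2real m)" by (subst mr(1)) (use mr(2) in \<open>simp add: c_def ennreal_mult''[symmetric]\<close>)
      also have "\<dots> = 1" using mr(2) by (simp add: c_def)
      finally show ?thesis .
    qed
    then have "collision TYPE('n) \<alpha> (\<lambda>_. c)"
      using \<alpha> mr(2) by unfold_locales (auto simp: c_def)
    then show ?thesis using that[of "\<lambda>_. c"] zero by simp
  next
    case False
    then have n: "2 \<le> CARD('n)" using zero_less_card_finite[where 'a='n] by linarith
    define h' where "h' z = indicator {-1<..<1} z * h z" for z
    have meas: "h' \<in> borel_measurable borel"
      using ker by (simp add: angular_kernel_def set_borel_measurable_def h'_def[abs_def])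
    have nn: "0 \<le> h' z" for z using ker by (auto simp: angular_kernel_def h'_def split: split_indicator)
    have ae: "AE \<sigma> in sphere_measure. h' (e \<bullet> \<sigma>) = h (e \<bullet> \<sigma>)" if "norm e = 1" for e :: "real^'n"
      using AE_sphere_not_pole[OF n that] by (rule eventually_mono) (simp add: h'_def)
    have m2: "(\<lambda>\<sigma>. h' (e \<bullet> \<sigma>)) \<in> borel_measurable sphere_measure" for e :: "real^'n"
      by (rule measurable_compose[OF _ meas]) measurable
    have m1: "(\<lambda>\<sigma>. h (e \<bullet> \<sigma>)) \<in> borel_measurable sphere_measure" if "norm e = 1" for e :: "real^'n"
      using norm1[OF that] by (auto simp: has_bochner_integral_iff)
    have "(\<integral>\<^sup>+\<sigma>. ennreal (h' (e \<bullet> \<sigma>)) \<partial>sphere_measure) = 1" if e: "norm e = 1" for e :: "real^'n"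
    proof -
      have "integrable sphere_measure (\<lambda>\<sigma>. h' (e \<bullet> \<sigma>))" "(\<integral>\<sigma>. h' (e \<bullet> \<sigma>) \<partial>sphere_measure) = 1"
        using norm1[OF e] integrable_cong_AE[OF m2 m1[OF e] ae[OF e]] integral_cong_AE[OF m2 m1[OF e] ae[OF e]]
        by (auto simp: has_bochner_integral_iff)
      then show ?thesis using nn by (simp add: nn_integral_eq_integral)
    qed
    then have "collision TYPE('n) \<alpha> h'" using \<alpha> meas nn by unfold_locales auto
    moreover have "collision_op \<alpha> h f f x = collision_op \<alpha> h' f f x" if f: "f \<in> borel_measurable borel" for f :: "real^'n \<Rightarrow> real" and x
    proof -
      have "(\<integral>\<sigma>. (f (post_velocity x y \<sigma>) * f (post_velocity_star x y \<sigma>) - f x * f y) * collision_kernel \<alpha> h (x - y) \<sigma> \<partial>sphere_measure) =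
        (\<integral>\<sigma>. (f (post_velocity x y \<sigma>) * f (post_velocity_star x y \<sigma>) - f x * f y) * collision_kernel \<alpha> h' (x - y) \<sigma> \<partial>sphere_measure)" for y
      proof (cases "x = y")
        case False
        then have e: "norm (sgn (x - y)) = 1" by (simp add: norm_sgn)
        have [measurable]: "(\<lambda>\<sigma>. f (post_velocity x y \<sigma>)) \<in> borel_measurable sphere_measure" "(\<lambda>\<sigma>. f (post_velocity_star x y \<sigma>)) \<in> borel_measurable sphere_measure"
          unfolding post_velocity_def post_velocity_star_def by (rule measurable_compose[OF _ f], measurable)+
        note [measurable] = m1[OF e] m2[of "sgn (x - y)"]
        show ?thesis
        proof (rule integral_cong_AE)
          show "AE \<sigma> in sphere_measure. (f (post_velocity x y \<sigma>) * f (post_velocity_star x y \<sigma>) - f x * f y) * collision_kernel \<alpha> h (x - y) \<sigma> =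
            (f (post_velocity x y \<sigma>) * f (post_velocity_star x y \<sigma>) - f x * f y) * collision_kernel \<alpha> h' (x - y) \<sigma>"
            using ae[OF e] by (rule eventually_mono) (simp add: collision_kernel_def)
        qed (unfold collision_kernel_def, measurable)
      qed (simp add: collision_kernel_def)
      then show ?thesis by (simp add: collision_op_def)
    qed
    ultimately show ?thesis by (rule that)
  qed
qed

section \<open>Moments and Gaussian integrals\<close>

lemma Gamma_shift_le:
  assumes b: "0 < (b::real)"
  shows "Gamma (real (Suc m) + b) \<le> Gamma (1 + b) * (1 + b) ^ m * fact (Suc m)"
proof (induction m)
  case (Suc m)
  have "Gamma (real (Suc (Suc m)) + b) = Gamma ((real (Suc m) + b) + 1)" by (simp add: algebra_simps)
  also have "\<dots> = (real (Suc m) + b) * Gamma (real (Suc m) + b)"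
    using b by (intro Gamma_plus1) (auto dest: plus_of_nat_eq_0_imp elim!: nonpos_Ints_cases)
  also have "\<dots> \<le> (real (Suc (Suc m)) * (1 + b)) * (Gamma (1 + b) * (1 + b) ^ m * fact (Suc m))"
    using b by (intro mult_mono Suc) (auto simp: algebra_simps intro: Gamma_real_nonneg)
  also have "\<dots> = Gamma (1 + b) * (1 + b) ^ Suc m * fact (Suc (Suc m))" by (simp add: algebra_simps)
  finally show ?case .
qed simp

text \<open>The mass of the Gamma integral on \<open>[s + 1, s + 2]\<close> is a lower bound for \<open>\<Gamma>(p + b)\<close>.  Since \<open>s + 1 \<ge> 1\<close>, the
  exponent \<open>p + b - 1\<close> may be lowered to \<open>p - 1\<close>; this keeps the estimate uniform in \<open>p\<close>.\<close>

lemma power_le_Gamma: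
  assumes b: "0 < b" and p: "1 \<le> p" and s: "0 \<le> (s::real)"
  shows "s powr p \<le> exp (2 * s + 2) * Gamma (p + b)"
proof -
  have pb: "0 < p + b" using b p by simp
  have "ennreal ((s + 1) powr (p - 1) * exp (- (s + 2))) = (\<integral>\<^sup>+t. ennreal ((s + 1) powr (p - 1) * exp (- (s + 2))) * indicator {s + 1..s + 2} t \<partial>lborel)"
    by (subst nn_integral_cmult_indicator) simp_all
  also have "\<dots> \<le> (\<integral>\<^sup>+t. ennreal (indicator {0..} t * t powr (p + b - 1) / exp t) \<partial>lborel)"
  proof (rule nn_integral_mono)
    fix t :: real
    show "ennreal ((s + 1) powr (p - 1) * exp (- (s + 2))) * indicator {s + 1..s + 2} t \<le> ennreal (indicator {0..} t * t powr (p + b - 1) / exp t)"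
    proof (cases "t \<in> {s + 1..s + 2}")
      case True
      have "(s + 1) powr (p - 1) \<le> (s + 1) powr (p + b - 1)" using s b by (intro powr_mono) auto
      also have "\<dots> \<le> t powr (p + b - 1)" using True s b p by (intro powr_mono2) auto
      finally have "(s + 1) powr (p - 1) * exp (- (s + 2)) \<le> t powr (p + b - 1) * exp (- t)"
        using True by (intro mult_mono) auto
      then show ?thesis using True s by (simp add: exp_minus divide_inverse ennreal_leI)
    qed simp
  qed
  also have "\<dots> = ennreal (Gamma (p + b))" by (rule Gamma_conv_nn_integral_real[OF pb, symmetric])
  finally have le: "(s + 1) powr (p - 1) * exp (- (s + 2)) \<le> Gamma (p + b)"
    using pb by (subst (asm) ennreal_le_iff) (auto intro: Gamma_real_nonneg)
  have "s powr p \<le> (s + 1) powr p" using s p by (intro powr_mono2) auto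
  also have "\<dots> = (s + 1) * (s + 1) powr (p - 1)" using s by (simp add: powr_mult_base)
  also have "\<dots> \<le> exp s * (s + 1) powr (p - 1)"
    using exp_ge_add_one_self[of s] by (intro mult_right_mono) (auto simp: add.commute)
  also have "\<dots> = exp (2 * s + 2) * ((s + 1) powr (p - 1) * exp (- (s + 2)))"
    by (simp add: exp_add[symmetric] exp_minus field_simps)
  also have "\<dots> \<le> exp (2 * s + 2) * Gamma (p + b)" by (intro mult_left_mono le) simp
  finally show ?thesis .
qed

text \<open>The rate \<open>1 / (2 B)\<close> turns the exponential series into a geometric one with ratio \<open>1 / 2\<close>.\<close>

lemma gauss_from_moments:
  fixes g :: "'a::euclidean_space \<Rightarrow> real"
  assumes [measurable]: "g \<in> borel_measurable borel" and A: "0 \<le> A" and B: "0 < B"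
    and mom: "\<And>m. (\<integral>\<^sup>+x. ennreal (\<bar>g x\<bar> * (norm x) ^ (2 * m)) \<partial>lborel) \<le> ennreal (A * B ^ m * fact m)"
  shows "wint (gauss (1 / (2 * B))) g \<le> ennreal (2 * A)"
proof -
  define a where "a = 1 / (2 * B)"
  have a: "0 < a" using B by (simp add: a_def)
  have "wint (gauss a) g = (\<integral>\<^sup>+x. (\<Sum>m. ennreal (a ^ m / fact m) * ennreal (\<bar>g x\<bar> * (norm x) ^ (2 * m))) \<partial>lborel)"
    unfolding wint_def
  proof (rule nn_integral_cong)
    fix x :: 'a
    have "(\<lambda>m. (a * (norm x)\<^sup>2) ^ m /\<^sub>R fact m) sums exp (a * (norm x)\<^sup>2)" by (rule exp_converges)
    from sums_mult[OF this, of "\<bar>g x\<bar>"]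
    have "(\<lambda>m. a ^ m / fact m * (\<bar>g x\<bar> * (norm x) ^ (2 * m))) sums (\<bar>g x\<bar> * gauss a x)"
      by (simp add: power_mult_distrib power_mult[symmetric] divide_inverse ac_simps)
    then have "(\<Sum>m. ennreal (a ^ m / fact m * (\<bar>g x\<bar> * (norm x) ^ (2 * m)))) = ennreal (\<bar>g x\<bar> * gauss a x)"
      using a by (subst suminf_ennreal2) (auto simp: sums_iff)
    then show "ennreal (\<bar>g x\<bar> * gauss a x) = (\<Sum>m. ennreal (a ^ m / fact m) * ennreal (\<bar>g x\<bar> * (norm x) ^ (2 * m)))"
      using a by (simp add: ennreal_mult[symmetric])
  qed
  also have "\<dots> = (\<Sum>m. ennreal (a ^ m / fact m) * (\<integral>\<^sup>+x. ennreal (\<bar>g x\<bar> * (norm x) ^ (2 * m)) \<partial>lborel))"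
    by (subst nn_integral_suminf) (auto simp: nn_integral_cmult)
  also have "\<dots> \<le> (\<Sum>m. ennreal (A * (1 / 2) ^ m))"
  proof (intro suminf_le)
    fix m
    have "ennreal (a ^ m / fact m) * (\<integral>\<^sup>+x. ennreal (\<bar>g x\<bar> * (norm x) ^ (2 * m)) \<partial>lborel) \<le> ennreal (a ^ m / fact m) * ennreal (A * B ^ m * fact m)"
      by (intro mult_left_mono mom) simp
    also have "\<dots> = ennreal (A * (a * B) ^ m)" using a A B by (simp add: ennreal_mult[symmetric] power_mult_distrib)
    also have "a * B = 1 / 2" using B by (simp add: a_def)
    finally show "ennreal (a ^ m / fact m) * (\<integral>\<^sup>+x. ennreal (\<bar>g x\<bar> * (norm x) ^ (2 * m)) \<partial>lborel) \<le> ennreal (A * (1 / 2) ^ m)" .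
  qed auto
  also have "\<dots> = ennreal (\<Sum>m. A * (1 / 2) ^ m)"
    using A by (intro suminf_ennreal2) (auto intro!: summable_mult summable_geometric)
  also have "(\<Sum>m. A * (1 / 2) ^ m) = 2 * A"
    by (subst suminf_mult) (auto simp: suminf_geometric)
  finally show ?thesis by (simp add: a_def)
qed

text \<open>Half of the Gaussian rate pays for \<open>power_le_Gamma\<close>, with \<open>s = a |x|\<^sup>2 / 2\<close>.\<close>

lemma moment_from_gauss:
  fixes g :: "'a::euclidean_space \<Rightarrow> real"
  assumes [measurable]: "g \<in> borel_measurable borel" and a: "0 < a" and C: "0 \<le> C" and g: "wint (gauss a) g \<le> ennreal C"
    and b: "0 < b" and p: "1 \<le> p"
  shows "(\<integral>\<^sup>+x. ennreal (\<bar>g x\<bar> * norm x powr (2 * p)) \<partial>lborel) \<le> ennreal (C * exp 2 * (2 / a) powr p * Gamma (p + b))"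
proof -
  have G: "0 \<le> Gamma (p + b)" using b p by (intro Gamma_real_nonneg) auto
  have "(\<integral>\<^sup>+x. ennreal (\<bar>g x\<bar> * norm x powr (2 * p)) \<partial>lborel) \<le> wint (\<lambda>x. (exp 2 * (2 / a) powr p * Gamma (p + b)) * gauss a x) g"
    unfolding wint_def
  proof (intro nn_integral_mono ennreal_leI mult_left_mono)
    fix x :: 'a
    define s where "s = a / 2 * (norm x)\<^sup>2"
    have s: "0 \<le> s" using a by (simp add: s_def)
    have "norm x powr (2 * p) = (norm x powr 2) powr p" by (rule powr_powr[symmetric])
    also have "\<dots> = ((norm x)\<^sup>2) powr p" by simp
    also have "(norm x)\<^sup>2 = (2 / a) * s" using a by (simp add: s_def)
    also have "((2 / a) * s) powr p = (2 / a) powr p * s powr p" using a s by (intro powr_mult)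
    also have "\<dots> \<le> (2 / a) powr p * (exp (2 * s + 2) * Gamma (p + b))"
      by (intro mult_left_mono power_le_Gamma b p s) simp
    also have "\<dots> = (exp 2 * (2 / a) powr p * Gamma (p + b)) * gauss a x"
      by (simp add: s_def exp_add)
    finally show "norm x powr (2 * p) \<le> (exp 2 * (2 / a) powr p * Gamma (p + b)) * gauss a x" .
  qed simp
  also have "\<dots> = ennreal (exp 2 * (2 / a) powr p * Gamma (p + b)) * wint (gauss a) g"
    using G by (intro wint_cmult) auto
  also have "\<dots> \<le> ennreal (exp 2 * (2 / a) powr p * Gamma (p + b)) * ennreal C" by (intro mult_left_mono g) simp
  also have "\<dots> = ennreal (C * exp 2 * (2 / a) powr p * Gamma (p + b))" using C G by (simp add: ennreal_mult[symmetric] ac_simps)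
  finally show ?thesis .
qed

section \<open>Weak derivatives of a solution\<close>

text \<open>Needed to compare the chosen representative of the derivative of order zero with the density itself.\<close>

lemma weak_deriv_unique:
  fixes f :: "real^'n \<Rightarrow> real"
  assumes d: "has_weak_deriv \<nu> f d" "has_weak_deriv \<nu> f d'" and i: "integrable lborel d" "integrable lborel d'"
  shows "AE x in lborel. d x = d' x"
proof -
  obtain "is" where l: "\<And>j. count_list is j = \<nu> j" using exists_list_with_counts by metis
  have "AE x in lborel. d x - d' x = 0"
  proof (rule AE_zero_if_test_integrals_zero)
    show "integrable lborel (\<lambda>x. d x - d' x)" using i by simp
    fix \<phi> :: "real^'n \<Rightarrow> real" assume \<phi>: "test_function \<phi>"
    have "(\<integral>x. f x * foldr partial is \<phi> x \<partial>lborel) = (- 1) ^ multi_order \<nu> * (\<integral>x. e x * \<phi> x \<partial>lborel)" if "has_weak_deriv \<nu> f e" for e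
      using that \<phi> l unfolding has_weak_deriv_def by simp
    from this[OF d(1)] this[OF d(2)]
    have "(- 1) ^ multi_order \<nu> * (\<integral>x. d x * \<phi> x \<partial>lborel) = (- 1) ^ multi_order \<nu> * (\<integral>x. d' x * \<phi> x \<partial>lborel)" by simp
    then have "(\<integral>x. d x * \<phi> x \<partial>lborel) = (\<integral>x. d' x * \<phi> x \<partial>lborel)" by simp
    then show "(\<integral>x. (d x - d' x) * \<phi> x \<partial>lborel) = 0"
      using integrable_times_test[OF i(1) \<phi>] integrable_times_test[OF i(2) \<phi>] by (simp add: left_diff_distrib)
  qed
  then show ?thesis by eventually_elim simp
qed

lemma weak_deriv_of_finite_moment:
  fixes f :: "real^'n \<Rightarrow> real"
  assumes "deriv_moment \<nu> 0 f < \<infinity>"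
  shows "has_weak_deriv \<nu> f (weak_deriv \<nu> f)" "integrable lborel (weak_deriv \<nu> f)"
    and "deriv_moment \<nu> p f = (\<integral>\<^sup>+x. ennreal (\<bar>weak_deriv \<nu> f x\<bar> * norm x powr (2 * p)) \<partial>lborel)"
proof -
  have ex: "\<exists>d. has_weak_deriv \<nu> f d" using assms by (auto simp: deriv_moment_def deriv_integral_def split: if_splits)
  then show hw: "has_weak_deriv \<nu> f (weak_deriv \<nu> f)" unfolding weak_deriv_def by (rule someI_ex)
  show eq: "deriv_moment \<nu> p f = (\<integral>\<^sup>+x. ennreal (\<bar>weak_deriv \<nu> f x\<bar> * norm x powr (2 * p)) \<partial>lborel)" for p
    using ex by (simp add: deriv_moment_def deriv_integral_def)
  have m: "weak_deriv \<nu> f \<in> borel_measurable borel"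
    using hw by (intro locally_integrable_measurable) (simp add: has_weak_deriv_def)
  have "(\<integral>\<^sup>+x. ennreal (norm (weak_deriv \<nu> f x)) \<partial>lborel) = deriv_moment \<nu> 0 f"
    unfolding eq by (rule nn_integral_cong_AE, rule eventually_mono[OF AE_lborel_singleton[of "0::real^'n"]]) simp
  then show "integrable lborel (weak_deriv \<nu> f)" using assms m by (auto simp: integrable_iff_bounded)
qed

lemma locally_integrable_of_integrable: "integrable lborel f \<Longrightarrow> locally_integrable f"
  unfolding locally_integrable_def set_integrable_def
  by (intro allI impI integrable_mult_indicator) (simp_all add: borel_compact)

lemma has_weak_deriv_0: "integrable lborel f \<Longrightarrow> has_weak_deriv (\<lambda>_. 0) f f"
  by (auto simp: has_weak_deriv_def multi_order_def locally_integrable_of_integrable)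
    (metis count_notin foldr.simps(1) id_apply list.set_intros(1) count_list_0_iff neq_Nil_conv)

text \<open>The solution is extended to negative times by its initial value.\<close>

lemma boltzmann_flow_of_solution:
  fixes f0 :: "real^'n \<Rightarrow> real"
  assumes h': "collision TYPE('n) \<alpha> h'"
    and op: "\<And>(f :: real^'n \<Rightarrow> real) x. f \<in> borel_measurable borel \<Longrightarrow> collision_op \<alpha> h f f x = collision_op \<alpha> h' f f x"
    and init: "initial_datum f0" and sol: "boltzmann_solution \<alpha> h f0 f"
  shows "boltzmann_flow \<alpha> h' (\<lambda>t. f (max 0 t)) (\<integral>\<xi>. f0 \<xi> * (norm \<xi>)\<^sup>2 \<partial>lborel)"
proof -
  interpret collision \<alpha> h' "TYPE('n)" by (rule h')
  have fm: "(\<lambda>(t, \<xi>). f t \<xi>) \<in> borel_measurable (restrict_space borel ({0..} \<times> UNIV))"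
    using sol by (simp add: boltzmann_solution_def)
  have "(\<lambda>(t, x). (max 0 t, x)) \<in> (borel :: real measure) \<Otimes>\<^sub>M (borel :: (real^'n) measure) \<rightarrow>\<^sub>M restrict_space borel ({0..} \<times> UNIV)"
  proof (rule measurable_restrict_space2)
    show "(\<lambda>(t, x). (max 0 t, x)) \<in> space (borel \<Otimes>\<^sub>M borel) \<rightarrow> {0::real..} \<times> (UNIV :: (real^'n) set)" by auto
    show "(\<lambda>(t, x). (max 0 t, x)) \<in> (borel :: real measure) \<Otimes>\<^sub>M (borel :: (real^'n) measure) \<rightarrow>\<^sub>M borel"
      unfolding borel_prod[symmetric] by measurable
  qed
  from measurable_compose[OF this fm]
  have m2: "(\<lambda>(t, x). f (max 0 t) x) \<in> borel_measurable (borel \<Otimes>\<^sub>M borel)" by (simp add: split_def)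
  then have m1: "f s \<in> borel_measurable borel" if "0 \<le> s" for s
    using measurable_compose[OF measurable_Pair1' m2, of s] that by (simp add: max_absorb2)
  show ?thesis
  proof unfold_locales
    show "(\<lambda>(t, x). f (max 0 t) x) \<in> borel_measurable (borel \<Otimes>\<^sub>M borel)" by (rule m2)
    show "0 \<le> f (max 0 t) x" for t x using sol by (simp add: boltzmann_solution_def)
  next
    fix t :: real assume t: "0 \<le> t"
    have i1: "(\<integral>\<xi>. f0 \<xi> \<partial>lborel) = 1" using init by (simp add: initial_datum_def has_bochner_integral_iff)
    show "has_bochner_integral lborel (f (max 0 t)) 1"
      "has_bochner_integral lborel (\<lambda>x. f (max 0 t) x * (norm x)\<^sup>2) (\<integral>\<xi>. f0 \<xi> * (norm \<xi>)\<^sup>2 \<partial>lborel)"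
      using sol t i1 by (auto simp: boltzmann_solution_def max_absorb2)
    have "AE x in lborel. set_integrable lborel {0..t} (\<lambda>s. collision_op \<alpha> h (f s) (f s) x) \<and>
        f t x = f0 x + (LINT s:{0..t}|lborel. collision_op \<alpha> h (f s) (f s) x)"
      using sol t by (simp add: boltzmann_solution_def)
    moreover have "indicator {0..t} s *\<^sub>R collision_op \<alpha> h (f s) (f s) x = indicator {0..t} s *\<^sub>R collision_op \<alpha> h' (f (max 0 s)) (f (max 0 s)) x" for s x
      by (cases "s \<in> {0..t}") (auto simp: op m1 max_absorb2)
    moreover have "f 0 = f0" using sol by (simp add: boltzmann_solution_def)
    ultimately show "AE x in lborel. set_integrable lborel {0..t} (\<lambda>s. collision_op \<alpha> h' (f (max 0 s)) (f (max 0 s)) x) \<and>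
        f (max 0 t) x = f (max 0 0) x + (LINT s:{0..t}|lborel. collision_op \<alpha> h' (f (max 0 s)) (f (max 0 s)) x)"
      using t by (simp only: set_integrable_def set_lebesgue_integral_def max_absorb2 max.idem)
  qed
qed

text \<open>Only the integer moments enter the exponential series; the growth condition covers those from the
  second on, and the zeroth and first are covered by the bound \<open>M\<close>.\<close>

lemma gauss_bound_from_initial_moments:
  fixes f :: "real^'n \<Rightarrow> real"
  assumes b: "0 < b" and k: "0 < k" and q: "1 \<le> q"
    and M: "deriv_moment \<nu> 0 f \<le> ennreal M" "deriv_moment \<nu> 1 f \<le> ennreal M"
    and mom: "\<forall>j::nat\<ge>3. normalized_deriv_moment b \<nu> (j / 2) f \<le> ennreal (k * q powr (j / 2))"
  shows "\<exists>a>0. \<exists>C\<ge>0. wint (gauss a) (weak_deriv \<nu> f) \<le> ennreal C"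
proof -
  have fin: "deriv_moment \<nu> 0 f < \<infinity>" using M(1) by (auto intro: le_less_trans)
  note W = weak_deriv_of_finite_moment[OF fin]
  have m: "weak_deriv \<nu> f \<in> borel_measurable borel" using W(2) by auto
  have even: "(\<integral>\<^sup>+x. ennreal (\<bar>weak_deriv \<nu> f x\<bar> * (norm x) ^ (2 * j)) \<partial>lborel) = deriv_moment \<nu> (real j) f" for j
    unfolding W(3) using AE_lborel_singleton[of "0::real^'n"]
    by (intro nn_integral_cong_AE) (auto elim!: eventually_mono simp: powr_realpow[symmetric] powr_numeral mult.commute)
  define A where "A = max \<bar>M\<bar> (k * Gamma (1 + b))"
  define B where "B = q * (1 + b)"
  have A: "0 \<le> A" by (simp add: A_def)
  have B: "1 \<le> B" using mult_mono[of 1 q 1 "1 + b"] q b by (simp add: B_def)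
  have "(\<integral>\<^sup>+x. ennreal (\<bar>weak_deriv \<nu> f x\<bar> * (norm x) ^ (2 * j)) \<partial>lborel) \<le> ennreal (A * B ^ j * fact j)" for j
  proof -
    consider "j = 0" | "j = 1" | "2 \<le> j" by linarith
    then show ?thesis
    proof cases
      case 1
      then have "ennreal M \<le> ennreal (A * B ^ j * fact j)" by (intro ennreal_leI) (simp add: A_def)
      then show ?thesis using M(1) 1 unfolding even by auto
    next
      case 2
      have "A * 1 \<le> A * B" using A B by (intro mult_left_mono) auto
      moreover have "M \<le> A" by (simp add: A_def)
      ultimately have "ennreal M \<le> ennreal (A * B ^ j * fact j)" using 2 by (intro ennreal_leI) simp
      then show ?thesis using M(2) 2 unfolding even by auto
    next
      case 3
      define G where "G = Gamma (real j + b)"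
      have G: "0 < G" using b by (simp add: G_def Gamma_real_pos)
      obtain i where i: "j = Suc i" using 3 by (cases j) auto
      have "normalized_deriv_moment b \<nu> (real (2 * j) / 2) f \<le> ennreal (k * q powr (real (2 * j) / 2))"
        using 3 by (intro mom[rule_format]) linarith
      then have "deriv_moment \<nu> (real j) f / ennreal G \<le> ennreal (k * q ^ j)"
        using q by (simp add: normalized_deriv_moment_def G_def powr_realpow)
      then have "deriv_moment \<nu> (real j) f / ennreal G * ennreal G \<le> ennreal (k * q ^ j) * ennreal G"
        by (rule mult_right_mono) simp
      then have "deriv_moment \<nu> (real j) f \<le> ennreal (k * q ^ j * G)"
        using G k q by (simp add: ennreal_divide_times ennreal_mult[symmetric] ennreal_times_divide[symmetric] mult_divide_eq_ennreal)
      also have "\<dots> \<le> ennreal (A * B ^ j * fact j)"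
      proof (rule ennreal_leI)
        have "G \<le> Gamma (1 + b) * (1 + b) ^ i * fact j" unfolding G_def i by (rule Gamma_shift_le[OF b])
        also have "\<dots> \<le> Gamma (1 + b) * (1 + b) ^ j * fact j"
          using b unfolding i by (intro mult_right_mono mult_left_mono power_increasing) (auto intro: Gamma_real_nonneg)
        finally have "k * q ^ j * G \<le> k * q ^ j * (Gamma (1 + b) * (1 + b) ^ j * fact j)"
          using k q by (intro mult_left_mono) auto
        also have "\<dots> = (k * Gamma (1 + b)) * B ^ j * fact j" by (simp add: B_def power_mult_distrib)
        also have "\<dots> \<le> A * B ^ j * fact j" using B by (intro mult_right_mono) (auto simp: A_def)
        finally show "k * q ^ j * G \<le> A * B ^ j * fact j" .
      qed
      finally show ?thesis unfolding even .
    qed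
  qed
  from gauss_from_moments[OF m A _ this] B show ?thesis
    using A by (intro exI[of _ "1 / (2 * B)"] conjI exI[of _ "2 * A"]) auto
qed

lemma finite_multi_indices: "finite {\<nu> :: 'n::finite \<Rightarrow> nat. \<nu> \<le> \<eta>}"
proof -
  have "{\<nu> :: 'n \<Rightarrow> nat. \<nu> \<le> \<eta>} \<subseteq> PiE UNIV (\<lambda>i. {..\<eta> i})" by (auto simp: le_fun_def)
  then show ?thesis by (rule finite_subset) (auto intro!: finite_PiE)
qed

theorem theorem2:
  fixes \<alpha> b :: real and h :: "real \<Rightarrow> real"
  assumes "0 < \<alpha>" and "\<alpha> \<le> 1"
    and "angular_kernel TYPE('n::finite) h"
    and "0 < b"
  shows "\<exists>K :: ('n \<Rightarrow> nat) \<Rightarrow> ennreal \<Rightarrow> real \<Rightarrow> real.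
    (\<forall>\<eta> N k. 0 < K \<eta> N k) \<and>
    (\<forall>(f0 :: real ^ 'n \<Rightarrow> real) f \<eta> T k q.
       initial_datum f0 \<longrightarrow>
       boltzmann_solution \<alpha> h f0 f \<longrightarrow>
       0 < T \<longrightarrow>
       (\<forall>t\<in>{0..T}. 0 < deriv_moment \<eta> 0 (f t)) \<longrightarrow>
       (\<exists>M::real. \<forall>\<nu>\<le>\<eta>. \<forall>t\<in>{0..T}.
          deriv_moment \<nu> 0 (f t) \<le> ennreal M \<and> deriv_moment \<nu> 1 (f t) \<le> ennreal M) \<longrightarrow>
       0 < k \<longrightarrow>
       1 \<le> q \<longrightarrow>
       (\<forall>\<nu>\<le>\<eta>. \<forall>j::nat\<ge>3.
          normalized_deriv_moment b \<nu> (j / 2) (f 0) \<le> ennreal (k * q powr (j / 2))) \<longrightarrow>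
       (\<exists>Q\<ge>q. \<forall>\<nu>\<le>\<eta>. \<forall>t\<in>{0..T}. \<forall>j::nat\<ge>3.
          normalized_deriv_moment b \<nu> (j / 2) (f t) \<le>
            ennreal (K \<eta> (Linf_sobolev_norm T (multi_order \<eta>) 2 f) k * Q powr (j / 2))))"
proof (intro exI[of _ "\<lambda>_ _ _. 1"] conjI allI impI)
  fix f0 :: "real ^ 'n \<Rightarrow> real" and f \<eta> T k q
  assume init: "initial_datum f0" and sol: "boltzmann_solution \<alpha> h f0 f" and T: "0 < T"
    and bd: "\<exists>M::real. \<forall>\<nu>\<le>\<eta>. \<forall>t\<in>{0..T}. deriv_moment \<nu> 0 (f t) \<le> ennreal M \<and> deriv_moment \<nu> 1 (f t) \<le> ennreal M"
    and k: "0 < k" and q: "1 \<le> q"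
    and mom: "\<forall>\<nu>\<le>\<eta>. \<forall>j::nat\<ge>3. normalized_deriv_moment b \<nu> (j / 2) (f 0) \<le> ennreal (k * q powr (j / 2))"
  obtain M where M: "\<And>\<nu> t. \<nu> \<le> \<eta> \<Longrightarrow> t \<in> {0..T} \<Longrightarrow> deriv_moment \<nu> 0 (f t) \<le> ennreal M"
    "\<And>\<nu> t. \<nu> \<le> \<eta> \<Longrightarrow> t \<in> {0..T} \<Longrightarrow> deriv_moment \<nu> 1 (f t) \<le> ennreal M" using bd by blast
  have fin: "deriv_moment \<nu> 0 (f t) < \<infinity>" if "\<nu> \<le> \<eta>" "t \<in> {0..T}" for \<nu> t
    using M(1)[OF that] by (auto intro: le_less_trans)
  obtain h' where h': "collision TYPE('n) \<alpha> h'"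
    "\<And>(f :: real^'n \<Rightarrow> real) x. f \<in> borel_measurable borel \<Longrightarrow> collision_op \<alpha> h f f x = collision_op \<alpha> h' f f x"
    using regular_kernel_exists[OF assms(1-3)] by blast
  define F where "F t = f (max 0 t)" for t
  have Ft: "F t = f t" if "t \<in> {0..T}" for t using that by (simp add: F_def max_absorb2)
  interpret boltzmann_flow \<alpha> h' "TYPE('n)" F "\<integral>\<xi>. f0 \<xi> * (norm \<xi>)\<^sup>2 \<partial>lborel"
    unfolding F_def[abs_def] by (rule boltzmann_flow_of_solution[OF h' init sol])
  have T0: "0 \<in> {0..T}" using T by simp
  have Fi: "integrable lborel (F t)" if "t \<in> {0..T}" for t using f_integrable(1)[of t] that by simp
  \<comment> \<open>At order zero the density itself is used, since \<open>weak_deriv\<close> agrees with it only almost everywhere.\<close>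
  define g where "g t \<nu> = (if \<nu> = (\<lambda>_. 0) then F t else weak_deriv \<nu> (F t))" for t \<nu>
  have g: "has_weak_deriv \<nu> (F t) (g t \<nu>)" "integrable lborel (g t \<nu>)" if "\<nu> \<le> \<eta>" "t \<in> {0..T}" for \<nu> t
    using weak_deriv_of_finite_moment[OF fin[OF that]] has_weak_deriv_0[OF Fi[OF that(2)]] Fi[OF that(2)]
    by (auto simp: g_def Ft[OF that(2)])
  have gw: "AE x in lborel. g t \<nu> x = weak_deriv \<nu> (f t) x" if "\<nu> \<le> \<eta>" "t \<in> {0..T}" for \<nu> t
    using weak_deriv_unique[OF g(1)[OF that]] g(2)[OF that] weak_deriv_of_finite_moment[OF fin[OF that]]
    by (simp add: Ft[OF that(2)])
  have wg: "wint w (g t \<nu>) = wint w (weak_deriv \<nu> (f t))" if "\<nu> \<le> \<eta>" "t \<in> {0..T}" for w \<nu> t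
    unfolding wint_def using gw[OF that] by (intro nn_integral_cong_AE) (auto elim!: eventually_mono)
  have "\<exists>a>0. \<exists>C\<ge>0. \<forall>t\<in>{0..T}. wint (gauss a) (weak_deriv \<nu> (f t)) \<le> ennreal C" if \<nu>: "\<nu> \<le> \<eta>" for \<nu>
  proof -
    have "\<exists>a>0. \<exists>C\<ge>0. \<forall>t\<in>{0..T}. wint (gauss a) (g t \<nu>) \<le> ennreal C"
    proof (rule derivative_propagation[OF T _ _ _ \<nu>])
      show "derivative_family \<eta> (g t)" if "t \<in> {0..T}" for t
        using g that by (intro derivative_familyI[of \<eta> "F t"]) auto
      show "g t (\<lambda>_. 0) = F t" for t by (simp add: g_def)
      show "\<exists>a>0. \<exists>C\<ge>0. wint (gauss a) (g 0 \<mu>) \<le> ennreal C" if "\<mu> \<le> \<eta>" for \<mu>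
        unfolding wg[OF that T0] using mom that
        by (intro gauss_bound_from_initial_moments[OF assms(4) k q M(1)[OF that T0] M(2)[OF that T0]]) auto
    qed
    then show ?thesis using wg[OF \<nu>] by simp
  qed
  then have "\<exists>a>0. \<exists>C\<ge>0. \<forall>\<nu>\<in>{\<nu>. \<nu> \<le> \<eta>}. \<forall>t\<in>{0..T}. wint (gauss a) ((\<lambda>\<nu> t. weak_deriv \<nu> (f t)) \<nu> t) \<le> ennreal C"
    by (intro uniform_gauss_bound finite_multi_indices) auto
  then obtain a C where a: "0 < a" "0 \<le> C" and C: "\<And>\<nu> t. \<nu> \<le> \<eta> \<Longrightarrow> t \<in> {0..T} \<Longrightarrow> wint (gauss a) (weak_deriv \<nu> (f t)) \<le> ennreal C"
    by auto
  \<comment> \<open>\<open>D \<ge> 1\<close> and \<open>p \<ge> 1\<close> give \<open>D \<le> D\<^sup>p\<close>: the constant is absorbed into the geometric factor.\<close>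
  define D where "D = max 1 (C * exp 2)"
  define Q where "Q = max q (D * (2 / a))"
  have D: "1 \<le> D" by (simp add: D_def)
  show "\<exists>Q\<ge>q. \<forall>\<nu>\<le>\<eta>. \<forall>t\<in>{0..T}. \<forall>j::nat\<ge>3. normalized_deriv_moment b \<nu> (j / 2) (f t) \<le> ennreal (1 * Q powr (j / 2))"
  proof (intro exI[of _ Q] conjI allI impI ballI)
    show "q \<le> Q" by (simp add: Q_def)
    fix \<nu> t and j :: nat assume \<nu>: "\<nu> \<le> \<eta>" and t: "t \<in> {0..T}" and j: "3 \<le> j"
    define p where "p = real j / 2"
    have p: "1 \<le> p" using j by (simp add: p_def)
    define G where "G = Gamma (p + b)"
    have G: "0 < G" using p assms(4) by (simp add: G_def Gamma_real_pos)
    note W = weak_deriv_of_finite_moment[OF fin[OF \<nu> t]]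
    have "deriv_moment \<nu> p (f t) \<le> ennreal (C * exp 2 * (2 / a) powr p * G)"
      unfolding W(3) G_def using W(2) by (intro moment_from_gauss[OF _ a C[OF \<nu> t] assms(4) p]) auto
    also have "\<dots> \<le> ennreal (Q powr p * G)"
    proof (intro ennreal_leI mult_right_mono)
      have "C * exp 2 * (2 / a) powr p \<le> D powr p * (2 / a) powr p"
      proof (rule mult_right_mono)
        have "C * exp 2 \<le> D powr 1" using D by (simp add: D_def)
        also have "\<dots> \<le> D powr p" using D p by (intro powr_mono) auto
        finally show "C * exp 2 \<le> D powr p" .
      qed simp
      also have "\<dots> = (D * (2 / a)) powr p" using D a by (intro powr_mult[symmetric])
      also have "\<dots> \<le> Q powr p" using D a p by (intro powr_mono2) (auto simp: Q_def)
      finally show "C * exp 2 * (2 / a) powr p \<le> Q powr p" .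
    qed (use G in simp)
    finally have "deriv_moment \<nu> p (f t) / ennreal G \<le> ennreal (Q powr p * G) / ennreal G"
      by (rule divide_right_mono_ennreal)
    also have "\<dots> = ennreal (Q powr p)" using G by (simp add: divide_ennreal)
    finally show "normalized_deriv_moment b \<nu> (real j / 2) (f t) \<le> ennreal (1 * Q powr (real j / 2))"
      by (simp add: normalized_deriv_moment_def G_def p_def)
  qed
qed simp

end
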